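(* Let $U$ be the unique weak solution of $\partial_tu=\partial_x^2u+\partial_x\partial_tB$ in $\mathcal Q_+=\mathbb R\times(0,\infty)$ subject to $\lim_{t\downarrow0}u(\cdot,t)=0$, given by the continuous version of $U(x,t)=\iint_{\mathcal Q_+}B(\mathrm dy,\mathrm ds)\,g(y,s;x,t)$. Then $U$ satisfies $$\partial_x^2\,U+\big[(-\partial_t^2)^{1/2}+\sqrt2\,\partial_x(-\partial_t^2)^{1/4}\big]U^a=\partial_x\partial_t\tilde B$$ in the sense that, almost surely, $$U\Big(\partial_x^2f+\big[(-\partial_t^2)^{1/2}-\sqrt2\,\partial_x(-\partial_t^2)^{1/4}\big]f^a\Big)=\partial_x\partial_t\tilde B(f)\qquad\text{for all }f\in C_c^\infty(\mathcal Q_+),$$ where $U^a,f^a$ stand for the extensions of $U(x,t),f(x,t)$ to $(x,t)\in\mathbb R^2$ which are antisymmetric in $t$, and $\tilde B=\{\tilde B_{xt};x\in\mathbb R,t\ge0\}$ is a Brownian sheet on $(\Omega,\mathcal F,\mathbb P)$.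
   Context: $(\Omega,\mathcal F,\mathbb P)$ is a complete probability space carrying a Brownian sheet $B=\{B_{xt};x\in\mathbb R,t\ge0\}$, and $\iint B(\mathrm dy,\mathrm ds)$ denotes the stochastic integral against $B$. The heat kernel is $g(y,s;x,t)=\frac1{\sqrt{4\pi(t-s)}}\exp\{-\frac{(x-y)^2}{4(t-s)}\}\mathbf 1_{(s,\infty)}(t)$. The operators $(-\partial_t^2)^{\gamma/2}$ act in the variable $t\in\mathbb R$ and are defined through the Fourier transform in $t$: $((-\partial_t^2)^{\gamma/2}f)^F=|\cdot|^\gamma f^F$. Functions of the form $(-\partial_t^2)^{\gamma/2}f^a$ are restricted to $\mathcal Q_+$ when $U$ is applied to them. $U$ is regarded as a regular generalised function, $U(f)=\int_{\mathbb R}\int_0^\infty U(x,t)f(x,t)\,\mathrm dt\,\mathrm dx$, and $\partial_x\partial_t\tilde B(f)=\int_{\mathbb R}\int_0^\infty\tilde B_{xt}\,\partial_x\partial_tf(x,t)\,\mathrm dt\,\mathrm dx$. Since $(-\partial_t^2)^{1/4}f^a(x,t)$ in general is only known to decay like $t^{-3/2}$ as $t\to\infty$, the term $U(\partial_x(-\partial_t^2)^{1/4}f^a)$ is understood as $$U(\partial_x(-\partial_t^2)^{1/4}f^a)=\lim_{N\uparrow\infty}\int_{\mathbb R}\int_0^\infty\chi_N(t)U(x,t)\,\partial_x(-\partial_t^2)^{1/4}f^a(x,t)\,\mathrm dt\,\mathrm dx,$$ where $\chi_N$, $N=1,2,\dots$, are symmetric $C^\infty$-functions on $\mathbb R$ with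 $\chi_N\equiv1$ on $[-N,N]$ and $\operatorname{supp}\chi_N\subseteq(-N-1,N+1)$; on a set of full probability this limit exists for all $f\in C_c^\infty(\mathcal Q_+)$ and defines a generalised function of $f$ (its negative is denoted $\partial_x(-\partial_t^2)^{1/4}U^a$).
   Formalization: The cut-off functions χ_N are additionally assumed bounded uniformly in N (as when 0 ≤ χ_N ≤ 1); without such a bound, large values of χ_N on N<|t|<N+1 can make the limit defining U(∂_x(-∂_t²)^{1/4}f^a) diverge. *)

theory Defs
  imports "HOL-Probability.Probability"
begin

text \<open>Points of the plane are pairs \<open>(x, t)\<close>: space first, time second.\<close>

definition Qplus :: "(real \<times> real) set" where
  "Qplus = UNIV \<times> {0<..}"

section \<open>Test functions\<close>

definition dx :: "(real \<times> real \<Rightarrow> real) \<Rightarrow> real \<times> real \<Rightarrow> real" where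
  "dx f = (\<lambda>(x, t). deriv (\<lambda>y. f (y, t)) x)"

definition dt :: "(real \<times> real \<Rightarrow> real) \<Rightarrow> real \<times> real \<Rightarrow> real" where
  "dt f = (\<lambda>(x, t). deriv (\<lambda>s. f (x, s)) t)"

primrec Ck :: "nat \<Rightarrow> (real \<times> real \<Rightarrow> real) \<Rightarrow> bool" where
  "Ck 0 f \<longleftrightarrow> continuous_on UNIV f"
| "Ck (Suc k) f \<longleftrightarrow> (\<forall>p. f differentiable (at p)) \<and> Ck k (dx f) \<and> Ck k (dt f)"

text \<open>Functions in \<open>C\<^sub>c\<^sup>\<infinity>(S)\<close>, for open \<open>S\<close>, are represented by their extensions by zero
  to the whole plane.\<close>

definition Cc_infty :: "(real \<times> real) set \<Rightarrow> (real \<times> real \<Rightarrow> real) set" where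
  "Cc_infty S = {f. (\<forall>k. Ck k f) \<and> compact (closure {p. f p \<noteq> 0}) \<and> closure {p. f p \<noteq> 0} \<subseteq> S}"

definition anti :: "(real \<times> real \<Rightarrow> real) \<Rightarrow> real \<times> real \<Rightarrow> real" where
  "anti f = (\<lambda>(x, t). if t > 0 then f (x, t) else if t < 0 then - f (x, - t) else 0)"

text \<open>The cut-off functions \<open>\<kappa>\<^sub>N\<close>, \<open>N = 1, 2, \<dots>\<close>; the value at \<open>N = 0\<close> plays no role. The bound
  has to be uniform in \<open>N\<close>, otherwise what happens on \<open>N < \<bar>t\<bar> < N + 1\<close> could spoil convergence.\<close>

definition cutoff_seq :: "(nat \<Rightarrow> real \<Rightarrow> real) \<Rightarrow> bool" where
  "cutoff_seq \<kappa> \<longleftrightarrow>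
     (\<forall>N\<ge>1. (\<forall>k t. ((deriv ^^ k) (\<kappa> N)) differentiable (at t))
        \<and> (\<forall>t. \<kappa> N (- t) = \<kappa> N t)
        \<and> (\<forall>t\<in>{- real N..real N}. \<kappa> N t = 1)
        \<and> closure {t. \<kappa> N t \<noteq> 0} \<subseteq> {- (real N + 1)<..<real N + 1})
     \<and> (\<exists>C. \<forall>N\<ge>1. \<forall>t. \<bar>\<kappa> N t\<bar> \<le> C)"

section \<open>Fractional time derivatives\<close>

definition fourier :: "(real \<Rightarrow> real) \<Rightarrow> real \<Rightarrow> complex" where
  "fourier f \<tau> = (LINT t|lborel. of_real (f t) * cis (- (\<tau> * t)))"

text \<open>The operator \<open>(-\<partial>\<^sub>t\<^sup>2)\<^bsup>\<gamma>/2\<^esup>\<close> with symbol \<open>\<bar>\<tau>\<bar>\<^sup>\<gamma>\<close>, acting in the time variable, via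
  the inverse Fourier transform. The symbol is even, so the integral is real for real \<open>f\<close>.\<close>

definition frac_dt :: "real \<Rightarrow> (real \<times> real \<Rightarrow> real) \<Rightarrow> real \<times> real \<Rightarrow> real" where
  "frac_dt \<gamma> f = (\<lambda>(x, t).
     Re ((LINT \<tau>|lborel. of_real (\<bar>\<tau>\<bar> powr \<gamma>) * fourier (\<lambda>s. f (x, s)) \<tau> * cis (\<tau> * t)) / (2 * pi)))"

section \<open>Brownian sheets and stochastic integrals\<close>

definition centered_gaussian :: "'a measure \<Rightarrow> ('a \<Rightarrow> real) \<Rightarrow> bool" where
  "centered_gaussian M X \<longleftrightarrow> X \<in> borel_measurable M \<and>
     ((AE \<omega> in M. X \<omega> = 0) \<or>
      (\<exists>\<sigma>>0. distributed M lborel X (\<lambda>z. ennreal (normal_density 0 \<sigma> z))))"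

text \<open>Only the values at indices \<open>(x, t)\<close> with \<open>t \<ge> 0\<close> matter. The sheet is two-sided in \<open>x\<close>: the
  parts over \<open>x \<ge> 0\<close> and \<open>x \<le> 0\<close> are independent.\<close>

definition brownian_sheet :: "'a measure \<Rightarrow> (real \<times> real \<Rightarrow> 'a \<Rightarrow> real) \<Rightarrow> bool" where
  "brownian_sheet M B \<longleftrightarrow>
     (\<forall>F c. finite F \<and> F \<subseteq> UNIV \<times> {0..} \<longrightarrow> centered_gaussian M (\<lambda>\<omega>. \<Sum>p\<in>F. c p * B p \<omega>))
     \<and> (\<forall>x y s t. 0 \<le> s \<and> 0 \<le> t \<longrightarrow>
          (LINT \<omega>|M. B (x, s) \<omega> * B (y, t) \<omega>)
            = min s t * (if x * y > 0 then min \<bar>x\<bar> \<bar>y\<bar> else 0))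
     \<and> (AE \<omega> in M. continuous_on (UNIV \<times> {0..}) (\<lambda>p. B p \<omega>))"

text \<open>An entry \<open>(c, a, b, s, t)\<close> of a list stands for \<open>c\<close> times the indicator function of the rectangle
  \<open>{a<..b} \<times> {s<..t}\<close>.\<close>

type_synonym steps = "(real \<times> real \<times> real \<times> real \<times> real) list"

definition valid_steps :: "steps \<Rightarrow> bool" where
  "valid_steps L \<longleftrightarrow> (\<forall>(c, a, b, s, t)\<in>set L. a \<le> b \<and> 0 \<le> s \<and> s \<le> t)"

definition step_fun :: "steps \<Rightarrow> real \<times> real \<Rightarrow> real" where
  "step_fun L p = (\<Sum>(c, a, b, s, t)\<leftarrow>L. c * indicator ({a<..b} \<times> {s<..t}) p)"

definition step_integral :: "(real \<times> real \<Rightarrow> 'a \<Rightarrow> real) \<Rightarrow> steps \<Rightarrow> 'a \<Rightarrow> real" where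
  "step_integral B L \<omega> =
     (\<Sum>(c, a, b, s, t)\<leftarrow>L. c * (B (b, t) \<omega> - B (a, t) \<omega> - B (b, s) \<omega> + B (a, s) \<omega>))"

text \<open>\<open>X\<close> is a version of the stochastic integral over \<open>Qplus\<close> of the deterministic function \<open>h\<close>
  with respect to \<open>B\<close>, i.e. of the \<open>L\<^sup>2\<close>-limit of elementary integrals. By the isometry property
  this determines \<open>X\<close> up to almost sure equality.\<close>

definition has_stoch_integral ::
  "'a measure \<Rightarrow> (real \<times> real \<Rightarrow> 'a \<Rightarrow> real) \<Rightarrow> (real \<times> real \<Rightarrow> real) \<Rightarrow> ('a \<Rightarrow> real) \<Rightarrow> bool" where
  "has_stoch_integral M B h X \<longleftrightarrow>
     h \<in> borel_measurable borel \<and> X \<in> borel_measurable M \<and>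
     (\<exists>L. (\<forall>n. valid_steps (L n))
        \<and> (\<lambda>n. \<integral>\<^sup>+p\<in>Qplus. ennreal ((h p - step_fun (L n) p)\<^sup>2) \<partial>lborel) \<longlonglongrightarrow> 0
        \<and> (\<lambda>n. \<integral>\<^sup>+\<omega>. ennreal ((X \<omega> - step_integral B (L n) \<omega>)\<^sup>2) \<partial>M) \<longlonglongrightarrow> 0)"

section \<open>The stochastic heat equation\<close>

definition heat_kernel :: "real \<times> real \<Rightarrow> real \<times> real \<Rightarrow> real" where
  "heat_kernel = (\<lambda>(y, s) (x, t).
     if s < t then 1 / sqrt (4 * pi * (t - s)) * exp (- ((x - y)\<^sup>2 / (4 * (t - s)))) else 0)"

definition pairing :: "(real \<times> real \<Rightarrow> real) \<Rightarrow> (real \<times> real \<Rightarrow> real) \<Rightarrow> real" where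
  "pairing u f = (LINT p:Qplus|lborel. u p * f p)"

text \<open>Weak solutions of \<open>\<partial>\<^sub>t u = \<partial>\<^sub>x\<^sup>2 u + \<partial>\<^sub>x \<partial>\<^sub>t B\<close> in \<open>Qplus\<close> with zero initial condition. The
  generalised function \<open>\<partial>\<^sub>x \<partial>\<^sub>t B\<close> maps \<open>f\<close> to the pairing of \<open>B\<close> with \<open>\<partial>\<^sub>x \<partial>\<^sub>t f\<close>.\<close>

definition weak_solution ::
  "'a measure \<Rightarrow> (real \<times> real \<Rightarrow> 'a \<Rightarrow> real) \<Rightarrow> (real \<times> real \<Rightarrow> 'a \<Rightarrow> real) \<Rightarrow> bool" where
  "weak_solution M B u \<longleftrightarrow>
     (AE \<omega> in M.
        (\<forall>f\<in>Cc_infty Qplus.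
           pairing (\<lambda>p. u p \<omega>) (\<lambda>p. - dt f p)
             = pairing (\<lambda>p. u p \<omega>) (dx (dx f)) + pairing (\<lambda>p. B p \<omega>) (dx (dt f)))
        \<and> (\<forall>x. ((\<lambda>t. u (x, t) \<omega>) \<longlongrightarrow> 0) (at_right 0)))"

end

theory Submission
  imports Defs "HOL-Real_Asymp.Real_Asymp"
begin

text \<open>Put \<open>m(\<xi>, \<tau>) = \<bar>\<tau>\<bar> - \<xi>\<^sup>2 - \<i> \<surd>2 \<xi> \<bar>\<tau>\<bar>\<^bsup>1/2\<^esup>\<close>. Since \<open>\<bar>m\<bar>\<^sup>2 = \<xi>\<^sup>4 + \<tau>\<^sup>2 = \<bar>\<i> \<tau> + \<xi>\<^sup>2\<bar>\<^sup>2\<close>, the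
  solution has the covariance of the functions \<open>e\<^bsup>-\<i> \<xi> x\<^esup> sin (\<tau> t) / m\<close>. Hence the field obtained by testing \<open>U\<close>
  with the operator of the theorem applied to a function has the covariance of white noise. Applied to
  approximations of indicators of rectangles this yields the sheet \<open>B'\<close>: convergence and continuity follow from
  sixth moments of Gaussian increments on dyadic grids, as in Kolmogorov's criterion.

  Both sides of the equation are then compared on the kernels
  \<open>(1 - \<partial>\<^sub>x\<^sup>2)\<^bsup>-2\<^esup> (1 - \<partial>\<^sub>t\<^sup>2)\<^bsup>-2\<^esup> \<delta>\<^bsub>p\<^esub>\<close>, where their difference has second moment zero. By Fubini's theorem they
  agree, almost surely, for almost every \<open>p\<close> at once, and every test function is a superposition of these kernels;
  this makes the exceptional set independent of \<open>f\<close>.\<close>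

section \<open>Square integrable functions\<close>

definition sqi :: "'z measure \<Rightarrow> ('z \<Rightarrow> 'e::euclidean_space) \<Rightarrow> bool" where
  "sqi N f \<longleftrightarrow> f \<in> borel_measurable N \<and> integrable N (\<lambda>z. (norm (f z))\<^sup>2)"

definition ip :: "'z measure \<Rightarrow> ('z \<Rightarrow> 'e::euclidean_space) \<Rightarrow> ('z \<Rightarrow> 'e) \<Rightarrow> real" where
  "ip N f g = (LINT z|N. f z \<bullet> g z)"

lemma sqi_meas: "sqi N f \<Longrightarrow> f \<in> borel_measurable N"
  by (simp add: sqi_def)

lemma abs_inner_le_sq: "\<bar>x \<bullet> y\<bar> \<le> (norm x)\<^sup>2 + (norm (y::'e::euclidean_space))\<^sup>2"
proof -
  have "2 * (norm x * norm y) \<le> (norm x)\<^sup>2 + (norm y)\<^sup>2"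
    using sum_squares_bound[of "norm x" "norm y"] by simp
  moreover have "0 \<le> norm x * norm y" by simp
  ultimately show ?thesis
    using Cauchy_Schwarz_ineq2[of x y] by linarith
qed

lemma sqi_inner_integrable:
  assumes "sqi N f" "sqi N g" shows "integrable N (\<lambda>z. f z \<bullet> g z)"
proof (rule Bochner_Integration.integrable_bound)
  show "integrable N (\<lambda>z. (norm (f z))\<^sup>2 + (norm (g z))\<^sup>2)"
    using assms by (simp add: sqi_def)
  show "(\<lambda>z. f z \<bullet> g z) \<in> borel_measurable N"
    using assms by (auto simp: sqi_def)
  show "AE z in N. norm (f z \<bullet> g z) \<le> norm ((norm (f z))\<^sup>2 + (norm (g z))\<^sup>2)"
    using abs_inner_le_sq[of "f _" "g _"] by auto
qed

lemma sqi_scale: "sqi N f \<Longrightarrow> sqi N (\<lambda>z. c *\<^sub>R f z)"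
  by (auto simp: sqi_def power_mult_distrib)

lemma sqi_add:
  assumes "sqi N f" "sqi N g" shows "sqi N (\<lambda>z. f z + g z)"
proof -
  have "integrable N (\<lambda>z. (norm (f z))\<^sup>2 + 2 * (f z \<bullet> g z) + (norm (g z))\<^sup>2)"
    using assms sqi_inner_integrable[OF assms] by (auto simp: sqi_def)
  moreover have "(norm (f z + g z))\<^sup>2 = (norm (f z))\<^sup>2 + 2 * (f z \<bullet> g z) + (norm (g z))\<^sup>2" for z
    by (simp add: power2_norm_eq_inner inner_add inner_commute)
  ultimately show ?thesis using assms by (auto simp: sqi_def)
qed

lemma sqi_diff: "sqi N f \<Longrightarrow> sqi N g \<Longrightarrow> sqi N (\<lambda>z. f z - g z)"
  using sqi_add[of N f "\<lambda>z. (-1) *\<^sub>R g z"] sqi_scale[of N g "-1"] by simp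

lemma ip_commute: "ip N f g = ip N g f"
  by (simp add: ip_def inner_commute)

lemma ip_nonneg: "0 \<le> ip N f f"
  by (simp add: ip_def)

lemma ip_self: "ip N f f = (LINT z|N. (norm (f z))\<^sup>2)"
  by (simp add: ip_def power2_norm_eq_inner)

lemma ip_add_left: "sqi N f \<Longrightarrow> sqi N g \<Longrightarrow> sqi N h \<Longrightarrow> ip N (\<lambda>z. f z + g z) h = ip N f h + ip N g h"
  using sqi_inner_integrable[of N f h] sqi_inner_integrable[of N g h] by (simp add: ip_def inner_add_left)

lemma ip_diff_left: "sqi N f \<Longrightarrow> sqi N g \<Longrightarrow> sqi N h \<Longrightarrow> ip N (\<lambda>z. f z - g z) h = ip N f h - ip N g h"
  using sqi_inner_integrable[of N f h] sqi_inner_integrable[of N g h] by (simp add: ip_def inner_diff_left)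

lemma ip_scale_left: "ip N (\<lambda>z. c *\<^sub>R f z) h = c * ip N f h"
  by (simp add: ip_def)

lemma ip_diff_right: "sqi N f \<Longrightarrow> sqi N g \<Longrightarrow> sqi N h \<Longrightarrow> ip N h (\<lambda>z. f z - g z) = ip N h f - ip N h g"
  using ip_diff_left[of N f g h] by (simp add: ip_commute)

lemma ip_scale_right: "ip N h (\<lambda>z. c *\<^sub>R f z) = c * ip N h f"
  by (simp add: ip_def)

lemma ip_diff_self:
  assumes "sqi N f" "sqi N g"
  shows "ip N (\<lambda>z. f z - g z) (\<lambda>z. f z - g z) = ip N f f - 2 * ip N f g + ip N g g"
  using assms sqi_diff[OF assms]
  by (simp add: ip_diff_left ip_diff_right ip_commute[of N g f])

lemma ip_Cauchy_Schwarz: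
  assumes "sqi N f" "sqi N g"
  shows "(ip N f g)\<^sup>2 \<le> ip N f f * ip N g g"
proof -
  let ?A = "ip N f f" and ?B = "ip N f g" and ?C = "ip N g g"
  have q: "2 * t * ?B \<le> ?A + t\<^sup>2 * ?C" for t
  proof -
    have s: "sqi N (\<lambda>z. t *\<^sub>R g z)" using assms by (simp add: sqi_scale)
    have "0 \<le> ip N (\<lambda>z. f z - t *\<^sub>R g z) (\<lambda>z. f z - t *\<^sub>R g z)" by (rule ip_nonneg)
    also have "\<dots> = ?A - 2 * t * ?B + t\<^sup>2 * ?C"
      using ip_diff_self[OF assms(1) s]
      by (simp add: ip_scale_left ip_scale_right power2_eq_square)
    finally show ?thesis by simp
  qed
  show ?thesis
  proof (cases "?C = 0")
    case True
    have "?B = 0"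
    proof (rule ccontr)
      assume "?B \<noteq> 0"
      then show False using q[of "(?A + 1) / (2 * ?B)"] True by simp
    qed
    then show ?thesis using ip_nonneg[of N f] ip_nonneg[of N g] by simp
  next
    case False
    then have C: "?C > 0" using ip_nonneg[of N g] by simp
    have "2 * (?B / ?C) * ?B \<le> ?A + (?B / ?C)\<^sup>2 * ?C" by (rule q)
    then have "2 * ?B\<^sup>2 / ?C \<le> ?A + ?B\<^sup>2 / ?C" using C by (simp add: power2_eq_square)
    then have "?B\<^sup>2 / ?C \<le> ?A" by simp
    then show ?thesis using C by (simp add: field_simps)
  qed
qed

lemma ip_tendsto:
  assumes "\<And>n. sqi N (f n)" "sqi N g" "sqi N h"
    and "(\<lambda>n. ip N (\<lambda>z. f n z - g z) (\<lambda>z. f n z - g z)) \<longlonglongrightarrow> 0"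
  shows "(\<lambda>n. ip N (f n) h) \<longlonglongrightarrow> ip N g h"
proof -
  have "(\<lambda>n. sqrt (ip N (\<lambda>z. f n z - g z) (\<lambda>z. f n z - g z) * ip N h h)) \<longlonglongrightarrow> 0"
    using tendsto_real_sqrt[OF tendsto_mult_left_zero[OF assms(4)]] by simp
  moreover have "\<bar>ip N (f n) h - ip N g h\<bar> \<le> sqrt (ip N (\<lambda>z. f n z - g z) (\<lambda>z. f n z - g z) * ip N h h)" for n
    using ip_Cauchy_Schwarz[OF sqi_diff[OF assms(1)[of n] assms(2)] assms(3)] assms
    by (intro real_le_rsqrt) (simp add: ip_diff_left)
  ultimately have "(\<lambda>n. ip N (f n) h - ip N g h) \<longlonglongrightarrow> 0"
    unfolding real_norm_def[symmetric] by (rule Lim_null_comparison[OF always_eventually[OF allI], rotated])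
  then show ?thesis by (simp add: LIM_zero_iff)
qed

lemma ip_tendsto2:
  assumes "\<And>n. sqi N (f n)" "sqi N f'" "\<And>n. sqi N (g n)" "sqi N g'"
    and F: "(\<lambda>n. ip N (\<lambda>z. f n z - f' z) (\<lambda>z. f n z - f' z)) \<longlonglongrightarrow> 0"
    and G: "(\<lambda>n. ip N (\<lambda>z. g n z - g' z) (\<lambda>z. g n z - g' z)) \<longlonglongrightarrow> 0"
  shows "(\<lambda>n. ip N (f n) (g n)) \<longlonglongrightarrow> ip N f' g'"
proof -
  let ?F = "\<lambda>n. \<lambda>z. f n z - f' z" and ?G = "\<lambda>n. \<lambda>z. g n z - g' z"
  have "(\<lambda>n. sqrt (ip N (?F n) (?F n) * ip N (?G n) (?G n))) \<longlonglongrightarrow> 0"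
    using tendsto_real_sqrt[OF tendsto_mult[OF F G]] by simp
  moreover have "\<bar>ip N (?F n) (?G n)\<bar> \<le> sqrt (ip N (?F n) (?F n) * ip N (?G n) (?G n))" for n
    using ip_Cauchy_Schwarz[OF sqi_diff[OF assms(1)[of n] assms(2)] sqi_diff[OF assms(3)[of n] assms(4)]]
    by (intro real_le_rsqrt) simp
  ultimately have 1: "(\<lambda>n. ip N (?F n) (?G n)) \<longlonglongrightarrow> 0"
    unfolding real_norm_def[symmetric] by (rule Lim_null_comparison[OF always_eventually[OF allI], rotated])
  have 2: "(\<lambda>n. ip N (f n) g') \<longlonglongrightarrow> ip N f' g'"
    using assms by (intro ip_tendsto)
  have 3: "(\<lambda>n. ip N (g n) f') \<longlonglongrightarrow> ip N g' f'"
    using assms by (intro ip_tendsto)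
  have "ip N (f n) (g n) = ip N (?F n) (?G n) + ip N (f n) g' + ip N (g n) f' - ip N f' g'" for n
    using assms(1-4) sqi_diff[OF assms(1)[of n] assms(2)] sqi_diff[OF assms(3)[of n] assms(4)]
    by (simp add: ip_diff_left ip_diff_right ip_commute[of N "g n" f'] ip_commute[of N g' f'])
  moreover have "(\<lambda>n. ip N (?F n) (?G n) + ip N (f n) g' + ip N (g n) f' - ip N f' g') \<longlonglongrightarrow> 0 + ip N f' g' + ip N g' f' - ip N f' g'"
    using 1 2 3 by (intro tendsto_intros)
  ultimately show ?thesis by (simp add: ip_commute[of N g' f'])
qed

lemma ip_tendsto_eq:
  assumes "\<And>n. sqi N (f n)" "sqi N g" "sqi N h"
    and "(\<lambda>n. ip N (\<lambda>z. f n z - g z) (\<lambda>z. f n z - g z)) \<longlonglongrightarrow> 0"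
    and "\<And>n. sqi N' (f' n)" "sqi N' g'" "sqi N' h'"
    and "(\<lambda>n. ip N' (\<lambda>z. f' n z - g' z) (\<lambda>z. f' n z - g' z)) \<longlonglongrightarrow> 0"
    and "\<And>n. ip N (f n) h = ip N' (f' n) h'"
  shows "ip N g h = ip N' g' h'"
  using ip_tendsto[OF assms(1-4)] ip_tendsto[OF assms(5-8)] assms(9)
  by (simp add: LIMSEQ_unique)

lemma sqi_Fatou:
  fixes f :: "nat \<Rightarrow> 'z \<Rightarrow> 'e::euclidean_space"
  assumes f: "\<And>n. sqi N (f n)" and g[measurable]: "g \<in> borel_measurable N"
    and lim: "AE z in N. (\<lambda>n. f n z) \<longlonglongrightarrow> g z"
    and le: "\<And>n m. n \<le> m \<Longrightarrow> ip N (\<lambda>z. f n z - f m z) (\<lambda>z. f n z - f m z) \<le> e n"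
  shows "sqi N g" "ip N (\<lambda>z. f n z - g z) (\<lambda>z. f n z - g z) \<le> e n"
proof -
  note [measurable] = sqi_meas[OF f]
  have e: "0 \<le> e n" for n using le[of n n] ip_nonneg order_trans by blast
  have nn: "(\<integral>\<^sup>+z. ennreal ((norm (f n z - g z))\<^sup>2) \<partial>N) \<le> ennreal (e n)" for n
  proof -
    have "(\<integral>\<^sup>+z. ennreal ((norm (f n z - g z))\<^sup>2) \<partial>N)
        = (\<integral>\<^sup>+z. liminf (\<lambda>m. ennreal ((norm (f n z - f m z))\<^sup>2)) \<partial>N)"
      using lim
    proof (intro nn_integral_cong_AE, eventually_elim)
      fix z assume "(\<lambda>n. f n z) \<longlonglongrightarrow> g z"
      then have "(\<lambda>m. ennreal ((norm (f n z - f m z))\<^sup>2)) \<longlonglongrightarrow> ennreal ((norm (f n z - g z))\<^sup>2)"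
        by (intro tendsto_intros)
      then show "ennreal ((norm (f n z - g z))\<^sup>2) = liminf (\<lambda>m. ennreal ((norm (f n z - f m z))\<^sup>2))"
        by (subst lim_imp_Liminf) simp_all
    qed
    also have "\<dots> \<le> liminf (\<lambda>m. \<integral>\<^sup>+z. ennreal ((norm (f n z - f m z))\<^sup>2) \<partial>N)"
      by (intro nn_integral_liminf) simp
    also have "\<dots> \<le> liminf (\<lambda>m. ennreal (e n))"
    proof (intro Liminf_mono eventually_sequentiallyI[of n])
      fix m assume "n \<le> m"
      have "(\<integral>\<^sup>+z. ennreal ((norm (f n z - f m z))\<^sup>2) \<partial>N) = ennreal (ip N (\<lambda>z. f n z - f m z) (\<lambda>z. f n z - f m z))"
        unfolding ip_self using sqi_diff[OF f[of n] f[of m]]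
        by (intro nn_integral_eq_integral) (auto simp: sqi_def)
      also have "\<dots> \<le> ennreal (e n)" using le[OF \<open>n \<le> m\<close>] by (rule ennreal_leI)
      finally show "(\<integral>\<^sup>+z. ennreal ((norm (f n z - f m z))\<^sup>2) \<partial>N) \<le> ennreal (e n)" .
    qed
    also have "\<dots> = ennreal (e n)" by (simp add: Liminf_const)
    finally show ?thesis .
  qed
  have d: "sqi N (\<lambda>z. f n z - g z)" for n
    unfolding sqi_def
  proof (intro conjI integrableI_bounded)
    show "(\<integral>\<^sup>+z. ennreal (norm ((norm (f n z - g z))\<^sup>2)) \<partial>N) < \<infinity>"
      using nn[of n] by (simp add: order_le_less_trans)
  qed simp_all
  from sqi_diff[OF f[of 0] d[of 0]] show "sqi N g" by simp
  have "ennreal (ip N (\<lambda>z. f n z - g z) (\<lambda>z. f n z - g z)) = (\<integral>\<^sup>+z. ennreal ((norm (f n z - g z))\<^sup>2) \<partial>N)"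
    unfolding ip_self using d[of n]
    by (intro nn_integral_eq_integral[symmetric]) (auto simp: sqi_def)
  with nn[of n] e[of n] show "ip N (\<lambda>z. f n z - g z) (\<lambda>z. f n z - g z) \<le> e n"
    by (metis ennreal_le_iff)
qed

text \<open>Minkowski's inequality for integrals, together with the interchange of an integral with an
  inner product.\<close>

lemma sqi_integral:
  fixes X :: "'q \<Rightarrow> 'z \<Rightarrow> 'e::euclidean_space"
  assumes "sigma_finite_measure Q" "sigma_finite_measure N"
    and X[measurable]: "(\<lambda>(q, z). X q z) \<in> borel_measurable (Q \<Otimes>\<^sub>M N)"
    and sq: "\<And>q. q \<in> space Q \<Longrightarrow> sqi N (X q)"
    and r: "\<And>q. q \<in> space Q \<Longrightarrow> ip N (X q) (X q) \<le> (r q)\<^sup>2" "\<And>q. 0 < r q"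
    and \<kappa>[measurable]: "\<kappa> \<in> borel_measurable Q" and rm[measurable]: "r \<in> borel_measurable Q"
    and int: "integrable Q (\<lambda>q. \<bar>\<kappa> q\<bar> * r q)"
  shows "AE z in N. integrable Q (\<lambda>q. \<kappa> q *\<^sub>R X q z)"
    and "sqi N (\<lambda>z. LINT q|Q. \<kappa> q *\<^sub>R X q z)"
    and "\<And>y. sqi N y \<Longrightarrow> ip N (\<lambda>z. LINT q|Q. \<kappa> q *\<^sub>R X q z) y = (LINT q|Q. \<kappa> q * ip N (X q) y)"
proof -
  interpret Q: sigma_finite_measure Q by fact
  interpret N: sigma_finite_measure N by fact
  interpret P: pair_sigma_finite Q N ..
  have r0: "0 \<le> r q" for q using r(2)[of q] by simp
  define K where "K = (LINT q|Q. \<bar>\<kappa> q\<bar> * r q)"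
  have K: "(\<integral>\<^sup>+q. ennreal (\<bar>\<kappa> q\<bar> * r q) \<partial>Q) = ennreal K"
    unfolding K_def using int r0 by (intro nn_integral_eq_integral) auto
  have xn: "(\<integral>\<^sup>+z. ennreal ((norm (X q z))\<^sup>2) \<partial>N) \<le> ennreal ((r q)\<^sup>2)" if "q \<in> space Q" for q
  proof -
    have "(\<integral>\<^sup>+z. ennreal ((norm (X q z))\<^sup>2) \<partial>N) = ennreal (ip N (X q) (X q))"
      unfolding ip_self using sq[OF that] by (intro nn_integral_eq_integral) (auto simp: sqi_def)
    then show ?thesis using r(1)[OF that] by (simp add: ennreal_leI)
  qed
  define S where "S z = (\<integral>\<^sup>+q. ennreal (\<bar>\<kappa> q\<bar> * norm (X q z)) \<partial>Q)" for z
  have [measurable]: "S \<in> borel_measurable N"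
    unfolding S_def by measurable
  have CS: "(S z)\<^sup>2 \<le> ennreal K * (\<integral>\<^sup>+q. ennreal (\<bar>\<kappa> q\<bar> / r q * (norm (X q z))\<^sup>2) \<partial>Q)" if z: "z \<in> space N" for z
  proof -
    note [measurable] = measurable_compose[OF measurable_Pair2'[OF z] X, simplified]
    have "S z = (\<integral>\<^sup>+q. ennreal (sqrt (\<bar>\<kappa> q\<bar> * r q)) * ennreal (sqrt (\<bar>\<kappa> q\<bar> / r q) * norm (X q z)) \<partial>Q)"
      unfolding S_def
    proof (intro nn_integral_cong)
      fix q
      have "sqrt (\<bar>\<kappa> q\<bar> * r q) * (sqrt (\<bar>\<kappa> q\<bar> / r q) * norm (X q z)) = \<bar>\<kappa> q\<bar> * norm (X q z)"
      proof -
        have "sqrt (\<bar>\<kappa> q\<bar> * r q) * sqrt (\<bar>\<kappa> q\<bar> / r q) = sqrt (\<bar>\<kappa> q\<bar>\<^sup>2)"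
          using r(2)[of q] by (simp only: real_sqrt_mult[symmetric]) (simp add: field_simps power2_eq_square)
        then show ?thesis by (simp add: mult.assoc[symmetric])
      qed
      then show "ennreal (\<bar>\<kappa> q\<bar> * norm (X q z)) = ennreal (sqrt (\<bar>\<kappa> q\<bar> * r q)) * ennreal (sqrt (\<bar>\<kappa> q\<bar> / r q) * norm (X q z))"
        using r0 by (subst ennreal_mult'[symmetric]) (auto simp del: real_sqrt_mult)
    qed
    then have "(S z)\<^sup>2 \<le> (\<integral>\<^sup>+q. (ennreal (sqrt (\<bar>\<kappa> q\<bar> * r q)))\<^sup>2 \<partial>Q) * (\<integral>\<^sup>+q. (ennreal (sqrt (\<bar>\<kappa> q\<bar> / r q) * norm (X q z)))\<^sup>2 \<partial>Q)"
      using Cauchy_Schwarz_nn_integral[of "\<lambda>q. ennreal (sqrt (\<bar>\<kappa> q\<bar> * r q))" Q "\<lambda>q. ennreal (sqrt (\<bar>\<kappa> q\<bar> / r q) * norm (X q z))"]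
      by simp
    also have "(\<integral>\<^sup>+q. (ennreal (sqrt (\<bar>\<kappa> q\<bar> * r q)))\<^sup>2 \<partial>Q) = ennreal K"
      unfolding K[symmetric] using r0 by (intro nn_integral_cong) (simp add: ennreal_power)
    also have "(\<integral>\<^sup>+q. (ennreal (sqrt (\<bar>\<kappa> q\<bar> / r q) * norm (X q z)))\<^sup>2 \<partial>Q) = (\<integral>\<^sup>+q. ennreal (\<bar>\<kappa> q\<bar> / r q * (norm (X q z))\<^sup>2) \<partial>Q)"
      using r0 by (intro nn_integral_cong) (simp add: ennreal_power power_mult_distrib)
    finally show ?thesis .
  qed
  have S2: "(\<integral>\<^sup>+z. (S z)\<^sup>2 \<partial>N) \<le> ennreal K * ennreal K"
  proof -
    have "(\<integral>\<^sup>+z. (S z)\<^sup>2 \<partial>N) \<le> (\<integral>\<^sup>+z. ennreal K * (\<integral>\<^sup>+q. ennreal (\<bar>\<kappa> q\<bar> / r q * (norm (X q z))\<^sup>2) \<partial>Q) \<partial>N)"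
      by (intro nn_integral_mono CS)
    also have "\<dots> = ennreal K * (\<integral>\<^sup>+z. (\<integral>\<^sup>+q. ennreal (\<bar>\<kappa> q\<bar> / r q * (norm (X q z))\<^sup>2) \<partial>Q) \<partial>N)"
      by (intro nn_integral_cmult) simp
    finally have 1: "(\<integral>\<^sup>+z. (S z)\<^sup>2 \<partial>N) \<le> ennreal K * (\<integral>\<^sup>+z. (\<integral>\<^sup>+q. ennreal (\<bar>\<kappa> q\<bar> / r q * (norm (X q z))\<^sup>2) \<partial>Q) \<partial>N)" .
    have "(\<integral>\<^sup>+z. (\<integral>\<^sup>+q. ennreal (\<bar>\<kappa> q\<bar> / r q * (norm (X q z))\<^sup>2) \<partial>Q) \<partial>N)
      = (\<integral>\<^sup>+q. (\<integral>\<^sup>+z. ennreal (\<bar>\<kappa> q\<bar> / r q * (norm (X q z))\<^sup>2) \<partial>N) \<partial>Q)"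
      by (intro P.Fubini') simp
    also have "\<dots> = (\<integral>\<^sup>+q. ennreal (\<bar>\<kappa> q\<bar> / r q) * (\<integral>\<^sup>+z. ennreal ((norm (X q z))\<^sup>2) \<partial>N) \<partial>Q)"
      using r0 by (intro nn_integral_cong, subst nn_integral_cmult[symmetric]) (auto simp: ennreal_mult[symmetric] simp del: times_divide_eq_left)
    also have "\<dots> \<le> (\<integral>\<^sup>+q. ennreal (\<bar>\<kappa> q\<bar> / r q) * ennreal ((r q)\<^sup>2) \<partial>Q)"
      using xn by (intro nn_integral_mono mult_left_mono) auto
    also have "\<dots> = ennreal K"
      unfolding K[symmetric] using r(2) r0
      by (intro nn_integral_cong) (simp add: ennreal_mult'[symmetric] power2_eq_square less_imp_neq[symmetric])
    finally have "(\<integral>\<^sup>+z. (\<integral>\<^sup>+q. ennreal (\<bar>\<kappa> q\<bar> / r q * (norm (X q z))\<^sup>2) \<partial>Q) \<partial>N) \<le> ennreal K" .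
    then show ?thesis using 1 by (meson mult_left_mono order_trans zero_le)
  qed
  then have "(\<integral>\<^sup>+z. (S z)\<^sup>2 \<partial>N) \<noteq> \<infinity>"
    by (metis ennreal_mult_less_top ennreal_less_top infinity_ennreal_def leD)
  then have fin: "AE z in N. S z < \<infinity>"
    using nn_integral_PInf_AE[of "\<lambda>z. (S z)\<^sup>2" N]
    by (auto elim!: eventually_mono simp: less_top power_less_top_ennreal)
  have int_z: "integrable Q (\<lambda>q. \<kappa> q *\<^sub>R X q z)" if z: "z \<in> space N" and "S z < \<infinity>" for z
  proof -
    note [measurable] = measurable_compose[OF measurable_Pair2'[OF z] X, simplified]
    show ?thesis
      using that(2) unfolding S_def by (intro integrableI_bounded) simp_all
  qed
  show AEi: "AE z in N. integrable Q (\<lambda>q. \<kappa> q *\<^sub>R X q z)"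
    using fin AE_space by eventually_elim (rule int_z)
  have m: "(\<lambda>z. LINT q|Q. \<kappa> q *\<^sub>R X q z) \<in> borel_measurable N"
    by measurable
  show "sqi N (\<lambda>z. LINT q|Q. \<kappa> q *\<^sub>R X q z)"
    unfolding sqi_def
  proof (intro conjI integrableI_bounded)
    have "(\<integral>\<^sup>+z. ennreal (norm ((norm (LINT q|Q. \<kappa> q *\<^sub>R X q z))\<^sup>2)) \<partial>N) \<le> (\<integral>\<^sup>+z. (S z)\<^sup>2 \<partial>N)"
    proof (intro nn_integral_mono_AE, use AEi in eventually_elim)
      fix z assume i: "integrable Q (\<lambda>q. \<kappa> q *\<^sub>R X q z)"
      have "ennreal (norm (LINT q|Q. \<kappa> q *\<^sub>R X q z)) \<le> S z"
        unfolding S_def using integral_norm_bound_ennreal[OF i] by simp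
      then have "(ennreal (norm (LINT q|Q. \<kappa> q *\<^sub>R X q z)))\<^sup>2 \<le> (S z)\<^sup>2"
        by (intro power_mono) auto
      then show "ennreal (norm ((norm (LINT q|Q. \<kappa> q *\<^sub>R X q z))\<^sup>2)) \<le> (S z)\<^sup>2"
        by (simp add: ennreal_power)
    qed
    also have "\<dots> < \<infinity>" using S2 by (metis ennreal_mult_less_top ennreal_less_top infinity_ennreal_def order_le_less_trans)
    finally show "(\<integral>\<^sup>+z. ennreal (norm ((norm (LINT q|Q. \<kappa> q *\<^sub>R X q z))\<^sup>2)) \<partial>N) < \<infinity>" .
  qed (use m in simp_all)
  fix y :: "'z \<Rightarrow> 'e" assume y: "sqi N y"
  note [measurable] = sqi_meas[OF y]
  define Y where "Y = (LINT z|N. (norm (y z))\<^sup>2)"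
  have Y: "(\<integral>\<^sup>+z. ennreal ((norm (y z))\<^sup>2) \<partial>N) = ennreal Y" "0 \<le> Y"
    unfolding Y_def using y by (auto intro!: nn_integral_eq_integral simp: sqi_def)
  have I: "integrable (Q \<Otimes>\<^sub>M N) (\<lambda>(q, z). \<kappa> q * (X q z \<bullet> y z))"
  proof (rule integrableI_bounded)
    have "(\<integral>\<^sup>+p. ennreal (norm (case p of (q, z) \<Rightarrow> \<kappa> q * (X q z \<bullet> y z))) \<partial>(Q \<Otimes>\<^sub>M N))
      = (\<integral>\<^sup>+q. \<integral>\<^sup>+z. ennreal \<bar>\<kappa> q * (X q z \<bullet> y z)\<bar> \<partial>N \<partial>Q)"
      by (subst N.nn_integral_fst[symmetric]) (simp_all add: split_beta')
    also have "\<dots> \<le> (\<integral>\<^sup>+q. ennreal (\<bar>\<kappa> q\<bar> * r q) * ennreal (1 + Y) \<partial>Q)"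
    proof (intro nn_integral_mono)
      fix q assume q: "q \<in> space Q"
      note [measurable] = measurable_compose[OF measurable_Pair1'[OF q] X, simplified]
      have "\<bar>\<kappa> q * (X q z \<bullet> y z)\<bar> \<le> \<bar>\<kappa> q\<bar> / r q * (norm (X q z))\<^sup>2 + \<bar>\<kappa> q\<bar> * r q * (norm (y z))\<^sup>2" for z
      proof -
        have "\<bar>X q z \<bullet> y z\<bar> = r q * \<bar>((1 / r q) *\<^sub>R X q z) \<bullet> y z\<bar>"
          using r(2)[of q] by (simp add: abs_mult)
        also have "\<dots> \<le> r q * ((norm ((1 / r q) *\<^sub>R X q z))\<^sup>2 + (norm (y z))\<^sup>2)"
          using r0[of q] by (intro mult_left_mono abs_inner_le_sq)
        also have "\<dots> = 1 / r q * (norm (X q z))\<^sup>2 + r q * (norm (y z))\<^sup>2"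
          using r(2)[of q] by (simp add: field_simps power2_eq_square)
        finally have "\<bar>\<kappa> q\<bar> * \<bar>X q z \<bullet> y z\<bar> \<le> \<bar>\<kappa> q\<bar> * (1 / r q * (norm (X q z))\<^sup>2 + r q * (norm (y z))\<^sup>2)"
          by (intro mult_left_mono) auto
        then show ?thesis by (simp add: abs_mult algebra_simps)
      qed
      then have "(\<integral>\<^sup>+z. ennreal \<bar>\<kappa> q * (X q z \<bullet> y z)\<bar> \<partial>N)
        \<le> (\<integral>\<^sup>+z. ennreal (\<bar>\<kappa> q\<bar> / r q) * ennreal ((norm (X q z))\<^sup>2) + ennreal (\<bar>\<kappa> q\<bar> * r q) * ennreal ((norm (y z))\<^sup>2) \<partial>N)"
        using r0[of q] by (intro nn_integral_mono) (simp add: ennreal_mult'[symmetric] ennreal_plus[symmetric] del: ennreal_plus)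
      also have "\<dots> = ennreal (\<bar>\<kappa> q\<bar> / r q) * (\<integral>\<^sup>+z. ennreal ((norm (X q z))\<^sup>2) \<partial>N) + ennreal (\<bar>\<kappa> q\<bar> * r q) * ennreal Y"
        by (subst nn_integral_add) (simp_all add: nn_integral_cmult Y)
      also have "\<dots> \<le> ennreal (\<bar>\<kappa> q\<bar> / r q) * ennreal ((r q)\<^sup>2) + ennreal (\<bar>\<kappa> q\<bar> * r q) * ennreal Y"
        using xn[OF q] by (intro add_mono mult_left_mono) auto
      also have "ennreal (\<bar>\<kappa> q\<bar> / r q) * ennreal ((r q)\<^sup>2) = ennreal (\<bar>\<kappa> q\<bar> * r q)"
        using r(2)[of q] r0[of q] by (simp add: ennreal_mult'[symmetric] power2_eq_square less_imp_neq[symmetric])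
      also have "ennreal (\<bar>\<kappa> q\<bar> * r q) + ennreal (\<bar>\<kappa> q\<bar> * r q) * ennreal Y = ennreal (\<bar>\<kappa> q\<bar> * r q) * ennreal (1 + Y)"
        using Y(2) by (simp add: distrib_left)
      finally show "(\<integral>\<^sup>+z. ennreal \<bar>\<kappa> q * (X q z \<bullet> y z)\<bar> \<partial>N) \<le> ennreal (\<bar>\<kappa> q\<bar> * r q) * ennreal (1 + Y)" .
    qed
    also have "\<dots> = ennreal K * ennreal (1 + Y)"
      by (subst nn_integral_multc) (simp_all add: K)
    also have "\<dots> < \<infinity>" by (simp add: ennreal_mult_less_top)
    finally show "(\<integral>\<^sup>+p. ennreal (norm (case p of (q, z) \<Rightarrow> \<kappa> q * (X q z \<bullet> y z))) \<partial>(Q \<Otimes>\<^sub>M N)) < \<infinity>" .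
  qed measurable
  have "ip N (\<lambda>z. LINT q|Q. \<kappa> q *\<^sub>R X q z) y = (LINT z|N. (LINT q|Q. \<kappa> q * (X q z \<bullet> y z)))"
    unfolding ip_def
  proof (intro integral_cong_AE)
    show "AE z in N. (LINT q|Q. \<kappa> q *\<^sub>R X q z) \<bullet> y z = (LINT q|Q. \<kappa> q * (X q z \<bullet> y z))"
      using AEi by eventually_elim (simp flip: integral_inner_left)
  qed measurable
  also have "\<dots> = (LINT q|Q. (LINT z|N. \<kappa> q * (X q z \<bullet> y z)))"
    using P.Fubini_integral[OF I] .
  also have "\<dots> = (LINT q|Q. \<kappa> q * ip N (X q) y)"
    by (simp add: ip_def)
  finally show "ip N (\<lambda>z. LINT q|Q. \<kappa> q *\<^sub>R X q z) y = (LINT q|Q. \<kappa> q * ip N (X q) y)" .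
qed


section \<open>Integrability and Fourier inversion on the line\<close>

definition pw :: "real \<Rightarrow> real \<Rightarrow> real \<Rightarrow> real" where
  "pw p q x = (if \<bar>x\<bar> \<le> 1 then \<bar>x\<bar> powr p else \<bar>x\<bar> powr q)"

lemma pw_measurable[measurable]: "pw p q \<in> borel_measurable borel"
  unfolding pw_def by measurable

lemma pw_nonneg[simp]: "0 \<le> pw p q x"
  by (simp add: pw_def)

lemma integrable_pw:
  assumes "-1 < p" "q < -1" shows "integrable lborel (pw p q)"
proof -
  have abs_int: "set_integrable lborel S f"
    if "(f has_integral I) S" "\<And>x. x \<in> S \<Longrightarrow> 0 \<le> f x" "(\<lambda>x. indicator S x *\<^sub>R f x) \<in> borel_measurable lborel"
    for f :: "real \<Rightarrow> real" and S I
  proof -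
    have "f absolutely_integrable_on S"
      using that(1,2) by (intro nonnegative_absolutely_integrable_1) (auto simp: integrable_on_def)
    then show ?thesis
      using that(3) unfolding set_integrable_def by (simp add: integrable_completion)
  qed
  have 1: "set_integrable lborel {0..1} (\<lambda>x. x powr p)"
    using has_integral_powr_from_0[of p 1] assms by (intro abs_int) auto
  have 2: "set_integrable lborel {1..} (\<lambda>x. x powr q)"
    using has_integral_powr_to_inf[of q 1] assms by (intro abs_int) auto
  define h where "h = (\<lambda>x::real. indicator {0..1} x *\<^sub>R x powr p + indicator {1..} x *\<^sub>R x powr q)"
  have h: "integrable lborel h"
    unfolding h_def using 1 2 by (auto simp: set_integrable_def)
  then have h': "integrable lborel (\<lambda>x. h (- x))"
    using lborel_integrable_real_affine[of h "-1" 0] by simp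
  show ?thesis
  proof (rule Bochner_Integration.integrable_bound[OF Bochner_Integration.integrable_add[OF h h']])
    show "AE x in lborel. norm (pw p q x) \<le> norm (h x + h (- x))"
    proof (intro AE_I2)
      fix x :: real
      have h0: "0 \<le> h y" for y unfolding h_def by (auto split: split_indicator)
      have "pw p q x \<le> h x \<or> pw p q x \<le> h (- x)"
        unfolding pw_def h_def by (auto split: split_indicator simp: abs_if)
      then have "pw p q x \<le> h x + h (- x)"
        using h0[of x] h0[of "-x"] by linarith
      then show "norm (pw p q x) \<le> norm (h x + h (- x))" by simp
    qed
  qed simp
qed

lemma integrable_pw_bound:
  fixes f :: "real \<Rightarrow> 'b::{banach, second_countable_topology}"
  assumes "-1 < p" "q < -1" "f \<in> borel_measurable borel" "\<And>x. x \<noteq> 0 \<Longrightarrow> norm (f x) \<le> C * pw p q x"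
  shows "integrable lborel f"
proof (rule Bochner_Integration.integrable_bound)
  show "integrable lborel (\<lambda>x. C * pw p q x)"
    using integrable_pw[OF assms(1,2)] by simp
  show "AE x in lborel. norm (f x) \<le> norm (C * pw p q x)"
  proof (rule AE_mp[OF AE_lborel_singleton[of 0]], intro AE_I2 impI)
    fix x :: real assume "x \<noteq> 0"
    then show "norm (f x) \<le> norm (C * pw p q x)" using assms(4)[of x] by simp
  qed
qed (use assms in simp)

lemma integrable_mult_prod:
  fixes f :: "'x \<Rightarrow> 'b::{real_normed_field, banach, second_countable_topology}"
  assumes "sigma_finite_measure M1" "sigma_finite_measure M2" "integrable M1 f" "integrable M2 g"
  shows "integrable (M1 \<Otimes>\<^sub>M M2) (\<lambda>p. f (fst p) * g (snd p))"
proof -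
  interpret sigma_finite_measure M1 by fact
  interpret M2: sigma_finite_measure M2 by fact
  interpret pair_sigma_finite M1 M2 ..
  note [measurable] = borel_measurable_integrable[OF assms(3)] borel_measurable_integrable[OF assms(4)]
  show ?thesis
    using assms(3,4) by (intro Fubini_integrable) (simp_all add: norm_mult)
qed

lemma integral_mult_prod:
  fixes f :: "'x \<Rightarrow> 'b::{real_normed_field, banach, second_countable_topology}"
  assumes "sigma_finite_measure M1" "sigma_finite_measure M2" "integrable M1 f" "integrable M2 g"
  shows "(LINT p|(M1 \<Otimes>\<^sub>M M2). f (fst p) * g (snd p)) = (LINT x|M1. f x) * (LINT y|M2. g y)"
proof -
  interpret sigma_finite_measure M1 by fact
  interpret M2: sigma_finite_measure M2 by fact
  interpret pair_sigma_finite M1 M2 ..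
  show ?thesis
    using integral_fst'[OF integrable_mult_prod[OF assms]] assms(3,4) by simp
qed

lemma integrable_lborel2:
  fixes f g :: "real \<Rightarrow> 'b::{real_normed_field, banach, second_countable_topology}"
  assumes "integrable lborel f" "integrable lborel g"
  shows "integrable lborel (\<lambda>p. f (fst p) * g (snd p))"
  using integrable_mult_prod[OF _ _ assms] by (simp add: lborel_prod sigma_finite_lborel)

lemma integral_lborel2:
  fixes f g :: "real \<Rightarrow> 'b::{real_normed_field, banach, second_countable_topology}"
  assumes "integrable lborel f" "integrable lborel g"
  shows "(LINT p|lborel. f (fst p) * g (snd p)) = (LINT x|lborel. f x) * (LINT y|lborel. g y)"
  using integral_mult_prod[OF _ _ assms] by (simp add: lborel_prod sigma_finite_lborel)

lemma integrable_mult_bounded: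
  fixes f :: "'x \<Rightarrow> 'b::{real_normed_field, second_countable_topology, banach}"
  assumes "integrable N f" "g \<in> borel_measurable N" "\<And>x. norm (g x) \<le> C"
  shows "integrable N (\<lambda>x. f x * g x)"
proof (rule Bochner_Integration.integrable_bound)
  show "integrable N (\<lambda>x. C * norm (f x))" using assms(1) by simp
  have "0 \<le> C" using assms(3) norm_ge_zero order_trans by blast
  then show "AE x in N. norm (f x * g x) \<le> norm (C * norm (f x))"
    using assms(3) by (auto simp: norm_mult mult.commute[of C] intro!: mult_left_mono AE_I2)
  show "(\<lambda>x. f x * g x) \<in> borel_measurable N"
    using assms by (intro borel_measurable_times) auto
qed

definition FI :: "(real \<Rightarrow> complex) \<Rightarrow> real \<Rightarrow> complex" where
  "FI \<phi> x = (LINT \<xi>|lborel. \<phi> \<xi> * cis (\<xi> * x))"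

lemma cis_measurable[measurable]: "cis \<in> borel_measurable borel"
  by (intro borel_measurable_continuous_onI continuous_intros)

lemma FI_measurable[measurable]:
  assumes [measurable]: "\<phi> \<in> borel_measurable borel" shows "FI \<phi> \<in> borel_measurable borel"
  unfolding FI_def by measurable

lemma FI_integrable: "integrable lborel \<phi> \<Longrightarrow> integrable lborel (\<lambda>\<xi>. \<phi> \<xi> * cis (\<xi> * x))"
  by (rule integrable_mult_bounded[where C=1]) auto

lemma norm_FI_le: "norm (FI \<phi> x) \<le> (LINT \<xi>|lborel. norm (\<phi> \<xi>))"
  unfolding FI_def by (rule order_trans[OF integral_norm_bound]) (simp add: norm_mult)

lemma integral_normal_cis:
  "(LINT x|lborel. of_real (std_normal_density x) * cis (t * x)) = complex_of_real (exp (- (t\<^sup>2) / 2))"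
  using fun_cong[OF char_std_normal_distribution, of t]
  unfolding char_def by (subst (asm) integral_density) (simp_all add: cis_conv_exp scaleR_conv_of_real)

lemma integral_scaled_normal_cis:
  assumes "0 < c"
  shows "(LINT x|lborel. of_real (std_normal_density (x / c)) * cis (u * x))
    = complex_of_real (sqrt (2 * pi) * c * std_normal_density (u * c))"
proof -
  have "(LINT x|lborel. of_real (std_normal_density (x / c)) * cis (u * x))
    = \<bar>c\<bar> *\<^sub>R (LINT x|lborel. of_real (std_normal_density ((0 + c * x) / c)) * cis (u * (0 + c * x)))"
    using assms by (intro lborel_integral_real_affine) simp
  also have "\<dots> = \<bar>c\<bar> *\<^sub>R (LINT x|lborel. of_real (std_normal_density x) * cis ((u * c) * x))"
    using assms by (simp add: mult.assoc)
  also have "\<dots> = complex_of_real (sqrt (2 * pi) * c * std_normal_density (u * c))"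
    unfolding integral_normal_cis using assms by (simp add: std_normal_density_def scaleR_conv_of_real)
  finally show ?thesis .
qed

lemma fourier_inversion:
  fixes \<phi> :: "real \<Rightarrow> complex"
  assumes \<phi>: "integrable lborel \<phi>" "\<And>\<xi>. norm (\<phi> \<xi>) \<le> C" "isCont \<phi> \<xi>0" and F: "integrable lborel (FI \<phi>)"
  shows "(LINT x|lborel. FI \<phi> x * cis (- (\<xi>0 * x))) = 2 * pi * \<phi> \<xi>0"
proof -
  note [measurable] = borel_measurable_integrable[OF \<phi>(1)]
  define D where "D n x = sqrt (2 * pi) * std_normal_density (x / real (Suc n))" for n x
  have [measurable]: "D n \<in> borel_measurable borel" for n unfolding D_def by measurable
  have D0: "0 \<le> D n x" "D n x \<le> 1" for n x
    by (auto simp: D_def std_normal_density_def)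
  have D_int: "integrable lborel (D n)" for n
  proof -
    have "integrable lborel (\<lambda>x. std_normal_density (0 + (1 / real (Suc n)) * x))"
      by (rule lborel_integrable_real_affine) (simp_all add: integrable_normal_density)
    then show ?thesis unfolding D_def by simp
  qed
  define I where "I n = (LINT x|lborel. FI \<phi> x * cis (- (\<xi>0 * x)) * of_real (D n x))" for n
  have "I \<longlonglongrightarrow> (LINT x|lborel. FI \<phi> x * cis (- (\<xi>0 * x)))"
    unfolding I_def
  proof (rule integral_dominated_convergence[where w="\<lambda>x. norm (FI \<phi> x)"])
    show "AE x in lborel. (\<lambda>n. FI \<phi> x * cis (- (\<xi>0 * x)) * of_real (D n x)) \<longlonglongrightarrow> FI \<phi> x * cis (- (\<xi>0 * x))"
    proof (intro AE_I2)
      fix x :: real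
      have "(\<lambda>n. x / real (Suc n)) \<longlonglongrightarrow> 0"
        by real_asymp
      then have "(\<lambda>n. D n x) \<longlonglongrightarrow> sqrt (2 * pi) * (1 / sqrt (2 * pi) * exp (- 0\<^sup>2 / 2))"
        unfolding D_def std_normal_density_def by (intro tendsto_intros) auto
      then have "(\<lambda>n. D n x) \<longlonglongrightarrow> 1" by simp
      then have "(\<lambda>n. FI \<phi> x * cis (- (\<xi>0 * x)) * of_real (D n x)) \<longlonglongrightarrow> FI \<phi> x * cis (- (\<xi>0 * x)) * of_real 1"
        by (intro tendsto_intros)
      then show "(\<lambda>n. FI \<phi> x * cis (- (\<xi>0 * x)) * of_real (D n x)) \<longlonglongrightarrow> FI \<phi> x * cis (- (\<xi>0 * x))" by simp
    qed
    show "AE x in lborel. norm (FI \<phi> x * cis (- (\<xi>0 * x)) * of_real (D n x)) \<le> norm (FI \<phi> x)" for n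
      using D0 by (auto simp: norm_mult intro!: AE_I2 mult_left_le)
    show "integrable lborel (\<lambda>x. norm (FI \<phi> x))" using F by simp
  qed (measurable)
  moreover have "I n = (LINT z|lborel. 2 * pi * (\<phi> (\<xi>0 + z / real (Suc n)) * of_real (std_normal_density z)))" for n
  proof -
    have int2: "integrable lborel (\<lambda>p. of_real (D n (fst p)) * \<phi> (snd p))"
      by (intro integrable_lborel2 \<phi>(1)) (use D_int in simp)
    have int: "integrable (lborel \<Otimes>\<^sub>M lborel) (\<lambda>(x, \<xi>). \<phi> \<xi> * cis (\<xi> * x) * cis (- (\<xi>0 * x)) * of_real (D n x))"
      unfolding lborel_prod
    proof (rule Bochner_Integration.integrable_bound[OF int2])
      show "(\<lambda>(x, \<xi>). \<phi> \<xi> * cis (\<xi> * x) * cis (- (\<xi>0 * x)) * complex_of_real (D n x)) \<in> borel_measurable lborel"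
        by (subst lborel_prod[symmetric]) measurable
    qed (auto simp: norm_mult)
    have "I n = (LINT x|lborel. LINT \<xi>|lborel. \<phi> \<xi> * cis (\<xi> * x) * cis (- (\<xi>0 * x)) * of_real (D n x))"
      unfolding I_def FI_def by (simp add: mult.assoc flip: integral_mult_left_zero)
    also have "\<dots> = (LINT \<xi>|lborel. LINT x|lborel. \<phi> \<xi> * cis (\<xi> * x) * cis (- (\<xi>0 * x)) * of_real (D n x))"
      using lborel_pair.Fubini_integral[OF int] by simp
    also have "\<dots> = (LINT \<xi>|lborel. \<phi> \<xi> * of_real (2 * pi * real (Suc n) * std_normal_density ((\<xi> - \<xi>0) * real (Suc n))))"
    proof (intro Bochner_Integration.integral_cong refl)
      fix \<xi> :: real
      have "(LINT x|lborel. \<phi> \<xi> * cis (\<xi> * x) * cis (- (\<xi>0 * x)) * of_real (D n x))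
        = (LINT x|lborel. (\<phi> \<xi> * sqrt (2 * pi)) * (of_real (std_normal_density (x / real (Suc n))) * cis ((\<xi> - \<xi>0) * x)))"
        unfolding D_def by (intro Bochner_Integration.integral_cong refl) (simp add: cis_mult algebra_simps)
      also have "\<dots> = (\<phi> \<xi> * sqrt (2 * pi)) * of_real (sqrt (2 * pi) * real (Suc n) * std_normal_density ((\<xi> - \<xi>0) * real (Suc n)))"
        by (subst integral_mult_right_zero, subst integral_scaled_normal_cis) auto
      also have "\<dots> = \<phi> \<xi> * of_real ((sqrt (2 * pi) * sqrt (2 * pi)) * real (Suc n) * std_normal_density ((\<xi> - \<xi>0) * real (Suc n)))"
        unfolding of_real_mult by (simp only: mult_ac)
      also have "sqrt (2 * pi) * sqrt (2 * pi) = 2 * pi" by simp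
      finally show "(LINT x|lborel. \<phi> \<xi> * cis (\<xi> * x) * cis (- (\<xi>0 * x)) * of_real (D n x))
        = \<phi> \<xi> * of_real (2 * pi * real (Suc n) * std_normal_density ((\<xi> - \<xi>0) * real (Suc n)))" .
    qed
    also have "\<dots> = \<bar>1 / real (Suc n)\<bar> *\<^sub>R (LINT z|lborel. \<phi> (\<xi>0 + (1 / real (Suc n)) * z) *
        of_real (2 * pi * real (Suc n) * std_normal_density ((\<xi>0 + (1 / real (Suc n)) * z - \<xi>0) * real (Suc n))))"
      by (rule lborel_integral_real_affine) simp
    also have "\<dots> = (LINT z|lborel. (1 / real (Suc n)) *\<^sub>R (\<phi> (\<xi>0 + (1 / real (Suc n)) * z) *
        of_real (2 * pi * real (Suc n) * std_normal_density z)))"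
      by (subst integral_scaleR_right) simp
    also have "\<dots> = (LINT z|lborel. 2 * pi * (\<phi> (\<xi>0 + z / real (Suc n)) * of_real (std_normal_density z)))"
      by (intro Bochner_Integration.integral_cong refl) (simp add: scaleR_conv_of_real field_simps del: of_nat_Suc)
    finally show ?thesis .
  qed
  moreover have "(\<lambda>n. LINT z|lborel. 2 * pi * (\<phi> (\<xi>0 + z / real (Suc n)) * of_real (std_normal_density z)))
    \<longlonglongrightarrow> (LINT z|lborel. 2 * pi * (\<phi> \<xi>0 * of_real (std_normal_density z)))"
  proof (rule integral_dominated_convergence[where w="\<lambda>z. 2 * pi * (C * std_normal_density z)"])
    show "AE z in lborel. (\<lambda>n. 2 * pi * (\<phi> (\<xi>0 + z / real (Suc n)) * of_real (std_normal_density z)))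
      \<longlonglongrightarrow> 2 * pi * (\<phi> \<xi>0 * of_real (std_normal_density z))"
    proof (intro AE_I2 tendsto_intros)
      fix z :: real
      have "(\<lambda>n. \<xi>0 + z / real (Suc n)) \<longlonglongrightarrow> \<xi>0" by real_asymp
      then show "(\<lambda>n. \<phi> (\<xi>0 + z / real (Suc n))) \<longlonglongrightarrow> \<phi> \<xi>0"
        using \<phi>(3) by (rule isCont_tendsto_compose[rotated])
    qed
    show "AE z in lborel. norm (2 * pi * (\<phi> (\<xi>0 + z / real (Suc n)) * of_real (std_normal_density z))) \<le> 2 * pi * (C * std_normal_density z)" for n
      using \<phi>(2) by (auto simp: norm_mult intro!: AE_I2 mult_right_mono mult_left_mono)
  qed (simp_all add: integrable_normal_density)
  moreover have "(LINT z|lborel. 2 * pi * (\<phi> \<xi>0 * of_real (std_normal_density z))) = 2 * pi * \<phi> \<xi>0"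
    by (simp add: integral_complex_of_real integral_normal_density)
  ultimately show ?thesis
    using LIMSEQ_unique by (metis (no_types, lifting) ext)
qed

section \<open>Decay of Fourier integrals\<close>

lemma integral_FTC_jump:
  fixes F :: "real \<Rightarrow> 'e::euclidean_space"
  assumes F: "\<And>x. x \<noteq> 0 \<Longrightarrow> (F has_vector_derivative f x) (at x)"
    and f: "\<And>x. x \<noteq> 0 \<Longrightarrow> isCont f x" "integrable lborel f"
    and lim: "(F \<longlongrightarrow> A) (at_right 0)" "(F \<longlongrightarrow> B) (at_left 0)" "(F \<longlongrightarrow> 0) at_top" "(F \<longlongrightarrow> 0) at_bot"
  shows "(LINT x|lborel. f x) = B - A"
proof -
  have si: "set_integrable lborel S f" if "S \<in> sets lborel" for S
    using that f(2) by (rule integrable_mult_indicator[folded set_integrable_def])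
  have 1: "(LBINT x=ereal 0..\<infinity>. f x) = 0 - A"
    using F f lim si by (intro interval_integral_FTC_integrable[where F=F]) (auto simp: ereal_tendsto_simps)
  have 2: "(LBINT x=-\<infinity>..ereal 0. f x) = B - 0"
    using F f lim si by (intro interval_integral_FTC_integrable[where F=F]) (auto simp: ereal_tendsto_simps)
  have "(LINT x|lborel. f x) = (LINT x|lborel. indicator {0<..} x *\<^sub>R f x + indicator {..<0} x *\<^sub>R f x)"
  proof (rule integral_cong_AE)
    show "AE x in lborel. f x = indicator {0<..} x *\<^sub>R f x + indicator {..<0} x *\<^sub>R f x"
      using AE_lborel_singleton[of 0] by eventually_elim (auto simp: indicator_def)
  qed (use borel_measurable_integrable[OF f(2)] in measurable)
  also have "\<dots> = (LINT x|lborel. indicator {0<..} x *\<^sub>R f x) + (LINT x|lborel. indicator {..<0} x *\<^sub>R f x)"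
    using si[of "{0<..}"] si[of "{..<0}"] by (intro Bochner_Integration.integral_add) (auto simp: set_integrable_def)
  also have "\<dots> = B - A"
    using 1 2 by (simp add: interval_lebesgue_integral_def set_lebesgue_integral_def)
  finally show ?thesis .
qed

lemma cis_linear_deriv:
  "((\<lambda>\<xi>. cis (\<xi> * x)) has_vector_derivative \<i> * of_real x * cis (\<xi> * x)) (at \<xi>)"
  unfolding has_vector_derivative_def
  by (auto intro!: derivative_eq_intros simp: fun_eq_iff scaleR_conv_of_real)

lemma isCont_cis: "isCont f x \<Longrightarrow> isCont (\<lambda>x. cis (f x)) x"
  unfolding isCont_def by (rule tendsto_cis)

lemma FI_decay:
  fixes \<phi> \<phi>1 \<phi>2 :: "real \<Rightarrow> complex"
  assumes d: "\<And>\<xi>. \<xi> \<noteq> 0 \<Longrightarrow> (\<phi> has_vector_derivative \<phi>1 \<xi>) (at \<xi>)" "\<And>\<xi>. \<xi> \<noteq> 0 \<Longrightarrow> (\<phi>1 has_vector_derivative \<phi>2 \<xi>) (at \<xi>)"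
    and c: "isCont \<phi> 0" "isCont \<phi>1 0" "\<And>\<xi>. \<xi> \<noteq> 0 \<Longrightarrow> isCont \<phi>2 \<xi>"
    and i: "integrable lborel \<phi>" "integrable lborel \<phi>2"
    and l: "(\<phi> \<longlongrightarrow> 0) at_top" "(\<phi> \<longlongrightarrow> 0) at_bot" "(\<phi>1 \<longlongrightarrow> 0) at_top" "(\<phi>1 \<longlongrightarrow> 0) at_bot"
  shows "norm (FI \<phi> x) \<le> ((LINT \<xi>|lborel. norm (\<phi> \<xi>)) + (LINT \<xi>|lborel. norm (\<phi>2 \<xi>))) / (1 + x\<^sup>2)"
proof -
  have 0: "x\<^sup>2 * norm (FI \<phi> x) \<le> (LINT \<xi>|lborel. norm (\<phi>2 \<xi>))"
  proof (cases "x = 0")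
    case False
    define F where "F = (\<lambda>\<xi>. \<phi> \<xi> * cis (\<xi> * x) / (\<i> * x) + \<phi>1 \<xi> * cis (\<xi> * x) / x\<^sup>2)"
    have cont: "isCont \<phi> \<xi>" "isCont \<phi>1 \<xi>" for \<xi>
      using d[of \<xi>] c by (cases "\<xi> = 0"; force intro: has_vector_derivative_continuous)+
    have contF: "isCont F \<xi>" for \<xi>
      unfolding F_def using cont False by (intro continuous_intros isCont_cis) auto
    have int: "integrable lborel (\<lambda>\<xi>. \<phi> \<xi> * cis (\<xi> * x))" "integrable lborel (\<lambda>\<xi>. \<phi>2 \<xi> * cis (\<xi> * x))"
      using i FI_integrable by auto
    have "(LINT \<xi>|lborel. \<phi> \<xi> * cis (\<xi> * x) + \<phi>2 \<xi> * cis (\<xi> * x) / x\<^sup>2) = F 0 - F 0"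
    proof (rule integral_FTC_jump[where F=F])
      fix \<xi> :: real assume \<xi>: "\<xi> \<noteq> 0"
      have "(F has_vector_derivative
        ((\<phi> \<xi> * (\<i> * of_real x * cis (\<xi> * x)) + \<phi>1 \<xi> * cis (\<xi> * x)) / (\<i> * x)
          + (\<phi>1 \<xi> * (\<i> * of_real x * cis (\<xi> * x)) + \<phi>2 \<xi> * cis (\<xi> * x)) / x\<^sup>2)) (at \<xi>)"
        unfolding F_def
        by (intro has_vector_derivative_add has_vector_derivative_divide has_vector_derivative_mult d[OF \<xi>] cis_linear_deriv)
      also have "(\<phi> \<xi> * (\<i> * of_real x * cis (\<xi> * x)) + \<phi>1 \<xi> * cis (\<xi> * x)) / (\<i> * x)
          + (\<phi>1 \<xi> * (\<i> * of_real x * cis (\<xi> * x)) + \<phi>2 \<xi> * cis (\<xi> * x)) / x\<^sup>2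
        = \<phi> \<xi> * cis (\<xi> * x) + \<phi>2 \<xi> * cis (\<xi> * x) / x\<^sup>2"
        using False by (simp add: field_simps power2_eq_square)
      finally show "(F has_vector_derivative \<phi> \<xi> * cis (\<xi> * x) + \<phi>2 \<xi> * cis (\<xi> * x) / x\<^sup>2) (at \<xi>)" .
      show "isCont (\<lambda>\<xi>. \<phi> \<xi> * cis (\<xi> * x) + \<phi>2 \<xi> * cis (\<xi> * x) / x\<^sup>2) \<xi>"
        using cont c(3)[OF \<xi>] False by (intro continuous_intros isCont_cis) auto
    next
      show "integrable lborel (\<lambda>\<xi>. \<phi> \<xi> * cis (\<xi> * x) + \<phi>2 \<xi> * cis (\<xi> * x) / x\<^sup>2)"
        using int by simp
      show "(F \<longlongrightarrow> F 0) (at_right 0)" "(F \<longlongrightarrow> F 0) (at_left 0)"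
        using contF[of 0] by (auto simp: isCont_def intro: filterlim_at_within_not_equal tendsto_mono[OF at_le])
      have F0: "(F \<longlongrightarrow> 0) net" if "(\<phi> \<longlongrightarrow> 0) net" "(\<phi>1 \<longlongrightarrow> 0) net" for net
      proof -
        have "((\<lambda>\<xi>. norm (\<phi> \<xi>) / \<bar>x\<bar> + norm (\<phi>1 \<xi>) / x\<^sup>2) \<longlongrightarrow> 0 / \<bar>x\<bar> + 0 / x\<^sup>2) net"
          using that False by (intro tendsto_intros tendsto_norm_zero) auto
        then have "((\<lambda>\<xi>. norm (\<phi> \<xi>) / \<bar>x\<bar> + norm (\<phi>1 \<xi>) / x\<^sup>2) \<longlongrightarrow> 0) net" by simp
        then show ?thesis
        proof (rule Lim_null_comparison[rotated], intro always_eventually allI)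
          fix \<xi>
          show "norm (F \<xi>) \<le> norm (\<phi> \<xi>) / \<bar>x\<bar> + norm (\<phi>1 \<xi>) / x\<^sup>2"
            unfolding F_def by (rule order_trans[OF norm_triangle_ineq]) (simp add: norm_mult norm_divide norm_power)
        qed
      qed
      show "(F \<longlongrightarrow> 0) at_top" "(F \<longlongrightarrow> 0) at_bot" using F0 l by auto
    qed
    then have "FI \<phi> x = - (FI \<phi>2 x / x\<^sup>2)"
      using int by (simp add: FI_def add_eq_0_iff)
    then have "x\<^sup>2 * norm (FI \<phi> x) = norm (FI \<phi>2 x)"
      using False by (simp add: norm_divide norm_power)
    then show ?thesis using norm_FI_le[of \<phi>2 x] by simp
  qed simp
  have "(1 + x\<^sup>2) * norm (FI \<phi> x) \<le> (LINT \<xi>|lborel. norm (\<phi> \<xi>)) + (LINT \<xi>|lborel. norm (\<phi>2 \<xi>))"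
    using 0 norm_FI_le[of \<phi> x] by (simp add: algebra_simps)
  moreover have "0 < 1 + x\<^sup>2" by (simp add: add_pos_nonneg)
  ultimately show ?thesis by (simp add: pos_le_divide_eq mult.commute)
qed

definition symb :: "real \<Rightarrow> real \<Rightarrow> (real \<Rightarrow> complex) \<Rightarrow> bool" where
  "symb r C \<phi> \<longleftrightarrow> (\<exists>\<phi>1 \<phi>2. (\<forall>\<xi>. (\<phi> has_vector_derivative \<phi>1 \<xi>) (at \<xi>))
     \<and> (\<forall>\<xi>. (\<phi>1 has_vector_derivative \<phi>2 \<xi>) (at \<xi>)) \<and> (\<forall>\<xi>. isCont \<phi>2 \<xi>)
     \<and> (\<forall>\<xi>. norm (\<phi> \<xi>) \<le> C * (1 + \<bar>\<xi>\<bar>) powr (- r) \<and> norm (\<phi>1 \<xi>) \<le> C * (1 + \<bar>\<xi>\<bar>) powr (- r)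
          \<and> norm (\<phi>2 \<xi>) \<le> C * (1 + \<bar>\<xi>\<bar>) powr (- r)))"

lemma symbI:
  assumes "\<And>\<xi>. (\<phi> has_vector_derivative \<phi>' \<xi>) (at \<xi>)" "\<And>\<xi>. (\<phi>' has_vector_derivative \<phi>'' \<xi>) (at \<xi>)" "\<And>\<xi>. isCont \<phi>'' \<xi>"
    "\<And>\<xi>. norm (\<phi> \<xi>) \<le> C * (1 + \<bar>\<xi>\<bar>) powr (- r)" "\<And>\<xi>. norm (\<phi>' \<xi>) \<le> C * (1 + \<bar>\<xi>\<bar>) powr (- r)"
    "\<And>\<xi>. norm (\<phi>'' \<xi>) \<le> C * (1 + \<bar>\<xi>\<bar>) powr (- r)"
  shows "symb r C \<phi>"
  unfolding symb_def using assms by blast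

lemma symbE:
  assumes "symb r C \<phi>"
  obtains \<phi>1 \<phi>2 where "\<And>\<xi>. (\<phi> has_vector_derivative \<phi>1 \<xi>) (at \<xi>)" "\<And>\<xi>. (\<phi>1 has_vector_derivative \<phi>2 \<xi>) (at \<xi>)" "\<And>\<xi>. isCont \<phi>2 \<xi>"
    "\<And>\<xi>. norm (\<phi> \<xi>) \<le> C * (1 + \<bar>\<xi>\<bar>) powr (- r)" "\<And>\<xi>. norm (\<phi>1 \<xi>) \<le> C * (1 + \<bar>\<xi>\<bar>) powr (- r)"
    "\<And>\<xi>. norm (\<phi>2 \<xi>) \<le> C * (1 + \<bar>\<xi>\<bar>) powr (- r)"
  using assms unfolding symb_def by blast

lemma symb_nonneg: "symb r C \<phi> \<Longrightarrow> 0 \<le> C"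
proof -
  assume "symb r C \<phi>"
  then have "norm (\<phi> 0) \<le> C * (1 + \<bar>0\<bar>) powr (- r)" by (elim symbE) blast
  then show "0 \<le> C" using norm_ge_zero[of "\<phi> 0"] by (simp del: norm_ge_zero)
qed

lemma symb_mono:
  assumes "symb r C \<phi>" "s \<le> r" "C \<le> D" shows "symb s D \<phi>"
proof -
  have "C * (1 + \<bar>\<xi>\<bar>) powr (- r) \<le> D * (1 + \<bar>\<xi>\<bar>) powr (- s)" for \<xi> :: real
    using assms symb_nonneg[OF assms(1)] by (intro mult_mono powr_mono) auto
  with assms(1) show ?thesis
    by (elim symbE, intro symbI) (assumption | meson order_trans)+
qed

lemma symb_mult:
  assumes "symb r C \<phi>" "symb s D \<psi>" shows "symb (r + s) (4 * C * D) (\<lambda>\<xi>. \<phi> \<xi> * \<psi> \<xi>)"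
proof -
  obtain \<phi>1 \<phi>2 where f: "\<And>\<xi>. (\<phi> has_vector_derivative \<phi>1 \<xi>) (at \<xi>)" "\<And>\<xi>. (\<phi>1 has_vector_derivative \<phi>2 \<xi>) (at \<xi>)" "\<And>\<xi>. isCont \<phi>2 \<xi>"
    "\<And>\<xi>. norm (\<phi> \<xi>) \<le> C * (1 + \<bar>\<xi>\<bar>) powr (- r)" "\<And>\<xi>. norm (\<phi>1 \<xi>) \<le> C * (1 + \<bar>\<xi>\<bar>) powr (- r)"
    "\<And>\<xi>. norm (\<phi>2 \<xi>) \<le> C * (1 + \<bar>\<xi>\<bar>) powr (- r)" using assms(1) by (elim symbE) blast
  obtain \<psi>1 \<psi>2 where g: "\<And>\<xi>. (\<psi> has_vector_derivative \<psi>1 \<xi>) (at \<xi>)" "\<And>\<xi>. (\<psi>1 has_vector_derivative \<psi>2 \<xi>) (at \<xi>)" "\<And>\<xi>. isCont \<psi>2 \<xi>"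
    "\<And>\<xi>. norm (\<psi> \<xi>) \<le> D * (1 + \<bar>\<xi>\<bar>) powr (- s)" "\<And>\<xi>. norm (\<psi>1 \<xi>) \<le> D * (1 + \<bar>\<xi>\<bar>) powr (- s)"
    "\<And>\<xi>. norm (\<psi>2 \<xi>) \<le> D * (1 + \<bar>\<xi>\<bar>) powr (- s)" using assms(2) by (elim symbE) blast
  have C: "0 \<le> C" "0 \<le> D" using assms symb_nonneg by auto
  have cont: "isCont \<phi> \<xi>" "isCont \<phi>1 \<xi>" "isCont \<psi> \<xi>" "isCont \<psi>1 \<xi>" for \<xi>
    using f(1,2) g(1,2) by (blast intro: has_vector_derivative_continuous)+
  have prod: "norm (a * b) \<le> C * D * (1 + \<bar>\<xi>\<bar>) powr (- (r + s))"
    if "norm a \<le> C * (1 + \<bar>\<xi>\<bar>) powr (- r)" "norm b \<le> D * (1 + \<bar>\<xi>\<bar>) powr (- s)" for a b :: complex and \<xi> :: real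
  proof -
    have "norm (a * b) \<le> (C * (1 + \<bar>\<xi>\<bar>) powr (- r)) * (D * (1 + \<bar>\<xi>\<bar>) powr (- s))"
      unfolding norm_mult using that C by (intro mult_mono) auto
    also have "\<dots> = C * D * ((1 + \<bar>\<xi>\<bar>) powr (- r) * (1 + \<bar>\<xi>\<bar>) powr (- s))" by simp
    also have "(1 + \<bar>\<xi>\<bar>) powr (- r) * (1 + \<bar>\<xi>\<bar>) powr (- s) = (1 + \<bar>\<xi>\<bar>) powr (- (r + s))"
      by (simp add: powr_add[symmetric])
    finally show ?thesis .
  qed
  have nn: "0 \<le> C * D * (1 + \<bar>\<xi>\<bar>) powr (- (r + s))" for \<xi> :: real using C by simp
  show ?thesis
  proof (rule symbI[where \<phi>'="\<lambda>\<xi>. \<phi> \<xi> * \<psi>1 \<xi> + \<phi>1 \<xi> * \<psi> \<xi>" and \<phi>''="\<lambda>\<xi>. (\<phi> \<xi> * \<psi>2 \<xi> + \<phi>1 \<xi> * \<psi>1 \<xi>) + (\<phi>1 \<xi> * \<psi>1 \<xi> + \<phi>2 \<xi> * \<psi> \<xi>)"])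
    fix \<xi> :: real
    show "((\<lambda>\<xi>. \<phi> \<xi> * \<psi> \<xi>) has_vector_derivative \<phi> \<xi> * \<psi>1 \<xi> + \<phi>1 \<xi> * \<psi> \<xi>) (at \<xi>)"
      by (intro has_vector_derivative_mult f g)
    show "((\<lambda>\<xi>. \<phi> \<xi> * \<psi>1 \<xi> + \<phi>1 \<xi> * \<psi> \<xi>) has_vector_derivative (\<phi> \<xi> * \<psi>2 \<xi> + \<phi>1 \<xi> * \<psi>1 \<xi>) + (\<phi>1 \<xi> * \<psi>1 \<xi> + \<phi>2 \<xi> * \<psi> \<xi>)) (at \<xi>)"
      by (intro has_vector_derivative_add has_vector_derivative_mult f g)
    show "isCont (\<lambda>\<xi>. (\<phi> \<xi> * \<psi>2 \<xi> + \<phi>1 \<xi> * \<psi>1 \<xi>) + (\<phi>1 \<xi> * \<psi>1 \<xi> + \<phi>2 \<xi> * \<psi> \<xi>)) \<xi>"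
      by (intro continuous_intros f g cont)
    note p = prod[OF f(4) g(4), of \<xi>] prod[OF f(4) g(5), of \<xi>] prod[OF f(5) g(4), of \<xi>] prod[OF f(4) g(6), of \<xi>] prod[OF f(5) g(5), of \<xi>] prod[OF f(6) g(4), of \<xi>]
    have 4: "4 * C * D * (1 + \<bar>\<xi>\<bar>) powr (- (r + s)) = 4 * (C * D * (1 + \<bar>\<xi>\<bar>) powr (- (r + s)))" by simp
    show "norm (\<phi> \<xi> * \<psi> \<xi>) \<le> 4 * C * D * (1 + \<bar>\<xi>\<bar>) powr (- (r + s))"
      unfolding 4 using p nn[of \<xi>] by linarith
    show "norm (\<phi> \<xi> * \<psi>1 \<xi> + \<phi>1 \<xi> * \<psi> \<xi>) \<le> 4 * C * D * (1 + \<bar>\<xi>\<bar>) powr (- (r + s))"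
      unfolding 4 using p nn[of \<xi>] norm_triangle_ineq[of "\<phi> \<xi> * \<psi>1 \<xi>" "\<phi>1 \<xi> * \<psi> \<xi>"] by linarith
    show "norm ((\<phi> \<xi> * \<psi>2 \<xi> + \<phi>1 \<xi> * \<psi>1 \<xi>) + (\<phi>1 \<xi> * \<psi>1 \<xi> + \<phi>2 \<xi> * \<psi> \<xi>)) \<le> 4 * C * D * (1 + \<bar>\<xi>\<bar>) powr (- (r + s))"
      unfolding 4 using p nn[of \<xi>] norm_triangle_ineq[of "\<phi> \<xi> * \<psi>2 \<xi>" "\<phi>1 \<xi> * \<psi>1 \<xi>"]
        norm_triangle_ineq[of "\<phi>1 \<xi> * \<psi>1 \<xi>" "\<phi>2 \<xi> * \<psi> \<xi>"]
        norm_triangle_ineq[of "\<phi> \<xi> * \<psi>2 \<xi> + \<phi>1 \<xi> * \<psi>1 \<xi>" "\<phi>1 \<xi> * \<psi>1 \<xi> + \<phi>2 \<xi> * \<psi> \<xi>"] by linarith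
  qed
qed

lemma symb_add:
  assumes "symb r C \<phi>" "symb r D \<psi>" shows "symb r (C + D) (\<lambda>\<xi>. \<phi> \<xi> + \<psi> \<xi>)"
proof -
  obtain \<phi>1 \<phi>2 where f: "\<And>\<xi>. (\<phi> has_vector_derivative \<phi>1 \<xi>) (at \<xi>)" "\<And>\<xi>. (\<phi>1 has_vector_derivative \<phi>2 \<xi>) (at \<xi>)" "\<And>\<xi>. isCont \<phi>2 \<xi>"
    "\<And>\<xi>. norm (\<phi> \<xi>) \<le> C * (1 + \<bar>\<xi>\<bar>) powr (- r)" "\<And>\<xi>. norm (\<phi>1 \<xi>) \<le> C * (1 + \<bar>\<xi>\<bar>) powr (- r)"
    "\<And>\<xi>. norm (\<phi>2 \<xi>) \<le> C * (1 + \<bar>\<xi>\<bar>) powr (- r)" using assms(1) by (elim symbE) blast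
  obtain \<psi>1 \<psi>2 where g: "\<And>\<xi>. (\<psi> has_vector_derivative \<psi>1 \<xi>) (at \<xi>)" "\<And>\<xi>. (\<psi>1 has_vector_derivative \<psi>2 \<xi>) (at \<xi>)" "\<And>\<xi>. isCont \<psi>2 \<xi>"
    "\<And>\<xi>. norm (\<psi> \<xi>) \<le> D * (1 + \<bar>\<xi>\<bar>) powr (- r)" "\<And>\<xi>. norm (\<psi>1 \<xi>) \<le> D * (1 + \<bar>\<xi>\<bar>) powr (- r)"
    "\<And>\<xi>. norm (\<psi>2 \<xi>) \<le> D * (1 + \<bar>\<xi>\<bar>) powr (- r)" using assms(2) by (elim symbE) blast
  show ?thesis
    by (rule symbI[where \<phi>'="\<lambda>\<xi>. \<phi>1 \<xi> + \<psi>1 \<xi>" and \<phi>''="\<lambda>\<xi>. \<phi>2 \<xi> + \<psi>2 \<xi>"])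
       (auto intro!: has_vector_derivative_add f g continuous_intros norm_triangle_mono simp: distrib_right)
qed

lemma symb_const: "symb 0 (norm c) (\<lambda>_. c)"
  by (rule symbI[where \<phi>'="\<lambda>_. 0" and \<phi>''="\<lambda>_. 0"]) auto

lemma symb_cmult: "symb r C \<phi> \<Longrightarrow> symb r (4 * norm c * C) (\<lambda>\<xi>. c * \<phi> \<xi>)"
  using symb_mult[OF symb_const[of c], of r C \<phi>] by simp

lemma symb_ident: "symb (-1) 1 of_real"
proof (rule symbI[where \<phi>'="\<lambda>_. 1" and \<phi>''="\<lambda>_. 0"])
  show "(complex_of_real has_vector_derivative 1) (at \<xi>)" for \<xi>
    using has_vector_derivative_of_real[of "\<lambda>x. x" 1 "at \<xi>"] by (auto intro: derivative_eq_intros)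
qed (auto simp: has_vector_derivative_const)

lemma symb_cis: "symb 0 ((1 + \<bar>x\<bar>)\<^sup>2) (\<lambda>\<xi>. cis (\<xi> * x))"
proof (rule symbI[where \<phi>'="\<lambda>\<xi>. \<i> * of_real x * cis (\<xi> * x)" and \<phi>''="\<lambda>\<xi>. \<i> * of_real x * (\<i> * of_real x * cis (\<xi> * x))"])
  fix \<xi> :: real
  show "((\<lambda>\<xi>. cis (\<xi> * x)) has_vector_derivative \<i> * of_real x * cis (\<xi> * x)) (at \<xi>)"
    by (rule cis_linear_deriv)
  then show "((\<lambda>\<xi>. \<i> * of_real x * cis (\<xi> * x)) has_vector_derivative \<i> * of_real x * (\<i> * of_real x * cis (\<xi> * x))) (at \<xi>)"
    by (rule has_vector_derivative_mult_right)
  have a: "1 \<le> (1 + \<bar>x\<bar>)\<^sup>2" "\<bar>x\<bar> \<le> (1 + \<bar>x\<bar>)\<^sup>2" "\<bar>x\<bar> * \<bar>x\<bar> \<le> (1 + \<bar>x\<bar>)\<^sup>2"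
    by (auto simp: power2_eq_square algebra_simps)
  have "1 + \<bar>\<xi>\<bar> \<noteq> 0" by linarith
  then show "norm (cis (\<xi> * x)) \<le> (1 + \<bar>x\<bar>)\<^sup>2 * (1 + \<bar>\<xi>\<bar>) powr (- 0)"
    "norm (\<i> * of_real x * cis (\<xi> * x)) \<le> (1 + \<bar>x\<bar>)\<^sup>2 * (1 + \<bar>\<xi>\<bar>) powr (- 0)"
    "norm (\<i> * of_real x * (\<i> * of_real x * cis (\<xi> * x))) \<le> (1 + \<bar>x\<bar>)\<^sup>2 * (1 + \<bar>\<xi>\<bar>) powr (- 0)"
    using a by (simp_all add: norm_mult)
qed (intro continuous_intros isCont_cis)

lemma symb_inverse_quadratic:
  assumes ab: "0 < a" "0 < b"
  shows "\<exists>C. symb 2 C (\<lambda>\<xi>. complex_of_real (1 / (a + b * \<xi>\<^sup>2)))"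
proof -
  define q where "q \<xi> = a + b * \<xi>\<^sup>2" for \<xi> :: real
  have q: "0 < q \<xi>" for \<xi> using ab by (simp add: q_def add_pos_nonneg)
  have q0: "q \<xi> \<noteq> 0" for \<xi> using q[of \<xi>] by simp
  define K where "K = 2 / min a b"
  have m: "0 < min a b" using ab by simp
  have K: "0 < K" using ab by (simp add: K_def)
  have pw2: "(1 + \<bar>\<xi>\<bar>) powr (- 2) = 1 / (1 + \<bar>\<xi>\<bar>)\<^sup>2" for \<xi> :: real
    by (simp add: powr_minus powr_numeral field_simps)
  have q1: "1 + \<xi>\<^sup>2 \<le> K * q \<xi>" for \<xi> :: real
  proof -
    have "min a b * (1 + \<xi>\<^sup>2) \<le> q \<xi>" unfolding q_def
      by (simp add: distrib_left) (intro add_mono mult_right_mono, auto)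
    then have "1 + \<xi>\<^sup>2 \<le> q \<xi> / min a b"
      using m by (simp add: pos_le_divide_eq mult.commute del: min_less_iff_conj)
    moreover have "K * q \<xi> = 2 * (q \<xi> / min a b)" by (simp add: K_def)
    moreover have "0 \<le> \<xi>\<^sup>2" by simp
    ultimately show ?thesis by linarith
  qed
  have iq: "1 / q \<xi> \<le> 2 * K * (1 + \<bar>\<xi>\<bar>) powr (- 2)" for \<xi>
  proof -
    have "(1 + \<bar>\<xi>\<bar>)\<^sup>2 \<le> 2 * (1 + \<xi>\<^sup>2)"
      using sum_squares_bound[of 1 "\<bar>\<xi>\<bar>"] by (simp add: power2_sum)
    also have "\<dots> \<le> 2 * K * q \<xi>" using q1[of \<xi>] by simp
    finally have "(1 + \<bar>\<xi>\<bar>)\<^sup>2 \<le> 2 * K * q \<xi>" .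
    moreover have "0 < (1 + \<bar>\<xi>\<bar>)\<^sup>2" by (simp add: add_pos_nonneg)
    ultimately show ?thesis unfolding pw2 using q[of \<xi>] by (simp add: field_simps)
  qed
  have r1: "2 * b * \<bar>\<xi>\<bar> / q \<xi> \<le> b * K" for \<xi>
  proof -
    have "2 * b * \<bar>\<xi>\<bar> \<le> b * (1 + \<xi>\<^sup>2)"
      using sum_squares_bound[of 1 "\<bar>\<xi>\<bar>"] ab by (simp add: mult.assoc)
    also have "\<dots> \<le> b * (K * q \<xi>)" using q1[of \<xi>] ab by (intro mult_left_mono) auto
    finally show ?thesis using q[of \<xi>] by (simp add: field_simps)
  qed
  have r2: "2 * b / q \<xi> \<le> 2 * b * K" for \<xi>
  proof -
    have "1 \<le> K * q \<xi>" using q1[of \<xi>] zero_le_power2[of \<xi>] by linarith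
    then show ?thesis using q[of \<xi>] ab by (simp add: field_simps)
  qed
  define D where "D = 2 * K * (1 + b * K + 2 * b * K + 2 * (b * K)\<^sup>2)"
  have bK: "0 \<le> b * K" using ab K by simp
  have real_d1: "((\<lambda>\<xi>. 1 / q \<xi>) has_real_derivative (- (2 * b * \<xi>) / (q \<xi>)\<^sup>2)) (at \<xi>)" for \<xi>
    unfolding q_def using q0[of \<xi>, unfolded q_def]
    by (auto intro!: derivative_eq_intros simp: power2_eq_square)
  have dq: "(q has_real_derivative (2 * b * \<xi>)) (at \<xi>)" for \<xi>
    unfolding q_def by (auto intro!: derivative_eq_intros)
  have real_d2: "((\<lambda>\<xi>. - (2 * b * \<xi>) / (q \<xi>)\<^sup>2) has_real_derivative (8 * b\<^sup>2 * \<xi>\<^sup>2 / (q \<xi>)^3 - 2 * b / (q \<xi>)\<^sup>2)) (at \<xi>)" for \<xi>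
    using q0[of \<xi>]
    by (auto intro!: derivative_eq_intros dq simp: power2_eq_square power3_eq_cube field_simps)
  have "symb 2 D (\<lambda>\<xi>. complex_of_real (1 / q \<xi>))"
  proof (rule symbI[where \<phi>'="\<lambda>\<xi>. of_real (- (2 * b * \<xi>) / (q \<xi>)\<^sup>2)" and \<phi>''="\<lambda>\<xi>. of_real (8 * b\<^sup>2 * \<xi>\<^sup>2 / (q \<xi>)^3 - 2 * b / (q \<xi>)\<^sup>2)"])
    fix \<xi> :: real
    show "((\<lambda>\<xi>. complex_of_real (1 / q \<xi>)) has_vector_derivative complex_of_real (- (2 * b * \<xi>) / (q \<xi>)\<^sup>2)) (at \<xi>)"
      using real_d1 by (intro has_vector_derivative_of_real) (simp add: has_real_derivative_iff_has_vector_derivative)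
    show "((\<lambda>\<xi>. complex_of_real (- (2 * b * \<xi>) / (q \<xi>)\<^sup>2)) has_vector_derivative complex_of_real (8 * b\<^sup>2 * \<xi>\<^sup>2 / (q \<xi>)^3 - 2 * b / (q \<xi>)\<^sup>2)) (at \<xi>)"
      using real_d2 by (intro has_vector_derivative_of_real) (simp add: has_real_derivative_iff_has_vector_derivative)
    show "isCont (\<lambda>\<xi>. complex_of_real (8 * b\<^sup>2 * \<xi>\<^sup>2 / (q \<xi>)^3 - 2 * b / (q \<xi>)\<^sup>2)) \<xi>"
      using q0 unfolding q_def by (intro continuous_intros) auto
    have fin: "t / q \<xi> \<le> D * (1 + \<bar>\<xi>\<bar>) powr (- 2)" if "t \<le> 1 + b * K + 2 * b * K + 2 * (b * K)\<^sup>2" "0 \<le> t" for t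
    proof -
      have "t * (1 / q \<xi>) \<le> (1 + b * K + 2 * b * K + 2 * (b * K)\<^sup>2) * (2 * K * (1 + \<bar>\<xi>\<bar>) powr (- 2))"
        using that iq[of \<xi>] q[of \<xi>] by (intro mult_mono) auto
      moreover have "t * (1 / q \<xi>) = t / q \<xi>" by simp
      ultimately show ?thesis by (simp only: D_def mult_ac)
    qed
    show "norm (complex_of_real (1 / q \<xi>)) \<le> D * (1 + \<bar>\<xi>\<bar>) powr (- 2)"
    proof -
      have "1 \<le> 1 + b * K + 2 * b * K + 2 * (b * K)\<^sup>2"
        using bK zero_le_power2[of "b * K"] by linarith
      from fin[OF this] show ?thesis unfolding norm_of_real using q[of \<xi>] by simp
    qed
    have "norm (complex_of_real (- (2 * b * \<xi>) / (q \<xi>)\<^sup>2)) = (2 * b * \<bar>\<xi>\<bar> / q \<xi>) / q \<xi>"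
      using q[of \<xi>] ab by (simp only: norm_of_real) (simp add: abs_mult power2_eq_square)
    also have "\<dots> \<le> D * (1 + \<bar>\<xi>\<bar>) powr (- 2)"
    proof (rule fin)
      show "2 * b * \<bar>\<xi>\<bar> / q \<xi> \<le> 1 + b * K + 2 * b * K + 2 * (b * K)\<^sup>2"
        using r1[of \<xi>] bK zero_le_power2[of "b * K"] by linarith
    qed (use q[of \<xi>] ab in simp)
    finally show "norm (complex_of_real (- (2 * b * \<xi>) / (q \<xi>)\<^sup>2)) \<le> D * (1 + \<bar>\<xi>\<bar>) powr (- 2)" .
    have "norm (complex_of_real (8 * b\<^sup>2 * \<xi>\<^sup>2 / (q \<xi>)^3 - 2 * b / (q \<xi>)\<^sup>2)) \<le> 8 * b\<^sup>2 * \<xi>\<^sup>2 / (q \<xi>)^3 + 2 * b / (q \<xi>)\<^sup>2"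
      unfolding norm_of_real using q[of \<xi>] ab by (intro order_trans[OF abs_triangle_ineq4]) (simp add: abs_mult)
    also have "\<dots> = (2 * (2 * b * \<bar>\<xi>\<bar> / q \<xi>)\<^sup>2 + 2 * b / q \<xi>) / q \<xi>"
      using q0[of \<xi>] by (simp add: field_simps power2_eq_square power3_eq_cube)
    also have "\<dots> \<le> D * (1 + \<bar>\<xi>\<bar>) powr (- 2)"
    proof (rule fin)
      have "(2 * b * \<bar>\<xi>\<bar> / q \<xi>)\<^sup>2 \<le> (b * K)\<^sup>2"
        using r1[of \<xi>] q[of \<xi>] ab by (intro power_mono) auto
      then show "2 * (2 * b * \<bar>\<xi>\<bar> / q \<xi>)\<^sup>2 + 2 * b / q \<xi> \<le> 1 + b * K + 2 * b * K + 2 * (b * K)\<^sup>2"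
        using r2[of \<xi>] bK by linarith
      show "0 \<le> 2 * (2 * b * \<bar>\<xi>\<bar> / q \<xi>)\<^sup>2 + 2 * b / q \<xi>"
        using q[of \<xi>] ab by simp
    qed
    finally show "norm (complex_of_real (8 * b\<^sup>2 * \<xi>\<^sup>2 / (q \<xi>)^3 - 2 * b / (q \<xi>)\<^sup>2)) \<le> D * (1 + \<bar>\<xi>\<bar>) powr (- 2)" .
  qed
  then show ?thesis unfolding q_def by blast
qed

definition dec :: "real \<Rightarrow> (real \<Rightarrow> complex) \<Rightarrow> bool" where
  "dec K \<phi> \<longleftrightarrow> continuous_on UNIV \<phi> \<and> bounded (range \<phi>) \<and> integrable lborel \<phi>
     \<and> (\<forall>x. norm (FI \<phi> x) \<le> K / (1 + x\<^sup>2))"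

lemma one_plus_sq_pos: "0 < 1 + (x::real)\<^sup>2"
  by (simp add: add_pos_nonneg)

lemma integrable_inverse_quadratic: "integrable lborel (\<lambda>x::real. 1 / (1 + x\<^sup>2))"
proof (rule integrable_pw_bound[where p=0 and q="-2" and C=1])
  fix x :: real assume "x \<noteq> 0"
  show "norm (1 / (1 + x\<^sup>2)) \<le> 1 * pw 0 (-2) x"
    using \<open>x \<noteq> 0\<close> one_plus_sq_pos[of x]
    by (auto simp: pw_def powr_minus powr_numeral field_simps)
qed simp_all

lemma dec_cont: "dec K \<phi> \<Longrightarrow> isCont \<phi> \<xi>"
  by (auto simp: dec_def continuous_on_eq_continuous_at)

lemma dec_meas: "dec K \<phi> \<Longrightarrow> \<phi> \<in> borel_measurable borel"
  by (auto simp: dec_def intro: borel_measurable_continuous_onI)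

lemma dec_integrable: "dec K \<phi> \<Longrightarrow> integrable lborel \<phi>"
  by (simp add: dec_def)

lemma dec_FI_bound: "dec K \<phi> \<Longrightarrow> norm (FI \<phi> x) \<le> K / (1 + x\<^sup>2)"
  by (simp add: dec_def)

lemma dec_FI_integrable: "dec K \<phi> \<Longrightarrow> integrable lborel (FI \<phi>)"
proof -
  assume d: "dec K \<phi>"
  then have "0 \<le> K" using order_trans[OF norm_ge_zero dec_FI_bound[OF d, of 0]] by simp
  have "integrable lborel (\<lambda>x. K * (1 / (1 + x\<^sup>2)))"
    using integrable_inverse_quadratic by (rule integrable_mult_right)
  then show ?thesis
    by (rule Bochner_Integration.integrable_bound)
       (use dec_FI_bound[OF d] dec_meas[OF d] one_plus_sq_pos \<open>0 \<le> K\<close> in \<open>auto simp: abs_of_nonneg less_imp_le\<close>)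
qed

lemma dec_inversion:
  fixes \<phi> :: "real \<Rightarrow> complex"
  shows "dec K \<phi> \<Longrightarrow> (LINT x|lborel. FI \<phi> x * cis (- (\<xi> * x))) = 2 * pi * \<phi> \<xi>"
proof -
  assume d: "dec K \<phi>"
  then obtain C where "\<And>\<xi>. norm (\<phi> \<xi>) \<le> C" unfolding dec_def bounded_iff by auto
  then show ?thesis using d dec_FI_integrable[OF d] dec_cont[OF d] dec_integrable[OF d]
    by (intro fourier_inversion) auto
qed

lemma dec_mono: "dec K \<phi> \<Longrightarrow> K \<le> L \<Longrightarrow> dec L \<phi>"
  unfolding dec_def using one_plus_sq_pos by (meson divide_right_mono less_imp_le order_trans)

lemma decI:
  assumes d: "\<And>\<xi>. \<xi> \<noteq> 0 \<Longrightarrow> (\<phi> has_vector_derivative \<phi>' \<xi>) (at \<xi>)" "\<And>\<xi>. \<xi> \<noteq> 0 \<Longrightarrow> (\<phi>' has_vector_derivative \<phi>'' \<xi>) (at \<xi>)"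
    and c: "isCont \<phi> 0" "isCont \<phi>' 0" "\<And>\<xi>. \<xi> \<noteq> 0 \<Longrightarrow> isCont \<phi>'' \<xi>" "\<phi>'' \<in> borel_measurable borel"
    and b: "\<And>\<xi>. \<xi> \<noteq> 0 \<Longrightarrow> norm (\<phi> \<xi>) \<le> C * pw 0 (-2) \<xi>"
      "\<And>\<xi>. \<xi> \<noteq> 0 \<Longrightarrow> norm (\<phi>'' \<xi>) \<le> C * pw (-1/2) (-2) \<xi>"
    and b1: "\<And>\<xi>. 1 < \<bar>\<xi>\<bar> \<Longrightarrow> norm (\<phi>' \<xi>) \<le> D * \<bar>\<xi>\<bar> powr (-2)" and C: "0 \<le> C"
  shows "dec (((LINT \<xi>|lborel. pw 0 (-2) \<xi>) + (LINT \<xi>|lborel. pw (-1/2) (-2) \<xi>)) * C) \<phi>"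
proof -
  have cont: "isCont \<phi> \<xi>" for \<xi>
    using d(1)[of \<xi>] c by (cases "\<xi> = 0") (auto intro: has_vector_derivative_continuous)
  have [measurable]: "\<phi> \<in> borel_measurable borel"
    using cont by (intro borel_measurable_continuous_onI) (simp add: continuous_on_eq_continuous_at)
  have i: "integrable lborel \<phi>" "integrable lborel \<phi>''"
    using b c(4) by (auto intro: integrable_pw_bound[OF _ _ _ b(1)] integrable_pw_bound[OF _ _ _ b(2)])
  have pw_le1: "C * pw 0 (-2) \<xi> \<le> C" if "\<xi> \<noteq> 0" for \<xi>
    using C that powr_mono[of "-2" 0 "\<bar>\<xi>\<bar>"] by (intro mult_left_le) (auto simp: pw_def)
  have bdd: "bounded (range \<phi>)"
    unfolding bounded_iff
  proof (intro exI[of _ "max C (norm (\<phi> 0))"] ballI)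
    fix y assume "y \<in> range \<phi>"
    then obtain \<xi> where y: "y = \<phi> \<xi>" by auto
    show "norm y \<le> max C (norm (\<phi> 0))"
      using b(1)[of \<xi>] pw_le1[of \<xi>] unfolding y by (cases "\<xi> = 0") auto
  qed
  have lim: "((\<lambda>\<xi>. E * \<bar>\<xi>\<bar> powr (-2)) \<longlongrightarrow> 0) at_top" "((\<lambda>\<xi>. E * \<bar>\<xi>\<bar> powr (-2)) \<longlongrightarrow> 0) at_bot" for E :: real
    by real_asymp (subst filterlim_at_bot_mirror, simp, real_asymp)
  have ev: "\<forall>\<^sub>F \<xi>::real in at_top. 1 < \<bar>\<xi>\<bar>" "\<forall>\<^sub>F \<xi>::real in at_bot. 1 < \<bar>\<xi>\<bar>"
    by (rule eventually_mono[OF eventually_gt_at_top[of 1]], simp)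
       (rule eventually_mono[OF eventually_gt_at_bot[of "-1"]], simp)
  have b': "norm (\<phi> \<xi>) \<le> C * \<bar>\<xi>\<bar> powr (-2)" if "1 < \<bar>\<xi>\<bar>" for \<xi>
    using b(1)[of \<xi>] that by (auto simp: pw_def split: if_splits)
  have l: "(\<phi> \<longlongrightarrow> 0) at_top" "(\<phi> \<longlongrightarrow> 0) at_bot" "(\<phi>' \<longlongrightarrow> 0) at_top" "(\<phi>' \<longlongrightarrow> 0) at_bot"
    by (rule Lim_null_comparison[OF eventually_mono[OF ev(1) b'] lim(1)]
             Lim_null_comparison[OF eventually_mono[OF ev(2) b'] lim(2)]
             Lim_null_comparison[OF eventually_mono[OF ev(1) b1] lim(1)]
             Lim_null_comparison[OF eventually_mono[OF ev(2) b1] lim(2)]; assumption)+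
  have le: "(LINT \<xi>|lborel. norm (\<psi> \<xi>)) \<le> C * (LINT \<xi>|lborel. pw p (-2) \<xi>)"
    if "integrable lborel \<psi>" "-1 < p" "\<And>\<xi>. \<xi> \<noteq> 0 \<Longrightarrow> norm (\<psi> \<xi>) \<le> C * pw p (-2) \<xi>" for \<psi> :: "real \<Rightarrow> complex" and p
  proof -
    have "(LINT \<xi>|lborel. norm (\<psi> \<xi>)) \<le> (LINT \<xi>|lborel. C * pw p (-2) \<xi>)"
      using that integrable_pw[of p "-2"]
      by (intro integral_mono_AE) (auto intro: AE_mp[OF AE_lborel_singleton[of 0]])
    then show ?thesis by simp
  qed
  have "norm (FI \<phi> x) \<le> (((LINT \<xi>|lborel. pw 0 (-2) \<xi>) + (LINT \<xi>|lborel. pw (-1/2) (-2) \<xi>)) * C) / (1 + x\<^sup>2)" for x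
  proof (rule order_trans[OF FI_decay[OF d c(1,2,3) i l]])
    show "((LINT \<xi>|lborel. norm (\<phi> \<xi>)) + (LINT \<xi>|lborel. norm (\<phi>'' \<xi>))) / (1 + x\<^sup>2)
      \<le> (((LINT \<xi>|lborel. pw 0 (-2) \<xi>) + (LINT \<xi>|lborel. pw (-1/2) (-2) \<xi>)) * C) / (1 + x\<^sup>2)"
      using le[OF i(1) _ b(1)] le[OF i(2) _ b(2)] one_plus_sq_pos[of x]
      by (intro divide_right_mono) (auto simp: algebra_simps)
  qed
  then show ?thesis
    unfolding dec_def using cont bdd i by (auto simp: continuous_on_eq_continuous_at)
qed

lemma symb_pw:
  assumes "2 \<le> r" "0 \<le> C" "\<xi> \<noteq> 0" "-1/2 \<le> q" "q \<le> 0"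
  shows "C * (1 + \<bar>\<xi>\<bar>) powr (- r) \<le> C * pw (if \<bar>\<xi>\<bar> \<le> 1 then q else 0) (- r) \<xi>"
proof (intro mult_left_mono assms)
  show "(1 + \<bar>\<xi>\<bar>) powr (- r) \<le> pw (if \<bar>\<xi>\<bar> \<le> 1 then q else 0) (- r) \<xi>"
  proof (cases "\<bar>\<xi>\<bar> \<le> 1")
    case True
    have "(1 + \<bar>\<xi>\<bar>) powr (- r) \<le> (1 + \<bar>\<xi>\<bar>) powr 0" using assms by (intro powr_mono) auto
    also have "\<dots> \<le> \<bar>\<xi>\<bar> powr q" using True assms powr_mono'[of q 0 "\<bar>\<xi>\<bar>"] by auto
    finally show ?thesis using True by (simp add: pw_def)
  next
    case False
    then show ?thesis using assms by (auto simp: pw_def intro!: powr_mono2')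
  qed
qed

lemma dec_symb: "\<exists>K\<ge>0. \<forall>r C \<phi>. 2 \<le> r \<longrightarrow> symb r C \<phi> \<longrightarrow> dec (K * C) \<phi>"
proof -
  define K where "K = (LINT \<xi>|lborel. pw 0 (-2) \<xi>) + (LINT \<xi>|lborel. pw (-1/2) (-2) \<xi>)"
  have "dec (K * C) \<phi>" if r: "2 \<le> r" and s: "symb r C \<phi>" for r C \<phi>
  proof -
    have C: "0 \<le> C" using symb_nonneg[OF s] .
    from symb_mono[OF s r order_refl] obtain \<phi>1 \<phi>2 where f: "\<And>\<xi>. (\<phi> has_vector_derivative \<phi>1 \<xi>) (at \<xi>)" "\<And>\<xi>. (\<phi>1 has_vector_derivative \<phi>2 \<xi>) (at \<xi>)" "\<And>\<xi>. isCont \<phi>2 \<xi>"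
      "\<And>\<xi>. norm (\<phi> \<xi>) \<le> C * (1 + \<bar>\<xi>\<bar>) powr (- 2)" "\<And>\<xi>. norm (\<phi>1 \<xi>) \<le> C * (1 + \<bar>\<xi>\<bar>) powr (- 2)"
      "\<And>\<xi>. norm (\<phi>2 \<xi>) \<le> C * (1 + \<bar>\<xi>\<bar>) powr (- 2)" by (elim symbE) blast
    show ?thesis
      unfolding K_def
    proof (rule decI[where \<phi>'=\<phi>1 and \<phi>''=\<phi>2 and D=C])
      show "isCont \<phi> 0" "isCont \<phi>1 0" using f by (blast intro: has_vector_derivative_continuous)+
      show "\<phi>2 \<in> borel_measurable borel"
        using f(3) by (intro borel_measurable_continuous_onI) (simp add: continuous_on_eq_continuous_at)
      fix \<xi> :: real
      show "norm (\<phi> \<xi>) \<le> C * pw 0 (-2) \<xi>" if "\<xi> \<noteq> 0"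
        using f(4)[of \<xi>] symb_pw[of 2 C \<xi> 0] C that by auto
      show "norm (\<phi>2 \<xi>) \<le> C * pw (-1/2) (-2) \<xi>" if "\<xi> \<noteq> 0"
        using f(6)[of \<xi>] symb_pw[of 2 C \<xi> "-1/2"] C that by (auto simp: pw_def split: if_splits)
      show "norm (\<phi>1 \<xi>) \<le> C * \<bar>\<xi>\<bar> powr (-2)" if "1 < \<bar>\<xi>\<bar>"
        using f(5)[of \<xi>] symb_pw[of 2 C \<xi> "0"] C that by (cases "\<xi> = 0") (auto simp: pw_def split: if_splits)
    qed (use f C in auto)
  qed
  moreover have "0 \<le> K" unfolding K_def by (intro add_nonneg_nonneg Bochner_Integration.integral_nonneg) auto
  ultimately show ?thesis by blast
qed

lemma abs_powr_deriv:
  assumes "x \<noteq> (0::real)"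
  shows "((\<lambda>x. \<bar>x\<bar> powr p) has_real_derivative (p * sgn x * \<bar>x\<bar> powr (p - 1))) (at x)"
proof (cases "0 < x")
  case True
  have "((\<lambda>x. x powr p) has_real_derivative (p * sgn x * \<bar>x\<bar> powr (p - 1))) (at x)"
    using True by (auto intro!: derivative_eq_intros)
  then show ?thesis
    by (rule has_field_derivative_transform_within_open[where S="{0<..}"]) (use True in auto)
next
  case False
  then have "x < 0" using assms by simp
  have "((\<lambda>x. (- x) powr p) has_real_derivative (p * sgn x * \<bar>x\<bar> powr (p - 1))) (at x)"
    using \<open>x < 0\<close> by (auto intro!: derivative_eq_intros)
  then show ?thesis
    by (rule has_field_derivative_transform_within_open[where S="{..<0}"]) (use \<open>x < 0\<close> in auto)
qed

lemma sgn_abs_powr_deriv: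
  assumes "x \<noteq> (0::real)"
  shows "((\<lambda>x. sgn x * \<bar>x\<bar> powr p) has_real_derivative (p * \<bar>x\<bar> powr (p - 1))) (at x)"
proof -
  have "((\<lambda>y. sgn x * \<bar>y\<bar> powr p) has_real_derivative (sgn x * (p * sgn x * \<bar>x\<bar> powr (p - 1)))) (at x)"
    by (rule DERIV_cmult[OF abs_powr_deriv[OF assms]])
  moreover have "sgn x * (p * sgn x * \<bar>x\<bar> powr (p - 1)) = p * \<bar>x\<bar> powr (p - 1)"
    using assms by (auto simp: sgn_if)
  ultimately have *: "((\<lambda>y. sgn x * \<bar>y\<bar> powr p) has_real_derivative (p * \<bar>x\<bar> powr (p - 1))) (at x)" by simp
  show ?thesis
  proof (cases "0 < x")
    case True
    with * show ?thesis by (elim has_field_derivative_transform_within_open[where S="{0<..}"]) auto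
  next
    case False
    with assms * show ?thesis by (elim has_field_derivative_transform_within_open[where S="{..<0}"]) auto
  qed
qed

lemma dec_frac:
  assumes \<gamma>: "1/2 \<le> \<gamma>" "\<gamma> \<le> 1"
  shows "\<exists>K\<ge>0. \<forall>C \<beta>. symb 4 C \<beta> \<longrightarrow> \<beta> 0 = 0 \<longrightarrow> dec (K * C) (\<lambda>\<tau>. of_real (\<bar>\<tau>\<bar> powr \<gamma>) * \<beta> \<tau>)"
proof -
  define K where "K = ((LINT \<xi>|lborel. pw 0 (-2) \<xi>) + (LINT \<xi>|lborel. pw (-1/2) (-2) \<xi>)) * 4"
  have "dec (K * C) (\<lambda>\<tau>. of_real (\<bar>\<tau>\<bar> powr \<gamma>) * \<beta> \<tau>)" if s: "symb 4 C \<beta>" and 0: "\<beta> 0 = 0" for C \<beta>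
  proof -
    have C: "0 \<le> C" using symb_nonneg[OF s] .
    from s obtain \<beta>1 \<beta>2 where f: "\<And>\<xi>. (\<beta> has_vector_derivative \<beta>1 \<xi>) (at \<xi>)" "\<And>\<xi>. (\<beta>1 has_vector_derivative \<beta>2 \<xi>) (at \<xi>)" "\<And>\<xi>. isCont \<beta>2 \<xi>"
      "\<And>\<xi>. norm (\<beta> \<xi>) \<le> C * (1 + \<bar>\<xi>\<bar>) powr (- 4)" "\<And>\<xi>. norm (\<beta>1 \<xi>) \<le> C * (1 + \<bar>\<xi>\<bar>) powr (- 4)"
      "\<And>\<xi>. norm (\<beta>2 \<xi>) \<le> C * (1 + \<bar>\<xi>\<bar>) powr (- 4)" by (elim symbE) blast
    have cont: "isCont \<beta> \<xi>" "isCont \<beta>1 \<xi>" for \<xi> using f by (blast intro: has_vector_derivative_continuous)+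
    have [measurable]: "\<beta> \<in> borel_measurable borel" "\<beta>1 \<in> borel_measurable borel" "\<beta>2 \<in> borel_measurable borel"
      using f(3) cont by (auto intro!: borel_measurable_continuous_onI simp: continuous_on_eq_continuous_at)
    have le1: "C * (1 + \<bar>\<xi>\<bar>) powr (- 4) \<le> C" for \<xi> :: real
    proof -
      have "1 + \<bar>\<xi>\<bar> \<noteq> 0" by linarith
      then show ?thesis using C powr_mono[of "-4" 0 "1 + \<bar>\<xi>\<bar>"] by (intro mult_left_le) auto
    qed
    have le4: "C * (1 + \<bar>\<xi>\<bar>) powr (- 4) \<le> C * \<bar>\<xi>\<bar> powr (-4)" if "\<xi> \<noteq> 0" for \<xi> :: real
      using C that by (intro mult_left_mono powr_mono2') auto
    have lin: "norm (\<beta> \<tau>) \<le> C * \<bar>\<tau>\<bar>" for \<tau>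
    proof -
      have "norm (\<beta> \<tau> - \<beta> 0) \<le> C * norm (\<tau> - 0)"
      proof (rule differentiable_bound[where S=UNIV and f'="\<lambda>x h. h *\<^sub>R \<beta>1 x"])
        fix x :: real
        show "onorm (\<lambda>h. h *\<^sub>R \<beta>1 x) \<le> C"
          using f(5)[of x] le1[of x] C by (intro onorm_le) (auto simp: mult.commute[of C] intro!: mult_left_mono)
        show "(\<beta> has_derivative (\<lambda>h. h *\<^sub>R \<beta>1 x)) (at x within UNIV)"
          using f(1)[of x] by (simp add: has_vector_derivative_def)
      qed auto
      then show ?thesis by (simp add: 0)
    qed
    define \<phi>1 where "\<phi>1 = (\<lambda>\<tau>. of_real (\<bar>\<tau>\<bar> powr \<gamma>) * \<beta>1 \<tau> + of_real (\<gamma> * (sgn \<tau> * \<bar>\<tau>\<bar> powr (\<gamma> - 1))) * \<beta> \<tau>)"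
    define \<phi>2 where "\<phi>2 = (\<lambda>\<tau>. (of_real (\<bar>\<tau>\<bar> powr \<gamma>) * \<beta>2 \<tau> + of_real (\<gamma> * (sgn \<tau> * \<bar>\<tau>\<bar> powr (\<gamma> - 1))) * \<beta>1 \<tau>)
       + (of_real (\<gamma> * (sgn \<tau> * \<bar>\<tau>\<bar> powr (\<gamma> - 1))) * \<beta>1 \<tau> + of_real (\<gamma> * ((\<gamma> - 1) * \<bar>\<tau>\<bar> powr (\<gamma> - 2))) * \<beta> \<tau>))"
    have pm: "\<bar>\<tau>\<bar> powr (\<gamma> - 1) * \<bar>\<tau>\<bar> = \<bar>\<tau>\<bar> powr \<gamma>" "\<bar>\<tau>\<bar> powr (\<gamma> - 2) * \<bar>\<tau>\<bar> = \<bar>\<tau>\<bar> powr (\<gamma> - 1)" if "\<tau> \<noteq> 0" for \<tau> :: real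
      using that powr_add[of "\<bar>\<tau>\<bar>" "\<gamma> - 1" 1] powr_add[of "\<bar>\<tau>\<bar>" "\<gamma> - 2" 1] by auto
    have \<phi>1_le: "norm (\<phi>1 \<tau>) \<le> 2 * C * \<bar>\<tau>\<bar> powr \<gamma>" for \<tau>
    proof (cases "\<tau> = 0")
      case False
      have "norm (\<phi>1 \<tau>) \<le> \<bar>\<tau>\<bar> powr \<gamma> * norm (\<beta>1 \<tau>) + \<gamma> * \<bar>\<tau>\<bar> powr (\<gamma> - 1) * norm (\<beta> \<tau>)"
        unfolding \<phi>1_def by (rule order_trans[OF norm_triangle_ineq]) (use \<gamma> False in \<open>simp add: norm_mult abs_mult\<close>)
      also have "\<dots> \<le> \<bar>\<tau>\<bar> powr \<gamma> * C + \<gamma> * \<bar>\<tau>\<bar> powr (\<gamma> - 1) * (C * \<bar>\<tau>\<bar>)"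
        using lin[of \<tau>] f(5)[of \<tau>] le1[of \<tau>] \<gamma> by (intro add_mono mult_left_mono) auto
      also have "\<gamma> * \<bar>\<tau>\<bar> powr (\<gamma> - 1) * (C * \<bar>\<tau>\<bar>) = \<gamma> * (C * \<bar>\<tau>\<bar> powr \<gamma>)"
        using pm(1)[OF False] by (simp add: mult_ac)
      also have "\<gamma> * (C * \<bar>\<tau>\<bar> powr \<gamma>) \<le> C * \<bar>\<tau>\<bar> powr \<gamma>"
        using \<gamma> C by (intro mult_left_le_one_le) auto
      finally show ?thesis by (simp add: mult_ac)
    qed (simp add: \<phi>1_def 0)
    have lim0: "isCont \<psi> 0" if "\<psi> 0 = 0" "\<And>\<tau>. norm (\<psi> \<tau>) \<le> E * \<bar>\<tau>\<bar> powr \<gamma>" for \<psi> :: "real \<Rightarrow> complex" and E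
    proof -
      have "((\<lambda>\<tau>::real. E * \<bar>\<tau>\<bar> powr \<gamma>) \<longlongrightarrow> E * \<bar>0\<bar> powr \<gamma>) (at 0)"
        using \<gamma> by (intro tendsto_intros) auto
      then have "((\<lambda>\<tau>::real. E * \<bar>\<tau>\<bar> powr \<gamma>) \<longlongrightarrow> 0) (at 0)" using \<gamma> by simp
      from Lim_null_comparison[OF _ this, of \<psi>] that show ?thesis by (auto simp: isCont_def)
    qed
    have "dec (((LINT \<xi>|lborel. pw 0 (-2) \<xi>) + (LINT \<xi>|lborel. pw (-1/2) (-2) \<xi>)) * (4 * C)) (\<lambda>\<tau>. of_real (\<bar>\<tau>\<bar> powr \<gamma>) * \<beta> \<tau>)"
    proof (rule decI[where \<phi>'=\<phi>1 and \<phi>''=\<phi>2 and D="2 * C"])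
      fix \<tau> :: real assume t: "\<tau> \<noteq> 0"
      have d1: "((\<lambda>\<tau>. complex_of_real (\<bar>\<tau>\<bar> powr \<gamma>)) has_vector_derivative of_real (\<gamma> * (sgn \<tau> * \<bar>\<tau>\<bar> powr (\<gamma> - 1)))) (at \<tau>)"
        using abs_powr_deriv[OF t, of \<gamma>] by (intro has_vector_derivative_of_real) (simp add: has_real_derivative_iff_has_vector_derivative mult.assoc)
      have d2: "((\<lambda>\<tau>. complex_of_real (\<gamma> * (sgn \<tau> * \<bar>\<tau>\<bar> powr (\<gamma> - 1)))) has_vector_derivative of_real (\<gamma> * ((\<gamma> - 1) * \<bar>\<tau>\<bar> powr (\<gamma> - 2)))) (at \<tau>)"
        using DERIV_cmult[OF sgn_abs_powr_deriv[OF t, of "\<gamma> - 1"], of \<gamma>]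
        by (intro has_vector_derivative_of_real) (simp add: has_real_derivative_iff_has_vector_derivative)
      show "((\<lambda>\<tau>. of_real (\<bar>\<tau>\<bar> powr \<gamma>) * \<beta> \<tau>) has_vector_derivative \<phi>1 \<tau>) (at \<tau>)"
        unfolding \<phi>1_def by (intro has_vector_derivative_mult d1 f)
      show "(\<phi>1 has_vector_derivative \<phi>2 \<tau>) (at \<tau>)"
        unfolding \<phi>1_def \<phi>2_def by (intro has_vector_derivative_add has_vector_derivative_mult d1 d2 f)
      show "isCont \<phi>2 \<tau>"
        unfolding \<phi>2_def using t by (intro continuous_intros f cont isCont_sgn) auto
      show "norm (complex_of_real (\<bar>\<tau>\<bar> powr \<gamma>) * \<beta> \<tau>) \<le> 4 * C * pw 0 (-2) \<tau>"
      proof (cases "\<bar>\<tau>\<bar> \<le> 1")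
        case True
        have "norm (complex_of_real (\<bar>\<tau>\<bar> powr \<gamma>) * \<beta> \<tau>) \<le> 1 * C"
          unfolding norm_mult using True \<gamma> f(4)[of \<tau>] le1[of \<tau>] powr_le1[of \<gamma> "\<bar>\<tau>\<bar>"] by (intro mult_mono) auto
        then show ?thesis using True C t by (simp add: pw_def)
      next
        case False
        have "norm (complex_of_real (\<bar>\<tau>\<bar> powr \<gamma>) * \<beta> \<tau>) \<le> \<bar>\<tau>\<bar> powr \<gamma> * (C * \<bar>\<tau>\<bar> powr (-4))"
          unfolding norm_mult using False f(4)[of \<tau>] le4[OF t] by (intro mult_mono) auto
        also have "\<dots> = C * \<bar>\<tau>\<bar> powr (\<gamma> - 4)" by (simp add: powr_diff powr_minus field_simps)
        also have "\<dots> \<le> C * \<bar>\<tau>\<bar> powr (-2)" using False C \<gamma> by (intro mult_left_mono powr_mono) auto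
        also have "\<dots> \<le> 4 * C * \<bar>\<tau>\<bar> powr (-2)" using C by (intro mult_right_mono) auto
        finally show ?thesis using False by (simp add: pw_def)
      qed
      have n2: "norm (\<phi>2 \<tau>) \<le> \<bar>\<tau>\<bar> powr \<gamma> * norm (\<beta>2 \<tau>) + 2 * (\<bar>\<tau>\<bar> powr (\<gamma> - 1) * norm (\<beta>1 \<tau>)) + \<bar>\<tau>\<bar> powr (\<gamma> - 2) * norm (\<beta> \<tau>)"
      proof -
        have "norm (\<phi>2 \<tau>) \<le> (\<bar>\<tau>\<bar> powr \<gamma> * norm (\<beta>2 \<tau>) + \<gamma> * \<bar>\<tau>\<bar> powr (\<gamma> - 1) * norm (\<beta>1 \<tau>)) + (\<gamma> * \<bar>\<tau>\<bar> powr (\<gamma> - 1) * norm (\<beta>1 \<tau>) + \<gamma> * (1 - \<gamma>) * \<bar>\<tau>\<bar> powr (\<gamma> - 2) * norm (\<beta> \<tau>))"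
          unfolding \<phi>2_def using \<gamma> t
          by (intro norm_triangle_mono) (simp_all add: norm_mult abs_mult del: of_real_mult of_real_diff)
        also have "\<dots> \<le> (\<bar>\<tau>\<bar> powr \<gamma> * norm (\<beta>2 \<tau>) + 1 * \<bar>\<tau>\<bar> powr (\<gamma> - 1) * norm (\<beta>1 \<tau>)) + (1 * \<bar>\<tau>\<bar> powr (\<gamma> - 1) * norm (\<beta>1 \<tau>) + 1 * \<bar>\<tau>\<bar> powr (\<gamma> - 2) * norm (\<beta> \<tau>))"
          using \<gamma> mult_le_one[of \<gamma> "1 - \<gamma>"] by (intro add_mono mult_right_mono order_refl) auto
        finally show ?thesis by (simp add: algebra_simps)
      qed
      show "norm (\<phi>2 \<tau>) \<le> 4 * C * pw (-1/2) (-2) \<tau>"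
      proof (cases "\<bar>\<tau>\<bar> \<le> 1")
        case True
        have "norm (\<phi>2 \<tau>) \<le> \<bar>\<tau>\<bar> powr \<gamma> * C + 2 * (\<bar>\<tau>\<bar> powr (\<gamma> - 1) * C) + \<bar>\<tau>\<bar> powr (\<gamma> - 2) * (C * \<bar>\<tau>\<bar>)"
          using n2 f(5,6)[of \<tau>] le1[of \<tau>] lin[of \<tau>]
          by (elim order_trans) (intro add_mono mult_left_mono, auto)
        also have "\<bar>\<tau>\<bar> powr (\<gamma> - 2) * (C * \<bar>\<tau>\<bar>) = \<bar>\<tau>\<bar> powr (\<gamma> - 1) * C"
          using pm(2)[OF t] by (simp add: mult_ac)
        also have "\<bar>\<tau>\<bar> powr \<gamma> * C + 2 * (\<bar>\<tau>\<bar> powr (\<gamma> - 1) * C) + \<bar>\<tau>\<bar> powr (\<gamma> - 1) * C \<le>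
          \<bar>\<tau>\<bar> powr (-1/2) * C + 2 * (\<bar>\<tau>\<bar> powr (-1/2) * C) + \<bar>\<tau>\<bar> powr (-1/2) * C"
          using True \<gamma> C t by (intro add_mono mult_right_mono mult_left_mono powr_mono') auto
        finally show ?thesis using True by (simp add: pw_def)
      next
        case False
        have "norm (\<phi>2 \<tau>) \<le> \<bar>\<tau>\<bar> powr \<gamma> * (C * \<bar>\<tau>\<bar> powr (-4)) + 2 * (\<bar>\<tau>\<bar> powr \<gamma> * (C * \<bar>\<tau>\<bar> powr (-4))) + \<bar>\<tau>\<bar> powr \<gamma> * (C * \<bar>\<tau>\<bar> powr (-4))"
          using n2 f(4,5,6)[of \<tau>] le4[OF t] False
          by (elim order_trans) (intro add_mono mult_left_mono mult_mono powr_mono, auto)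
        also have "\<dots> = 4 * C * (\<bar>\<tau>\<bar> powr (\<gamma> - 4))" by (simp add: powr_diff powr_minus field_simps)
        also have "\<dots> \<le> 4 * C * \<bar>\<tau>\<bar> powr (-2)" using False C \<gamma> by (intro mult_left_mono powr_mono) auto
        finally show ?thesis using False by (simp add: pw_def)
      qed
    next
      fix \<tau> :: real assume t: "1 < \<bar>\<tau>\<bar>"
      then have t0: "\<tau> \<noteq> 0" by auto
      have "norm (\<phi>1 \<tau>) \<le> \<bar>\<tau>\<bar> powr \<gamma> * norm (\<beta>1 \<tau>) + \<gamma> * \<bar>\<tau>\<bar> powr (\<gamma> - 1) * norm (\<beta> \<tau>)"
        unfolding \<phi>1_def by (rule order_trans[OF norm_triangle_ineq]) (use \<gamma> t in \<open>auto simp: norm_mult abs_mult\<close>)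
      also have "\<dots> \<le> \<bar>\<tau>\<bar> powr \<gamma> * (C * \<bar>\<tau>\<bar> powr (-4)) + 1 * \<bar>\<tau>\<bar> powr \<gamma> * (C * \<bar>\<tau>\<bar> powr (-4))"
        using f(4,5)[of \<tau>] le4[OF t0] t \<gamma> by (intro add_mono mult_mono powr_mono) auto
      also have "\<dots> = 2 * C * (\<bar>\<tau>\<bar> powr (\<gamma> - 4))" by (simp add: powr_diff powr_minus field_simps)
      also have "\<dots> \<le> 2 * C * \<bar>\<tau>\<bar> powr (-2)" using t C \<gamma> by (intro mult_left_mono powr_mono) auto
      finally show "norm (\<phi>1 \<tau>) \<le> 2 * C * \<bar>\<tau>\<bar> powr (-2)" .
    next
      show "isCont \<phi>1 0" using \<phi>1_le 0 by (intro lim0[where E="2 * C"]) (auto simp: \<phi>1_def)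
      show "isCont (\<lambda>\<tau>. complex_of_real (\<bar>\<tau>\<bar> powr \<gamma>) * \<beta> \<tau>) 0"
      proof (rule lim0[where E=C])
        show "norm (complex_of_real (\<bar>\<tau>\<bar> powr \<gamma>) * \<beta> \<tau>) \<le> C * \<bar>\<tau>\<bar> powr \<gamma>" for \<tau>
          using f(4)[of \<tau>] le1[of \<tau>] by (auto simp: norm_mult mult.commute[of C] intro!: mult_left_mono)
      qed (simp add: 0)
      show "\<phi>2 \<in> borel_measurable borel" unfolding \<phi>2_def by measurable
      show "0 \<le> 4 * C" using C by simp
    qed
    then show ?thesis by (simp add: K_def mult_ac)
  qed
  moreover have "0 \<le> K" unfolding K_def by (intro mult_nonneg_nonneg add_nonneg_nonneg Bochner_Integration.integral_nonneg) auto
  ultimately show ?thesis by blast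
qed

lemma integral_reflect: "(LINT x|lborel. f (- x)) = (LINT x|lborel. (f (x::real) :: 'b::{banach, second_countable_topology}))"
  using lborel_integral_real_affine[of "-1" f 0] by simp

lemma FI_uminus: "FI \<phi> (- t) = FI (\<lambda>\<xi>. \<phi> (- \<xi>)) t"
  unfolding FI_def using integral_reflect[of "\<lambda>\<xi>. \<phi> \<xi> * cis (\<xi> * - t)"] by simp

lemma FI_cnj: "cnj (FI \<phi> t) = FI (\<lambda>\<xi>. cnj (\<phi> (- \<xi>))) t"
proof -
  have "cnj (FI \<phi> t) = (LINT \<xi>|lborel. cnj (\<phi> \<xi> * cis (\<xi> * t)))"
    unfolding FI_def by (rule Bochner_Integration.integral_cnj[symmetric])
  also have "\<dots> = (LINT \<xi>|lborel. cnj (\<phi> (- \<xi>) * cis (- \<xi> * t)))"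
    by (rule integral_reflect[symmetric])
  finally show ?thesis by (simp add: FI_def cis_cnj)
qed

lemma integral_even_half:
  fixes g :: "real \<Rightarrow> real"
  assumes g: "integrable lborel g" "\<And>x. g (- x) = g x"
  shows "(LINT x|lborel. indicator {0<..} x * g x) = (LINT x|lborel. g x) / 2"
proof -
  have i: "integrable lborel (\<lambda>x. indicator S x * g x)" if "S \<in> sets borel" for S
    using integrable_mult_indicator[OF _ g(1), of S] that by simp
  have "(LINT x|lborel. g x) = (LINT x|lborel. indicator {0<..} x * g x + indicator {..<0} x * g x)"
  proof (rule integral_cong_AE)
    show "AE x in lborel. g x = indicator {0<..} x * g x + indicator {..<0} x * g x"
      using AE_lborel_singleton[of 0] by eventually_elim (auto simp: indicator_def)
  qed (use borel_measurable_integrable[OF g(1)] in measurable)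
  also have "\<dots> = (LINT x|lborel. indicator {0<..} x * g x) + (LINT x|lborel. indicator {..<0} x * g x)"
    using i by (intro Bochner_Integration.integral_add) auto
  also have "(LINT x|lborel. indicator {..<0} x * g x) = (LINT x|lborel. indicator {..<0} (- x) * g (- x))"
    using integral_reflect[of "\<lambda>x. indicator {..<0} x * g x"] by simp
  also have "\<dots> = (LINT x|lborel. indicator {0<..} x * g x)"
    by (intro Bochner_Integration.integral_cong) (auto simp: g(2) indicator_def)
  finally show ?thesis by simp
qed

text \<open>Inverse transforms: \<open>hx j \<alpha>\<close> is the \<open>j\<close>-th derivative of the function with Fourier transform \<open>\<alpha>\<close>,
  \<open>hs \<gamma> \<beta>\<close> has the sine transform \<open>\<bar>\<tau>\<bar>\<^sup>\<gamma> \<beta>\<close> on the half line for odd \<open>\<beta>\<close>, and \<open>hc \<beta>\<close> is the derivative of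
  \<open>hs 0 \<beta>\<close>.\<close>

definition hx :: "nat \<Rightarrow> (real \<Rightarrow> complex) \<Rightarrow> real \<Rightarrow> real" where
  "hx j \<alpha> y = Re (FI (\<lambda>\<xi>. (\<i> * of_real \<xi>) ^ j * \<alpha> \<xi>) y) / (2 * pi)"

definition hs :: "real \<Rightarrow> (real \<Rightarrow> real) \<Rightarrow> real \<Rightarrow> real" where
  "hs \<gamma> \<beta> t = Im (FI (\<lambda>\<tau>. of_real (\<bar>\<tau>\<bar> powr \<gamma> * \<beta> \<tau>)) t) / pi"

definition hc :: "(real \<Rightarrow> real) \<Rightarrow> real \<Rightarrow> real" where
  "hc \<beta> t = Re (FI (\<lambda>\<tau>. of_real (\<tau> * \<beta> \<tau>)) t) / pi"

definition xadm :: "(real \<Rightarrow> complex) \<Rightarrow> real \<Rightarrow> bool" where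
  "xadm \<alpha> K \<longleftrightarrow> (\<forall>\<xi>. \<alpha> (- \<xi>) = cnj (\<alpha> \<xi>)) \<and> (\<forall>j\<le>2. dec K (\<lambda>\<xi>. (\<i> * of_real \<xi>) ^ j * \<alpha> \<xi>))"

definition tadm :: "(real \<Rightarrow> real) \<Rightarrow> real \<Rightarrow> bool" where
  "tadm \<beta> K \<longleftrightarrow> (\<forall>\<tau>. \<beta> (- \<tau>) = - \<beta> \<tau>) \<and> (\<forall>\<gamma>\<in>{0, 1/2, 1}. dec K (\<lambda>\<tau>. of_real (\<bar>\<tau>\<bar> powr \<gamma> * \<beta> \<tau>)))
     \<and> dec K (\<lambda>\<tau>. of_real (\<tau> * \<beta> \<tau>))"

lemma scaled_bound:
  assumes "dec K \<phi>" "\<bar>v\<bar> \<le> norm (FI \<phi> y)" "1 \<le> c"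
  shows "\<bar>v / c\<bar> \<le> K / (1 + y\<^sup>2)"
proof -
  have "\<bar>v / c\<bar> \<le> \<bar>v\<bar>" using assms(3) by (simp add: divide_le_eq mult_left_le_one_le mult_le_cancel_left1)
  then show ?thesis using dec_FI_bound[OF assms(1), of y] assms(2) by linarith
qed

lemma pi_ge_1: "1 \<le> pi" "1 \<le> 2 * pi"
  using pi_gt3 by auto

lemma hx_bound: "xadm \<alpha> K \<Longrightarrow> j \<le> 2 \<Longrightarrow> \<bar>hx j \<alpha> y\<bar> \<le> K / (1 + y\<^sup>2)"
  unfolding hx_def xadm_def
  by (rule scaled_bound[where \<phi>="\<lambda>\<xi>. (\<i> * of_real \<xi>) ^ j * \<alpha> \<xi>"]) (auto simp: abs_Re_le_cmod pi_ge_1)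

lemma tadm_dec_powr: "tadm \<beta> K \<Longrightarrow> \<gamma> \<in> {0, 1/2, 1} \<Longrightarrow> dec K (\<lambda>\<tau>. of_real (\<bar>\<tau>\<bar> powr \<gamma> * \<beta> \<tau>))"
  unfolding tadm_def by blast

lemma hs_bound: "tadm \<beta> K \<Longrightarrow> \<gamma> \<in> {0, 1/2, 1} \<Longrightarrow> \<bar>hs \<gamma> \<beta> y\<bar> \<le> K / (1 + y\<^sup>2)"
  unfolding hs_def
  by (rule scaled_bound[OF tadm_dec_powr]) (assumption | rule abs_Im_le_cmod pi_ge_1)+

lemma hc_bound: "tadm \<beta> K \<Longrightarrow> \<bar>hc \<beta> y\<bar> \<le> K / (1 + y\<^sup>2)"
  unfolding hc_def tadm_def
  by (rule scaled_bound[where \<phi>="\<lambda>\<tau>. of_real (\<tau> * \<beta> \<tau>)"]) (auto simp: abs_Re_le_cmod pi_ge_1)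

lemma integrable_quadratic_bound:
  fixes f :: "real \<Rightarrow> 'b::{banach, second_countable_topology}"
  assumes "f \<in> borel_measurable borel" "\<And>x. norm (f x) \<le> K / (1 + x\<^sup>2)"
  shows "integrable lborel f"
proof (rule Bochner_Integration.integrable_bound)
  show "integrable lborel (\<lambda>x. K * (1 / (1 + x\<^sup>2)))"
    using integrable_inverse_quadratic by (rule integrable_mult_right)
  show "AE x in lborel. norm (f x) \<le> norm (K * (1 / (1 + x\<^sup>2)))"
    using assms(2) by (intro AE_I2) (metis abs_ge_self mult.right_neutral order_trans real_norm_def times_divide_eq_right)
qed (use assms in simp)

lemma xadm_dec: "xadm \<alpha> K \<Longrightarrow> dec K \<alpha>"
proof -
  assume "xadm \<alpha> K"
  then have "dec K (\<lambda>\<xi>. (\<i> * of_real \<xi>) ^ 0 * \<alpha> \<xi>)" unfolding xadm_def by blast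
  then show ?thesis by simp
qed

lemma xadm_meas: "xadm \<alpha> K \<Longrightarrow> \<alpha> \<in> borel_measurable borel"
  by (rule dec_meas[OF xadm_dec])

lemma tadm_zero: "tadm \<beta> K \<Longrightarrow> \<beta> 0 = 0"
proof -
  assume "tadm \<beta> K"
  then have "\<beta> (- 0) = - \<beta> 0" unfolding tadm_def by blast
  then show "\<beta> 0 = 0" by simp
qed

lemma tadm_powr0: "tadm \<beta> K \<Longrightarrow> \<bar>\<tau>\<bar> powr 0 * \<beta> \<tau> = \<beta> \<tau>"
  using tadm_zero[of \<beta> K] by (cases "\<tau> = 0") auto

lemma tadm_dec: "tadm \<beta> K \<Longrightarrow> dec K (\<lambda>\<tau>. of_real (\<beta> \<tau>))"
proof -
  assume t: "tadm \<beta> K"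
  then have "dec K (\<lambda>\<tau>. of_real (\<bar>\<tau>\<bar> powr 0 * \<beta> \<tau>))" unfolding tadm_def by blast
  then show ?thesis unfolding tadm_powr0[OF t] .
qed

lemma tadm_meas: "tadm \<beta> K \<Longrightarrow> \<beta> \<in> borel_measurable borel"
proof -
  assume "tadm \<beta> K"
  then have [measurable]: "(\<lambda>\<tau>. complex_of_real (\<beta> \<tau>)) \<in> borel_measurable borel"
    by (rule dec_meas[OF tadm_dec])
  have "(\<lambda>\<tau>. Re (complex_of_real (\<beta> \<tau>))) \<in> borel_measurable borel" by measurable
  then show ?thesis by simp
qed

lemma hx_measurable[measurable]:
  assumes [measurable]: "\<alpha> \<in> borel_measurable borel" shows "hx j \<alpha> \<in> borel_measurable borel"
  unfolding hx_def by measurable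

lemma hs_measurable[measurable]:
  assumes [measurable]: "\<beta> \<in> borel_measurable borel" shows "hs \<gamma> \<beta> \<in> borel_measurable borel"
  unfolding hs_def by measurable

lemma hc_measurable[measurable]:
  assumes [measurable]: "\<beta> \<in> borel_measurable borel" shows "hc \<beta> \<in> borel_measurable borel"
  unfolding hc_def by measurable

lemma hx_integrable: "xadm \<alpha> K \<Longrightarrow> j \<le> 2 \<Longrightarrow> integrable lborel (hx j \<alpha>)"
  using hx_bound[of \<alpha> K j] xadm_meas by (intro integrable_quadratic_bound[where K=K]) auto

lemma hs_integrable: "tadm \<beta> K \<Longrightarrow> \<gamma> \<in> {0, 1/2, 1} \<Longrightarrow> integrable lborel (hs \<gamma> \<beta>)"
  using hs_bound[of \<beta> K \<gamma>] tadm_meas by (intro integrable_quadratic_bound[where K=K]) auto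

lemma hc_integrable: "tadm \<beta> K \<Longrightarrow> integrable lborel (hc \<beta>)"
  using hc_bound[of \<beta> K] tadm_meas by (intro integrable_quadratic_bound[where K=K]) auto

lemma hx_FT:
  assumes "xadm \<alpha> K" "j \<le> 2"
  shows "(LINT y|lborel. of_real (hx j \<alpha> y) * cis (- (\<xi> * y))) = (\<i> * of_real \<xi>) ^ j * \<alpha> \<xi>"
proof -
  let ?\<phi> = "\<lambda>\<xi>. (\<i> * complex_of_real \<xi>) ^ j * \<alpha> \<xi>"
  have d: "dec K ?\<phi>" and h: "\<And>\<xi>. \<alpha> (- \<xi>) = cnj (\<alpha> \<xi>)" using assms by (auto simp: xadm_def)
  have "cnj (FI ?\<phi> y) = FI ?\<phi> y" for y
    unfolding FI_cnj by (simp add: h)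
  then have "FI ?\<phi> y \<in> \<real>" for y by (metis Reals_cnj_iff)
  then have "FI ?\<phi> y = of_real (Re (FI ?\<phi> y))" for y by (simp add: of_real_Re)
  then have "complex_of_real (hx j \<alpha> y) = FI ?\<phi> y / (2 * pi)" for y
    unfolding hx_def by simp
  then have "(LINT y|lborel. of_real (hx j \<alpha> y) * cis (- (\<xi> * y))) = (LINT y|lborel. FI ?\<phi> y * cis (- (\<xi> * y)) / (2 * pi))"
    by simp
  also have "\<dots> = (LINT y|lborel. FI ?\<phi> y * cis (- (\<xi> * y))) / (2 * pi)" by simp
  also have "\<dots> = ?\<phi> \<xi>" unfolding dec_inversion[OF d] by simp
  finally show ?thesis .
qed

lemma hs_FT:
  assumes "tadm \<beta> K" "\<gamma> \<in> {0, 1/2, 1}"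
  shows "(LINT t|lborel. indicator {0<..} t * (hs \<gamma> \<beta> t * sin (\<tau> * t))) = \<bar>\<tau>\<bar> powr \<gamma> * \<beta> \<tau>"
proof -
  let ?\<phi> = "\<lambda>\<tau>. complex_of_real (\<bar>\<tau>\<bar> powr \<gamma> * \<beta> \<tau>)"
  have d: "dec K ?\<phi>" using tadm_dec_powr[OF assms] .
  have h: "\<And>\<tau>. \<beta> (- \<tau>) = - \<beta> \<tau>" using assms by (auto simp: tadm_def)
  have neg: "FI (\<lambda>\<tau>. - ?\<phi> \<tau>) y = - FI ?\<phi> y" for y by (simp add: FI_def)
  have "cnj (FI ?\<phi> y) = - FI ?\<phi> y" for y
    unfolding FI_cnj neg[symmetric] by (simp add: h)
  then have "Re (cnj (FI ?\<phi> y)) = Re (- FI ?\<phi> y)" for y by simp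
  then have "Re (FI ?\<phi> y) = 0" for y by simp
  then have F: "FI ?\<phi> y = \<i> * of_real (pi * hs \<gamma> \<beta> y)" for y
    by (simp add: complex_eq_iff hs_def)
  have odd: "hs \<gamma> \<beta> (- y) = - hs \<gamma> \<beta> y" for y
    unfolding hs_def FI_uminus using neg[of y] by (simp add: h)
  have i: "integrable lborel (hs \<gamma> \<beta>)" using hs_integrable[OF assms] .
  have is0: "integrable lborel (\<lambda>y. hs \<gamma> \<beta> y * sin (\<tau> * y))"
    using i by (rule integrable_mult_bounded[where C=1]) (auto simp: abs_sin_le_one)
  have "2 * pi * (\<bar>\<tau>\<bar> powr \<gamma> * \<beta> \<tau>) = Re (2 * pi * ?\<phi> \<tau>)" by simp
  also have "\<dots> = Re (LINT y|lborel. FI ?\<phi> y * cis (- (\<tau> * y)))"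
    unfolding dec_inversion[OF d] ..
  also have "\<dots> = (LINT y|lborel. Re (FI ?\<phi> y * cis (- (\<tau> * y))))"
    using dec_FI_integrable[OF d] by (intro integral_Re[symmetric] integrable_mult_bounded[where C=1]) auto
  also have "\<dots> = (LINT y|lborel. pi * (hs \<gamma> \<beta> y * sin (\<tau> * y)))"
    unfolding F by (intro Bochner_Integration.integral_cong) auto
  also have "\<dots> = pi * (LINT y|lborel. hs \<gamma> \<beta> y * sin (\<tau> * y))" by simp
  finally have "(LINT y|lborel. hs \<gamma> \<beta> y * sin (\<tau> * y)) = 2 * (\<bar>\<tau>\<bar> powr \<gamma> * \<beta> \<tau>)" by simp
  then show ?thesis
    using integral_even_half[OF is0] by (simp add: odd)
qed

lemma hc_FT:
  assumes "tadm \<beta> K"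
  shows "(LINT t|lborel. indicator {0<..} t * (hc \<beta> t * cos (\<tau> * t))) = \<tau> * \<beta> \<tau>"
proof -
  let ?\<phi> = "\<lambda>\<tau>. complex_of_real (\<tau> * \<beta> \<tau>)"
  have d: "dec K ?\<phi>" and h: "\<And>\<tau>. \<beta> (- \<tau>) = - \<beta> \<tau>" using assms by (auto simp: tadm_def)
  have "cnj (FI ?\<phi> y) = FI ?\<phi> y" for y
    unfolding FI_cnj by (simp add: h)
  then have "FI ?\<phi> y \<in> \<real>" for y by (metis Reals_cnj_iff)
  then have "FI ?\<phi> y = of_real (Re (FI ?\<phi> y))" for y by (simp add: of_real_Re)
  then have F: "FI ?\<phi> y = of_real (pi * hc \<beta> y)" for y unfolding hc_def by simp
  have even: "hc \<beta> (- y) = hc \<beta> y" for y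
    unfolding hc_def FI_uminus by (simp add: h)
  have i: "integrable lborel (hc \<beta>)" using hc_integrable[OF assms] .
  have is0: "integrable lborel (\<lambda>y. hc \<beta> y * cos (\<tau> * y))"
    using i by (rule integrable_mult_bounded[where C=1]) (auto simp: abs_cos_le_one)
  have "2 * pi * (\<tau> * \<beta> \<tau>) = Re (2 * pi * ?\<phi> \<tau>)" by simp
  also have "\<dots> = Re (LINT y|lborel. FI ?\<phi> y * cis (- (\<tau> * y)))"
    unfolding dec_inversion[OF d] ..
  also have "\<dots> = (LINT y|lborel. Re (FI ?\<phi> y * cis (- (\<tau> * y))))"
    using dec_FI_integrable[OF d] by (intro integral_Re[symmetric] integrable_mult_bounded[where C=1]) auto
  also have "\<dots> = (LINT y|lborel. pi * (hc \<beta> y * cos (\<tau> * y)))"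
    unfolding F by (intro Bochner_Integration.integral_cong) auto
  also have "\<dots> = pi * (LINT y|lborel. hc \<beta> y * cos (\<tau> * y))" by simp
  finally have "(LINT y|lborel. hc \<beta> y * cos (\<tau> * y)) = 2 * (\<tau> * \<beta> \<tau>)" by simp
  then show ?thesis
    using integral_even_half[OF is0] by (simp add: even)
qed

lemma symb_i_power:
  assumes "symb 4 C \<alpha>" "j \<le> 2" shows "symb 2 (256 * C) (\<lambda>\<xi>. (\<i> * of_real \<xi>) ^ j * \<alpha> \<xi>)"
proof -
  have C: "0 \<le> C" using symb_nonneg[OF assms(1)] .
  have i: "symb (-1) 4 (\<lambda>\<xi>. \<i> * of_real \<xi>)" using symb_cmult[OF symb_ident, of \<i>] by simp
  have 1: "symb 3 (16 * C) (\<lambda>\<xi>. (\<i> * of_real \<xi>) * \<alpha> \<xi>)" using symb_mult[OF i assms(1)] by simp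
  have 2: "symb 2 (256 * C) (\<lambda>\<xi>. (\<i> * of_real \<xi>) * ((\<i> * of_real \<xi>) * \<alpha> \<xi>))" using symb_mult[OF i 1] by simp
  from assms(2) consider "j = 0" | "j = 1" | "j = 2" by linarith
  then show ?thesis
  proof cases
    case 1 then show ?thesis using symb_mono[OF assms(1), of 2 "256 * C"] C by simp
  next
    case 2 then show ?thesis using symb_mono[OF 1, of 2 "256 * C"] C by simp
  next
    case 3 then show ?thesis using 2 by (simp add: power2_eq_square mult.assoc)
  qed
qed

lemma xadm_symb: "\<exists>K\<ge>0. \<forall>C \<alpha>. symb 4 C \<alpha> \<longrightarrow> (\<forall>\<xi>. \<alpha> (- \<xi>) = cnj (\<alpha> \<xi>)) \<longrightarrow> xadm \<alpha> (K * C)"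
proof -
  obtain K where K: "0 \<le> K" "\<And>r C \<phi>. 2 \<le> r \<Longrightarrow> symb r C \<phi> \<Longrightarrow> dec (K * C) \<phi>" using dec_symb by blast
  have "xadm \<alpha> (K * 256 * C)" if "symb 4 C \<alpha>" "\<forall>\<xi>. \<alpha> (- \<xi>) = cnj (\<alpha> \<xi>)" for C \<alpha>
    using K(2)[OF order_refl symb_i_power[OF that(1)]] that(2) by (auto simp: xadm_def mult.assoc)
  then show ?thesis using K(1) by (intro exI[of _ "K * 256"]) auto
qed

lemma tadm_symb: "\<exists>K\<ge>0. \<forall>C \<beta>. symb 4 C (\<lambda>\<tau>. of_real (\<beta> \<tau>)) \<longrightarrow> (\<forall>\<tau>. \<beta> (- \<tau>) = - \<beta> \<tau>) \<longrightarrow> tadm \<beta> (K * C)"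
proof -
  obtain K where K: "0 \<le> K" "\<And>r C \<phi>. 2 \<le> r \<Longrightarrow> symb r C \<phi> \<Longrightarrow> dec (K * C) \<phi>" using dec_symb by blast
  obtain L where L: "0 \<le> L" "\<And>C \<beta>. symb 4 C \<beta> \<Longrightarrow> \<beta> 0 = 0 \<Longrightarrow> dec (L * C) (\<lambda>\<tau>. of_real (\<bar>\<tau>\<bar> powr (1/2)) * \<beta> \<tau>)"
    using dec_frac[of "1/2"] by auto
  obtain M where M: "0 \<le> M" "\<And>C \<beta>. symb 4 C \<beta> \<Longrightarrow> \<beta> 0 = 0 \<Longrightarrow> dec (M * C) (\<lambda>\<tau>. of_real (\<bar>\<tau>\<bar> powr 1) * \<beta> \<tau>)"
    using dec_frac[of "1"] by auto
  define N where "N = 4 * K + L + M"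
  have "tadm \<beta> (N * C)" if s: "symb 4 C (\<lambda>\<tau>. of_real (\<beta> \<tau>))" and o: "\<forall>\<tau>. \<beta> (- \<tau>) = - \<beta> \<tau>" for C \<beta>
  proof -
    have C: "0 \<le> C" using symb_nonneg[OF s] .
    have "\<beta> (- 0) = - \<beta> 0" using o by blast
    then have 0: "\<beta> 0 = 0" by simp
    have le: "K * C \<le> N * C" "L * C \<le> N * C" "M * C \<le> N * C" "K * (4 * C) \<le> N * C"
      using C K(1) L(1) M(1) by (auto simp: N_def algebra_simps)
    have p0: "\<bar>\<tau>\<bar> powr 0 * \<beta> \<tau> = \<beta> \<tau>" for \<tau> using 0 by (cases "\<tau> = 0") auto
    have "dec (N * C) (\<lambda>\<tau>. of_real (\<bar>\<tau>\<bar> powr 0 * \<beta> \<tau>))"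
      unfolding p0 by (rule dec_mono[OF K(2)[OF _ s] le(1)]) simp
    moreover have "dec (N * C) (\<lambda>\<tau>. of_real (\<bar>\<tau>\<bar> powr (1/2) * \<beta> \<tau>))"
      using dec_mono[OF L(2)[OF s] le(2)] 0 by simp
    moreover have "dec (N * C) (\<lambda>\<tau>. of_real (\<bar>\<tau>\<bar> powr 1 * \<beta> \<tau>))"
      using dec_mono[OF M(2)[OF s] le(3)] 0 by simp
    moreover have s3: "symb 3 (4 * C) (\<lambda>\<tau>. of_real (\<tau> * \<beta> \<tau>))"
      using symb_mult[OF symb_ident s] by simp
    then have "dec (N * C) (\<lambda>\<tau>. of_real (\<tau> * \<beta> \<tau>))"
      by (intro dec_mono[OF K(2)[OF _ s3] le(4)]) simp
    ultimately show ?thesis using o by (auto simp: tadm_def)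
  qed
  moreover have "0 \<le> N" using K L M by (simp add: N_def)
  ultimately show ?thesis by blast
qed

text \<open>\<open>k\<alpha> x\<close> and \<open>k\<beta> t\<close> are the transforms of \<open>(1 - \<partial>\<^sup>2)\<^bsup>-2\<^esup>\<close> applied to point masses; \<open>a\<alpha>\<close> and \<open>a\<beta>\<close> are those of
  indicators of intervals with one endpoint \<open>0\<close>, damped at frequencies below \<open>\<epsilon>\<close> and above \<open>1 / \<epsilon>\<close>.\<close>

definition k\<alpha> :: "real \<Rightarrow> real \<Rightarrow> complex" where
  "k\<alpha> x \<xi> = cis (- (\<xi> * x)) / of_real ((1 + \<xi>\<^sup>2)\<^sup>2)"

definition k\<beta> :: "real \<Rightarrow> real \<Rightarrow> real" where
  "k\<beta> t \<tau> = sin (\<tau> * t) / (1 + \<tau>\<^sup>2)\<^sup>2"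

definition a\<alpha> :: "real \<Rightarrow> real \<Rightarrow> real \<Rightarrow> complex" where
  "a\<alpha> \<epsilon> x \<xi> = (1 - cis (- (\<xi> * x))) * (- \<i> * of_real \<xi>) / of_real ((\<xi>\<^sup>2 + \<epsilon>\<^sup>2) * (1 + \<epsilon>\<^sup>2 * \<xi>\<^sup>2)\<^sup>2)"

definition a\<beta> :: "real \<Rightarrow> real \<Rightarrow> real \<Rightarrow> real" where
  "a\<beta> \<epsilon> t \<tau> = (1 - cos (\<tau> * t)) * \<tau> / ((\<tau>\<^sup>2 + \<epsilon>\<^sup>2) * (1 + \<epsilon>\<^sup>2 * \<tau>\<^sup>2)\<^sup>2)"

lemma symb_cnj: assumes "symb r C \<phi>" shows "symb r C (\<lambda>\<xi>. cnj (\<phi> \<xi>))"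
  using assms
  by (elim symbE, intro symbI[where \<phi>'="\<lambda>\<xi>. cnj (_ \<xi>)" and \<phi>''="\<lambda>\<xi>. cnj (_ \<xi>)"])
     (auto intro: has_vector_derivative_cnj continuous_intros)

lemma symb_Im: assumes "symb r C \<phi>" shows "symb r (10 * C) (\<lambda>\<xi>. of_real (Im (\<phi> \<xi>)))"
proof -
  have C: "0 \<le> C" using symb_nonneg[OF assms] .
  have "symb r (C + 4 * norm (-1::complex) * C) (\<lambda>\<xi>. \<phi> \<xi> + (-1) * cnj (\<phi> \<xi>))"
    by (intro symb_add symb_cmult symb_cnj assms)
  from symb_cmult[OF this, of "- \<i> / 2"] have "symb r (10 * C) (\<lambda>\<xi>. - \<i> / 2 * (\<phi> \<xi> + (-1) * cnj (\<phi> \<xi>)))"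
    by (simp add: mult.commute)
  moreover have "- \<i> / 2 * (z + (-1) * cnj z) = of_real (Im z)" for z
    by (simp add: complex_eq_iff)
  ultimately show ?thesis using C by simp
qed

lemma xadm_k\<alpha>: "\<exists>K\<ge>0. \<forall>x. xadm (k\<alpha> x) (K * (1 + \<bar>x\<bar>)\<^sup>2)"
proof -
  obtain K where K: "0 \<le> K" "\<And>C \<alpha>. symb 4 C \<alpha> \<Longrightarrow> \<forall>\<xi>. \<alpha> (- \<xi>) = cnj (\<alpha> \<xi>) \<Longrightarrow> xadm \<alpha> (K * C)" using xadm_symb by blast
  obtain D where D: "symb 2 D (\<lambda>\<xi>. complex_of_real (1 / (1 + 1 * \<xi>\<^sup>2)))" using symb_inverse_quadratic[of 1 1] by auto
  have "symb 4 (4 * (1 + \<bar>x\<bar>)\<^sup>2 * (4 * D * D)) (k\<alpha> x)" for x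
    using symb_mult[OF symb_cis[of "- x"] symb_mult[OF D D]]
    by (simp add: k\<alpha>_def[abs_def] power2_eq_square)
  then have "xadm (k\<alpha> x) (K * (4 * (1 + \<bar>x\<bar>)\<^sup>2 * (4 * D * D)))" for x
    by (intro K) (auto simp: k\<alpha>_def cis_cnj)
  then have "xadm (k\<alpha> x) (K * 16 * (D * D) * (1 + \<bar>x\<bar>)\<^sup>2)" for x
    by (simp add: mult_ac)
  then show ?thesis using K(1) by (intro exI[of _ "K * 16 * (D * D)"]) auto
qed

lemma tadm_k\<beta>: "\<exists>K\<ge>0. \<forall>x. tadm (k\<beta> x) (K * (1 + \<bar>x\<bar>)\<^sup>2)"
proof -
  obtain K where K: "0 \<le> K" "\<And>C \<beta>. symb 4 C (\<lambda>\<tau>. of_real (\<beta> \<tau>)) \<Longrightarrow> \<forall>\<tau>. \<beta> (- \<tau>) = - \<beta> \<tau> \<Longrightarrow> tadm \<beta> (K * C)" using tadm_symb by blast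
  obtain D where D: "symb 2 D (\<lambda>\<xi>. complex_of_real (1 / (1 + 1 * \<xi>\<^sup>2)))" using symb_inverse_quadratic[of 1 1] by auto
  have "symb 4 (4 * (1 + \<bar>x\<bar>)\<^sup>2 * (4 * D * D)) (\<lambda>\<xi>. cis (\<xi> * x) * (of_real (1 / (1 + 1 * \<xi>\<^sup>2)) * of_real (1 / (1 + 1 * \<xi>\<^sup>2))))" for x
    using symb_mult[OF symb_cis[of "x"] symb_mult[OF D D]] by simp
  from symb_Im[OF this] have "symb 4 (10 * (4 * (1 + \<bar>x\<bar>)\<^sup>2 * (4 * D * D))) (\<lambda>\<tau>. of_real (k\<beta> x \<tau>))" for x
    by (simp add: k\<beta>_def[abs_def] power2_eq_square)
  then have "tadm (k\<beta> x) (K * (10 * (4 * (1 + \<bar>x\<bar>)\<^sup>2 * (4 * D * D))))" for x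
    by (intro K) (auto simp: k\<beta>_def)
  then have "tadm (k\<beta> x) (K * 160 * (D * D) * (1 + \<bar>x\<bar>)\<^sup>2)" for x
    by (simp add: mult_ac)
  then show ?thesis using K(1) by (intro exI[of _ "K * 160 * (D * D)"]) auto
qed

lemma symb_a\<alpha>:
  assumes "0 < \<epsilon>" shows "\<exists>C. symb 4 C (a\<alpha> \<epsilon> x)"
proof -
  obtain D where D: "symb 2 D (\<lambda>\<xi>. complex_of_real (1 / (\<epsilon>\<^sup>2 + 1 * \<xi>\<^sup>2)))" using symb_inverse_quadratic[of "\<epsilon>\<^sup>2" 1] assms by auto
  obtain E where E: "symb 2 E (\<lambda>\<xi>. complex_of_real (1 / (1 + \<epsilon>\<^sup>2 * \<xi>\<^sup>2)))" using symb_inverse_quadratic[of 1 "\<epsilon>\<^sup>2"] assms by auto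
  have 1: "symb 0 (norm (1::complex) + 4 * norm (-1::complex) * (1 + \<bar>- x\<bar>)\<^sup>2) (\<lambda>\<xi>. 1 + (-1) * cis (\<xi> * (- x)))"
    by (intro symb_add symb_const symb_cmult symb_cis)
  have 2: "symb (-1) (4 * norm (- \<i>) * 1) (\<lambda>\<xi>. (- \<i>) * of_real \<xi>)"
    by (intro symb_cmult symb_ident)
  have "\<exists>C. symb (0 + (- 1 + (2 + (2 + 2)))) C (\<lambda>\<xi>. (1 + (-1) * cis (\<xi> * (- x))) * (((- \<i>) * of_real \<xi>) * (of_real (1 / (\<epsilon>\<^sup>2 + 1 * \<xi>\<^sup>2)) * (of_real (1 / (1 + \<epsilon>\<^sup>2 * \<xi>\<^sup>2)) * of_real (1 / (1 + \<epsilon>\<^sup>2 * \<xi>\<^sup>2))))))"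
    by (rule exI, rule symb_mult[OF 1 symb_mult[OF 2 symb_mult[OF D symb_mult[OF E E]]]])
  then obtain C where C: "symb 5 C (\<lambda>\<xi>. (1 + (-1) * cis (\<xi> * (- x))) * (((- \<i>) * of_real \<xi>) * (of_real (1 / (\<epsilon>\<^sup>2 + 1 * \<xi>\<^sup>2)) * (of_real (1 / (1 + \<epsilon>\<^sup>2 * \<xi>\<^sup>2)) * of_real (1 / (1 + \<epsilon>\<^sup>2 * \<xi>\<^sup>2))))))"
    by auto
  moreover have "(1 + (-1) * cis (\<xi> * (- x))) * (((- \<i>) * of_real \<xi>) * (of_real (1 / (\<epsilon>\<^sup>2 + 1 * \<xi>\<^sup>2)) * (of_real (1 / (1 + \<epsilon>\<^sup>2 * \<xi>\<^sup>2)) * of_real (1 / (1 + \<epsilon>\<^sup>2 * \<xi>\<^sup>2)))))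
    = a\<alpha> \<epsilon> x \<xi>" for \<xi>
    by (simp add: a\<alpha>_def power2_eq_square add.commute)
  ultimately have "symb 5 C (a\<alpha> \<epsilon> x)" by simp
  then show ?thesis using symb_mono[of 5 C _ 4 C] by auto
qed

lemma a\<beta>_eq: "a\<beta> \<epsilon> t \<tau> = - Im (a\<alpha> \<epsilon> t \<tau>)"
proof -
  have "Im ((1 - cis (- (\<tau> * t))) * (- \<i> * of_real \<tau>)) = - ((1 - cos (\<tau> * t)) * \<tau>)"
    by (simp add: algebra_simps)
  then show ?thesis
    unfolding a\<alpha>_def a\<beta>_def by (simp only: Im_divide_of_real minus_divide_left[symmetric] minus_minus)
qed

lemma xadm_a\<alpha>:
  assumes "0 < \<epsilon>" shows "\<exists>K. xadm (a\<alpha> \<epsilon> x) K"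
proof -
  have "\<forall>\<xi>. a\<alpha> \<epsilon> x (- \<xi>) = cnj (a\<alpha> \<epsilon> x \<xi>)" by (simp add: a\<alpha>_def cis_cnj)
  then show ?thesis using symb_a\<alpha>[OF assms, of x] xadm_symb by blast
qed

lemma tadm_a\<beta>:
  assumes "0 < \<epsilon>" shows "\<exists>K. tadm (a\<beta> \<epsilon> x) K"
proof -
  obtain C where "symb 4 C (a\<alpha> \<epsilon> x)" using symb_a\<alpha>[OF assms] by blast
  from symb_cmult[OF symb_Im[OF this], of "-1"] have "symb 4 (4 * (10 * C)) (\<lambda>\<tau>. of_real (a\<beta> \<epsilon> x \<tau>))"
    by (simp add: a\<beta>_eq)
  moreover have "\<forall>\<tau>. a\<beta> \<epsilon> x (- \<tau>) = - a\<beta> \<epsilon> x \<tau>" by (simp add: a\<beta>_def)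
  ultimately show ?thesis using tadm_symb by blast
qed

section \<open>Spectral integrals\<close>

lemma fst_snd_borel[measurable]:
  "fst \<in> borel_measurable (borel :: (real \<times> real) measure)"
  "snd \<in> borel_measurable (borel :: (real \<times> real) measure)"
  by (auto intro!: borel_measurable_continuous_onI continuous_intros)

lemma exp_abs_le:
  fixes c x :: real
  assumes "0 < c" shows "exp (- (c * \<bar>x\<bar>)) \<le> (1 + 2 / c\<^sup>2) / (1 + x\<^sup>2)"
proof -
  have "1 + (c * \<bar>x\<bar>)\<^sup>2 / 2 \<le> exp (c * \<bar>x\<bar>)"
    using exp_lower_Taylor_quadratic[of "c * \<bar>x\<bar>"] assms by (simp add: add_increasing2)
       (smt (verit) mult_nonneg_nonneg abs_ge_zero)
  moreover have "1 + x\<^sup>2 \<le> (1 + 2 / c\<^sup>2) * (1 + (c * \<bar>x\<bar>)\<^sup>2 / 2)"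
    using assms by (simp add: field_simps power_mult_distrib)
  moreover have "(1 + 2 / c\<^sup>2) * (1 + (c * \<bar>x\<bar>)\<^sup>2 / 2) \<le> (1 + 2 / c\<^sup>2) * exp (c * \<bar>x\<bar>)"
    using calculation(1) by (intro mult_left_mono) auto
  ultimately have "1 + x\<^sup>2 \<le> (1 + 2 / c\<^sup>2) * exp (c * \<bar>x\<bar>)" by linarith
  then show ?thesis
    using one_plus_sq_pos[of x] by (simp add: exp_minus field_simps)
qed

lemma integrable_exp_abs:
  fixes c :: real
  assumes "0 < c" shows "integrable lborel (\<lambda>x. exp (- (c * \<bar>x\<bar>)))"
  using exp_abs_le[OF assms] by (intro integrable_quadratic_bound[where K="1 + 2 / c\<^sup>2"]) auto

lemma FI_exp_abs:
  assumes c: "0 < c"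
  shows "FI (\<lambda>\<xi>. of_real (exp (- (c * \<bar>\<xi>\<bar>)))) x = of_real (2 * c / (c\<^sup>2 + x\<^sup>2))"
proof -
  define p where "p = Complex (- c) x"
  define q where "q = Complex c x"
  have pq: "p \<noteq> 0" "q \<noteq> 0" using c by (auto simp: p_def q_def complex_eq_iff)
  define F where "F \<xi> = (if 0 < \<xi> then exp (of_real \<xi> * p) / p else exp (of_real \<xi> * q) / q)" for \<xi>
  have ex: "of_real (exp (- (c * \<bar>\<xi>\<bar>))) * cis (\<xi> * x) = exp (of_real \<xi> * (if 0 < \<xi> then p else q))" for \<xi>
    by (auto simp: exp_eq_polar p_def q_def mult.commute)
  have dexp: "((\<lambda>\<xi>. exp (of_real \<xi> * z) / z) has_vector_derivative exp (of_real \<xi> * z)) (at \<xi>)" if "z \<noteq> 0" for z :: complex and \<xi> :: real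
  proof -
    have "((\<lambda>w. exp (w * z) / z) has_field_derivative exp (of_real \<xi> * z)) (at (of_real \<xi>))"
      using that by (auto intro!: derivative_eq_intros)
    from has_vector_derivative_real_field[OF this] show ?thesis by simp
  qed
  have "FI (\<lambda>\<xi>. of_real (exp (- (c * \<bar>\<xi>\<bar>)))) x = 1 / q - 1 / p"
    unfolding FI_def
  proof (rule integral_FTC_jump[where F=F])
    fix \<xi> :: real assume "\<xi> \<noteq> 0"
    then consider "0 < \<xi>" | "\<xi> < 0" by linarith
    then show "(F has_vector_derivative complex_of_real (exp (- (c * \<bar>\<xi>\<bar>))) * cis (\<xi> * x)) (at \<xi>)"
    proof cases
      case 1
      have "(F has_vector_derivative exp (of_real \<xi> * p)) (at \<xi>)"
        by (rule has_vector_derivative_transform_within_open[OF dexp[OF pq(1)], where S="{0<..}"]) (use 1 in \<open>auto simp: F_def\<close>)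
      then show ?thesis unfolding ex using 1 by simp
    next
      case 2
      have "(F has_vector_derivative exp (of_real \<xi> * q)) (at \<xi>)"
        by (rule has_vector_derivative_transform_within_open[OF dexp[OF pq(2)], where S="{..<0}"]) (use 2 in \<open>auto simp: F_def\<close>)
      then show ?thesis unfolding ex using 2 by simp
    qed
  next
    fix \<xi> :: real
    show "isCont (\<lambda>\<xi>. complex_of_real (exp (- (c * \<bar>\<xi>\<bar>))) * cis (\<xi> * x)) \<xi>"
      by (intro continuous_intros isCont_cis)
    show "integrable lborel (\<lambda>\<xi>. complex_of_real (exp (- (c * \<bar>\<xi>\<bar>))) * cis (\<xi> * x))"
      using integrable_exp_abs[OF c] by (intro FI_integrable) simp
    have "((\<lambda>\<xi>. exp (of_real \<xi> * p) / p) \<longlongrightarrow> exp (of_real 0 * p) / p) (at_right 0)"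
      using pq by (intro tendsto_intros) auto
    then have "((\<lambda>\<xi>. exp (of_real \<xi> * p) / p) \<longlongrightarrow> 1 / p) (at_right 0)" by simp
    then show "(F \<longlongrightarrow> 1 / p) (at_right 0)"
      by (rule Lim_transform_eventually) (auto simp: F_def eventually_at_right_field intro!: exI[of _ 1])
    have "((\<lambda>\<xi>. exp (of_real \<xi> * q) / q) \<longlongrightarrow> exp (of_real 0 * q) / q) (at_left 0)"
      using pq by (intro tendsto_intros) auto
    then have "((\<lambda>\<xi>. exp (of_real \<xi> * q) / q) \<longlongrightarrow> 1 / q) (at_left 0)" by simp
    then show "(F \<longlongrightarrow> 1 / q) (at_left 0)"
      by (rule Lim_transform_eventually) (auto simp: F_def eventually_at_left_field intro!: exI[of _ "-1"])
    have nF: "norm (F \<xi>) \<le> (1 / norm p + 1 / norm q) * exp (- (c * \<bar>\<xi>\<bar>))" for \<xi>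
    proof -
      have "norm (F \<xi>) = (if 0 < \<xi> then 1 / norm p else 1 / norm q) * exp (- (c * \<bar>\<xi>\<bar>))"
        by (simp add: F_def norm_divide norm_exp_eq_Re p_def q_def mult.commute)
      also have "\<dots> \<le> (1 / norm p + 1 / norm q) * exp (- (c * \<bar>\<xi>\<bar>))"
        by (intro mult_right_mono) auto
      finally show ?thesis .
    qed
    have "((\<lambda>\<xi>. (1 / norm p + 1 / norm q) * exp (- (c * \<bar>\<xi>\<bar>))) \<longlongrightarrow> 0) at_top"
      using c by real_asymp
    with nF show "(F \<longlongrightarrow> 0) at_top" by (intro Lim_null_comparison[of F "\<lambda>\<xi>. (1 / norm p + 1 / norm q) * exp (- (c * \<bar>\<xi>\<bar>))"]) auto
    have "((\<lambda>\<xi>. (1 / norm p + 1 / norm q) * exp (- (c * \<bar>\<xi>\<bar>))) \<longlongrightarrow> 0) at_bot"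
      using c by (subst filterlim_at_bot_mirror) (simp, real_asymp)
    with nF show "(F \<longlongrightarrow> 0) at_bot" by (intro Lim_null_comparison[of F "\<lambda>\<xi>. (1 / norm p + 1 / norm q) * exp (- (c * \<bar>\<xi>\<bar>))"]) auto
  qed
  also have "1 / q - 1 / p = of_real (2 * c / (c\<^sup>2 + x\<^sup>2))"
  proof -
    have "p * q = - of_real (c\<^sup>2 + x\<^sup>2)" by (simp add: p_def q_def complex_eq_iff power2_eq_square)
    moreover have "p - q = - of_real (2 * c)" by (simp add: p_def q_def complex_eq_iff)
    moreover have "1 / q - 1 / p = (p - q) / (p * q)" using pq by (simp add: field_simps)
    ultimately show ?thesis by (simp only: minus_divide_divide of_real_divide)
  qed
  finally show ?thesis .
qed

lemma integrable_cauchy: "0 < (c::real) \<Longrightarrow> integrable lborel (\<lambda>x::real. 1 / (c\<^sup>2 + x\<^sup>2))"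
proof (rule integrable_quadratic_bound[where K="1 + 1 / c\<^sup>2"])
  fix x :: real assume c: "0 < c"
  have "1 + x\<^sup>2 \<le> (1 + 1 / c\<^sup>2) * (c\<^sup>2 + x\<^sup>2)" using c by (simp add: field_simps)
  moreover have "0 < c\<^sup>2 + x\<^sup>2" using c by (simp add: add_pos_nonneg)
  ultimately show "norm (1 / (c\<^sup>2 + x\<^sup>2)) \<le> (1 + 1 / c\<^sup>2) / (1 + x\<^sup>2)"
    using one_plus_sq_pos[of x] by (simp add: field_simps)
qed measurable

lemma integrable_cauchy_cos: "0 < c \<Longrightarrow> integrable lborel (\<lambda>x::real. cos (r * x) / (c\<^sup>2 + x\<^sup>2))"
  using integrable_mult_bounded[OF integrable_cauchy, of c "\<lambda>x. cos (r * x)" 1] by simp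

lemma integral_cauchy_cos:
  assumes c: "0 < c"
  shows "(LINT x|lborel. cos (r * x) / (c\<^sup>2 + x\<^sup>2)) = pi / c * exp (- (c * \<bar>r\<bar>))"
proof -
  let ?\<phi> = "\<lambda>\<xi>. complex_of_real (exp (- (c * \<bar>\<xi>\<bar>)))"
  have i: "integrable lborel (FI ?\<phi>)"
    unfolding FI_exp_abs[OF c] using integrable_mult_right[OF integrable_cauchy[OF c], of "2 * c"]
    by (intro integrable_of_real) simp
  have "(LINT x|lborel. FI ?\<phi> x * cis (- (r * x))) = 2 * pi * ?\<phi> r"
    using i integrable_exp_abs[OF c] c
    by (intro fourier_inversion[where C=1]) (auto intro!: continuous_intros)
  then have "Re (LINT x|lborel. FI ?\<phi> x * cis (- (r * x))) = 2 * pi * exp (- (c * \<bar>r\<bar>))"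
    by simp
  moreover have "Re (LINT x|lborel. FI ?\<phi> x * cis (- (r * x))) = (LINT x|lborel. Re (FI ?\<phi> x * cis (- (r * x))))"
    using i by (intro integral_Re[symmetric] integrable_mult_bounded[where C=1]) auto
  moreover have "(LINT x|lborel. Re (FI ?\<phi> x * cis (- (r * x)))) = (LINT x|lborel. 2 * c * (cos (r * x) / (c\<^sup>2 + x\<^sup>2)))"
    unfolding FI_exp_abs[OF c] by (intro Bochner_Integration.integral_cong) (auto simp: field_simps)
  moreover have "\<dots> = 2 * c * (LINT x|lborel. cos (r * x) / (c\<^sup>2 + x\<^sup>2))"
    by (rule integral_mult_right_zero)
  ultimately have "2 * c * (LINT x|lborel. cos (r * x) / (c\<^sup>2 + x\<^sup>2)) = 2 * pi * exp (- (c * \<bar>r\<bar>))" by simp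
  then show ?thesis using c by (simp add: field_simps)
qed

lemma one_minus_cos_le: "1 - cos (x::real) \<le> x\<^sup>2 / 2" "1 - cos (x::real) \<le> 2"
proof -
  have "(sin (x / 2))\<^sup>2 \<le> (x / 2)\<^sup>2"
    using abs_sin_x_le_abs_x[of "x / 2"] by (metis abs_le_square_iff)
  then show "1 - cos x \<le> x\<^sup>2 / 2"
    using cos_double_sin[of "x / 2"] by (simp add: power_divide field_simps)
  show "1 - cos x \<le> 2" using cos_ge_minus_one[of x] by linarith
qed

definition omc :: "real \<Rightarrow> real \<Rightarrow> real" where
  "omc z \<xi> = (1 - cos (\<xi> * z)) / \<xi>\<^sup>2"

lemma integrable_omc: "integrable lborel (omc z)"
  unfolding omc_def
proof (rule integrable_pw_bound[where p=0 and q="-2" and C="z\<^sup>2 + 2"])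
  fix \<xi> :: real assume "\<xi> \<noteq> 0"
  then show "norm ((1 - cos (\<xi> * z)) / \<xi>\<^sup>2) \<le> (z\<^sup>2 + 2) * pw 0 (- 2) \<xi>"
    using one_minus_cos_le[of "\<xi> * z"] cos_le_one[of "\<xi> * z"]
    by (auto simp: pw_def powr_minus powr_numeral field_simps power_mult_distrib)
      (smt (verit) mult_nonneg_nonneg zero_le_power2)+
qed (simp_all, measurable)

lemma integral_omc: "(LINT \<xi>|lborel. omc z \<xi>) = pi * \<bar>z\<bar>"
  unfolding omc_def
proof (rule LIMSEQ_unique)
  define c where "c n = 1 / real (Suc n)" for n
  have c: "0 < c n" for n by (simp add: c_def)
  show "(\<lambda>n. LINT \<xi>|lborel. (1 - cos (\<xi> * z)) / ((c n)\<^sup>2 + \<xi>\<^sup>2)) \<longlonglongrightarrow> (LINT \<xi>|lborel. (1 - cos (\<xi> * z)) / \<xi>\<^sup>2)"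
  proof (rule integral_dominated_convergence[OF _ _ integrable_omc[of z, unfolded omc_def]])
    show "AE \<xi> in lborel. (\<lambda>n. (1 - cos (\<xi> * z)) / ((c n)\<^sup>2 + \<xi>\<^sup>2)) \<longlonglongrightarrow> (1 - cos (\<xi> * z)) / \<xi>\<^sup>2"
    proof (rule AE_mp[OF AE_lborel_singleton[of 0]], intro AE_I2 impI)
      fix \<xi> :: real assume "\<xi> \<noteq> 0"
      have "c \<longlonglongrightarrow> 0" unfolding c_def by real_asymp
      then have "(\<lambda>n. (1 - cos (\<xi> * z)) / ((c n)\<^sup>2 + \<xi>\<^sup>2)) \<longlonglongrightarrow> (1 - cos (\<xi> * z)) / (0\<^sup>2 + \<xi>\<^sup>2)"
        using \<open>\<xi> \<noteq> 0\<close> by (intro tendsto_intros) auto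
      then show "(\<lambda>n. (1 - cos (\<xi> * z)) / ((c n)\<^sup>2 + \<xi>\<^sup>2)) \<longlonglongrightarrow> (1 - cos (\<xi> * z)) / \<xi>\<^sup>2" by simp
    qed
    show "AE \<xi> in lborel. norm ((1 - cos (\<xi> * z)) / ((c n)\<^sup>2 + \<xi>\<^sup>2)) \<le> (1 - cos (\<xi> * z)) / \<xi>\<^sup>2" for n
    proof (rule AE_mp[OF AE_lborel_singleton[of 0]], intro AE_I2 impI)
      fix \<xi> :: real assume "\<xi> \<noteq> 0"
      then show "norm ((1 - cos (\<xi> * z)) / ((c n)\<^sup>2 + \<xi>\<^sup>2)) \<le> (1 - cos (\<xi> * z)) / \<xi>\<^sup>2"
        by (auto intro!: divide_left_mono mult_pos_pos add_nonneg_pos)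
    qed
  qed measurable
  have "(LINT \<xi>|lborel. (1 - cos (\<xi> * z)) / ((c n)\<^sup>2 + \<xi>\<^sup>2)) = pi / c n * (1 - exp (- (c n * \<bar>z\<bar>)))" for n
  proof -
    have "(LINT \<xi>|lborel. (1 - cos (\<xi> * z)) / ((c n)\<^sup>2 + \<xi>\<^sup>2))
      = (LINT \<xi>|lborel. cos (0 * \<xi>) / ((c n)\<^sup>2 + \<xi>\<^sup>2) - cos (z * \<xi>) / ((c n)\<^sup>2 + \<xi>\<^sup>2))"
      by (simp add: diff_divide_distrib mult.commute)
    also have "\<dots> = pi / c n * exp (- (c n * \<bar>0\<bar>)) - pi / c n * exp (- (c n * \<bar>z\<bar>))"
      using integrable_cauchy_cos[OF c[of n], of 0] integrable_cauchy_cos[OF c[of n], of z]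
        integral_cauchy_cos[OF c[of n], of 0] integral_cauchy_cos[OF c[of n], of z]
      by (subst Bochner_Integration.integral_diff) auto
    finally show ?thesis by (simp add: algebra_simps)
  qed
  moreover have "(\<lambda>n. pi / c n * (1 - exp (- (c n * \<bar>z\<bar>)))) \<longlonglongrightarrow> pi * \<bar>z\<bar>"
    unfolding c_def by real_asymp
  ultimately show "(\<lambda>n. LINT \<xi>|lborel. (1 - cos (\<xi> * z)) / ((c n)\<^sup>2 + \<xi>\<^sup>2)) \<longlonglongrightarrow> pi * \<bar>z\<bar>" by simp
qed

definition \<alpha>0 :: "real \<Rightarrow> real \<Rightarrow> complex" where
  "\<alpha>0 x \<xi> = (1 - cis (- (\<xi> * x))) / (\<i> * of_real \<xi>)"

definition \<beta>0 :: "real \<Rightarrow> real \<Rightarrow> real" where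
  "\<beta>0 t \<tau> = (1 - cos (\<tau> * t)) / \<tau>"

lemma \<beta>0_eq: "\<beta>0 t \<tau> = - Im (\<alpha>0 t \<tau>)"
  by (cases "\<tau> = 0") (auto simp: \<alpha>0_def \<beta>0_def Im_divide power2_eq_square field_simps)

lemma sqi_Im:
  assumes "sqi N f" shows "sqi N (\<lambda>x. - Im (f x))" "ip N (\<lambda>x. - Im (f x)) (\<lambda>x. - Im (f x)) \<le> ip N f f"
proof -
  have m[measurable]: "f \<in> borel_measurable N" using assms by (simp add: sqi_def)
  have i: "integrable N (\<lambda>x. (norm (f x))\<^sup>2)" using assms by (simp add: sqi_def)
  have le: "(norm (- Im (f x)))\<^sup>2 \<le> (norm (f x))\<^sup>2" for x
    by (intro power_mono) (auto simp: abs_Im_le_cmod)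
  show s: "sqi N (\<lambda>x. - Im (f x))"
    unfolding sqi_def
  proof (intro conjI Bochner_Integration.integrable_bound[OF i])
    show "AE x in N. norm ((norm (- Im (f x)))\<^sup>2) \<le> norm ((norm (f x))\<^sup>2)" using le by simp
  qed measurable
  show "ip N (\<lambda>x. - Im (f x)) (\<lambda>x. - Im (f x)) \<le> ip N f f"
    unfolding ip_self using s i le by (intro integral_mono) (auto simp: sqi_def)
qed

lemma \<alpha>0_inner:
  "\<alpha>0 x \<xi> \<bullet> \<alpha>0 y \<xi> = omc x \<xi> + omc y \<xi> - omc (x - y) \<xi>"
proof (cases "\<xi> = 0")
  case False
  have "\<alpha>0 x \<xi> = Complex (sin (\<xi> * x) / \<xi>) (- ((1 - cos (\<xi> * x)) / \<xi>))" for x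
    using False by (simp add: \<alpha>0_def complex_eq_iff Re_divide Im_divide power2_eq_square field_simps)
  then have "\<alpha>0 x \<xi> \<bullet> \<alpha>0 y \<xi> = (sin (\<xi> * x) * sin (\<xi> * y) + (1 - cos (\<xi> * x)) * (1 - cos (\<xi> * y))) / \<xi>\<^sup>2"
    by (simp add: inner_complex_def power2_eq_square add_divide_distrib)
  also have "sin (\<xi> * x) * sin (\<xi> * y) + (1 - cos (\<xi> * x)) * (1 - cos (\<xi> * y)) =
    (1 - cos (\<xi> * x)) + (1 - cos (\<xi> * y)) - (1 - cos (\<xi> * (x - y)))"
    by (simp add: right_diff_distrib cos_diff algebra_simps)
  finally show ?thesis by (simp add: omc_def add_divide_distrib diff_divide_distrib)
qed (simp add: \<alpha>0_def omc_def)

lemma \<alpha>0_measurable[measurable]: "(\<lambda>(x, \<xi>). \<alpha>0 x \<xi>) \<in> borel_measurable (borel \<Otimes>\<^sub>M borel)"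
  unfolding \<alpha>0_def by measurable

lemma \<beta>0_measurable[measurable]: "(\<lambda>(x, \<xi>). \<beta>0 x \<xi>) \<in> borel_measurable (borel \<Otimes>\<^sub>M borel)"
  unfolding \<beta>0_def by measurable

lemma sqi_\<alpha>0: "sqi lborel (\<alpha>0 x)"
  unfolding sqi_def power2_norm_eq_inner \<alpha>0_inner
  using integrable_omc[of x] integrable_omc[of "x - x"] by (auto simp: \<alpha>0_def)

lemma ip_\<alpha>0: "ip lborel (\<alpha>0 x) (\<alpha>0 y) = pi * (\<bar>x\<bar> + \<bar>y\<bar> - \<bar>x - y\<bar>)"
  unfolding ip_def \<alpha>0_inner
  using integrable_omc[of x] integrable_omc[of y] integrable_omc[of "x - y"]
  by (simp add: integral_omc algebra_simps)

lemma \<beta>0_mult: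
  "\<beta>0 t \<tau> * \<beta>0 s \<tau> = omc t \<tau> + omc s \<tau> - omc (t - s) \<tau> / 2 - omc (t + s) \<tau> / 2"
proof (cases "\<tau> = 0")
  case False
  have "(1 - cos (\<tau> * t)) * (1 - cos (\<tau> * s)) = (1 - cos (\<tau> * t)) + (1 - cos (\<tau> * s))
     - (1 - cos (\<tau> * (t - s))) / 2 - (1 - cos (\<tau> * (t + s))) / 2"
    by (simp add: right_diff_distrib distrib_left cos_diff cos_add field_simps)
  then show ?thesis using False unfolding \<beta>0_def omc_def
    by (simp add: power2_eq_square field_simps)
qed (simp add: \<beta>0_def omc_def)

lemma sqi_\<beta>0: "sqi lborel (\<beta>0 t)"
proof -
  have "integrable lborel (\<lambda>\<tau>. \<beta>0 t \<tau> * \<beta>0 t \<tau>)"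
    unfolding \<beta>0_mult using integrable_omc[of t] integrable_omc[of "t - t"] integrable_omc[of "t + t"] by auto
  then show ?thesis unfolding sqi_def by (auto simp: \<beta>0_def power2_eq_square)
qed

lemma ip_\<beta>0: "0 \<le> t \<Longrightarrow> 0 \<le> s \<Longrightarrow> ip lborel (\<beta>0 t) (\<beta>0 s) = pi * min t s"
  unfolding ip_def inner_real_def \<beta>0_mult
  using integrable_omc[of t] integrable_omc[of s] integrable_omc[of "t - s"] integrable_omc[of "t + s"]
  by (simp add: integral_omc algebra_simps min_def abs_if) (auto simp: field_simps)

lemma ip_\<beta>0_diff: "ip lborel (\<lambda>\<tau>. \<beta>0 t \<tau> - \<beta>0 s \<tau>) (\<lambda>\<tau>. \<beta>0 t \<tau> - \<beta>0 s \<tau>) \<le> 2 * pi * \<bar>t - s\<bar>"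
  using sqi_Im(2)[OF sqi_diff[OF sqi_\<alpha>0[of t] sqi_\<alpha>0[of s]]]
    ip_diff_self[OF sqi_\<alpha>0[of t] sqi_\<alpha>0[of s]]
  by (simp add: \<beta>0_eq ip_\<alpha>0 algebra_simps)

lemma a\<alpha>_minus_\<alpha>0:
  assumes \<epsilon>: "0 < \<epsilon>"
  shows "(norm (a\<alpha> \<epsilon> x \<xi> - \<alpha>0 x \<xi>))\<^sup>2 \<le> x\<^sup>2 / (1 + (\<xi> / \<epsilon>)\<^sup>2) + 8 * \<epsilon>\<^sup>2 / (1 + (\<epsilon> * \<xi>)\<^sup>2)"
proof (cases "\<xi> = 0")
  case True
  then show ?thesis by (simp add: a\<alpha>_def \<alpha>0_def)
next
  case False
  define z where "z = \<epsilon>\<^sup>2 * \<xi>\<^sup>2"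
  define A where "A = \<xi>\<^sup>2 / (\<xi>\<^sup>2 + \<epsilon>\<^sup>2)"
  define e where "e = 1 - A / (1 + z)\<^sup>2"
  have z: "0 \<le> z" by (simp add: z_def)
  have pos: "0 < \<xi>\<^sup>2 + \<epsilon>\<^sup>2" using \<epsilon> by (simp add: add_nonneg_pos)
  have A: "0 \<le> A" "A \<le> 1" using pos by (auto simp: A_def)
  have z2: "1 + z \<noteq> 0" using z by linarith
  have z1: "1 \<le> (1 + z)\<^sup>2" using z by (simp add: power2_eq_square algebra_simps add_increasing)
  have e01: "0 \<le> e" "e \<le> 1"
    using A z1 by (auto simp: e_def divide_le_eq)
  have e_le: "e \<le> 1 / (1 + (\<xi> / \<epsilon>)\<^sup>2) + 2 * z / (1 + z)"
  proof -
    have "1 - A = 1 / (1 + (\<xi> / \<epsilon>)\<^sup>2)"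
      using \<epsilon> pos by (simp add: A_def field_simps)
    moreover have "A * (1 - 1 / (1 + z)\<^sup>2) \<le> 1 * (2 * z / (1 + z))"
    proof (intro mult_mono)
      have "1 - 1 / (1 + z)\<^sup>2 = ((1 + z)\<^sup>2 - 1) / (1 + z)\<^sup>2" using z2 by (simp add: diff_divide_distrib)
      also have "\<dots> \<le> (2 * z * (1 + z)) / (1 + z)\<^sup>2"
        using z z1 by (intro divide_right_mono) (auto simp: power2_eq_square algebra_simps)
      also have "\<dots> = 2 * z / (1 + z)" using z by (simp add: power2_eq_square)
      finally show "1 - 1 / (1 + z)\<^sup>2 \<le> 2 * z / (1 + z)" .
    qed (use A z z1 in \<open>auto simp: divide_le_eq\<close>)
    moreover have "e = (1 - A) + A * (1 - 1 / (1 + z)\<^sup>2)" by (simp add: e_def algebra_simps)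
    ultimately show ?thesis by simp
  qed
  have "a\<alpha> \<epsilon> x \<xi> = \<alpha>0 x \<xi> * of_real (A / (1 + z)\<^sup>2)"
  proof -
    have "- \<i> * complex_of_real \<xi> = of_real (\<xi>\<^sup>2) / (\<i> * of_real \<xi>)"
      using False by (simp add: field_simps power2_eq_square)
    then show ?thesis
      unfolding a\<alpha>_def \<alpha>0_def A_def z_def by (simp add: mult.commute)
  qed
  then have "\<alpha>0 x \<xi> - a\<alpha> \<epsilon> x \<xi> = \<alpha>0 x \<xi> * of_real e"
    by (simp add: e_def algebra_simps)
  then have "(norm (a\<alpha> \<epsilon> x \<xi> - \<alpha>0 x \<xi>))\<^sup>2 = (norm (\<alpha>0 x \<xi>))\<^sup>2 * e\<^sup>2"
    by (metis norm_minus_commute norm_mult norm_of_real power2_abs power_mult_distrib)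
  also have "\<dots> \<le> (norm (\<alpha>0 x \<xi>))\<^sup>2 * e"
    using e01 by (intro mult_left_mono) (auto simp: power2_eq_square mult_left_le)
  also have "\<dots> \<le> (norm (\<alpha>0 x \<xi>))\<^sup>2 * (1 / (1 + (\<xi> / \<epsilon>)\<^sup>2) + 2 * z / (1 + z))"
    by (intro mult_left_mono e_le) auto
  also have "\<dots> = (norm (\<alpha>0 x \<xi>))\<^sup>2 * (1 / (1 + (\<xi> / \<epsilon>)\<^sup>2)) + (norm (\<alpha>0 x \<xi>))\<^sup>2 * (2 * z / (1 + z))"
    by (simp add: distrib_left)
  also have "\<dots> \<le> x\<^sup>2 * (1 / (1 + (\<xi> / \<epsilon>)\<^sup>2)) + 4 / \<xi>\<^sup>2 * (2 * z / (1 + z))"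
  proof (intro add_mono mult_right_mono)
    have n: "(norm (\<alpha>0 x \<xi>))\<^sup>2 = 2 * (1 - cos (\<xi> * x)) / \<xi>\<^sup>2"
      unfolding power2_norm_eq_inner \<alpha>0_inner by (simp add: omc_def diff_divide_distrib)
    show "(norm (\<alpha>0 x \<xi>))\<^sup>2 \<le> x\<^sup>2"
      unfolding n using one_minus_cos_le(1)[of "\<xi> * x"] False by (simp add: field_simps power_mult_distrib)
    show "(norm (\<alpha>0 x \<xi>))\<^sup>2 \<le> 4 / \<xi>\<^sup>2"
    proof -
      have "2 * (1 - cos (\<xi> * x)) \<le> 2 * 2" by (intro mult_left_mono one_minus_cos_le) simp
      then have "2 * (1 - cos (\<xi> * x)) \<le> 4" by simp
      then show ?thesis unfolding n by (rule divide_right_mono) simp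
    qed
  qed (use z in \<open>auto intro!: divide_nonneg_nonneg add_nonneg_nonneg\<close>)
  also have "\<dots> = x\<^sup>2 / (1 + (\<xi> / \<epsilon>)\<^sup>2) + 8 * \<epsilon>\<^sup>2 / (1 + (\<epsilon> * \<xi>)\<^sup>2)"
    using False by (simp add: z_def power_mult_distrib)
  finally show ?thesis .
qed

definition J0 :: real where "J0 = (LINT x|lborel. 1 / (1 + x\<^sup>2))"

lemma J0_nonneg: "0 \<le> J0"
  unfolding J0_def by (intro Bochner_Integration.integral_nonneg) auto

lemma scaled_quadratic:
  assumes "0 < \<epsilon>"
  shows "integrable lborel (\<lambda>\<xi>. 1 / (1 + (\<epsilon> * \<xi>)\<^sup>2))" "(LINT \<xi>|lborel. 1 / (1 + (\<epsilon> * \<xi>)\<^sup>2)) = J0 / \<epsilon>"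
proof -
  show "integrable lborel (\<lambda>\<xi>. 1 / (1 + (\<epsilon> * \<xi>)\<^sup>2))"
    using lborel_integrable_real_affine[OF integrable_inverse_quadratic, of \<epsilon> 0] assms by simp
  show "(LINT \<xi>|lborel. 1 / (1 + (\<epsilon> * \<xi>)\<^sup>2)) = J0 / \<epsilon>"
    unfolding J0_def using lborel_integral_real_affine[of \<epsilon> "\<lambda>x. 1 / (1 + x\<^sup>2)" 0] assms by simp
qed

lemma a\<alpha>_measurable[measurable]: "(\<lambda>(x, \<xi>). a\<alpha> \<epsilon> x \<xi>) \<in> borel_measurable (borel \<Otimes>\<^sub>M borel)"
  unfolding a\<alpha>_def by measurable

lemma a\<alpha>_dist:
  assumes \<epsilon>: "0 < \<epsilon>"
  shows "sqi lborel (\<lambda>\<xi>. a\<alpha> \<epsilon> x \<xi> - \<alpha>0 x \<xi>)"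
    "ip lborel (\<lambda>\<xi>. a\<alpha> \<epsilon> x \<xi> - \<alpha>0 x \<xi>) (\<lambda>\<xi>. a\<alpha> \<epsilon> x \<xi> - \<alpha>0 x \<xi>) \<le> J0 * (x\<^sup>2 + 8) * \<epsilon>"
proof -
  define h where "h \<xi> = x\<^sup>2 * (1 / (1 + ((1 / \<epsilon>) * \<xi>)\<^sup>2)) + 8 * \<epsilon>\<^sup>2 * (1 / (1 + (\<epsilon> * \<xi>)\<^sup>2))" for \<xi>
  have h: "integrable lborel h" "(LINT \<xi>|lborel. h \<xi>) = J0 * (x\<^sup>2 + 8) * \<epsilon>"
  proof -
    have 1: "0 < 1 / \<epsilon>" using \<epsilon> by simp
    note i = integrable_mult_right[OF scaled_quadratic(1)[OF 1], of "x\<^sup>2"] integrable_mult_right[OF scaled_quadratic(1)[OF \<epsilon>], of "8 * \<epsilon>\<^sup>2"]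
    show "integrable lborel h" unfolding h_def by (rule Bochner_Integration.integrable_add[OF i])
    have "(LINT \<xi>|lborel. h \<xi>) = x\<^sup>2 * (J0 / (1 / \<epsilon>)) + 8 * \<epsilon>\<^sup>2 * (J0 / \<epsilon>)"
      unfolding h_def Bochner_Integration.integral_add[OF i] integral_mult_right_zero scaled_quadratic(2)[OF 1] scaled_quadratic(2)[OF \<epsilon>] ..
    also have "\<dots> = J0 * (x\<^sup>2 + 8) * \<epsilon>" using \<epsilon> by (simp add: power2_eq_square field_simps)
    finally show "(LINT \<xi>|lborel. h \<xi>) = J0 * (x\<^sup>2 + 8) * \<epsilon>" .
  qed
  have le: "(norm (a\<alpha> \<epsilon> x \<xi> - \<alpha>0 x \<xi>))\<^sup>2 \<le> h \<xi>" for \<xi>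
    using a\<alpha>_minus_\<alpha>0[OF \<epsilon>, of x \<xi>] by (simp add: h_def)
  show s: "sqi lborel (\<lambda>\<xi>. a\<alpha> \<epsilon> x \<xi> - \<alpha>0 x \<xi>)"
    unfolding sqi_def
  proof (intro conjI Bochner_Integration.integrable_bound[OF h(1)])
    show "AE \<xi> in lborel. norm ((norm (a\<alpha> \<epsilon> x \<xi> - \<alpha>0 x \<xi>))\<^sup>2) \<le> norm (h \<xi>)"
      by (intro AE_I2) (simp add: order_trans[OF le abs_ge_self])
  qed measurable
  show "ip lborel (\<lambda>\<xi>. a\<alpha> \<epsilon> x \<xi> - \<alpha>0 x \<xi>) (\<lambda>\<xi>. a\<alpha> \<epsilon> x \<xi> - \<alpha>0 x \<xi>) \<le> J0 * (x\<^sup>2 + 8) * \<epsilon>"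
    unfolding h(2)[symmetric] ip_self using s h le by (intro integral_mono) (auto simp: sqi_def)
qed

lemma sqi_a\<alpha>: "0 < \<epsilon> \<Longrightarrow> sqi lborel (a\<alpha> \<epsilon> x)"
  using sqi_add[OF a\<alpha>_dist(1)[of \<epsilon> x] sqi_\<alpha>0[of x]] by simp

lemma a\<beta>_dist:
  assumes \<epsilon>: "0 < \<epsilon>"
  shows "sqi lborel (\<lambda>\<xi>. a\<beta> \<epsilon> x \<xi> - \<beta>0 x \<xi>)"
    "ip lborel (\<lambda>\<xi>. a\<beta> \<epsilon> x \<xi> - \<beta>0 x \<xi>) (\<lambda>\<xi>. a\<beta> \<epsilon> x \<xi> - \<beta>0 x \<xi>) \<le> J0 * (x\<^sup>2 + 8) * \<epsilon>"
  using sqi_Im[OF a\<alpha>_dist(1)[OF \<epsilon>, of x]] a\<alpha>_dist(2)[OF \<epsilon>, of x] by (simp_all add: a\<beta>_eq \<beta>0_eq)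

lemma sqi_a\<beta>: "0 < \<epsilon> \<Longrightarrow> sqi lborel (a\<beta> \<epsilon> x)"
  using sqi_add[OF a\<beta>_dist(1)[of \<epsilon> x] sqi_\<beta>0[of x]] by simp

definition tens :: "(real \<Rightarrow> complex) \<Rightarrow> (real \<Rightarrow> real) \<Rightarrow> real \<times> real \<Rightarrow> complex" where
  "tens \<alpha> \<beta> p = \<beta> (snd p) *\<^sub>R \<alpha> (fst p)"

lemma sqi_tens:
  assumes "sqi lborel \<alpha>" "sqi lborel \<beta>" shows "sqi lborel (tens \<alpha> \<beta>)"
proof -
  have [measurable]: "\<alpha> \<in> borel_measurable borel" "\<beta> \<in> borel_measurable borel"
    using assms by (auto simp: sqi_def)
  have "integrable lborel (\<lambda>p. (norm (\<alpha> (fst p)))\<^sup>2 * (norm (\<beta> (snd p)))\<^sup>2)"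
    using assms by (intro integrable_lborel2) (auto simp: sqi_def)
  then show ?thesis unfolding sqi_def tens_def
    by (auto simp: power_mult_distrib mult.commute)
qed

lemma ip_tens:
  assumes "sqi lborel \<alpha>" "sqi lborel \<beta>" "sqi lborel \<alpha>'" "sqi lborel \<beta>'"
  shows "ip lborel (tens \<alpha> \<beta>) (tens \<alpha>' \<beta>') = ip lborel \<alpha> \<alpha>' * ip lborel \<beta> \<beta>'"
proof -
  have "ip lborel (tens \<alpha> \<beta>) (tens \<alpha>' \<beta>') = (LINT p|lborel. (\<alpha> (fst p) \<bullet> \<alpha>' (fst p)) * (\<beta> (snd p) \<bullet> \<beta>' (snd p)))"
    unfolding ip_def tens_def by (intro Bochner_Integration.integral_cong) auto
  then show ?thesis
    using integral_lborel2[OF sqi_inner_integrable[OF assms(1,3)] sqi_inner_integrable[OF assms(2,4)]]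
    by (simp add: ip_def)
qed

section \<open>The spectral representation of the covariance\<close>

definition msym :: "real \<times> real \<Rightarrow> complex" where
  "msym z = Complex (\<bar>snd z\<bar> - (fst z)\<^sup>2) (- (sqrt 2 * fst z * sqrt \<bar>snd z\<bar>))"

lemma norm_msym: "(norm (msym z))\<^sup>2 = (fst z) ^ 4 + (snd z)\<^sup>2"
  unfolding msym_def cmod_power2
  by (simp add: power2_diff power_mult_distrib)

definition uh :: "real \<times> real \<Rightarrow> real \<times> real \<Rightarrow> complex" where
  "uh p z = sin (snd z * snd p) *\<^sub>R (cis (- (fst z * fst p)) / msym z)"

lemma msym_measurable[measurable]: "msym \<in> borel_measurable borel"
  unfolding msym_def[abs_def] Complex_eq by measurable

lemma uh_measurable[measurable]: "(\<lambda>(p, z). uh p z) \<in> borel_measurable (borel \<Otimes>\<^sub>M borel)"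
  unfolding uh_def by measurable

lemma uh_inner:
  "uh p z \<bullet> uh p' z = cos (fst z * (fst p - fst p')) * (sin (snd z * snd p) * sin (snd z * snd p') / ((fst z) ^ 4 + (snd z)\<^sup>2))"
proof -
  have *: "(a / m) \<bullet> (b / m) = (a \<bullet> b) / (norm m)\<^sup>2" for a b m :: complex
  proof (cases "m = 0")
    case False
    have inner: "x \<bullet> y = Re (x * cnj y)" for x y :: complex by (simp add: inner_complex_def)
    have "(a / m) \<bullet> (b / m) = Re (a / m * cnj (b / m))" by (rule inner)
    also have "a / m * cnj (b / m) = (a * cnj b) / of_real ((norm m)\<^sup>2)"
      by (simp add: complex_norm_square del: of_real_power)
    also have "Re \<dots> = Re (a * cnj b) / (norm m)\<^sup>2" by (rule Re_divide_of_real)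
    finally show ?thesis by (simp add: inner_complex_def)
  qed simp
  have "cis (- (fst z * fst p)) \<bullet> cis (- (fst z * fst p')) = cos (fst z * (fst p - fst p'))"
    by (simp add: inner_complex_def right_diff_distrib cos_diff)
  then show ?thesis by (simp add: uh_def * norm_msym)
qed

lemma uh_norm: "(norm (uh p z))\<^sup>2 = (sin (snd z * snd p))\<^sup>2 / ((fst z) ^ 4 + (snd z)\<^sup>2)"
  unfolding power2_norm_eq_inner uh_inner by (simp add: power2_eq_square)

lemma weighted_prod_le_sum:
  assumes "0 < a" "0 < (b::real)" "0 \<le> \<theta>" "\<theta> \<le> 1"
  shows "a powr \<theta> * b powr (1 - \<theta>) \<le> a + b"
proof -
  let ?M = "max a b"
  have "a powr \<theta> * b powr (1 - \<theta>) \<le> ?M powr \<theta> * ?M powr (1 - \<theta>)"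
    using assms by (intro mult_mono powr_mono2) auto
  also have "\<dots> = ?M" using assms by (simp add: powr_add[symmetric])
  also have "\<dots> \<le> a + b" using assms by auto
  finally show ?thesis .
qed

lemma spectral_pw:
  assumes "\<xi> \<noteq> 0" "\<tau> \<noteq> 0"
  shows "min 1 \<bar>\<tau>\<bar> / (\<xi> ^ 4 + \<tau>\<^sup>2) \<le> pw (-1/2) (-3/2) \<xi> * pw (-3/4) (-5/4) \<tau>"
proof -
  have x4: "(\<xi> ^ 4) powr \<theta> = \<bar>\<xi>\<bar> powr (4 * \<theta>)" and t2: "(\<tau>\<^sup>2) powr \<theta> = \<bar>\<tau>\<bar> powr (2 * \<theta>)" for \<theta> :: real
  proof -
    have *: "\<xi> ^ 4 = \<bar>\<xi>\<bar> powr 4" "\<tau>\<^sup>2 = \<bar>\<tau>\<bar> powr 2" using assms by (simp_all add: powr_numeral)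
    show "(\<xi> ^ 4) powr \<theta> = \<bar>\<xi>\<bar> powr (4 * \<theta>)" "(\<tau>\<^sup>2) powr \<theta> = \<bar>\<tau>\<bar> powr (2 * \<theta>)" by (simp_all only: * powr_powr)
  qed
  have pos: "0 < \<xi> ^ 4 + \<tau>\<^sup>2" using assms by (simp add: add_pos_pos)
  have le: "1 / (\<xi> ^ 4 + \<tau>\<^sup>2) \<le> \<bar>\<xi>\<bar> powr (- (4 * \<theta>)) * \<bar>\<tau>\<bar> powr (- (2 * (1 - \<theta>)))" if "0 \<le> \<theta>" "\<theta> \<le> 1" for \<theta>
  proof -
    have "\<bar>\<xi>\<bar> powr (4 * \<theta>) * \<bar>\<tau>\<bar> powr (2 * (1 - \<theta>)) \<le> \<xi> ^ 4 + \<tau>\<^sup>2"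
      using weighted_prod_le_sum[of "\<xi> ^ 4" "\<tau>\<^sup>2" \<theta>] assms that by (simp add: x4 t2)
    moreover have "0 < \<bar>\<xi>\<bar> powr (4 * \<theta>) * \<bar>\<tau>\<bar> powr (2 * (1 - \<theta>))" using assms by simp
    ultimately have "1 / (\<xi> ^ 4 + \<tau>\<^sup>2) \<le> 1 / (\<bar>\<xi>\<bar> powr (4 * \<theta>) * \<bar>\<tau>\<bar> powr (2 * (1 - \<theta>)))"
      by (intro divide_left_mono mult_pos_pos pos) auto
    then show ?thesis by (simp only: powr_minus divide_inverse inverse_mult_distrib mult_1_left)
  qed
  have 1: "min 1 \<bar>\<tau>\<bar> * \<bar>\<tau>\<bar> powr (-7/4) \<le> pw (-3/4) (-5/4) \<tau>"
  proof (cases "\<bar>\<tau>\<bar> \<le> 1")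
    case True
    have "\<bar>\<tau>\<bar> * \<bar>\<tau>\<bar> powr (-7/4) = \<bar>\<tau>\<bar> powr (1 + (-7/4))" using assms by (subst powr_add) simp
    then show ?thesis using True by (simp add: pw_def)
  next
    case False
    then show ?thesis using powr_mono[of "-7/4" "-5/4" "\<bar>\<tau>\<bar>"] by (simp add: pw_def)
  qed
  have 2: "min 1 \<bar>\<tau>\<bar> * \<bar>\<tau>\<bar> powr (-5/4) \<le> pw (-3/4) (-5/4) \<tau>"
  proof (cases "\<bar>\<tau>\<bar> \<le> 1")
    case True
    have "\<bar>\<tau>\<bar> * \<bar>\<tau>\<bar> powr (-5/4) = \<bar>\<tau>\<bar> powr (1 + (-5/4))" using assms by (subst powr_add) simp
    also have "\<dots> \<le> \<bar>\<tau>\<bar> powr (-3/4)" using True assms by (intro powr_mono') auto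
    finally show ?thesis using True by (simp add: pw_def)
  qed (simp add: pw_def)
  show ?thesis
  proof (cases "\<bar>\<xi>\<bar> \<le> 1")
    case True
    have "min 1 \<bar>\<tau>\<bar> * (1 / (\<xi> ^ 4 + \<tau>\<^sup>2)) \<le> min 1 \<bar>\<tau>\<bar> * (\<bar>\<xi>\<bar> powr (-1/2) * \<bar>\<tau>\<bar> powr (-7/4))"
      using le[of "1/8"] by (intro mult_left_mono) auto
    also have "\<dots> = \<bar>\<xi>\<bar> powr (-1/2) * (min 1 \<bar>\<tau>\<bar> * \<bar>\<tau>\<bar> powr (-7/4))" by simp
    also have "\<dots> \<le> \<bar>\<xi>\<bar> powr (-1/2) * pw (-3/4) (-5/4) \<tau>" using 1 by (intro mult_left_mono) auto
    finally show ?thesis using True by (simp add: pw_def[of "-(1/2)"])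
  next
    case False
    have "min 1 \<bar>\<tau>\<bar> * (1 / (\<xi> ^ 4 + \<tau>\<^sup>2)) \<le> min 1 \<bar>\<tau>\<bar> * (\<bar>\<xi>\<bar> powr (-3/2) * \<bar>\<tau>\<bar> powr (-5/4))"
      using le[of "3/8"] by (intro mult_left_mono) auto
    also have "\<dots> = \<bar>\<xi>\<bar> powr (-3/2) * (min 1 \<bar>\<tau>\<bar> * \<bar>\<tau>\<bar> powr (-5/4))" by simp
    also have "\<dots> \<le> \<bar>\<xi>\<bar> powr (-3/2) * pw (-3/4) (-5/4) \<tau>" using 2 by (intro mult_left_mono) auto
    finally show ?thesis using False by (simp add: pw_def[of "-(1/2)"])
  qed
qed

lemma AE_lborel2_nonzero: "AE p in lborel. fst p \<noteq> (0::real) \<and> snd p \<noteq> (0::real)"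
proof -
  have "AE p in lborel \<Otimes>\<^sub>M lborel. fst p \<noteq> (0::real) \<and> snd p \<noteq> (0::real)"
  proof (rule lborel_pair.AE_pair_measure)
    show "AE x in lborel. AE y in lborel. fst (x, y) \<noteq> (0::real) \<and> snd (x, y) \<noteq> (0::real)"
      using AE_lborel_singleton[of "0::real"] AE_lborel_singleton[of "0::real"] by (auto elim!: eventually_mono)
  qed measurable
  then show ?thesis unfolding lborel_prod .
qed

definition S0 :: real where
  "S0 = 1 + (LINT z|lborel. pw (-1/2) (-3/2) (fst z) * pw (-3/4) (-5/4) (snd z))"

lemma S0_pos: "0 < S0"
  unfolding S0_def by (intro add_pos_nonneg Bochner_Integration.integral_nonneg) auto

lemma uh_sqi: "sqi lborel (uh p)" and ip_uh_le: "ip lborel (uh p) (uh p) \<le> S0 * (1 + \<bar>snd p\<bar>)"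
proof -
  let ?W = "\<lambda>z. pw (-1/2) (-3/2) (fst z) * pw (-3/4) (-5/4) (snd z)"
  have W: "integrable lborel ?W" by (intro integrable_lborel2 integrable_pw) auto
  have le: "AE z in lborel. (norm (uh p z))\<^sup>2 \<le> (1 + \<bar>snd p\<bar>) * ?W z"
    using AE_lborel2_nonzero
  proof eventually_elim
    fix z :: "real \<times> real" assume z: "fst z \<noteq> 0 \<and> snd z \<noteq> 0"
    have pos: "0 < (fst z) ^ 4 + (snd z)\<^sup>2" using z by (simp add: add_pos_pos)
    have "(sin (snd z * snd p))\<^sup>2 \<le> \<bar>sin (snd z * snd p)\<bar>"
    proof -
      have "\<bar>sin (snd z * snd p)\<bar> * \<bar>sin (snd z * snd p)\<bar> \<le> \<bar>sin (snd z * snd p)\<bar> * 1"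
        by (intro mult_left_mono) auto
      then show ?thesis by (simp add: power2_eq_square)
    qed
    also have "\<dots> \<le> (1 + \<bar>snd p\<bar>) * min 1 \<bar>snd z\<bar>"
    proof (cases "\<bar>snd z\<bar> \<le> 1")
      case True
      have "\<bar>sin (snd z * snd p)\<bar> \<le> \<bar>snd p\<bar> * \<bar>snd z\<bar>"
        using abs_sin_x_le_abs_x[of "snd z * snd p"] by (simp add: abs_mult mult.commute)
      also have "\<dots> \<le> (1 + \<bar>snd p\<bar>) * \<bar>snd z\<bar>" by (intro mult_right_mono) auto
      finally show ?thesis using True by simp
    next
      case False
      then have "min 1 \<bar>snd z\<bar> = 1" by simp
      then show ?thesis using abs_sin_le_one[of "snd z * snd p"] by (simp only: mult_1_right)
    qed
    finally have "(norm (uh p z))\<^sup>2 \<le> (1 + \<bar>snd p\<bar>) * min 1 \<bar>snd z\<bar> / ((fst z) ^ 4 + (snd z)\<^sup>2)"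
      unfolding uh_norm using pos by (intro divide_right_mono) auto
    also have "\<dots> = (1 + \<bar>snd p\<bar>) * (min 1 \<bar>snd z\<bar> / ((fst z) ^ 4 + (snd z)\<^sup>2))" by simp
    also have "\<dots> \<le> (1 + \<bar>snd p\<bar>) * ?W z"
      using spectral_pw[of "fst z" "snd z"] z by (intro mult_left_mono) auto
    finally show "(norm (uh p z))\<^sup>2 \<le> (1 + \<bar>snd p\<bar>) * ?W z" .
  qed
  have i: "integrable lborel (\<lambda>z. (1 + \<bar>snd p\<bar>) * ?W z)" using W by (rule integrable_mult_right)
  show s: "sqi lborel (uh p)"
    unfolding sqi_def
  proof (intro conjI Bochner_Integration.integrable_bound[OF i])
    show "AE z in lborel. norm ((norm (uh p z))\<^sup>2) \<le> norm ((1 + \<bar>snd p\<bar>) * ?W z)"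
      using le by eventually_elim (simp add: abs_mult)
  qed measurable
  have "ip lborel (uh p) (uh p) \<le> (LINT z|lborel. (1 + \<bar>snd p\<bar>) * ?W z)"
    unfolding ip_self using s i le by (intro integral_mono_AE) (auto simp: sqi_def)
  also have "\<dots> = (1 + \<bar>snd p\<bar>) * (LINT z|lborel. ?W z)" by (rule integral_mult_right_zero)
  also have "\<dots> \<le> (1 + \<bar>snd p\<bar>) * S0" unfolding S0_def by (intro mult_left_mono) auto
  finally show "ip lborel (uh p) (uh p) \<le> S0 * (1 + \<bar>snd p\<bar>)" by (simp add: mult.commute)
qed

lemma integral_sin_sin:
  assumes "\<xi> \<noteq> 0" "0 < t" "0 < t'"
  shows "(LINT \<tau>|lborel. sin (\<tau> * t) * sin (\<tau> * t') / (\<xi> ^ 4 + \<tau>\<^sup>2))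
    = pi * (LINT s|lborel. indicator {0<..<min t t'} s * exp (- (\<xi>\<^sup>2 * (t + t' - 2 * s))))"
proof -
  have c: "0 < \<xi>\<^sup>2" using assms by simp
  have x4: "\<xi> ^ 4 = (\<xi>\<^sup>2)\<^sup>2" by simp
  have "(LINT \<tau>|lborel. sin (\<tau> * t) * sin (\<tau> * t') / (\<xi> ^ 4 + \<tau>\<^sup>2))
    = (LINT \<tau>|lborel. (cos ((t - t') * \<tau>) / ((\<xi>\<^sup>2)\<^sup>2 + \<tau>\<^sup>2) - cos ((t + t') * \<tau>) / ((\<xi>\<^sup>2)\<^sup>2 + \<tau>\<^sup>2)) / 2)"
    unfolding x4 sin_times_sin
    by (intro Bochner_Integration.integral_cong) (auto simp: algebra_simps diff_divide_distrib)
  also have "\<dots> = (pi / \<xi>\<^sup>2 * exp (- (\<xi>\<^sup>2 * \<bar>t - t'\<bar>)) - pi / \<xi>\<^sup>2 * exp (- (\<xi>\<^sup>2 * \<bar>t + t'\<bar>))) / 2"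
    using integrable_cauchy_cos[OF c, of "t - t'"] integrable_cauchy_cos[OF c, of "t + t'"]
      integral_cauchy_cos[OF c, of "t - t'"] integral_cauchy_cos[OF c, of "t + t'"]
    by simp
  also have "\<dots> = pi * (exp (- (\<xi>\<^sup>2 * \<bar>t - t'\<bar>)) / (2 * \<xi>\<^sup>2) - exp (- (\<xi>\<^sup>2 * (t + t'))) / (2 * \<xi>\<^sup>2))"
    using assms by (simp add: field_simps)
  also have "exp (- (\<xi>\<^sup>2 * \<bar>t - t'\<bar>)) / (2 * \<xi>\<^sup>2) - exp (- (\<xi>\<^sup>2 * (t + t'))) / (2 * \<xi>\<^sup>2)
    = (LINT s|lborel. indicator {0<..<min t t'} s * exp (- (\<xi>\<^sup>2 * (t + t' - 2 * s))))"
  proof -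
    define m where "m = min t t'"
    let ?F = "\<lambda>s. exp (- (\<xi>\<^sup>2 * (t + t' - 2 * s))) / (2 * \<xi>\<^sup>2)"
    have "(LBINT s=ereal 0..ereal m. exp (- (\<xi>\<^sup>2 * (t + t' - 2 * s)))) = ?F m - ?F 0"
      using assms
      by (intro interval_integral_FTC_finite)
         (auto intro!: continuous_intros derivative_eq_intros simp: has_real_derivative_iff_has_vector_derivative[symmetric])
    moreover have "t + t' - 2 * m = \<bar>t - t'\<bar>" "0 \<le> m" using assms by (auto simp: m_def min_def)
    ultimately show ?thesis unfolding m_def[symmetric]
      by (simp add: interval_lebesgue_integral_def set_lebesgue_integral_def)
  qed
  finally show ?thesis .
qed

lemma integral_cos_gauss:
  assumes "0 < v"
  shows "integrable lborel (\<lambda>\<xi>. exp (- (\<xi>\<^sup>2 * v)))"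
    "(LINT \<xi>|lborel. cos (\<xi> * a) * exp (- (\<xi>\<^sup>2 * v))) = 2 * pi * normal_density 0 (sqrt (2 * v)) a"
proof -
  define c where "c = 1 / sqrt (2 * v)"
  have c: "0 < c" using assms by (simp add: c_def)
  have e: "exp (- (\<xi>\<^sup>2 * v)) = sqrt (2 * pi) * std_normal_density (\<xi> / c)" for \<xi>
    using assms by (simp add: std_normal_density_def c_def power_mult_distrib field_simps)
  have "integrable lborel (\<lambda>x. std_normal_density (0 + (1 / c) * x))"
    using c by (intro lborel_integrable_real_affine) (simp_all add: integrable_normal_density)
  then have i: "integrable lborel (\<lambda>\<xi>. std_normal_density (\<xi> / c))" by simp
  then show "integrable lborel (\<lambda>\<xi>. exp (- (\<xi>\<^sup>2 * v)))" unfolding e by simp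
  have "(LINT \<xi>|lborel. cos (\<xi> * a) * exp (- (\<xi>\<^sup>2 * v)))
    = (LINT \<xi>|lborel. sqrt (2 * pi) * Re (of_real (std_normal_density (\<xi> / c)) * cis (a * \<xi>)))"
    unfolding e by (intro Bochner_Integration.integral_cong) (auto simp: mult_ac)
  also have "\<dots> = sqrt (2 * pi) * Re (LINT \<xi>|lborel. of_real (std_normal_density (\<xi> / c)) * cis (a * \<xi>))"
    using i by (subst integral_mult_right_zero, subst integral_Re) (auto intro!: integrable_mult_bounded[where C=1])
  also have "\<dots> = sqrt (2 * pi) * (sqrt (2 * pi) * c * std_normal_density (a * c))"
    unfolding integral_scaled_normal_cis[OF c] by simp
  also have "\<dots> = 2 * pi * normal_density 0 (sqrt (2 * v)) a"
    using assms by (simp add: normal_density_def c_def power_mult_distrib real_sqrt_mult field_simps)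
  finally show "(LINT \<xi>|lborel. cos (\<xi> * a) * exp (- (\<xi>\<^sup>2 * v))) = 2 * pi * normal_density 0 (sqrt (2 * v)) a" .
qed

lemma heat_kernel_normal:
  "s < t \<Longrightarrow> heat_kernel (y, s) (x, t) = normal_density 0 (sqrt (2 * (t - s))) (x - y)"
  by (simp add: heat_kernel_def normal_density_def)

lemma heat_kernel_conv:
  assumes "s < t" "s < t'"
  shows "(\<integral>\<^sup>+y. ennreal (heat_kernel (y, s) (x, t) * heat_kernel (y, s) (x', t')) \<partial>lborel)
    = ennreal (normal_density 0 (sqrt (2 * (t + t' - 2 * s))) (x - x'))"
proof -
  let ?a = "sqrt (2 * (t - s))" and ?b = "sqrt (2 * (t' - s))"
  have "(\<integral>\<^sup>+y. ennreal (heat_kernel (y, s) (x, t) * heat_kernel (y, s) (x', t')) \<partial>lborel)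
    = (\<integral>\<^sup>+y. ennreal (normal_density 0 ?a (x - y) * normal_density 0 ?b (x' - y)) \<partial>lborel)"
    using assms by (simp add: heat_kernel_normal)
  also have "\<dots> = (\<integral>\<^sup>+u. ennreal (normal_density 0 ?a (x - (x' + 1 * u)) * normal_density 0 ?b (x' - (x' + 1 * u))) \<partial>lborel)"
    by (subst nn_integral_real_affine[where c=1 and t=x']) auto
  also have "\<dots> = (\<integral>\<^sup>+u. ennreal (normal_density 0 ?a ((x - x') - u) * normal_density 0 ?b u) \<partial>lborel)"
    by (intro nn_integral_cong) (simp add: normal_density_def algebra_simps)
  also have "\<dots> = ennreal (normal_density 0 (sqrt (?a\<^sup>2 + ?b\<^sup>2)) (x - x'))"
    using fun_cong[OF conv_normal_density_zero_mean[of ?a ?b], of "x - x'"] assms by simp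
  also have "?a\<^sup>2 + ?b\<^sup>2 = 2 * (t + t' - 2 * s)" using assms by simp
  finally show ?thesis .
qed

lemma heat_kernel_measurable[measurable]:
  "(\<lambda>q. heat_kernel q p) \<in> borel_measurable borel"
  unfolding heat_kernel_def split_beta' by measurable

text \<open>The factor \<open>2 \<pi>\<^sup>2\<close> normalises the spectral inner product.\<close>

lemma ip_uh_heat_kernel:
  assumes "0 < t" "0 < t'"
  shows "(\<integral>\<^sup>+q\<in>Qplus. ennreal (heat_kernel q (x, t) * heat_kernel q (x', t')) \<partial>lborel)
    = ennreal (ip lborel (uh (x, t)) (uh (x', t')) / (2 * pi\<^sup>2))"
    "0 \<le> ip lborel (uh (x, t)) (uh (x', t'))"
proof -
  define a where "a = x - x'"
  define f where "f = (\<lambda>(\<xi>, \<tau>). sin (\<tau> * t) * sin (\<tau> * t') / (\<xi> ^ 4 + \<tau>\<^sup>2) :: real)"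
  define n where "n s = indicator {0<..<min t t'} s * normal_density 0 (sqrt (2 * (t + t' - 2 * s))) a" for s
  define G where "G = (\<lambda>(\<xi>, s). indicator {0<..<min t t'} s * (cos (\<xi> * a) * exp (- (\<xi>\<^sup>2 * (t + t' - 2 * s)))))"
  have f: "integrable (lborel \<Otimes>\<^sub>M lborel) f"
    unfolding lborel_prod f_def
    using sqi_inner_integrable[OF uh_sqi[of "(0, t)"] uh_sqi[of "(0, t')"]] by (simp add: uh_inner split_beta')
  have fc: "integrable (lborel \<Otimes>\<^sub>M lborel) (\<lambda>(\<xi>, \<tau>). cos (\<xi> * a) * f (\<xi>, \<tau>))"
    unfolding lborel_prod f_def a_def
    using sqi_inner_integrable[OF uh_sqi[of "(x, t)"] uh_sqi[of "(x', t')"]] by (simp add: uh_inner split_beta')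
  have inner_f: "(LINT \<tau>|lborel. f (\<xi>, \<tau>)) = pi * (LINT s|lborel. indicator {0<..<min t t'} s * exp (- (\<xi>\<^sup>2 * (t + t' - 2 * s))))" if "\<xi> \<noteq> 0" for \<xi>
    using integral_sin_sin[OF that assms] by (simp add: f_def)
  have [measurable]: "G \<in> borel_measurable (lborel \<Otimes>\<^sub>M lborel)" unfolding G_def by measurable
  have si: "set_integrable lborel {0<..<min t t'} (\<lambda>s. exp (- (\<xi>\<^sup>2 * (t + t' - 2 * s))))" for \<xi>
    by (rule set_integrable_subset[OF borel_integrable_atLeastAtMost'[of 0 "min t t'"]]) (auto intro!: continuous_intros)
  have G_int: "integrable (lborel \<Otimes>\<^sub>M lborel) G"
  proof (rule lborel_pair.Fubini_integrable)
    have "integrable lborel (\<lambda>\<xi>. (LINT \<tau>|lborel. f (\<xi>, \<tau>)) * (\<bar>cos (\<xi> * a)\<bar> / pi))"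
      using lborel_pair.integrable_fst'[OF f]
      by (rule integrable_mult_bounded[where C="1 / pi"]) (auto intro!: divide_right_mono)
    moreover have "AE \<xi> in lborel. (LINT \<tau>|lborel. f (\<xi>, \<tau>)) * (\<bar>cos (\<xi> * a)\<bar> / pi) = (LINT s|lborel. norm (G (\<xi>, s)))"
      using AE_lborel_singleton[of 0]
    proof eventually_elim
      fix \<xi> :: real assume "\<xi> \<noteq> 0"
      have "(LINT s|lborel. norm (G (\<xi>, s))) = (LINT s|lborel. \<bar>cos (\<xi> * a)\<bar> * (indicator {0<..<min t t'} s * exp (- (\<xi>\<^sup>2 * (t + t' - 2 * s)))))"
        by (intro Bochner_Integration.integral_cong) (auto simp: G_def abs_mult)
      also have "\<dots> = \<bar>cos (\<xi> * a)\<bar> * (LINT s|lborel. indicator {0<..<min t t'} s * exp (- (\<xi>\<^sup>2 * (t + t' - 2 * s))))"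
        by (rule integral_mult_right_zero)
      finally show "(LINT \<tau>|lborel. f (\<xi>, \<tau>)) * (\<bar>cos (\<xi> * a)\<bar> / pi) = (LINT s|lborel. norm (G (\<xi>, s)))"
        using inner_f[OF \<open>\<xi> \<noteq> 0\<close>] by simp
    qed
    ultimately show "integrable lborel (\<lambda>\<xi>. LINT s|lborel. norm (G (\<xi>, s)))"
      by (elim integrable_cong_AE_imp) measurable
    show "AE \<xi> in lborel. integrable lborel (\<lambda>s. G (\<xi>, s))"
    proof (intro AE_I2)
      fix \<xi> :: real
      have "integrable lborel (\<lambda>s. cos (\<xi> * a) * (indicator {0<..<min t t'} s *\<^sub>R exp (- (\<xi>\<^sup>2 * (t + t' - 2 * s)))))"
        using si[of \<xi>] unfolding set_integrable_def by (rule integrable_mult_right)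
      then show "integrable lborel (\<lambda>s. G (\<xi>, s))" by (simp add: G_def mult_ac)
    qed
  qed measurable
  have G_inner: "(LINT \<xi>|lborel. G (\<xi>, s)) = 2 * pi * n s" for s
  proof (cases "s \<in> {0<..<min t t'}")
    case True
    then have "0 < t + t' - 2 * s" by auto
    from integral_cos_gauss(2)[OF this, of a] True show ?thesis by (simp add: G_def n_def)
  qed (simp add: G_def n_def)
  have n_int: "integrable lborel n"
    using lborel_pair.integrable_snd[of "\<lambda>\<xi> s. G (\<xi>, s)"] G_int by (simp add: G_inner)
  have "ip lborel (uh (x, t)) (uh (x', t')) = (LINT z|(lborel \<Otimes>\<^sub>M lborel). (\<lambda>(\<xi>, \<tau>). cos (\<xi> * a) * f (\<xi>, \<tau>)) z)"
    unfolding ip_def uh_inner lborel_prod by (simp add: f_def a_def split_beta')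
  also have "\<dots> = (LINT \<xi>|lborel. LINT \<tau>|lborel. cos (\<xi> * a) * f (\<xi>, \<tau>))"
    using lborel_pair.integral_fst'[OF fc] by simp
  also have "\<dots> = (LINT \<xi>|lborel. pi * (LINT s|lborel. G (\<xi>, s)))"
  proof (rule integral_cong_AE)
    show "AE \<xi> in lborel. (LINT \<tau>|lborel. cos (\<xi> * a) * f (\<xi>, \<tau>)) = pi * (LINT s|lborel. G (\<xi>, s))"
      using AE_lborel_singleton[of 0]
    proof eventually_elim
      fix \<xi> :: real assume "\<xi> \<noteq> 0"
      have "(LINT s|lborel. G (\<xi>, s)) = cos (\<xi> * a) * (LINT s|lborel. indicator {0<..<min t t'} s * exp (- (\<xi>\<^sup>2 * (t + t' - 2 * s))))"
        unfolding G_def by (simp add: mult.left_commute)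
      then show "(LINT \<tau>|lborel. cos (\<xi> * a) * f (\<xi>, \<tau>)) = pi * (LINT s|lborel. G (\<xi>, s))"
        using inner_f[OF \<open>\<xi> \<noteq> 0\<close>] by simp
    qed
  qed (use borel_measurable_integrable[OF lborel_pair.integrable_fst'[OF fc]] borel_measurable_integrable[OF lborel_pair.integrable_fst'[OF G_int]] in auto)
  also have "\<dots> = pi * (LINT \<xi>|lborel. LINT s|lborel. G (\<xi>, s))" by (rule integral_mult_right_zero)
  also have "(LINT \<xi>|lborel. LINT s|lborel. G (\<xi>, s)) = (LINT s|lborel. LINT \<xi>|lborel. G (\<xi>, s))"
    using lborel_pair.Fubini_integral[of "\<lambda>\<xi> s. G (\<xi>, s)"] G_int by simp
  also have "\<dots> = 2 * pi * (LINT s|lborel. n s)" unfolding G_inner by (rule integral_mult_right_zero)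
  finally have eq: "ip lborel (uh (x, t)) (uh (x', t')) / (2 * pi\<^sup>2) = (LINT s|lborel. n s)"
    by (simp add: power2_eq_square)
  moreover have "(\<integral>\<^sup>+q\<in>Qplus. ennreal (heat_kernel q (x, t) * heat_kernel q (x', t')) \<partial>lborel) = ennreal (LINT s|lborel. n s)"
  proof -
    have [measurable]: "Qplus \<in> sets borel"
      unfolding Qplus_def by (simp add: borel_prod[symmetric])
    have "(\<integral>\<^sup>+q\<in>Qplus. ennreal (heat_kernel q (x, t) * heat_kernel q (x', t')) \<partial>lborel)
      = (\<integral>\<^sup>+s. \<integral>\<^sup>+y. ennreal (heat_kernel (y, s) (x, t) * heat_kernel (y, s) (x', t')) * indicator Qplus (y, s) \<partial>lborel \<partial>lborel)"
      by (subst lborel_prod[symmetric], subst lborel_pair.nn_integral_snd[symmetric]) (simp_all add: lborel_prod)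
    also have "\<dots> = (\<integral>\<^sup>+s. ennreal (n s) \<partial>lborel)"
    proof (intro nn_integral_cong)
      fix s :: real
      show "(\<integral>\<^sup>+y. ennreal (heat_kernel (y, s) (x, t) * heat_kernel (y, s) (x', t')) * indicator Qplus (y, s) \<partial>lborel) = ennreal (n s)"
      proof (cases "s \<in> {0<..<min t t'}")
        case True
        then show ?thesis using heat_kernel_conv[of s t t' x x']
          by (simp add: Qplus_def n_def a_def indicator_def)
      next
        case False
        then have "(\<lambda>y. ennreal (heat_kernel (y, s) (x, t) * heat_kernel (y, s) (x', t')) * indicator Qplus (y, s)) = (\<lambda>_. 0)"
          by (auto simp: Qplus_def heat_kernel_def indicator_def)
        then show ?thesis using False by (simp only: n_def) simp
      qed
    qed
    also have "\<dots> = ennreal (LINT s|lborel. n s)"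
    proof (rule nn_integral_eq_integral[OF n_int])
      show "AE s in lborel. 0 \<le> n s" by (auto simp: n_def)
    qed
    finally show ?thesis .
  qed
  ultimately show "(\<integral>\<^sup>+q\<in>Qplus. ennreal (heat_kernel q (x, t) * heat_kernel q (x', t')) \<partial>lborel)
    = ennreal (ip lborel (uh (x, t)) (uh (x', t')) / (2 * pi\<^sup>2))" by simp
  have "0 \<le> (LINT s|lborel. n s)" unfolding n_def by (intro Bochner_Integration.integral_nonneg) auto
  then have "0 \<le> ip lborel (uh (x, t)) (uh (x', t')) / (2 * pi\<^sup>2)" unfolding eq .
  then show "0 \<le> ip lborel (uh (x, t)) (uh (x', t'))" by (simp add: zero_le_divide_iff)
qed

section \<open>The closed linear span of a Gaussian family\<close>

lemma norm_cis_diff_le: "norm (cis a - cis b) \<le> \<bar>a - b\<bar>"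
proof -
  have "cis a - cis b = cis b * (cis (a - b) - 1)"
    by (simp add: algebra_simps cis_mult)
  then have "norm (cis a - cis b) = norm (cis (a - b) - 1)" by (simp add: norm_mult)
  also have "\<dots> \<le> \<bar>a - b\<bar>"
    using iexp_approx1[of "a - b" 0] by (simp add: cis_conv_exp)
  finally show ?thesis .
qed

lemma char_normal:
  assumes "0 < \<sigma>"
  shows "char (density lborel (\<lambda>z. ennreal (normal_density 0 \<sigma> z))) u = of_real (exp (- ((\<sigma> * u)\<^sup>2) / 2))"
proof -
  have "char (density lborel (\<lambda>z. ennreal (normal_density 0 \<sigma> z))) u = (LINT x|lborel. normal_density 0 \<sigma> x *\<^sub>R cis (u * x))"
    unfolding char_def by (subst integral_density) (simp_all add: cis_conv_exp)
  also have "\<dots> = (LINT x|lborel. of_real (1 / \<sigma>) * (of_real (std_normal_density (x / \<sigma>)) * cis (u * x)))"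
    using assms by (intro Bochner_Integration.integral_cong)
      (auto simp: normal_density_def std_normal_density_def scaleR_conv_of_real real_sqrt_mult power_divide field_simps)
  also have "\<dots> = of_real (1 / \<sigma>) * of_real (sqrt (2 * pi) * \<sigma> * std_normal_density (u * \<sigma>))"
    by (subst integral_mult_right_zero) (simp only: integral_scaled_normal_cis[OF assms])
  also have "\<dots> = of_real (exp (- ((\<sigma> * u)\<^sup>2) / 2))"
    using assms by (simp add: std_normal_density_def mult.commute)
  finally show ?thesis .
qed

context prob_space
begin

lemma char_distr:
  "X \<in> borel_measurable M \<Longrightarrow> char (distr M borel X) u = (LINT \<omega>|M. cis (u * X \<omega>))"
  unfolding char_def by (subst integral_distr) (simp_all add: cis_conv_exp)

lemma centered_gaussian_char:
  assumes "centered_gaussian M X"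
  shows "\<exists>\<sigma>\<ge>0. \<forall>u. char (distr M borel X) u = of_real (exp (- ((\<sigma> * u)\<^sup>2) / 2))"
proof -
  have X[measurable]: "X \<in> borel_measurable M" using assms by (simp add: centered_gaussian_def)
  consider "AE \<omega> in M. X \<omega> = 0" | \<sigma> where "\<sigma> > 0" "distributed M lborel X (\<lambda>z. ennreal (normal_density 0 \<sigma> z))"
    using assms by (auto simp: centered_gaussian_def)
  then show ?thesis
  proof cases
    case 1
    have "char (distr M borel X) u = 1" for u
    proof -
      have "(LINT \<omega>|M. cis (u * X \<omega>)) = (LINT \<omega>|M. 1)"
        using 1 by (intro integral_cong_AE) (auto elim!: eventually_mono)
      then show ?thesis by (simp add: char_distr prob_space)
    qed
    then show ?thesis by (intro exI[of _ 0]) simp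
  next
    case 2
    have "distr M borel X = distr M lborel X" by (intro distr_cong) auto
    also have "\<dots> = density lborel (\<lambda>z. ennreal (normal_density 0 \<sigma> z))"
      using 2(2) by (simp add: distributed_def)
    finally show ?thesis using 2(1) char_normal[OF 2(1)] by (intro exI[of _ \<sigma>]) auto
  qed
qed

lemma centered_gaussianI_char:
  assumes X[measurable]: "X \<in> borel_measurable M" and "0 \<le> \<sigma>"
    and c: "\<And>u. char (distr M borel X) u = of_real (exp (- ((\<sigma> * u)\<^sup>2) / 2))"
  shows "centered_gaussian M X"
proof (cases "\<sigma> = 0")
  case True
  have eq: "distr M borel X = return borel 0"
  proof (rule Levy_uniqueness)
    show "real_distribution (distr M borel X)" by (rule real_distribution_distr) simp
    show "real_distribution (return borel (0::real))"
      by (simp add: real_distribution_def real_distribution_axioms_def prob_space_return)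
    show "char (distr M borel X) = char (return borel 0)"
      using c True by (auto simp: fun_eq_iff char_def integral_return)
  qed
  have "AE x in return borel (0::real). x = 0" by (simp add: AE_return)
  then have "AE x in distr M borel X. x = 0" by (simp only: eq)
  then have "AE \<omega> in M. X \<omega> = 0" by (subst (asm) AE_distr_iff) auto
  then show ?thesis by (simp add: centered_gaussian_def)
next
  case False
  then have s: "0 < \<sigma>" using assms by simp
  have "distr M borel X = density lborel (\<lambda>z. ennreal (normal_density 0 \<sigma> z))"
  proof (rule Levy_uniqueness)
    show "real_distribution (distr M borel X)" by (rule real_distribution_distr) simp
    show "real_distribution (density lborel (\<lambda>z. ennreal (normal_density 0 \<sigma> z)))"
      using prob_space_normal_density[OF s] by (simp add: real_distribution_def real_distribution_axioms_def)
    show "char (distr M borel X) = char (density lborel (\<lambda>z. ennreal (normal_density 0 \<sigma> z)))"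
      using c char_normal[OF s] by (simp add: fun_eq_iff)
  qed
  moreover have "distr M lborel X = distr M borel X" by (intro distr_cong) auto
  ultimately have "distributed M lborel X (\<lambda>z. ennreal (normal_density 0 \<sigma> z))"
    by (simp add: distributed_def)
  then show ?thesis using s by (auto simp: centered_gaussian_def)
qed

lemma centered_gaussian_limit:
  assumes g: "\<And>n. centered_gaussian M (Y n)" and X[measurable]: "X \<in> borel_measurable M"
    and lim: "(\<lambda>n. LINT \<omega>|M. min 1 \<bar>X \<omega> - Y n \<omega>\<bar>) \<longlonglongrightarrow> 0"
  shows "centered_gaussian M X"
proof -
  have Y[measurable]: "Y n \<in> borel_measurable M" for n using g by (simp add: centered_gaussian_def)
  define \<phi> where "\<phi> = char (distr M borel X)"
  have "\<exists>\<sigma>. \<forall>n. 0 \<le> \<sigma> n \<and> (\<forall>u. char (distr M borel (Y n)) u = of_real (exp (- ((\<sigma> n * u)\<^sup>2) / 2)))"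
    using centered_gaussian_char[OF g] by metis
  then obtain \<sigma> where \<sigma>: "\<And>n. 0 \<le> \<sigma> n"
    "\<And>n u. char (distr M borel (Y n)) u = of_real (exp (- ((\<sigma> n * u)\<^sup>2) / 2))" by blast
  have conv: "(\<lambda>n. complex_of_real (exp (- ((\<sigma> n * u)\<^sup>2) / 2))) \<longlonglongrightarrow> \<phi> u" for u
  proof -
    have le: "norm (complex_of_real (exp (- ((\<sigma> n * u)\<^sup>2) / 2)) - \<phi> u) \<le> (2 + \<bar>u\<bar>) * (LINT \<omega>|M. min 1 \<bar>X \<omega> - Y n \<omega>\<bar>)" for n
    proof -
      have i: "integrable M (\<lambda>\<omega>. cis (u * Z \<omega>))" if [measurable]: "Z \<in> borel_measurable M" for Z
        by (rule integrable_const_bound[where B=1]) auto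
      have im: "integrable M (\<lambda>\<omega>. min 1 \<bar>X \<omega> - Y n \<omega>\<bar>)"
        by (rule integrable_const_bound[where B=1]) auto
      have "complex_of_real (exp (- ((\<sigma> n * u)\<^sup>2) / 2)) - \<phi> u = (LINT \<omega>|M. cis (u * Y n \<omega>) - cis (u * X \<omega>))"
        unfolding \<sigma>(2)[symmetric] \<phi>_def char_distr[OF Y] char_distr[OF X]
        by (rule Bochner_Integration.integral_diff[symmetric]) (auto intro: i)
      also have "norm \<dots> \<le> (LINT \<omega>|M. norm (cis (u * Y n \<omega>) - cis (u * X \<omega>)))"
        by (rule integral_norm_bound)
      also have "\<dots> \<le> (LINT \<omega>|M. (2 + \<bar>u\<bar>) * min 1 \<bar>X \<omega> - Y n \<omega>\<bar>)"
      proof (rule integral_mono)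
        fix \<omega>
        have "norm (cis (u * Y n \<omega>) - cis (u * X \<omega>)) \<le> \<bar>u\<bar> * \<bar>X \<omega> - Y n \<omega>\<bar>"
          using norm_cis_diff_le[of "u * Y n \<omega>" "u * X \<omega>"] by (simp add: right_diff_distrib[symmetric] abs_mult abs_minus_commute)
        moreover have "norm (cis (u * Y n \<omega>) - cis (u * X \<omega>)) \<le> 2"
          using norm_triangle_ineq4[of "cis (u * Y n \<omega>)" "cis (u * X \<omega>)"] by simp
        moreover have "\<bar>u\<bar> * \<bar>X \<omega> - Y n \<omega>\<bar> \<le> (2 + \<bar>u\<bar>) * \<bar>X \<omega> - Y n \<omega>\<bar>"
          by (intro mult_right_mono) auto
        ultimately show "norm (cis (u * Y n \<omega>) - cis (u * X \<omega>)) \<le> (2 + \<bar>u\<bar>) * min 1 \<bar>X \<omega> - Y n \<omega>\<bar>"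
          by (auto simp: min_def)
      qed (use i im in auto)
      finally show ?thesis by simp
    qed
    have "(\<lambda>n. (2 + \<bar>u\<bar>) * (LINT \<omega>|M. min 1 \<bar>X \<omega> - Y n \<omega>\<bar>)) \<longlonglongrightarrow> 0"
      by (rule tendsto_mult_right_zero[OF lim])
    then have "(\<lambda>n. complex_of_real (exp (- ((\<sigma> n * u)\<^sup>2) / 2)) - \<phi> u) \<longlonglongrightarrow> 0"
      by (rule Lim_null_comparison[OF always_eventually[OF allI[OF le]]])
    then show ?thesis by (simp add: LIM_zero_iff)
  qed
  interpret D: real_distribution "distr M borel X" by (rule real_distribution_distr) simp
  have \<phi>0: "\<phi> 0 = 1" unfolding \<phi>_def by (rule D.char_zero)
  have "(\<phi> \<longlongrightarrow> \<phi> 0) (at_right 0)"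
    unfolding \<phi>_def using D.isCont_char[of 0] by (auto simp: isCont_def intro: tendsto_mono[OF at_le])
  then have "\<forall>\<^sub>F u in at_right 0. \<phi> u \<noteq> 0"
    using \<phi>0 tendsto_imp_eventually_ne[of \<phi> 1 "at_right 0" 0] by simp
  moreover have "\<forall>\<^sub>F u in at_right (0::real). 0 < u" by (auto simp: eventually_at_right_less)
  ultimately have "\<forall>\<^sub>F u in at_right 0. \<phi> u \<noteq> 0 \<and> 0 < u" by eventually_elim auto
  then obtain u0 where u0: "\<phi> u0 \<noteq> 0" "0 < u0"
    using eventually_happens[of "\<lambda>u. \<phi> u \<noteq> 0 \<and> 0 < u" "at_right (0::real)"] by auto
  define v where "v = - 2 * ln (norm (\<phi> u0)) / u0\<^sup>2"
  have s2: "(\<lambda>n. (\<sigma> n)\<^sup>2) \<longlonglongrightarrow> v"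
  proof -
    have "(\<lambda>n. ln (norm (complex_of_real (exp (- ((\<sigma> n * u0)\<^sup>2) / 2))))) \<longlonglongrightarrow> ln (norm (\<phi> u0))"
      using u0 by (intro tendsto_ln tendsto_norm conv) auto
    then have "(\<lambda>n. - ((\<sigma> n * u0)\<^sup>2) / 2) \<longlonglongrightarrow> ln (norm (\<phi> u0))" by simp
    then have "(\<lambda>n. - 2 * (- ((\<sigma> n * u0)\<^sup>2) / 2) / u0\<^sup>2) \<longlonglongrightarrow> v"
      unfolding v_def using u0 by (intro tendsto_intros) auto
    then show ?thesis using u0 by (simp add: power_mult_distrib)
  qed
  have v0: "0 \<le> v" using s2 by (rule LIMSEQ_le_const) auto
  show ?thesis
  proof (rule centered_gaussianI_char[OF X])
    show "0 \<le> sqrt v" using v0 by simp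
    fix u
    have "(\<lambda>n. complex_of_real (exp (- ((\<sigma> n)\<^sup>2 * u\<^sup>2) / 2))) \<longlonglongrightarrow> complex_of_real (exp (- (v * u\<^sup>2) / 2))"
      by (intro tendsto_intros s2) auto
    then have "(\<lambda>n. complex_of_real (exp (- ((\<sigma> n * u)\<^sup>2) / 2))) \<longlonglongrightarrow> complex_of_real (exp (- ((sqrt v * u)\<^sup>2) / 2))"
      using v0 by (simp add: power_mult_distrib)
    from LIMSEQ_unique[OF conv this] show "char (distr M borel X) u = of_real (exp (- ((sqrt v * u)\<^sup>2) / 2))"
      by (simp add: \<phi>_def)
  qed
qed

lemma centered_gaussian_moments:
  assumes "centered_gaussian M X"
  shows "integrable M (\<lambda>\<omega>. (X \<omega>)\<^sup>2)" "integrable M (\<lambda>\<omega>. (X \<omega>) ^ 6)"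
    "(LINT \<omega>|M. (X \<omega>) ^ 6) = 15 * (LINT \<omega>|M. (X \<omega>)\<^sup>2) ^ 3"
proof -
  have X[measurable]: "X \<in> borel_measurable M" using assms by (simp add: centered_gaussian_def)
  consider "AE \<omega> in M. X \<omega> = 0" | \<sigma> where "\<sigma> > 0" "distributed M lborel X (\<lambda>z. ennreal (normal_density 0 \<sigma> z))"
    using assms by (auto simp: centered_gaussian_def)
  then have "integrable M (\<lambda>\<omega>. (X \<omega>)\<^sup>2) \<and> integrable M (\<lambda>\<omega>. (X \<omega>) ^ 6) \<and> (LINT \<omega>|M. (X \<omega>) ^ 6) = 15 * (LINT \<omega>|M. (X \<omega>)\<^sup>2) ^ 3"
  proof cases
    case 1
    have "integrable M (\<lambda>\<omega>. (X \<omega>) ^ Suc n) \<and> (LINT \<omega>|M. (X \<omega>) ^ Suc n) = 0" for n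
    proof
      show "integrable M (\<lambda>\<omega>. (X \<omega>) ^ Suc n)"
        by (rule integrable_cong_AE_imp[of _ "\<lambda>_. 0"]) (use 1 in \<open>auto elim!: eventually_mono\<close>)
      have "(LINT \<omega>|M. (X \<omega>) ^ Suc n) = (LINT \<omega>|M. 0)"
        by (rule integral_cong_AE) (use 1 in \<open>auto elim!: eventually_mono\<close>)
      then show "(LINT \<omega>|M. (X \<omega>) ^ Suc n) = 0" by simp
    qed
    from this[of 1] this[of 5] show ?thesis by (simp add: numeral_eq_Suc)
  next
    case 2
    have m: "integrable M (\<lambda>\<omega>. (X \<omega>) ^ (2 * k)) \<and> (LINT \<omega>|M. (X \<omega>) ^ (2 * k)) = fact (2 * k) / ((2 / \<sigma>\<^sup>2) ^ k * fact k)" for k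
      using distributed_integrable[OF 2(2), of "\<lambda>x. x ^ (2 * k)"] distributed_integral[OF 2(2), of "\<lambda>x. x ^ (2 * k)"]
        normal_moment_even[OF 2(1), of 0 k]
      by (auto simp: has_bochner_integral_iff)
    have "integrable M (\<lambda>\<omega>. (X \<omega>)\<^sup>2) \<and> (LINT \<omega>|M. (X \<omega>)\<^sup>2) = \<sigma>\<^sup>2"
      using m[of 1] 2(1) by (simp add: fact_numeral)
    moreover have "integrable M (\<lambda>\<omega>. (X \<omega>) ^ 6) \<and> (LINT \<omega>|M. (X \<omega>) ^ 6) = 15 * \<sigma> ^ 6"
      using m[of 3] 2(1) by (simp add: fact_numeral field_simps power_divide)
    ultimately show ?thesis by (simp flip: power_mult)
  qed
  then show "integrable M (\<lambda>\<omega>. (X \<omega>)\<^sup>2)" "integrable M (\<lambda>\<omega>. (X \<omega>) ^ 6)"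
    "(LINT \<omega>|M. (X \<omega>) ^ 6) = 15 * (LINT \<omega>|M. (X \<omega>)\<^sup>2) ^ 3" by auto
qed

end

locale sheet = prob_space M for M :: "'a measure" +
  fixes B :: "real \<times> real \<Rightarrow> 'a \<Rightarrow> real"
  assumes sheet: "brownian_sheet M B"
begin

definition comb :: "(real \<times> real) set \<Rightarrow> (real \<times> real \<Rightarrow> real) \<Rightarrow> 'a \<Rightarrow> real" where
  "comb F c \<omega> = (\<Sum>p\<in>F. c p * B p \<omega>)"

lemma comb_gaussian: "finite F \<Longrightarrow> F \<subseteq> UNIV \<times> {0..} \<Longrightarrow> centered_gaussian M (comb F c)"
  using sheet unfolding brownian_sheet_def comb_def[abs_def] by blast

lemma comb_meas: "finite F \<Longrightarrow> F \<subseteq> UNIV \<times> {0..} \<Longrightarrow> comb F c \<in> borel_measurable M"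
  using comb_gaussian by (simp add: centered_gaussian_def)

text \<open>The limits in probability of finite linear combinations of the sheet.\<close>

definition gspan :: "('a \<Rightarrow> real) set" where
  "gspan = {X \<in> borel_measurable M. \<forall>\<epsilon>>0. \<exists>F c. finite F \<and> F \<subseteq> UNIV \<times> {0..}
     \<and> (LINT \<omega>|M. min 1 \<bar>X \<omega> - comb F c \<omega>\<bar>) < \<epsilon>}"

lemma gspan_meas[measurable_dest]: "X \<in> gspan \<Longrightarrow> X \<in> borel_measurable M"
  by (simp add: gspan_def)

lemma integrable_min1: "Z \<in> borel_measurable M \<Longrightarrow> integrable M (\<lambda>\<omega>. min 1 \<bar>Z \<omega> :: real\<bar>)"
  by (rule integrable_const_bound[where B=1]) auto

lemma gspan_comb: "finite F \<Longrightarrow> F \<subseteq> UNIV \<times> {0..} \<Longrightarrow> comb F c \<in> gspan"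
  unfolding gspan_def using comb_meas[of F c] by (auto intro!: exI[of _ F] exI[of _ c])

lemma gspan_B: "0 \<le> t \<Longrightarrow> B (x, t) \<in> gspan"
  using gspan_comb[of "{(x, t)}" "\<lambda>_. 1"] by (simp add: comb_def[abs_def])

lemma comb_add:
  assumes "finite F" "finite G"
  shows "comb F c \<omega> + comb G d \<omega> = comb (F \<union> G) (\<lambda>p. (if p \<in> F then c p else 0) + (if p \<in> G then d p else 0)) \<omega>"
proof -
  have "comb F c \<omega> = (\<Sum>p\<in>F \<union> G. (if p \<in> F then c p else 0) * B p \<omega>)"
    unfolding comb_def using assms by (intro sum.mono_neutral_cong_left) auto
  moreover have "comb G d \<omega> = (\<Sum>p\<in>F \<union> G. (if p \<in> G then d p else 0) * B p \<omega>)"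
    unfolding comb_def using assms by (intro sum.mono_neutral_cong_left) auto
  ultimately show ?thesis by (simp add: comb_def sum.distrib[symmetric] distrib_right)
qed

lemma gspan_add:
  assumes "X \<in> gspan" "Y \<in> gspan" shows "(\<lambda>\<omega>. X \<omega> + Y \<omega>) \<in> gspan"
proof -
  note [measurable] = gspan_meas[OF assms(1)] gspan_meas[OF assms(2)]
  have "\<exists>F c. finite F \<and> F \<subseteq> UNIV \<times> {0..} \<and> (LINT \<omega>|M. min 1 \<bar>X \<omega> + Y \<omega> - comb F c \<omega>\<bar>) < \<epsilon>" if \<epsilon>: "0 < \<epsilon>" for \<epsilon>
  proof -
    have "0 < \<epsilon> / 2" using \<epsilon> by simp
    then obtain F c G d where F: "finite F" "F \<subseteq> UNIV \<times> {0..}" "(LINT \<omega>|M. min 1 \<bar>X \<omega> - comb F c \<omega>\<bar>) < \<epsilon> / 2"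
      and G: "finite G" "G \<subseteq> UNIV \<times> {0..}" "(LINT \<omega>|M. min 1 \<bar>Y \<omega> - comb G d \<omega>\<bar>) < \<epsilon> / 2"
      using assms unfolding gspan_def by blast
    note [measurable] = comb_meas[OF F(1,2)] comb_meas[OF G(1,2)]
    define e where "e = (\<lambda>p. (if p \<in> F then c p else 0) + (if p \<in> G then d p else 0))"
    have FG: "finite (F \<union> G)" "F \<union> G \<subseteq> UNIV \<times> {0..}" using F G by auto
    note [measurable] = comb_meas[OF FG]
    have i: "integrable M (\<lambda>\<omega>. min 1 \<bar>X \<omega> - comb F c \<omega>\<bar>)" "integrable M (\<lambda>\<omega>. min 1 \<bar>Y \<omega> - comb G d \<omega>\<bar>)"
      "integrable M (\<lambda>\<omega>. min 1 \<bar>X \<omega> + Y \<omega> - comb (F \<union> G) e \<omega>\<bar>)"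
      by (rule integrable_min1; measurable)+
    have "(LINT \<omega>|M. min 1 \<bar>X \<omega> + Y \<omega> - comb (F \<union> G) e \<omega>\<bar>)
      \<le> (LINT \<omega>|M. min 1 \<bar>X \<omega> - comb F c \<omega>\<bar> + min 1 \<bar>Y \<omega> - comb G d \<omega>\<bar>)"
      by (rule integral_mono[OF i(3) Bochner_Integration.integrable_add[OF i(1,2)]])
         (auto simp: e_def comb_add[OF F(1) G(1), symmetric] min_def)
    also have "\<dots> < \<epsilon>" using i F(3) G(3) by simp
    finally show ?thesis using FG by blast
  qed
  then show ?thesis unfolding gspan_def by auto
qed

lemma gspan_scale:
  assumes "X \<in> gspan" shows "(\<lambda>\<omega>. a * X \<omega>) \<in> gspan"
proof -
  note [measurable] = gspan_meas[OF assms(1)]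
  have "\<exists>F c. finite F \<and> F \<subseteq> UNIV \<times> {0..} \<and> (LINT \<omega>|M. min 1 \<bar>a * X \<omega> - comb F c \<omega>\<bar>) < \<epsilon>" if \<epsilon>: "0 < \<epsilon>" for \<epsilon>
  proof -
    have "0 < \<epsilon> / (1 + \<bar>a\<bar>)" using \<epsilon> by (simp add: add_pos_nonneg)
    then obtain F c where F: "finite F" "F \<subseteq> UNIV \<times> {0..}" "(LINT \<omega>|M. min 1 \<bar>X \<omega> - comb F c \<omega>\<bar>) < \<epsilon> / (1 + \<bar>a\<bar>)"
      using assms unfolding gspan_def by blast
    note [measurable] = comb_meas[OF F(1,2)]
    have ac: "comb F (\<lambda>p. a * c p) \<omega> = a * comb F c \<omega>" for \<omega>
      by (simp add: comb_def sum_distrib_left mult.assoc)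
    have i: "integrable M (\<lambda>\<omega>. min 1 \<bar>X \<omega> - comb F c \<omega>\<bar>)" "integrable M (\<lambda>\<omega>. min 1 \<bar>a * X \<omega> - a * comb F c \<omega>\<bar>)"
      by (rule integrable_min1; measurable)+
    have "(LINT \<omega>|M. min 1 \<bar>a * X \<omega> - a * comb F c \<omega>\<bar>) \<le> (LINT \<omega>|M. (1 + \<bar>a\<bar>) * min 1 \<bar>X \<omega> - comb F c \<omega>\<bar>)"
    proof (rule integral_mono[OF i(2)])
      fix \<omega>
      let ?z = "\<bar>X \<omega> - comb F c \<omega>\<bar>"
      have "\<bar>a * X \<omega> - a * comb F c \<omega>\<bar> = \<bar>a\<bar> * ?z" by (simp add: right_diff_distrib[symmetric] abs_mult)
      also have "\<dots> \<le> (1 + \<bar>a\<bar>) * ?z" by (intro mult_right_mono) auto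
      finally show "min 1 \<bar>a * X \<omega> - a * comb F c \<omega>\<bar> \<le> (1 + \<bar>a\<bar>) * min 1 ?z"
        by (auto simp: min_def)
    qed (use i in simp)
    also have "\<dots> = (1 + \<bar>a\<bar>) * (LINT \<omega>|M. min 1 \<bar>X \<omega> - comb F c \<omega>\<bar>)" by (rule integral_mult_right_zero)
    also have "\<dots> < (1 + \<bar>a\<bar>) * (\<epsilon> / (1 + \<bar>a\<bar>))" by (intro mult_strict_left_mono F(3)) (simp add: add_pos_nonneg)
    also have "\<dots> = \<epsilon>" by (simp add: add_pos_nonneg less_imp_neq[symmetric])
    finally show ?thesis using F by (intro exI[of _ F] exI[of _ "\<lambda>p. a * c p"]) (simp add: ac)
  qed
  then show ?thesis unfolding gspan_def by auto
qed

lemma gspan_diff: "X \<in> gspan \<Longrightarrow> Y \<in> gspan \<Longrightarrow> (\<lambda>\<omega>. X \<omega> - Y \<omega>) \<in> gspan"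
  using gspan_add[of X "\<lambda>\<omega>. (-1) * Y \<omega>"] gspan_scale[of Y "-1"] by simp

lemma gspan_0: "(\<lambda>\<omega>. 0) \<in> gspan"
  using gspan_comb[of "{}"] by (simp add: comb_def[abs_def])

lemma gspan_sum: "(\<And>i. i \<in> I \<Longrightarrow> X i \<in> gspan) \<Longrightarrow> (\<lambda>\<omega>. \<Sum>i\<in>I. X i \<omega>) \<in> gspan"
  by (induction I rule: infinite_finite_induct) (auto intro: gspan_0 gspan_add)

lemma gspan_limit_dist:
  assumes X: "\<And>n. X n \<in> gspan" and [measurable]: "Y \<in> borel_measurable M"
    and lim: "(\<lambda>n. LINT \<omega>|M. min 1 \<bar>Y \<omega> - X n \<omega>\<bar>) \<longlonglongrightarrow> 0"
  shows "Y \<in> gspan"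
proof -
  note [measurable] = gspan_meas[OF X]
  have "\<exists>F c. finite F \<and> F \<subseteq> UNIV \<times> {0..} \<and> (LINT \<omega>|M. min 1 \<bar>Y \<omega> - comb F c \<omega>\<bar>) < \<epsilon>" if \<epsilon>: "0 < \<epsilon>" for \<epsilon>
  proof -
    have e2: "0 < \<epsilon> / 2" using \<epsilon> by simp
    from order_tendstoD(2)[OF lim e2] obtain n where n: "(LINT \<omega>|M. min 1 \<bar>Y \<omega> - X n \<omega>\<bar>) < \<epsilon> / 2"
      by (auto simp: eventually_sequentially)
    obtain F c where F: "finite F" "F \<subseteq> UNIV \<times> {0..}" "(LINT \<omega>|M. min 1 \<bar>X n \<omega> - comb F c \<omega>\<bar>) < \<epsilon> / 2"
      using X[of n] e2 unfolding gspan_def by blast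
    note [measurable] = comb_meas[OF F(1,2)]
    have i: "integrable M (\<lambda>\<omega>. min 1 \<bar>Y \<omega> - X n \<omega>\<bar>)" "integrable M (\<lambda>\<omega>. min 1 \<bar>X n \<omega> - comb F c \<omega>\<bar>)"
      "integrable M (\<lambda>\<omega>. min 1 \<bar>Y \<omega> - comb F c \<omega>\<bar>)"
      by (rule integrable_min1; measurable)+
    have "(LINT \<omega>|M. min 1 \<bar>Y \<omega> - comb F c \<omega>\<bar>) \<le> (LINT \<omega>|M. min 1 \<bar>Y \<omega> - X n \<omega>\<bar> + min 1 \<bar>X n \<omega> - comb F c \<omega>\<bar>)"
      by (rule integral_mono[OF i(3) Bochner_Integration.integrable_add[OF i(1,2)]]) (auto simp: min_def)
    also have "\<dots> < \<epsilon>" using i n F(3) by simp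
    finally show ?thesis using F by blast
  qed
  then show ?thesis unfolding gspan_def by auto
qed

lemma gspan_limit_AE:
  assumes X: "\<And>n. X n \<in> gspan" and [measurable]: "Y \<in> borel_measurable M"
    and lim: "AE \<omega> in M. (\<lambda>n. X n \<omega>) \<longlonglongrightarrow> Y \<omega>"
  shows "Y \<in> gspan"
proof (rule gspan_limit_dist[OF X])
  note [measurable] = gspan_meas[OF X]
  have "(\<lambda>n. LINT \<omega>|M. min 1 \<bar>Y \<omega> - X n \<omega>\<bar>) \<longlonglongrightarrow> (LINT \<omega>|M. 0)"
  proof (rule integral_dominated_convergence[where w="\<lambda>_. 1"])
    show "AE \<omega> in M. (\<lambda>n. min 1 \<bar>Y \<omega> - X n \<omega>\<bar>) \<longlonglongrightarrow> 0"
      using lim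
    proof eventually_elim
      fix \<omega> assume "(\<lambda>n. X n \<omega>) \<longlonglongrightarrow> Y \<omega>"
      then have "(\<lambda>n. min 1 \<bar>Y \<omega> - X n \<omega>\<bar>) \<longlonglongrightarrow> min 1 \<bar>Y \<omega> - Y \<omega>\<bar>" by (intro tendsto_intros)
      then show "(\<lambda>n. min 1 \<bar>Y \<omega> - X n \<omega>\<bar>) \<longlonglongrightarrow> 0" by simp
    qed
  qed auto
  then show "(\<lambda>n. LINT \<omega>|M. min 1 \<bar>Y \<omega> - X n \<omega>\<bar>) \<longlonglongrightarrow> 0" by simp
qed simp

lemma gspan_limit_L2:
  assumes X: "\<And>n. X n \<in> gspan" and [measurable]: "Y \<in> borel_measurable M"
    and lim: "(\<lambda>n. \<integral>\<^sup>+\<omega>. ennreal ((Y \<omega> - X n \<omega>)\<^sup>2) \<partial>M) \<longlonglongrightarrow> 0"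
  shows "Y \<in> gspan"
proof (rule gspan_limit_dist[OF X])
  note [measurable] = gspan_meas[OF X]
  define I where "I n = (LINT \<omega>|M. min 1 \<bar>Y \<omega> - X n \<omega>\<bar>)" for n
  have I: "ennreal (I n) = (\<integral>\<^sup>+\<omega>. ennreal (min 1 \<bar>Y \<omega> - X n \<omega>\<bar>) \<partial>M)" for n
    unfolding I_def using integrable_min1[of "\<lambda>\<omega>. Y \<omega> - X n \<omega>"] by (intro nn_integral_eq_integral[symmetric]) auto
  have I0: "0 \<le> I n" for n unfolding I_def by (intro Bochner_Integration.integral_nonneg) auto
  have sq: "(ennreal (I n))\<^sup>2 \<le> (\<integral>\<^sup>+\<omega>. ennreal ((Y \<omega> - X n \<omega>)\<^sup>2) \<partial>M)" for n
  proof -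
    have "(ennreal (I n))\<^sup>2 = (\<integral>\<^sup>+\<omega>. ennreal (min 1 \<bar>Y \<omega> - X n \<omega>\<bar>) * 1 \<partial>M)\<^sup>2" by (simp add: I)
    also have "\<dots> \<le> (\<integral>\<^sup>+\<omega>. (ennreal (min 1 \<bar>Y \<omega> - X n \<omega>\<bar>))\<^sup>2 \<partial>M) * (\<integral>\<^sup>+\<omega>. 1\<^sup>2 \<partial>M)"
      by (rule Cauchy_Schwarz_nn_integral) auto
    also have "\<dots> = (\<integral>\<^sup>+\<omega>. (ennreal (min 1 \<bar>Y \<omega> - X n \<omega>\<bar>))\<^sup>2 \<partial>M)" by (simp add: emeasure_space_1)
    also have "\<dots> \<le> (\<integral>\<^sup>+\<omega>. ennreal ((Y \<omega> - X n \<omega>)\<^sup>2) \<partial>M)"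
    proof (rule nn_integral_mono)
      fix \<omega>
      have "(min 1 \<bar>Y \<omega> - X n \<omega>\<bar>)\<^sup>2 \<le> \<bar>Y \<omega> - X n \<omega>\<bar>\<^sup>2" by (intro power_mono) auto
      then show "(ennreal (min 1 \<bar>Y \<omega> - X n \<omega>\<bar>))\<^sup>2 \<le> ennreal ((Y \<omega> - X n \<omega>)\<^sup>2)"
        by (subst ennreal_power) (auto intro!: ennreal_leI)
    qed
    finally show ?thesis .
  qed
  have "(\<lambda>n. (ennreal (I n))\<^sup>2) \<longlonglongrightarrow> 0"
    by (rule tendsto_sandwich[OF _ _ tendsto_const lim]) (use sq in auto)
  then have "(\<lambda>n. ennreal ((I n)\<^sup>2)) \<longlonglongrightarrow> ennreal 0" using I0 by (simp add: ennreal_power)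
  then have "(\<lambda>n. (I n)\<^sup>2) \<longlonglongrightarrow> 0" by (subst (asm) tendsto_ennreal_iff) auto
  then have "(\<lambda>n. sqrt ((I n)\<^sup>2)) \<longlonglongrightarrow> sqrt 0" by (rule tendsto_real_sqrt)
  then show "I \<longlonglongrightarrow> 0" using I0 by simp
qed simp

lemma gspan_gaussian:
  assumes "X \<in> gspan" shows "centered_gaussian M X"
proof -
  have "\<exists>F c. finite F \<and> F \<subseteq> UNIV \<times> {0..} \<and> (LINT \<omega>|M. min 1 \<bar>X \<omega> - comb F c \<omega>\<bar>) < 1 / real (Suc n)" for n
    using assms unfolding gspan_def by auto
  then obtain F c where F: "\<And>n. finite (F n)" "\<And>n. F n \<subseteq> UNIV \<times> {0..}"
    "\<And>n. (LINT \<omega>|M. min 1 \<bar>X \<omega> - comb (F n) (c n) \<omega>\<bar>) < 1 / real (Suc n)" by metis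
  show ?thesis
  proof (rule centered_gaussian_limit)
    show "centered_gaussian M (comb (F n) (c n))" for n using F by (intro comb_gaussian)
    show "X \<in> borel_measurable M" using assms by (rule gspan_meas)
    show "(\<lambda>n. LINT \<omega>|M. min 1 \<bar>X \<omega> - comb (F n) (c n) \<omega>\<bar>) \<longlonglongrightarrow> 0"
    proof (rule tendsto_sandwich[OF _ _ tendsto_const])
      show "(\<lambda>n. 1 / real (Suc n)) \<longlonglongrightarrow> 0" by real_asymp
      show "\<forall>\<^sub>F n in sequentially. 0 \<le> (LINT \<omega>|M. min 1 \<bar>X \<omega> - comb (F n) (c n) \<omega>\<bar>)"
        by (intro always_eventually allI Bochner_Integration.integral_nonneg) auto
      show "\<forall>\<^sub>F n in sequentially. (LINT \<omega>|M. min 1 \<bar>X \<omega> - comb (F n) (c n) \<omega>\<bar>) \<le> 1 / real (Suc n)"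
        using F(3) by (intro always_eventually allI less_imp_le)
    qed
  qed
qed

lemma gspan_sqi: "X \<in> gspan \<Longrightarrow> sqi M X"
  using centered_gaussian_moments(1)[OF gspan_gaussian] gspan_meas by (simp add: sqi_def)

end

section \<open>The covariance of the solution\<close>

lemma sqi_sum_list:
  assumes "\<And>e. e \<in> set L \<Longrightarrow> sqi N (f e)" shows "sqi N (\<lambda>z. \<Sum>e\<leftarrow>L. f e z)"
  using assms
proof (induction L)
  case Nil
  then show ?case by (simp add: sqi_def)
next
  case (Cons e L)
  then show ?case by (simp add: sqi_add)
qed

lemma ip_sum_list:
  assumes "\<And>e. e \<in> set L \<Longrightarrow> sqi N (f e)" "sqi N g"
  shows "ip N (\<lambda>z. \<Sum>e\<leftarrow>L. f e z) g = (\<Sum>e\<leftarrow>L. ip N (f e) g)"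
  using assms(1)
proof (induction L)
  case Nil
  then show ?case by (simp add: ip_def)
next
  case (Cons e L)
  then show ?case using ip_add_left[of N "f e" "\<lambda>z. \<Sum>e\<leftarrow>L. f e z" g] sqi_sum_list[of L N f] assms(2) by simp
qed

lemma ip_sum_list_eq:
  assumes "\<And>e. e \<in> set L \<union> set L' \<Longrightarrow> sqi N (f e)" "\<And>e. e \<in> set L \<union> set L' \<Longrightarrow> sqi N' (f' e)"
    and "\<And>e e'. e \<in> set L \<Longrightarrow> e' \<in> set L' \<Longrightarrow> ip N (f e) (f e') = ip N' (f' e) (f' e')"
  shows "ip N (\<lambda>z. \<Sum>e\<leftarrow>L. f e z) (\<lambda>z. \<Sum>e\<leftarrow>L'. f e z) = ip N' (\<lambda>z. \<Sum>e\<leftarrow>L. f' e z) (\<lambda>z. \<Sum>e\<leftarrow>L'. f' e z)"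
proof -
  have "ip N (f e) (\<lambda>z. \<Sum>e\<leftarrow>L'. f e z) = ip N' (f' e) (\<lambda>z. \<Sum>e\<leftarrow>L'. f' e z)" if e: "e \<in> set L" for e
  proof -
    have "ip N (f e) (\<lambda>z. \<Sum>e\<leftarrow>L'. f e z) = (\<Sum>e'\<leftarrow>L'. ip N (f e') (f e))"
      using ip_sum_list[of L' N f "f e"] assms(1) e by (subst ip_commute) auto
    also have "\<dots> = (\<Sum>e'\<leftarrow>L'. ip N' (f' e') (f' e))"
      using assms(3)[OF e] by (intro arg_cong[of _ _ sum_list] map_cong refl) (auto simp: ip_commute)
    also have "\<dots> = ip N' (f' e) (\<lambda>z. \<Sum>e\<leftarrow>L'. f' e z)"
      using ip_sum_list[of L' N' f' "f' e"] assms(2) e by (subst ip_commute[of N' "f' e"]) auto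
    finally show ?thesis .
  qed
  then have "(\<Sum>e\<leftarrow>L. ip N (f e) (\<lambda>z. \<Sum>e\<leftarrow>L'. f e z)) = (\<Sum>e\<leftarrow>L. ip N' (f' e) (\<lambda>z. \<Sum>e\<leftarrow>L'. f' e z))"
    by (intro arg_cong[of _ _ sum_list] map_cong refl) auto
  moreover have "sqi N (\<lambda>z. \<Sum>e\<leftarrow>L'. f e z)" "sqi N' (\<lambda>z. \<Sum>e\<leftarrow>L'. f' e z)"
    using assms(1,2) by (auto intro: sqi_sum_list)
  ultimately show ?thesis
    using assms(1,2) by (simp add: ip_sum_list)
qed

definition rcov :: "real \<Rightarrow> real \<Rightarrow> real" where
  "rcov x y = (if x * y > 0 then min \<bar>x\<bar> \<bar>y\<bar> else 0)"

lemma rcov_eq: "rcov x y = (\<bar>x\<bar> + \<bar>y\<bar> - \<bar>x - y\<bar>) / 2"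
  unfolding rcov_def zero_less_mult_iff by (auto simp: min_def abs_if)

lemma rcov_commute: "rcov x y = rcov y x"
  by (simp add: rcov_def mult.commute min.commute)

lemma rcov_increment:
  "a \<le> b \<Longrightarrow> c \<le> d \<Longrightarrow> rcov b d - rcov a d - rcov b c + rcov a c = max 0 (min b d - max a c)"
  unfolding rcov_eq by (auto simp: max_def min_def abs_if)

lemma min_increment:
  fixes a b c d :: real
  shows "a \<le> b \<Longrightarrow> c \<le> d \<Longrightarrow> min b d - min a d - min b c + min a c = max 0 (min b d - max a c)"
  by (auto simp: max_def min_def)

lemma sqi_indicator_box: "sqi lborel (\<lambda>p. c * indicator ({a<..b} \<times> {s<..t}) p :: real)" (is ?A)
  and ip_indicator_box: "ip lborel (\<lambda>p. c * indicator ({a<..b} \<times> {s<..t}) p :: real) (\<lambda>p. c' * indicator ({a'<..b'} \<times> {s'<..t'}) p)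
     = c * c' * (max 0 (min b b' - max a a') * max 0 (min t t' - max s s'))" (is ?B)
proof -
  have i: "integrable lborel (\<lambda>x. indicator {a<..b} x :: real)" for a b :: real
    by (rule integrable_real_indicator) (simp, cases "a \<le> b", auto)
  have box: "indicator ({a<..b} \<times> {s<..t}) p = (indicator {a<..b} (fst p) * indicator {s<..t} (snd p) :: real)" for a b s t :: real and p
    by (cases p) (simp add: indicator_times)
  have I: "integrable lborel (\<lambda>p. indicator {a<..b} (fst p) * indicator {s<..t} (snd p) :: real)" for a b s t :: real
    by (rule integrable_lborel2[OF i i])
  have eq: "(c * indicator ({a<..b} \<times> {s<..t}) p) * (c' * indicator ({a'<..b'} \<times> {s'<..t'}) p)
    = c * c' * (indicator {max a a'<..min b b'} (fst p) * indicator {max s s'<..min t t'} (snd p) :: real)" for p :: "real \<times> real" and c c' a b s t a' b' s' t' :: real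
  proof -
    have "indicator {max a a'<..min b b'} u = (indicator {a<..b} u * indicator {a'<..b'} u :: real)" for a b a' b' u :: real
      using indicator_inter_arith[of "{a<..b}" "{a'<..b'}" u] by (simp only: Int_greaterThanAtMost)
    then show ?thesis unfolding box by (simp add: mult_ac)
  qed
  have "(norm (c * indicator ({a<..b} \<times> {s<..t}) p))\<^sup>2 = c * c * (indicator {max a a<..min b b} (fst p) * indicator {max s s<..min t t} (snd p) :: real)" for p
    unfolding eq[symmetric] by (simp add: power2_eq_square)
  moreover have "(\<lambda>p. c * indicator ({a<..b} \<times> {s<..t}) p) \<in> borel_measurable (lborel :: (real \<times> real) measure)"
    unfolding box by measurable
  ultimately show ?A unfolding sqi_def using I by simp
  have len: "(LINT x|lborel. indicator {a<..b} x) = max 0 (b - a)" for a b :: real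
    by (cases "a \<le> b") (auto simp: max_def)
  show ?B
    unfolding ip_def inner_real_def eq integral_mult_right_zero integral_lborel2[OF i i] len ..
qed

context sheet
begin

lemma sqi_B: "0 \<le> t \<Longrightarrow> sqi M (B (x, t))"
  using gspan_sqi[OF gspan_B] .

lemma ip_B: "0 \<le> s \<Longrightarrow> 0 \<le> t \<Longrightarrow> ip M (B (x, s)) (B (y, t)) = min s t * rcov x y"
  using sheet unfolding brownian_sheet_def ip_def inner_real_def rcov_def by blast

definition inc :: "real \<Rightarrow> real \<Rightarrow> real \<Rightarrow> real \<Rightarrow> 'a \<Rightarrow> real" where
  "inc a b s t \<omega> = B (b, t) \<omega> - B (a, t) \<omega> - B (b, s) \<omega> + B (a, s) \<omega>"

lemma inc_gspan: "0 \<le> s \<Longrightarrow> s \<le> t \<Longrightarrow> inc a b s t \<in> gspan"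
  unfolding inc_def[abs_def] by (intro gspan_add gspan_diff gspan_B) auto

lemma ip_inc_left:
  assumes "0 \<le> s" "s \<le> t" "sqi M Y"
  shows "ip M (inc a b s t) Y = ip M (B (b, t)) Y - ip M (B (a, t)) Y - ip M (B (b, s)) Y + ip M (B (a, s)) Y"
  unfolding inc_def[abs_def] using assms
  by (simp add: ip_add_left ip_diff_left sqi_B sqi_diff)

lemma ip_inc:
  assumes "a \<le> b" "0 \<le> s" "s \<le> t" "a' \<le> b'" "0 \<le> s'" "s' \<le> t'"
  shows "ip M (inc a b s t) (inc a' b' s' t') = max 0 (min b b' - max a a') * max 0 (min t t' - max s s')"
proof -
  have B: "ip M (B (x, u)) (inc a' b' s' t') = (min u t' - min u s') * (rcov x b' - rcov x a')" if "0 \<le> u" for x u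
    using assms that
    by (subst ip_commute) (simp add: ip_inc_left sqi_B ip_B min.commute[of _ u] rcov_commute[of _ x] algebra_simps)
  have "ip M (inc a b s t) (inc a' b' s' t')
    = (min t t' - min s t' - min t s' + min s s') * (rcov b b' - rcov a b' - rcov b a' + rcov a a')"
    using assms gspan_sqi[OF inc_gspan[of s' t' a' b']] by (simp add: ip_inc_left B algebra_simps)
  also have "\<dots> = max 0 (min t t' - max s s') * max 0 (min b b' - max a a')"
    using assms by (simp only: rcov_increment min_increment)
  finally show ?thesis by (simp add: mult.commute)
qed

lemma step_integral_gspan: "valid_steps L \<Longrightarrow> step_integral B L \<in> gspan"
proof (induction L)
  case Nil
  then show ?case by (simp add: step_integral_def[abs_def] gspan_0)
next
  case (Cons e L)
  obtain c a b s t where e: "e = (c, a, b, s, t)" by (cases e)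
  have "(\<lambda>\<omega>. c * inc a b s t \<omega> + step_integral B L \<omega>) \<in> gspan"
    using Cons by (intro gspan_add gspan_scale inc_gspan) (auto simp: valid_steps_def e)
  then show ?case by (simp add: step_integral_def[abs_def] e inc_def)
qed

lemma step_isometry:
  assumes "valid_steps L" "valid_steps L'"
  shows "sqi lborel (step_fun L)" "ip M (step_integral B L) (step_integral B L') = ip lborel (step_fun L) (step_fun L')"
proof -
  define f where "f = (\<lambda>e \<omega>. case e of (c, a, b, s, t) \<Rightarrow> c * inc a b s t \<omega>)"
  define f' where "f' = (\<lambda>e p. case e of (c, a, b, s, t) \<Rightarrow> (c * indicator ({a<..b} \<times> {s<..t}) (p :: real \<times> real) :: real))"
  have f: "sqi M (f e)" if "e \<in> set L \<union> set L'" for e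
  proof -
    obtain c a b s t where e: "e = (c, a, b, s, t)" by (cases e)
    then have "0 \<le> s" "s \<le> t" using assms that by (auto simp: valid_steps_def)
    then show ?thesis using gspan_sqi[OF gspan_scale[OF inc_gspan]] by (simp add: f_def e)
  qed
  have f': "sqi lborel (f' e)" for e
    unfolding f'_def by (cases e) (simp add: sqi_indicator_box)
  have ff: "ip M (f e) (f e') = ip lborel (f' e) (f' e')" if "e \<in> set L" "e' \<in> set L'" for e e'
  proof -
    obtain c a b s t where e: "e = (c, a, b, s, t)" by (cases e)
    obtain c' a' b' s' t' where e': "e' = (c', a', b', s', t')" by (cases e')
    have v: "a \<le> b" "0 \<le> s" "s \<le> t" "a' \<le> b'" "0 \<le> s'" "s' \<le> t'"
      using assms that by (auto simp: valid_steps_def e e')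
    have "ip M (f e) (f e') = c * (c' * ip M (inc a b s t) (inc a' b' s' t'))"
      using ip_scale_left[of M c "inc a b s t"] ip_scale_right[of M _ c' "inc a' b' s' t'"]
      by (simp add: f_def e e')
    then show ?thesis unfolding ip_inc[OF v] f'_def e e' by (simp add: ip_indicator_box)
  qed
  have eq: "step_integral B L = (\<lambda>\<omega>. \<Sum>e\<leftarrow>L. f e \<omega>)" "step_fun L = (\<lambda>\<omega>. \<Sum>e\<leftarrow>L. f' e \<omega>)" for L
    by (auto simp: step_integral_def[abs_def] step_fun_def[abs_def] f_def f'_def inc_def fun_eq_iff
        intro!: arg_cong[of _ _ sum_list] map_cong)
  show "sqi lborel (step_fun L)" unfolding eq using f' by (intro sqi_sum_list) auto
  show "ip M (step_integral B L) (step_integral B L') = ip lborel (step_fun L) (step_fun L')"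
    unfolding eq using f f' ff by (intro ip_sum_list_eq) auto
qed

lemma step_fun_Qplus: "valid_steps L \<Longrightarrow> p \<notin> Qplus \<Longrightarrow> step_fun L p = 0"
  by (induction L) (auto simp: step_fun_def valid_steps_def Qplus_def indicator_def)

lemma Qplus_borel[measurable]: "Qplus \<in> sets borel"
  unfolding Qplus_def by (simp add: borel_prod[symmetric])

lemma nn_sq_tendsto:
  fixes X :: "'z \<Rightarrow> real"
  assumes "sqi N X" "\<And>n. sqi N (Y n)" "(\<lambda>n. \<integral>\<^sup>+z. ennreal ((X z - Y n z)\<^sup>2) \<partial>N) \<longlonglongrightarrow> 0"
  shows "(\<lambda>n. ip N (\<lambda>z. Y n z - X z) (\<lambda>z. Y n z - X z)) \<longlonglongrightarrow> 0"
proof -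
  have "(\<integral>\<^sup>+z. ennreal ((X z - Y n z)\<^sup>2) \<partial>N) = ennreal (ip N (\<lambda>z. Y n z - X z) (\<lambda>z. Y n z - X z))" for n
  proof -
    have "integrable N (\<lambda>z. (X z - Y n z)\<^sup>2)" using sqi_diff[OF assms(1) assms(2)[of n]] by (simp add: sqi_def)
    then have "(\<integral>\<^sup>+z. ennreal ((X z - Y n z)\<^sup>2) \<partial>N) = ennreal (LINT z|N. (X z - Y n z)\<^sup>2)"
      by (intro nn_integral_eq_integral) auto
    then show ?thesis unfolding ip_self by (simp add: power2_commute)
  qed
  then have "(\<lambda>n. ennreal (ip N (\<lambda>z. Y n z - X z) (\<lambda>z. Y n z - X z))) \<longlonglongrightarrow> ennreal 0" using assms(3) by simp
  then show ?thesis by (subst (asm) tendsto_ennreal_iff) (auto simp: ip_nonneg)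
qed

lemma stoch_integral_gspan:
  assumes "has_stoch_integral M B h X" shows "X \<in> gspan"
  using assms unfolding has_stoch_integral_def
  by (elim conjE exE) (rule gspan_limit_L2[OF step_integral_gspan], auto)

lemma stoch_integral_isometry:
  assumes X: "has_stoch_integral M B h X" and X': "has_stoch_integral M B h' X'"
    and h: "sqi lborel (\<lambda>q. indicator Qplus q * h q)" "sqi lborel (\<lambda>q. indicator Qplus q * h' q)"
  shows "ip M X X' = ip lborel (\<lambda>q. indicator Qplus q * h q) (\<lambda>q. indicator Qplus q * h' q)"
proof -
  have conv: "(\<lambda>n. ip lborel (\<lambda>q. step_fun (L n) q - indicator Qplus q * h q) (\<lambda>q. step_fun (L n) q - indicator Qplus q * h q)) \<longlonglongrightarrow> 0"
    if "\<And>n. valid_steps (L n)" "(\<lambda>n. \<integral>\<^sup>+p\<in>Qplus. ennreal ((h p - step_fun (L n) p)\<^sup>2) \<partial>lborel) \<longlonglongrightarrow> 0"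
      "sqi lborel (\<lambda>q. indicator Qplus q * h q)" for L h
  proof (rule nn_sq_tendsto[OF that(3)])
    show "sqi lborel (step_fun (L n))" for n using step_isometry(1)[OF that(1) that(1)] .
    have "ennreal ((h p - step_fun (L n) p)\<^sup>2) * indicator Qplus p = ennreal ((indicator Qplus p * h p - step_fun (L n) p)\<^sup>2)" for n p
      using step_fun_Qplus[OF that(1), of p n] by (auto simp: indicator_def)
    then show "(\<lambda>n. \<integral>\<^sup>+z. ennreal ((indicator Qplus z * h z - step_fun (L n) z)\<^sup>2) \<partial>lborel) \<longlonglongrightarrow> 0"
      using that(2) by simp
  qed
  obtain L where L: "\<And>n. valid_steps (L n)" "(\<lambda>n. \<integral>\<^sup>+p\<in>Qplus. ennreal ((h p - step_fun (L n) p)\<^sup>2) \<partial>lborel) \<longlonglongrightarrow> 0"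
    "(\<lambda>n. \<integral>\<^sup>+\<omega>. ennreal ((X \<omega> - step_integral B (L n) \<omega>)\<^sup>2) \<partial>M) \<longlonglongrightarrow> 0"
    using X unfolding has_stoch_integral_def by blast
  obtain L' where L': "\<And>n. valid_steps (L' n)" "(\<lambda>n. \<integral>\<^sup>+p\<in>Qplus. ennreal ((h' p - step_fun (L' n) p)\<^sup>2) \<partial>lborel) \<longlonglongrightarrow> 0"
    "(\<lambda>n. \<integral>\<^sup>+\<omega>. ennreal ((X' \<omega> - step_integral B (L' n) \<omega>)\<^sup>2) \<partial>M) \<longlonglongrightarrow> 0"
    using X' unfolding has_stoch_integral_def by blast
  have sX: "sqi M X" "sqi M X'" using stoch_integral_gspan X X' gspan_sqi by auto
  have sS: "sqi M (step_integral B (L n))" "sqi M (step_integral B (L' n))" for n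
    using gspan_sqi step_integral_gspan L(1) L'(1) by auto
  have "(\<lambda>n. ip M (step_integral B (L n)) (step_integral B (L' n))) \<longlonglongrightarrow> ip M X X'"
    by (intro ip_tendsto2 sS sX nn_sq_tendsto L(3) L'(3))
  moreover have "(\<lambda>n. ip lborel (step_fun (L n)) (step_fun (L' n))) \<longlonglongrightarrow> ip lborel (\<lambda>q. indicator Qplus q * h q) (\<lambda>q. indicator Qplus q * h' q)"
    by (intro ip_tendsto2 step_isometry(1)[OF L(1) L(1)] step_isometry(1)[OF L'(1) L'(1)] h conv L L')
  ultimately show ?thesis
    using step_isometry(2)[OF L(1) L'(1)] by (simp add: LIMSEQ_unique)
qed

end

locale she = sheet M B for M :: "'a measure" and B +
  fixes U :: "real \<times> real \<Rightarrow> 'a \<Rightarrow> real"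
  assumes stoch: "\<And>p. p \<in> Qplus \<Longrightarrow> has_stoch_integral M B (\<lambda>q. heat_kernel q p) (U p)"
    and cont: "AE \<omega> in M. continuous_on Qplus (\<lambda>p. U p \<omega>)"
begin

lemma U_gspan: "p \<in> Qplus \<Longrightarrow> U p \<in> gspan"
  using stoch_integral_gspan[OF stoch] .

lemma heat_kernel_nonneg: "0 \<le> heat_kernel q p"
  by (auto simp: heat_kernel_def split_beta')

lemma heat_kernel_sqi:
  assumes "p \<in> Qplus" shows "sqi lborel (\<lambda>q. indicator Qplus q * heat_kernel q p)"
proof -
  obtain x t where p: "p = (x, t)" "0 < t" using assms by (auto simp: Qplus_def)
  have "(\<integral>\<^sup>+q. ennreal (norm ((norm (indicator Qplus q * heat_kernel q p))\<^sup>2)) \<partial>lborel)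
    = (\<integral>\<^sup>+q\<in>Qplus. ennreal (heat_kernel q (x, t) * heat_kernel q (x, t)) \<partial>lborel)"
    by (intro nn_integral_cong) (auto simp: p indicator_def power2_eq_square)
  also have "\<dots> < \<infinity>" using ip_uh_heat_kernel(1)[OF p(2) p(2), of x x] by simp
  finally show ?thesis unfolding sqi_def by (intro conjI integrableI_bounded) auto
qed

lemma ip_U:
  assumes "p \<in> Qplus" "p' \<in> Qplus"
  shows "ip M (U p) (U p') = ip lborel (uh p) (uh p') / (2 * pi\<^sup>2)"
proof -
  obtain x t where p: "p = (x, t)" "0 < t" using assms by (auto simp: Qplus_def)
  obtain x' t' where p': "p' = (x', t')" "0 < t'" using assms by (auto simp: Qplus_def)
  let ?h = "\<lambda>q. indicator Qplus q * heat_kernel q p" and ?h' = "\<lambda>q. indicator Qplus q * heat_kernel q p'"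
  have "ennreal (ip lborel ?h ?h') = (\<integral>\<^sup>+q\<in>Qplus. ennreal (heat_kernel q (x, t) * heat_kernel q (x', t')) \<partial>lborel)"
  proof -
    have "ennreal (ip lborel ?h ?h') = (\<integral>\<^sup>+q. ennreal (?h q \<bullet> ?h' q) \<partial>lborel)"
      unfolding ip_def
    proof (rule nn_integral_eq_integral[symmetric])
      show "integrable lborel (\<lambda>q. ?h q \<bullet> ?h' q)"
        using assms by (intro sqi_inner_integrable heat_kernel_sqi)
      show "AE q in lborel. 0 \<le> ?h q \<bullet> ?h' q" by (simp add: heat_kernel_nonneg)
    qed
    also have "\<dots> = (\<integral>\<^sup>+q\<in>Qplus. ennreal (heat_kernel q (x, t) * heat_kernel q (x', t')) \<partial>lborel)"
      by (intro nn_integral_cong) (auto simp: p p' indicator_def)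
    finally show ?thesis .
  qed
  also have "\<dots> = ennreal (ip lborel (uh p) (uh p') / (2 * pi\<^sup>2))"
    unfolding p(1) p'(1) by (rule ip_uh_heat_kernel(1)[OF p(2) p'(2)])
  finally have e: "ennreal (ip lborel ?h ?h') = ennreal (ip lborel (uh p) (uh p') / (2 * pi\<^sup>2))" .
  have "0 \<le> ip lborel ?h ?h'"
    unfolding ip_def by (intro Bochner_Integration.integral_nonneg) (simp add: heat_kernel_nonneg)
  then have "ip lborel ?h ?h' = ip lborel (uh p) (uh p') / (2 * pi\<^sup>2)"
    using e ip_uh_heat_kernel(2)[OF p(2) p'(2), of x x'] unfolding p(1) p'(1) by (subst (asm) ennreal_inj) auto
  then show ?thesis using stoch_integral_isometry[OF stoch stoch heat_kernel_sqi heat_kernel_sqi] assms by simp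
qed

end

section \<open>Integrals of the solution against weighted functions\<close>

definition dn :: "nat \<Rightarrow> real \<Rightarrow> real" where
  "dn n x = real_of_int \<lfloor>x * 2 ^ n\<rfloor> / 2 ^ n"

lemma dn_le: "dn n x \<le> x" "x < dn n x + 1 / 2 ^ n"
  using of_int_floor_le[of "x * 2 ^ n"] real_of_int_floor_add_one_gt[of "x * 2 ^ n"]
  by (simp_all add: dn_def add_divide_distrib[symmetric] pos_divide_le_eq pos_less_divide_eq)

lemma half_pow_tendsto: "(\<lambda>n. 1 / 2 ^ n :: real) \<longlonglongrightarrow> 0"
  using LIMSEQ_power_zero[of "1/2 :: real"] by (simp add: power_one_over)

lemma dn_tendsto: "(\<lambda>n. dn n x) \<longlonglongrightarrow> x"
proof (rule tendsto_sandwich)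
  show "(\<lambda>n. x - 1 / 2 ^ n) \<longlonglongrightarrow> x" using tendsto_diff[OF tendsto_const half_pow_tendsto, of x] by simp
  show "\<forall>\<^sub>F n in sequentially. x - 1 / 2 ^ n \<le> dn n x" using dn_le(2)[of x] by (auto intro!: always_eventually less_imp_le simp: algebra_simps)
  show "\<forall>\<^sub>F n in sequentially. dn n x \<le> x" using dn_le(1)[of _ x] by (auto intro!: always_eventually)
qed simp

definition wt :: "real \<times> real \<Rightarrow> real" where
  "wt p = 1 / (1 + (fst p)\<^sup>2) * (1 / (1 + (snd p)\<^sup>2))"

lemma wt_pos: "0 < wt p"
  unfolding wt_def using one_plus_sq_pos by (intro mult_pos_pos divide_pos_pos) auto

lemma wt_measurable[measurable]: "wt \<in> borel_measurable borel"
  unfolding wt_def by measurable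

lemma integrable_sqrt_wt: "integrable lborel (\<lambda>t::real. sqrt (1 + \<bar>t\<bar>) / (1 + t\<^sup>2))"
proof (rule integrable_pw_bound[where p=0 and q="-3/2" and C=2])
  fix t :: real assume t: "t \<noteq> 0"
  show "norm (sqrt (1 + \<bar>t\<bar>) / (1 + t\<^sup>2)) \<le> 2 * pw 0 (-3/2) t"
  proof (cases "\<bar>t\<bar> \<le> 1")
    case True
    then have "sqrt (1 + \<bar>t\<bar>) \<le> sqrt 4" by (intro real_sqrt_le_mono) auto
    then have "sqrt (1 + \<bar>t\<bar>) \<le> 2 * (1 + t\<^sup>2)" by simp (smt (verit) zero_le_power2)
    then show ?thesis using True t one_plus_sq_pos[of t] by (simp add: pw_def divide_le_eq)
  next
    case False
    have "sqrt (1 + \<bar>t\<bar>) \<le> sqrt (4 * \<bar>t\<bar>)" using False by (intro real_sqrt_le_mono) auto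
    also have "\<dots> = 2 * \<bar>t\<bar> powr (1/2)" using False by (simp add: real_sqrt_mult powr_half_sqrt)
    finally have "sqrt (1 + \<bar>t\<bar>) / (1 + t\<^sup>2) \<le> 2 * \<bar>t\<bar> powr (1/2) / (1 + t\<^sup>2)"
      using one_plus_sq_pos[of t] by (intro divide_right_mono) auto
    also have "\<dots> \<le> 2 * \<bar>t\<bar> powr (1/2) / t\<^sup>2"
      using t one_plus_sq_pos[of t] by (intro divide_left_mono) auto
    also have "\<dots> = 2 * \<bar>t\<bar> powr (-3/2)"
    proof -
      have "\<bar>t\<bar> powr (1/2) / \<bar>t\<bar> powr 2 = \<bar>t\<bar> powr (1/2 - 2)" by (rule powr_diff[symmetric])
      then show ?thesis using t by (simp add: powr_numeral)
    qed
    finally show ?thesis using False one_plus_sq_pos[of t] by (simp add: pw_def abs_of_nonneg)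
  qed
qed auto

definition rU :: "real \<times> real \<Rightarrow> real" where
  "rU p = sqrt (S0 * (1 + \<bar>snd p\<bar>))"

lemma rU_pos: "0 < rU p"
  unfolding rU_def using S0_pos by (simp add: add_pos_nonneg)

lemma rU_measurable[measurable]: "rU \<in> borel_measurable borel"
  unfolding rU_def by measurable

lemma integrable_wt_rU: "integrable lborel (\<lambda>p. wt p * rU p)"
proof -
  have "integrable lborel (\<lambda>p::real \<times> real. (1 / (1 + (fst p)\<^sup>2)) * (sqrt (1 + \<bar>snd p\<bar>) / (1 + (snd p)\<^sup>2)))"
    by (rule integrable_lborel2[OF integrable_inverse_quadratic integrable_sqrt_wt])
  from integrable_mult_right[OF this, of "sqrt S0"] show ?thesis
    by (simp add: wt_def rU_def real_sqrt_mult mult_ac)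
qed

definition wbd :: "real \<Rightarrow> (real \<times> real \<Rightarrow> real) \<Rightarrow> bool" where
  "wbd K \<Phi> \<longleftrightarrow> \<Phi> \<in> borel_measurable borel \<and> (\<forall>p. \<bar>\<Phi> p\<bar> \<le> K * wt p)"

lemma wbd_meas[measurable_dest]: "wbd K \<Phi> \<Longrightarrow> \<Phi> \<in> borel_measurable borel"
  by (simp add: wbd_def)

lemma wbd_bound: "wbd K \<Phi> \<Longrightarrow> \<bar>\<Phi> p\<bar> \<le> K * wt p"
  unfolding wbd_def by blast

lemma wbd_integrable:
  assumes "wbd K \<Phi>" "integrable lborel (\<lambda>p. wt p * h p)" "h \<in> borel_measurable borel" "\<And>p. 0 \<le> h p"
  shows "integrable lborel (\<lambda>p. \<bar>\<Phi> p\<bar> * h p)"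
proof (rule Bochner_Integration.integrable_bound)
  show "integrable lborel (\<lambda>p. K * (wt p * h p))" using assms(2) by (rule integrable_mult_right)
  show "AE p in lborel. norm (\<bar>\<Phi> p\<bar> * h p) \<le> norm (K * (wt p * h p))"
  proof (intro AE_I2)
    fix p
    have "\<bar>\<Phi> p\<bar> * h p \<le> K * wt p * h p" using wbd_bound[OF assms(1)] assms(4) by (intro mult_right_mono) auto
    moreover have "0 \<le> \<bar>\<Phi> p\<bar> * h p" using assms(4) by simp
    ultimately show "norm (\<bar>\<Phi> p\<bar> * h p) \<le> norm (K * (wt p * h p))" by (simp add: mult.assoc)
  qed
qed (use assms(3) wbd_meas[OF assms(1)] in measurable)

definition uhp :: "real \<times> real \<Rightarrow> real \<times> real \<Rightarrow> complex" where
  "uhp p z = (if 0 < snd p then uh p z else 0)"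

lemma uhp_measurable[measurable]: "(\<lambda>(p, z). uhp p z) \<in> borel_measurable (borel \<Otimes>\<^sub>M borel)"
  unfolding uhp_def by measurable

lemma uhp_sqi: "sqi lborel (uhp p)"
  using uh_sqi[of p] by (cases "0 < snd p") (auto simp: uhp_def[abs_def] sqi_def)

lemma ip_uhp_le: "ip lborel (uhp p) (uhp p) \<le> (rU p)\<^sup>2"
  using ip_uh_le[of p] S0_pos by (cases "0 < snd p") (auto simp: uhp_def[abs_def] rU_def ip_def)

definition vh :: "(real \<times> real \<Rightarrow> real) \<Rightarrow> real \<times> real \<Rightarrow> complex" where
  "vh \<Phi> z = (LINT p|lborel. \<Phi> p *\<^sub>R uhp p z)"

lemma vh_sqi:
  assumes "wbd K \<Phi>"
  shows "sqi lborel (vh \<Phi>)" "sqi lborel y \<Longrightarrow> ip lborel (vh \<Phi>) y = (LINT p|lborel. \<Phi> p * ip lborel (uhp p) y)"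
proof -
  have *: "(\<lambda>(q, z). uhp q z) \<in> borel_measurable (lborel \<Otimes>\<^sub>M lborel)" by measurable
  note s = sqi_integral[OF sigma_finite_lborel sigma_finite_lborel * uhp_sqi ip_uhp_le rU_pos _ _ wbd_integrable[OF assms integrable_wt_rU _ less_imp_le[OF rU_pos]]]
  show "sqi lborel (vh \<Phi>)" unfolding vh_def[abs_def] using wbd_meas[OF assms] by (intro s(2)) auto
  show "sqi lborel y \<Longrightarrow> ip lborel (vh \<Phi>) y = (LINT p|lborel. \<Phi> p * ip lborel (uhp p) y)"
    unfolding vh_def[abs_def] using wbd_meas[OF assms] by (intro s(3)) auto
qed

text \<open>The image of a tensor product under the operator of the theorem; its transform is
  \<open>msym\<close> times that of the tensor product.\<close>

definition Top :: "(real \<Rightarrow> complex) \<Rightarrow> (real \<Rightarrow> real) \<Rightarrow> real \<times> real \<Rightarrow> real" where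
  "Top \<alpha> \<beta> p = hx 2 \<alpha> (fst p) * hs 0 \<beta> (snd p) + hx 0 \<alpha> (fst p) * hs 1 \<beta> (snd p)
     - sqrt 2 * (hx 1 \<alpha> (fst p) * hs (1/2) \<beta> (snd p))"

lemma prod_wt_bound:
  assumes "\<bar>a\<bar> \<le> K / (1 + (fst p)\<^sup>2)" "\<bar>b\<bar> \<le> L / (1 + (snd p)\<^sup>2)"
  shows "\<bar>a * b\<bar> \<le> K * L * wt p"
proof -
  have "\<bar>a\<bar> * \<bar>b\<bar> \<le> (K / (1 + (fst p)\<^sup>2)) * (L / (1 + (snd p)\<^sup>2))"
    by (rule mult_mono[OF assms order_trans[OF abs_ge_zero assms(1)] abs_ge_zero])
  then show ?thesis by (simp add: abs_mult wt_def)
qed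

lemma Top_wbd:
  assumes "xadm \<alpha> K" "tadm \<beta> L" shows "wbd (4 * (K * L)) (Top \<alpha> \<beta>)"
  unfolding wbd_def
proof (intro conjI allI)
  note [measurable] = xadm_meas[OF assms(1)] tadm_meas[OF assms(2)]
  show "Top \<alpha> \<beta> \<in> borel_measurable borel" unfolding Top_def by measurable
  fix p
  have KL: "0 \<le> K * L * wt p"
    using prod_wt_bound[OF hx_bound[OF assms(1), of 0] hs_bound[OF assms(2), of 0], of p] by (simp add: order_trans[OF abs_ge_zero])
  have s2: "sqrt 2 \<le> 2" by (rule real_le_lsqrt) auto
  have "sqrt 2 * \<bar>hx 1 \<alpha> (fst p) * hs (1/2) \<beta> (snd p)\<bar> \<le> 2 * (K * L * wt p)"
    by (intro mult_mono s2 prod_wt_bound hx_bound[OF assms(1)] hs_bound[OF assms(2)]) auto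
  then have "\<bar>sqrt 2 * (hx 1 \<alpha> (fst p) * hs (1/2) \<beta> (snd p))\<bar> \<le> 2 * (K * L * wt p)" by (simp add: abs_mult)
  moreover have "\<bar>hx 2 \<alpha> (fst p) * hs 0 \<beta> (snd p)\<bar> \<le> K * L * wt p"
    by (intro prod_wt_bound hx_bound[OF assms(1)] hs_bound[OF assms(2)]) auto
  moreover have "\<bar>hx 0 \<alpha> (fst p) * hs 1 \<beta> (snd p)\<bar> \<le> K * L * wt p"
    by (intro prod_wt_bound hx_bound[OF assms(1)] hs_bound[OF assms(2)]) auto
  ultimately show "\<bar>Top \<alpha> \<beta> p\<bar> \<le> 4 * (K * L) * wt p"
    unfolding Top_def by linarith
qed

lemma vh_Top:
  assumes a: "xadm \<alpha> K" and b: "tadm \<beta> L"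
  shows "AE z in lborel. vh (Top \<alpha> \<beta>) z = tens \<alpha> \<beta> z"
  using AE_lborel2_nonzero
proof eventually_elim
  fix z :: "real \<times> real" assume z: "fst z \<noteq> 0 \<and> snd z \<noteq> 0"
  define \<xi> \<tau> where "\<xi> = fst z" and "\<tau> = snd z"
  define X where "X j x = complex_of_real (hx j \<alpha> x) * cis (- (\<xi> * x))" for j x
  define Y where "Y \<gamma> t = complex_of_real (indicator {0<..} t * (hs \<gamma> \<beta> t * sin (\<tau> * t)))" for \<gamma> t
  have X: "integrable lborel (X j)" "(LINT x|lborel. X j x) = (\<i> * of_real \<xi>) ^ j * \<alpha> \<xi>" if "j \<le> 2" for j
    unfolding X_def using hx_FT[OF a that] hx_integrable[OF a that] by (auto intro!: integrable_mult_bounded[where C=1])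
  have Y: "integrable lborel (Y \<gamma>)" "(LINT t|lborel. Y \<gamma> t) = of_real (\<bar>\<tau>\<bar> powr \<gamma> * \<beta> \<tau>)" if "\<gamma> \<in> {0, 1/2, 1}" for \<gamma>
  proof -
    have "integrable lborel (\<lambda>t. hs \<gamma> \<beta> t * sin (\<tau> * t))"
      using hs_integrable[OF b that] by (rule integrable_mult_bounded[where C=1]) auto
    from integrable_mult_indicator[OF _ this, of "{0<..}"] show "integrable lborel (Y \<gamma>)" unfolding Y_def by (intro integrable_of_real) simp
    show "(LINT t|lborel. Y \<gamma> t) = of_real (\<bar>\<tau>\<bar> powr \<gamma> * \<beta> \<tau>)"
      unfolding Y_def integral_complex_of_real hs_FT[OF b that] ..
  qed
  have XY: "integrable lborel (\<lambda>p. X j (fst p) * Y \<gamma> (snd p))"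
    "(LINT p|lborel. X j (fst p) * Y \<gamma> (snd p)) = ((\<i> * of_real \<xi>) ^ j * \<alpha> \<xi>) * of_real (\<bar>\<tau>\<bar> powr \<gamma> * \<beta> \<tau>)"
    if "j \<le> 2" "\<gamma> \<in> {0, 1/2, 1}" for j \<gamma>
    using integrable_lborel2[OF X(1)[OF that(1)] Y(1)[OF that(2)]] integral_lborel2[OF X(1)[OF that(1)] Y(1)[OF that(2)]]
    unfolding X(2)[OF that(1)] Y(2)[OF that(2)] by auto
  have i: "integrable lborel (\<lambda>p. X 2 (fst p) * Y 0 (snd p))" "integrable lborel (\<lambda>p. X 0 (fst p) * Y 1 (snd p))"
    "integrable lborel (\<lambda>p. complex_of_real (sqrt 2) * (X 1 (fst p) * Y (1/2) (snd p)))"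
    by (intro XY integrable_mult_right; simp)+
  have "vh (Top \<alpha> \<beta>) z = (LINT p|lborel. (X 2 (fst p) * Y 0 (snd p) + X 0 (fst p) * Y 1 (snd p)
      - complex_of_real (sqrt 2) * (X 1 (fst p) * Y (1/2) (snd p))) / msym z)"
    unfolding vh_def
    by (intro Bochner_Integration.integral_cong)
       (auto simp: uhp_def uh_def Top_def X_def Y_def scaleR_conv_of_real \<xi>_def \<tau>_def indicator_def algebra_simps diff_divide_distrib add_divide_distrib)
  also have "\<dots> = (LINT p|lborel. X 2 (fst p) * Y 0 (snd p) + X 0 (fst p) * Y 1 (snd p)
      - complex_of_real (sqrt 2) * (X 1 (fst p) * Y (1/2) (snd p))) / msym z" by simp
  also have "(LINT p|lborel. X 2 (fst p) * Y 0 (snd p) + X 0 (fst p) * Y 1 (snd p)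
      - complex_of_real (sqrt 2) * (X 1 (fst p) * Y (1/2) (snd p)))
    = ((\<i> * of_real \<xi>) ^ 2 * \<alpha> \<xi>) * of_real (\<bar>\<tau>\<bar> powr 0 * \<beta> \<tau>) + ((\<i> * of_real \<xi>) ^ 0 * \<alpha> \<xi>) * of_real (\<bar>\<tau>\<bar> powr 1 * \<beta> \<tau>)
      - complex_of_real (sqrt 2) * (((\<i> * of_real \<xi>) ^ 1 * \<alpha> \<xi>) * of_real (\<bar>\<tau>\<bar> powr (1/2) * \<beta> \<tau>))"
    unfolding Bochner_Integration.integral_diff[OF Bochner_Integration.integrable_add[OF i(1,2)] i(3)]
      Bochner_Integration.integral_add[OF i(1,2)] integral_mult_right_zero
    using XY(2)[of 2 0] XY(2)[of 0 1] XY(2)[of 1 "1/2"] by simp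
  also have "\<dots> = tens \<alpha> \<beta> z * msym z"
  proof -
    have m: "msym z = of_real (\<bar>\<tau>\<bar> - \<xi>\<^sup>2) - \<i> * of_real (sqrt 2 * \<xi> * sqrt \<bar>\<tau>\<bar>)"
      by (simp add: msym_def Complex_eq \<xi>_def \<tau>_def)
    have "\<tau> \<noteq> 0" using z by (simp add: \<tau>_def)
    then have p: "\<bar>\<tau>\<bar> powr 0 = 1" "\<bar>\<tau>\<bar> powr 1 = \<bar>\<tau>\<bar>" "\<bar>\<tau>\<bar> powr (1/2) = sqrt \<bar>\<tau>\<bar>" by (auto simp: powr_half_sqrt)
    show ?thesis unfolding m p tens_def \<xi>_def[symmetric] \<tau>_def[symmetric]
      by (simp add: scaleR_conv_of_real power2_eq_square algebra_simps)
  qed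
  also have "tens \<alpha> \<beta> z * msym z / msym z = tens \<alpha> \<beta> z"
  proof -
    have "(norm (msym z))\<^sup>2 \<noteq> 0" unfolding norm_msym using z
      by (metis add_nonneg_eq_0_iff power_eq_0_iff zero_le_even_power even_numeral zero_le_power2)
    then show ?thesis by simp
  qed
  finally show "vh (Top \<alpha> \<beta>) z = tens \<alpha> \<beta> z" .
qed

context she
begin

text \<open>A version of \<open>U\<close> which is jointly measurable, so that Fubini's theorem applies.\<close>

definition Ut :: "real \<times> real \<Rightarrow> 'a \<Rightarrow> real" where
  "Ut p \<omega> = (if 0 < snd p then lim (\<lambda>n. U (dn n (fst p), dn n (snd p) + 1 / 2 ^ n) \<omega>) else 0)"

lemma Un_measurable:
  "(\<lambda>(p, \<omega>). if 0 < snd p then U (dn n (fst p), dn n (snd p) + 1 / 2 ^ n) \<omega> else 0) \<in> borel_measurable (lborel \<Otimes>\<^sub>M M)"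
proof -
  define f where "f ij pw = (if 0 < snd (fst pw) \<and> (0::int) \<le> snd ij then U (real_of_int (fst ij) / 2 ^ n, real_of_int (snd ij) / 2 ^ n + 1 / 2 ^ n) (snd pw) else 0)" for ij :: "int \<times> int" and pw :: "(real \<times> real) \<times> 'a"
  define g where "g pw = (\<lfloor>fst (fst pw) * 2 ^ n\<rfloor>, \<lfloor>snd (fst pw) * 2 ^ n\<rfloor>)" for pw :: "(real \<times> real) \<times> 'a"
  have "(\<lambda>pw. f (g pw) pw) \<in> borel_measurable (lborel \<Otimes>\<^sub>M M)"
  proof (rule measurable_compose_countable)
    fix ij :: "int \<times> int"
    show "f ij \<in> borel_measurable (lborel \<Otimes>\<^sub>M M)"
    proof (cases "0 \<le> snd ij")
      case True
      have "(real_of_int (fst ij) / 2 ^ n, real_of_int (snd ij) / 2 ^ n + 1 / 2 ^ n) \<in> Qplus"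
        using True by (auto simp: Qplus_def intro!: add_nonneg_pos divide_nonneg_pos)
      note [measurable] = gspan_meas[OF U_gspan[OF this]]
      show ?thesis unfolding f_def by measurable
    next
      case False
      then show ?thesis unfolding f_def by simp
    qed
    have "(\<lambda>pw :: (real \<times> real) \<times> 'a. (\<lfloor>fst (fst pw) * 2 ^ n\<rfloor>, \<lfloor>snd (fst pw) * 2 ^ n\<rfloor>)) \<in> measurable (lborel \<Otimes>\<^sub>M M) (count_space UNIV \<Otimes>\<^sub>M count_space UNIV)"
      by measurable
    then show "g \<in> measurable (lborel \<Otimes>\<^sub>M M) (count_space UNIV)"
      by (simp add: g_def[abs_def] pair_measure_countable)
  qed
  moreover have "f (g pw) pw = (case pw of (p, \<omega>) \<Rightarrow> if 0 < snd p then U (dn n (fst p), dn n (snd p) + 1 / 2 ^ n) \<omega> else 0)" for pw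
    by (auto simp: f_def g_def dn_def split_beta' not_le mult_less_0_iff)
  ultimately show ?thesis by simp
qed

lemma Ut_measurable[measurable]: "(\<lambda>(p, \<omega>). Ut p \<omega>) \<in> borel_measurable (lborel \<Otimes>\<^sub>M M)"
proof -
  have "(\<lambda>(p, \<omega>). Ut p \<omega>) = (\<lambda>pw. lim (\<lambda>n. (\<lambda>(p, \<omega>). if 0 < snd p then U (dn n (fst p), dn n (snd p) + 1 / 2 ^ n) \<omega> else 0) pw))"
    by (auto simp: fun_eq_iff Ut_def)
  then show ?thesis using borel_measurable_lim_metric[OF Un_measurable] by simp
qed

lemma U_dn_tendsto:
  assumes "continuous_on Qplus (\<lambda>p. U p \<omega>)" "0 < t"
  shows "(\<lambda>n. U (dn n x, dn n t + 1 / 2 ^ n) \<omega>) \<longlonglongrightarrow> U (x, t) \<omega>"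
proof -
  have o: "open Qplus" unfolding Qplus_def by (intro open_Times) auto
  have "isCont (\<lambda>p. U p \<omega>) (x, t)"
    using assms continuous_on_eq_continuous_at[OF o] by (auto simp: Qplus_def)
  moreover have "(\<lambda>n. (dn n x, dn n t + 1 / 2 ^ n)) \<longlonglongrightarrow> (x, t)"
    using tendsto_Pair[OF dn_tendsto[of x] tendsto_add[OF dn_tendsto[of t] half_pow_tendsto]] by simp
  ultimately show ?thesis by (rule isCont_tendsto_compose)
qed

lemma Ut_eq: "AE \<omega> in M. \<forall>p. Ut p \<omega> = indicator Qplus p * U p \<omega>"
  using cont
proof eventually_elim
  fix \<omega> assume c: "continuous_on Qplus (\<lambda>p. U p \<omega>)"
  show "\<forall>p. Ut p \<omega> = indicator Qplus p * U p \<omega>"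
  proof
    fix p :: "real \<times> real"
    show "Ut p \<omega> = indicator Qplus p * U p \<omega>"
    proof (cases "0 < snd p")
      case True
      then show ?thesis using limI[OF U_dn_tendsto[OF c True, of "fst p"]] by (auto simp: Ut_def Qplus_def indicator_def mem_Times_iff)
    qed (auto simp: Ut_def Qplus_def indicator_def mem_Times_iff)
  qed
qed

lemma Ut_eq': "AE \<omega> in M. Ut p \<omega> = indicator Qplus p * U p \<omega>"
  using Ut_eq by (rule eventually_mono) blast

lemma Ut_gspan: "Ut p \<in> gspan"
proof (cases "p \<in> Qplus")
  case True
  show ?thesis
    by (rule gspan_limit_AE[of "\<lambda>_. U p"]) (use U_gspan[OF True] Ut_eq'[of p] True in \<open>auto elim!: eventually_mono\<close>)
next
  case False
  show ?thesis
    by (rule gspan_limit_AE[of "\<lambda>_ _. 0"]) (use gspan_0 Ut_eq'[of p] False in \<open>auto elim!: eventually_mono\<close>)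
qed

lemma ip_Ut: "ip M (Ut p) (Ut p') = ip lborel (uhp p) (uhp p') / (2 * pi\<^sup>2)"
proof -
  have e: "ip M (Ut p) (Ut p') = (LINT \<omega>|M. (indicator Qplus p * indicator Qplus p') * (Ut p \<omega> * Ut p' \<omega>))"
    unfolding ip_def
  proof (intro integral_cong_AE)
    show "AE \<omega> in M. Ut p \<omega> \<bullet> Ut p' \<omega> = (indicator Qplus p * indicator Qplus p') * (Ut p \<omega> * Ut p' \<omega>)"
      using Ut_eq'[of p] Ut_eq'[of p'] by eventually_elim (auto simp: indicator_def)
  qed measurable
  show ?thesis
  proof (cases "p \<in> Qplus \<and> p' \<in> Qplus")
    case True
    have "ip M (Ut p) (Ut p') = ip M (U p) (U p')"
      unfolding ip_def
    proof (intro integral_cong_AE)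
      show "AE \<omega> in M. Ut p \<omega> \<bullet> Ut p' \<omega> = U p \<omega> \<bullet> U p' \<omega>"
        using Ut_eq'[of p] Ut_eq'[of p'] by eventually_elim (use True in auto)
    qed (use True gspan_meas[OF U_gspan] in auto)
    also have "\<dots> = ip lborel (uhp p) (uhp p') / (2 * pi\<^sup>2)"
      using ip_U[of p p'] True by (auto simp: uhp_def[abs_def] Qplus_def)
    finally show ?thesis .
  next
    case False
    then have "uhp p = (\<lambda>_. 0) \<or> uhp p' = (\<lambda>_. 0)" by (cases p; cases p') (auto simp: uhp_def[abs_def] Qplus_def)
    moreover have "ip M (Ut p) (Ut p') = 0" using False unfolding e by (auto simp: indicator_def)
    ultimately show ?thesis by (auto simp: ip_def)
  qed
qed

lemma ip_Ut_le: "ip M (Ut p) (Ut p) \<le> (rU p)\<^sup>2"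
proof -
  have "1 \<le> 2 * pi\<^sup>2" using pi_ge_1 one_le_power[of pi 2] by linarith
  then have "ip lborel (uhp p) (uhp p) / (2 * pi\<^sup>2) \<le> ip lborel (uhp p) (uhp p)"
    using ip_nonneg[of lborel "uhp p"] by (simp add: divide_le_eq mult_le_cancel_left1)
  then show ?thesis unfolding ip_Ut using ip_uhp_le[of p] by linarith
qed

definition VU :: "(real \<times> real \<Rightarrow> real) \<Rightarrow> 'a \<Rightarrow> real" where
  "VU \<Phi> \<omega> = (LINT p|lborel. \<Phi> p * Ut p \<omega>)"

lemma VU_sqi:
  assumes "wbd K \<Phi>"
  shows "AE \<omega> in M. integrable lborel (\<lambda>p. \<Phi> p * Ut p \<omega>)" "sqi M (VU \<Phi>)"
    "sqi M Y \<Longrightarrow> ip M (VU \<Phi>) Y = (LINT p|lborel. \<Phi> p * ip M (Ut p) Y)"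
proof -
  note s = sqi_integral[OF sigma_finite_lborel sigma_finite_measure_axioms Ut_measurable gspan_sqi[OF Ut_gspan] ip_Ut_le rU_pos _ _ wbd_integrable[OF assms integrable_wt_rU _ less_imp_le[OF rU_pos]]]
  show "AE \<omega> in M. integrable lborel (\<lambda>p. \<Phi> p * Ut p \<omega>)" using wbd_meas[OF assms] s(1) by simp
  show "sqi M (VU \<Phi>)" unfolding VU_def[abs_def] using wbd_meas[OF assms] s(2) by simp
  show "sqi M Y \<Longrightarrow> ip M (VU \<Phi>) Y = (LINT p|lborel. \<Phi> p * ip M (Ut p) Y)"
    unfolding VU_def[abs_def] using wbd_meas[OF assms] s(3)[of Y] by simp
qed

lemma VU_meas[measurable]: "VU \<Phi> \<in> borel_measurable M" if [measurable]: "\<Phi> \<in> borel_measurable borel"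
  unfolding VU_def by measurable

lemma ip_VU:
  assumes "wbd K \<Phi>" "wbd L \<Psi>"
  shows "ip M (VU \<Phi>) (VU \<Psi>) = ip lborel (vh \<Phi>) (vh \<Psi>) / (2 * pi\<^sup>2)"
proof -
  have 1: "ip M (Ut p) (VU \<Psi>) = ip lborel (uhp p) (vh \<Psi>) / (2 * pi\<^sup>2)" for p
    unfolding ip_commute[of M "Ut p"] ip_commute[of lborel "uhp p"]
      VU_sqi(3)[OF assms(2) gspan_sqi[OF Ut_gspan]] vh_sqi(2)[OF assms(2) uhp_sqi] ip_Ut by simp
  show ?thesis
    unfolding VU_sqi(3)[OF assms(1) VU_sqi(2)[OF assms(2)]] vh_sqi(2)[OF assms(1) vh_sqi(1)[OF assms(2)]] 1 by simp
qed

end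

section \<open>The new Brownian sheet\<close>

lemma integrable_wt: "integrable lborel wt"
  unfolding wt_def[abs_def] by (rule integrable_lborel2[OF integrable_inverse_quadratic integrable_inverse_quadratic])

lemma wbd_integrable1: "wbd K \<Phi> \<Longrightarrow> integrable lborel \<Phi>"
  using wbd_integrable[of K \<Phi> "\<lambda>_. 1"] integrable_wt wbd_meas[of K \<Phi>]
  by (simp add: integrable_norm_iff flip: real_norm_def)

lemma ip_cong_AE:
  assumes "sqi N f" "sqi N f'" "sqi N g" "sqi N g'" "AE z in N. f z = f' z" "AE z in N. g z = g' z"
  shows "ip N f g = ip N f' g'"
proof -
  note [measurable] = sqi_meas[OF assms(1)] sqi_meas[OF assms(2)] sqi_meas[OF assms(3)] sqi_meas[OF assms(4)]
  show ?thesis unfolding ip_def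
  proof (rule integral_cong_AE)
    show "AE z in N. f z \<bullet> g z = f' z \<bullet> g' z" using assms(5,6) by eventually_elim simp
  qed measurable
qed

lemma ip_add_self_le:
  assumes "sqi N f" "sqi N g"
  shows "ip N (\<lambda>z. f z + g z) (\<lambda>z. f z + g z) \<le> 2 * ip N f f + 2 * ip N g g"
proof -
  have "(norm (f z + g z))\<^sup>2 \<le> 2 * (norm (f z))\<^sup>2 + 2 * (norm (g z))\<^sup>2" for z
  proof -
    have "(norm (f z + g z))\<^sup>2 \<le> (norm (f z) + norm (g z))\<^sup>2" by (intro power_mono norm_triangle_ineq) auto
    also have "\<dots> \<le> 2 * (norm (f z))\<^sup>2 + 2 * (norm (g z))\<^sup>2"
      using sum_squares_bound[of "norm (f z)" "norm (g z)"] by (simp add: power2_sum)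
    finally show ?thesis .
  qed
  then have "ip N (\<lambda>z. f z + g z) (\<lambda>z. f z + g z) \<le> (LINT z|N. 2 * (norm (f z))\<^sup>2 + 2 * (norm (g z))\<^sup>2)"
    unfolding ip_self using assms sqi_add[OF assms] by (intro integral_mono) (auto simp: sqi_def)
  also have "\<dots> = 2 * ip N f f + 2 * ip N g g"
    unfolding ip_self using assms by (subst Bochner_Integration.integral_add) (auto simp: sqi_def)
  finally show ?thesis .
qed

lemma ip_diff_chain:
  assumes "sqi N f" "sqi N g" "sqi N h"
  shows "ip N (\<lambda>z. f z - h z) (\<lambda>z. f z - h z)
    \<le> 2 * ip N (\<lambda>z. f z - g z) (\<lambda>z. f z - g z) + 2 * ip N (\<lambda>z. g z - h z) (\<lambda>z. g z - h z)"
  using ip_add_self_le[OF sqi_diff[OF assms(1,2)] sqi_diff[OF assms(2,3)]] by simp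

lemma ip_diff_commute: "ip N (\<lambda>z. f z - g z) (\<lambda>z. f z - g z) = ip N (\<lambda>z. g z - f z) (\<lambda>z. g z - f z)"
  unfolding ip_self by (simp add: norm_minus_commute)

lemma tens_diff_le:
  assumes "sqi lborel a" "sqi lborel b" "sqi lborel a'" "sqi lborel b'"
  shows "ip lborel (\<lambda>z. tens a b z - tens a' b' z) (\<lambda>z. tens a b z - tens a' b' z)
    \<le> 2 * (ip lborel (\<lambda>z. a z - a' z) (\<lambda>z. a z - a' z) * ip lborel b b)
      + 2 * (ip lborel a' a' * ip lborel (\<lambda>z. b z - b' z) (\<lambda>z. b z - b' z))"
proof -
  have "tens a b z - tens a' b' z = tens (\<lambda>z. a z - a' z) b z + tens a' (\<lambda>z. b z - b' z) z" for z
    by (simp add: tens_def algebra_simps)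
  then show ?thesis
    using ip_add_self_le[OF sqi_tens[OF sqi_diff[OF assms(1,3)] assms(2)] sqi_tens[OF assms(3) sqi_diff[OF assms(2,4)]]]
    by (simp add: ip_tens assms sqi_diff)
qed

definition eps :: "nat \<Rightarrow> real" where "eps n = 1 / 2 ^ n"

lemma eps_pos: "0 < eps n" by (simp add: eps_def)

lemma eps_mono: "n \<le> m \<Longrightarrow> eps m \<le> eps n"
  by (simp add: eps_def power_increasing frac_le)

lemma eps_le1: "eps n \<le> 1" using eps_mono[of 0 n] by (simp add: eps_def)

lemma ip_\<alpha>0_diff: "ip lborel (\<lambda>\<xi>. \<alpha>0 x \<xi> - \<alpha>0 y \<xi>) (\<lambda>\<xi>. \<alpha>0 x \<xi> - \<alpha>0 y \<xi>) = 2 * pi * \<bar>x - y\<bar>"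
  using ip_diff_self[OF sqi_\<alpha>0[of x] sqi_\<alpha>0[of y]] by (simp add: ip_\<alpha>0 algebra_simps)

lemma ip_\<beta>0_self_le: "ip lborel (\<beta>0 t) (\<beta>0 t) \<le> 2 * pi * \<bar>t\<bar>"
  using sqi_Im(2)[OF sqi_\<alpha>0[of t]] by (simp add: \<beta>0_eq[abs_def] ip_\<alpha>0)

definition AR :: "real \<Rightarrow> real" where "AR R = 4 * pi * R + 2 * (J0 * (R\<^sup>2 + 8))"

definition ER :: "real \<Rightarrow> real" where "ER R = 4 * (2 * (J0 * (R\<^sup>2 + 8)) + 2 * pi)"

lemma J0_mono: "\<bar>x\<bar> \<le> R \<Longrightarrow> 0 \<le> e \<Longrightarrow> J0 * (x\<^sup>2 + 8) * e \<le> J0 * (R\<^sup>2 + 8) * e"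
  using J0_nonneg abs_le_square_iff[of x R] by (intro mult_right_mono mult_left_mono) auto

lemma AR_bounds:
  assumes "\<bar>x\<bar> \<le> R"
  shows "ip lborel (a\<alpha> (eps n) x) (a\<alpha> (eps n) x) \<le> AR R" "ip lborel (a\<beta> (eps n) x) (a\<beta> (eps n) x) \<le> AR R"
    "ip lborel (\<alpha>0 x) (\<alpha>0 x) \<le> AR R" "ip lborel (\<beta>0 x) (\<beta>0 x) \<le> AR R"
proof -
  have R: "0 \<le> R" using assms by linarith
  have J: "J0 * (x\<^sup>2 + 8) * eps n \<le> J0 * (R\<^sup>2 + 8)"
    using J0_mono[OF assms, of "eps n"] eps_pos[of n] eps_le1[of n] J0_nonneg
      mult_left_mono[OF eps_le1[of n], of "J0 * (R\<^sup>2 + 8)"] by (simp add: less_imp_le)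
  have J': "0 \<le> J0 * (R\<^sup>2 + 8)" using J0_nonneg by simp
  have px: "2 * pi * \<bar>x\<bar> \<le> 2 * pi * R" using assms by simp
  have pR: "0 \<le> pi * R" using R by simp
  have a: "ip lborel (\<alpha>0 x) (\<alpha>0 x) \<le> 2 * pi * R" using px by (simp add: ip_\<alpha>0 algebra_simps)
  have b: "ip lborel (\<beta>0 x) (\<beta>0 x) \<le> 2 * pi * R" using px ip_\<beta>0_self_le[of x] by linarith
  show "ip lborel (\<alpha>0 x) (\<alpha>0 x) \<le> AR R" using a pR J' unfolding AR_def by linarith
  show "ip lborel (\<beta>0 x) (\<beta>0 x) \<le> AR R" using b pR J' unfolding AR_def by linarith
  have "ip lborel (a\<alpha> (eps n) x) (a\<alpha> (eps n) x) \<le> 2 * ip lborel (\<lambda>\<xi>. a\<alpha> (eps n) x \<xi> - \<alpha>0 x \<xi>) (\<lambda>\<xi>. a\<alpha> (eps n) x \<xi> - \<alpha>0 x \<xi>) + 2 * ip lborel (\<alpha>0 x) (\<alpha>0 x)"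
    using ip_add_self_le[OF a\<alpha>_dist(1)[OF eps_pos, of n x] sqi_\<alpha>0[of x]] by simp
  then show "ip lborel (a\<alpha> (eps n) x) (a\<alpha> (eps n) x) \<le> AR R"
    using a\<alpha>_dist(2)[OF eps_pos, of n x] J a unfolding AR_def by linarith
  have "ip lborel (a\<beta> (eps n) x) (a\<beta> (eps n) x) \<le> 2 * ip lborel (\<lambda>\<xi>. a\<beta> (eps n) x \<xi> - \<beta>0 x \<xi>) (\<lambda>\<xi>. a\<beta> (eps n) x \<xi> - \<beta>0 x \<xi>) + 2 * ip lborel (\<beta>0 x) (\<beta>0 x)"
    using ip_add_self_le[OF a\<beta>_dist(1)[OF eps_pos, of n x] sqi_\<beta>0[of x]] by simp
  then show "ip lborel (a\<beta> (eps n) x) (a\<beta> (eps n) x) \<le> AR R"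
    using a\<beta>_dist(2)[OF eps_pos, of n x] J b unfolding AR_def by linarith
qed

lemma ER_bounds0:
  assumes "\<bar>x\<bar> \<le> R" "\<bar>x - y\<bar> \<le> eps n"
  shows "ip lborel (\<lambda>\<xi>. a\<alpha> (eps n) x \<xi> - \<alpha>0 y \<xi>) (\<lambda>\<xi>. a\<alpha> (eps n) x \<xi> - \<alpha>0 y \<xi>) \<le> ER R * eps n"
    "ip lborel (\<lambda>\<xi>. a\<beta> (eps n) x \<xi> - \<beta>0 y \<xi>) (\<lambda>\<xi>. a\<beta> (eps n) x \<xi> - \<beta>0 y \<xi>) \<le> ER R * eps n"
proof -
  have J: "J0 * (x\<^sup>2 + 8) * eps n \<le> J0 * (R\<^sup>2 + 8) * eps n"
    using J0_mono[OF assms(1), of "eps n"] eps_pos[of n] by simp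
  have J': "0 \<le> J0 * (R\<^sup>2 + 8) * eps n" using J0_nonneg eps_pos[of n] by simp
  have p: "2 * pi * \<bar>x - y\<bar> \<le> 2 * pi * eps n" using assms(2) by simp
  have p0: "0 \<le> pi * eps n" using eps_pos[of n] by simp
  have E: "ER R * eps n = 8 * (J0 * (R\<^sup>2 + 8) * eps n) + 8 * (pi * eps n)" by (simp add: ER_def algebra_simps)
  show "ip lborel (\<lambda>\<xi>. a\<alpha> (eps n) x \<xi> - \<alpha>0 y \<xi>) (\<lambda>\<xi>. a\<alpha> (eps n) x \<xi> - \<alpha>0 y \<xi>) \<le> ER R * eps n"
    using ip_diff_chain[OF sqi_a\<alpha>[OF eps_pos, of n x] sqi_\<alpha>0[of x] sqi_\<alpha>0[of y]] a\<alpha>_dist(2)[OF eps_pos, of n x] ip_\<alpha>0_diff[of x y] J J' p p0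
    unfolding E by linarith
  show "ip lborel (\<lambda>\<xi>. a\<beta> (eps n) x \<xi> - \<beta>0 y \<xi>) (\<lambda>\<xi>. a\<beta> (eps n) x \<xi> - \<beta>0 y \<xi>) \<le> ER R * eps n"
    using ip_diff_chain[OF sqi_a\<beta>[OF eps_pos, of n x] sqi_\<beta>0[of x] sqi_\<beta>0[of y]] a\<beta>_dist(2)[OF eps_pos, of n x] ip_\<beta>0_diff[of x y] J J' p p0
    unfolding E by linarith
qed

lemma ER_bounds:
  assumes "\<bar>x\<bar> \<le> R" "\<bar>y\<bar> \<le> R" "\<bar>x - y\<bar> \<le> eps n" "n \<le> m"
  shows "ip lborel (\<lambda>\<xi>. a\<alpha> (eps n) x \<xi> - a\<alpha> (eps m) y \<xi>) (\<lambda>\<xi>. a\<alpha> (eps n) x \<xi> - a\<alpha> (eps m) y \<xi>) \<le> 4 * (ER R * eps n)"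
    "ip lborel (\<lambda>\<xi>. a\<beta> (eps n) x \<xi> - a\<beta> (eps m) y \<xi>) (\<lambda>\<xi>. a\<beta> (eps n) x \<xi> - a\<beta> (eps m) y \<xi>) \<le> 4 * (ER R * eps n)"
proof -
  have "0 \<le> ER R" using J0_nonneg by (simp add: ER_def)
  then have e: "ER R * eps m \<le> ER R * eps n" using eps_mono[OF assms(4)] by (intro mult_left_mono) auto
  have y: "\<bar>y - y\<bar> \<le> eps m" using eps_pos[of m] by simp
  show "ip lborel (\<lambda>\<xi>. a\<alpha> (eps n) x \<xi> - a\<alpha> (eps m) y \<xi>) (\<lambda>\<xi>. a\<alpha> (eps n) x \<xi> - a\<alpha> (eps m) y \<xi>) \<le> 4 * (ER R * eps n)"
    using ip_diff_chain[OF sqi_a\<alpha>[OF eps_pos, of n x] sqi_\<alpha>0[of y] sqi_a\<alpha>[OF eps_pos, of m y]] ER_bounds0(1)[OF assms(1,3)]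
      ER_bounds0(1)[OF assms(2) y] ip_diff_commute[of lborel "\<alpha>0 y" "a\<alpha> (eps m) y"] e by linarith
  show "ip lborel (\<lambda>\<xi>. a\<beta> (eps n) x \<xi> - a\<beta> (eps m) y \<xi>) (\<lambda>\<xi>. a\<beta> (eps n) x \<xi> - a\<beta> (eps m) y \<xi>) \<le> 4 * (ER R * eps n)"
    using ip_diff_chain[OF sqi_a\<beta>[OF eps_pos, of n x] sqi_\<beta>0[of y] sqi_a\<beta>[OF eps_pos, of m y]] ER_bounds0(2)[OF assms(1,3)]
      ER_bounds0(2)[OF assms(2) y] ip_diff_commute[of lborel "\<beta>0 y" "a\<beta> (eps m) y"] e by linarith
qed

context sheet
begin

lemma Gaussian_increments_bound:
  fixes D :: "nat \<Rightarrow> 'i \<Rightarrow> 'a \<Rightarrow> real"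
  assumes I: "\<And>n. finite (I n)" "\<And>n. real (card (I n)) \<le> c * 4 ^ n"
    and D: "\<And>n i. i \<in> I n \<Longrightarrow> D n i \<in> gspan" "\<And>n i. i \<in> I n \<Longrightarrow> ip M (D n i) (D n i) \<le> C / 2 ^ n"
    and C: "0 \<le> C"
  shows "AE \<omega> in M. \<exists>K. \<forall>n. \<forall>i\<in>I n. \<bar>D n i \<omega>\<bar> \<le> K * root 6 (2/3) ^ n"
proof -
  note [measurable] = gspan_meas[OF D(1)]
  have c: "0 \<le> c" using I(2)[of 0] by (simp add: order_trans[OF of_nat_0_le_iff])
  define T where "T n \<omega> = (\<Sum>i\<in>I n. ennreal ((3/2) ^ n * (D n i \<omega>) ^ 6))" for n \<omega>
  have T_meas[measurable]: "T n \<in> borel_measurable M" for n unfolding T_def by measurable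
  have T_int: "(\<integral>\<^sup>+\<omega>. T n \<omega> \<partial>M) \<le> ennreal (15 * c * C ^ 3 * (3/4) ^ n)" for n
  proof -
    have one: "(\<integral>\<^sup>+\<omega>. ennreal ((3/2) ^ n * (D n i \<omega>) ^ 6) \<partial>M) \<le> ennreal ((3/2) ^ n * (15 * (C / 2 ^ n) ^ 3))" if i: "i \<in> I n" for i
    proof -
      note m = centered_gaussian_moments[OF gspan_gaussian[OF D(1)[OF i]]]
      have "(\<integral>\<^sup>+\<omega>. ennreal ((3/2) ^ n * (D n i \<omega>) ^ 6) \<partial>M) = ennreal (LINT \<omega>|M. (3/2) ^ n * (D n i \<omega>) ^ 6)"
        using m(2) by (intro nn_integral_eq_integral) auto
      also have "(LINT \<omega>|M. (3/2) ^ n * (D n i \<omega>) ^ 6) = (3/2) ^ n * (15 * (ip M (D n i) (D n i)) ^ 3)"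
        by (simp add: m(3) ip_self)
      also have "ennreal \<dots> \<le> ennreal ((3/2) ^ n * (15 * (C / 2 ^ n) ^ 3))"
        using D(2)[OF i] ip_nonneg by (intro ennreal_leI mult_left_mono power_mono) auto
      finally show ?thesis .
    qed
    have "(\<integral>\<^sup>+\<omega>. T n \<omega> \<partial>M) = (\<Sum>i\<in>I n. \<integral>\<^sup>+\<omega>. ennreal ((3/2) ^ n * (D n i \<omega>) ^ 6) \<partial>M)"
      unfolding T_def by (rule nn_integral_sum) measurable
    also have "\<dots> \<le> (\<Sum>i\<in>I n. ennreal ((3/2) ^ n * (15 * (C / 2 ^ n) ^ 3)))" by (intro sum_mono one)
    also have "\<dots> = ennreal (real (card (I n)) * ((3/2) ^ n * (15 * (C / 2 ^ n) ^ 3)))"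
      using C by (simp add: ennreal_of_nat_eq_real_of_nat ennreal_mult')
    also have "\<dots> \<le> ennreal ((c * 4 ^ n) * ((3/2) ^ n * (15 * (C / 2 ^ n) ^ 3)))"
      using C I(2) by (intro ennreal_leI mult_right_mono) auto
    also have "(c * 4 ^ n) * ((3/2) ^ n * (15 * (C / 2 ^ n) ^ 3)) = 15 * c * C ^ 3 * (3/4) ^ n"
    proof -
      have "((2::real) ^ n) ^ 3 = 8 ^ n" by (simp add: power_mult[symmetric] mult.commute[of n] power_mult)
      moreover have "(4::real) ^ n * (3/2) ^ n / 8 ^ n = (3/4) ^ n"
        by (simp only: power_mult_distrib[symmetric] power_divide[symmetric]) simp
      moreover have "(c * 4 ^ n) * ((3/2) ^ n * (15 * (C / 2 ^ n) ^ 3)) = 15 * c * C ^ 3 * (4 ^ n * (3/2) ^ n / (2 ^ n) ^ 3)"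
        by (simp only: power_divide[of C]) simp
      ultimately show ?thesis by simp
    qed
    finally show ?thesis .
  qed
  have "(\<integral>\<^sup>+\<omega>. (\<Sum>n. T n \<omega>) \<partial>M) = (\<Sum>n. \<integral>\<^sup>+\<omega>. T n \<omega> \<partial>M)"
    by (rule nn_integral_suminf) measurable
  also have "\<dots> \<le> (\<Sum>n. ennreal (15 * c * C ^ 3 * (3/4) ^ n))"
    by (intro suminf_le T_int) auto
  also have "\<dots> < \<infinity>"
  proof -
    have "summable (\<lambda>n. 15 * c * C ^ 3 * (3/4::real) ^ n)" by (intro summable_mult summable_geometric) simp
    then show ?thesis using c C by (simp add: suminf_ennreal2)
  qed
  finally have "AE \<omega> in M. (\<Sum>n. T n \<omega>) \<noteq> \<infinity>"
    by (intro nn_integral_PInf_AE) auto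
  then show ?thesis
  proof eventually_elim
    fix \<omega> assume fin: "(\<Sum>n. T n \<omega>) \<noteq> \<infinity>"
    define S where "S = enn2real (\<Sum>n. T n \<omega>)"
    have S: "(\<Sum>n. T n \<omega>) = ennreal S" "0 \<le> S" using fin by (auto simp: S_def less_top)
    show "\<exists>K. \<forall>n. \<forall>i\<in>I n. \<bar>D n i \<omega>\<bar> \<le> K * root 6 (2/3) ^ n"
    proof (intro exI allI ballI)
      fix n i assume i: "i \<in> I n"
      have "ennreal ((3/2) ^ n * (D n i \<omega>) ^ 6) \<le> T n \<omega>"
        unfolding T_def using i I(1) by (intro member_le_sum) auto
      also have "\<dots> \<le> (\<Sum>n. T n \<omega>)" using sum_le_suminf[of "\<lambda>n. T n \<omega>" "{n}"] by simp
      finally have "(3/2) ^ n * (D n i \<omega>) ^ 6 \<le> S" using S by simp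
      then have "(D n i \<omega>) ^ 6 \<le> S * (2/3) ^ n"
        by (simp add: power_divide field_simps)
      then have "root 6 ((D n i \<omega>) ^ 6) \<le> root 6 (S * (2/3) ^ n)" by simp
      moreover have "root 6 ((D n i \<omega>) ^ 6) = \<bar>D n i \<omega>\<bar>"
        by (metis abs_ge_zero even_numeral power_even_abs real_root_power_cancel zero_less_numeral)
      ultimately show "\<bar>D n i \<omega>\<bar> \<le> root 6 S * root 6 (2/3) ^ n"
        by (simp add: real_root_mult real_root_power)
    qed
  qed
qed

end

context she
begin

lemma VU_box_gspan:
  assumes w: "wbd K \<Phi>" and box: "\<And>p. \<Phi> p \<noteq> 0 \<Longrightarrow> \<bar>fst p\<bar> \<le> R \<and> d \<le> snd p \<and> snd p \<le> R" and d: "0 < d"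
  shows "VU \<Phi> \<in> gspan"
proof -
  note [measurable] = wbd_meas[OF w]
  have \<Phi>i: "integrable lborel \<Phi>" by (rule wbd_integrable1[OF w])
  define g where "g n ij = (real_of_int (fst ij) / 2 ^ n, real_of_int (snd ij) / 2 ^ n + 1 / 2 ^ n)" for n and ij :: "int \<times> int"
  define I where "I n = {\<lfloor>- R * 2 ^ n\<rfloor>..\<lfloor>R * 2 ^ n\<rfloor>} \<times> {0..\<lfloor>R * 2 ^ n\<rfloor>}" for n :: nat
  define cell where "cell n ij = {p :: real \<times> real. \<lfloor>fst p * 2 ^ n\<rfloor> = fst ij \<and> \<lfloor>snd p * 2 ^ n\<rfloor> = snd ij}" for n :: nat and ij :: "int \<times> int"
  have [measurable]: "cell n ij \<in> sets (borel :: (real \<times> real) measure)" for n ij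
  proof -
    have "(\<lambda>p :: real \<times> real. \<lfloor>fst p * 2 ^ n\<rfloor>) \<in> measurable borel (count_space UNIV)" "(\<lambda>p :: real \<times> real. \<lfloor>snd p * 2 ^ n\<rfloor>) \<in> measurable borel (count_space UNIV)"
      by measurable
    then have "{p \<in> space (borel :: (real \<times> real) measure). \<lfloor>fst p * 2 ^ n\<rfloor> = fst ij \<and> \<lfloor>snd p * 2 ^ n\<rfloor> = snd ij} \<in> sets borel"
      by measurable
    then show ?thesis by (simp add: cell_def)
  qed
  have ci: "integrable lborel (\<lambda>p. indicator (cell n ij) p * \<Phi> p)" for n ij
    using integrable_mult_indicator[OF _ \<Phi>i, of "cell n ij"] by simp
  define S where "S n \<omega> = (\<Sum>ij\<in>I n. (LINT p|lborel. indicator (cell n ij) p * \<Phi> p) * U (g n ij) \<omega>)" for n \<omega>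
  have gQ: "g n ij \<in> Qplus" if "ij \<in> I n" for n ij
    using that by (auto simp: g_def I_def Qplus_def intro!: add_nonneg_pos)
  have SG: "S n \<in> gspan" for n
    unfolding S_def[abs_def] by (intro gspan_sum gspan_scale U_gspan gQ)
  have pt: "(\<Sum>ij\<in>I n. indicator (cell n ij) p * \<Phi> p * U (g n ij) \<omega>) = \<Phi> p * U (dn n (fst p), dn n (snd p) + 1 / 2 ^ n) \<omega>" for n p \<omega>
  proof (cases "\<Phi> p = 0")
    case False
    from box[OF this] d have b: "- R \<le> fst p" "fst p \<le> R" "0 \<le> snd p" "snd p \<le> R" by auto
    define k where "k = (\<lfloor>fst p * 2 ^ n\<rfloor>, \<lfloor>snd p * 2 ^ n\<rfloor>)"
    have "k \<in> I n"
      unfolding k_def I_def using b mult_right_mono[OF b(1), of "2 ^ n"] by (auto intro!: floor_mono mult_right_mono)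
    moreover have "indicator (cell n ij) p = (if ij = k then 1 else 0 :: real)" for ij
      by (cases ij) (auto simp: cell_def k_def indicator_def)
    moreover have "finite (I n)" by (simp add: I_def)
    ultimately have "(\<Sum>ij\<in>I n. indicator (cell n ij) p * \<Phi> p * U (g n ij) \<omega>) = \<Phi> p * U (g n k) \<omega>"
      by (simp add: if_distrib[of "\<lambda>x. x * _"] cong: if_cong)
    then show ?thesis by (simp add: g_def k_def dn_def)
  qed simp
  have S_eq: "S n \<omega> = (LINT p|lborel. \<Phi> p * U (dn n (fst p), dn n (snd p) + 1 / 2 ^ n) \<omega>)" for n \<omega>
  proof -
    have "S n \<omega> = (LINT p|lborel. (\<Sum>ij\<in>I n. indicator (cell n ij) p * \<Phi> p * U (g n ij) \<omega>))"
      unfolding S_def using ci by (subst Bochner_Integration.integral_sum) auto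
    also have "\<dots> = (LINT p|lborel. \<Phi> p * U (dn n (fst p), dn n (snd p) + 1 / 2 ^ n) \<omega>)"
      unfolding pt ..
    finally show ?thesis .
  qed
  show ?thesis
  proof (rule gspan_limit_AE[OF SG])
    show "AE \<omega> in M. (\<lambda>n. S n \<omega>) \<longlonglongrightarrow> VU \<Phi> \<omega>"
      using cont Ut_eq
    proof eventually_elim
      fix \<omega> assume c: "continuous_on Qplus (\<lambda>p. U p \<omega>)" and e: "\<forall>p. Ut p \<omega> = indicator Qplus p * U p \<omega>"
      define Kc where "Kc = {- R - 1..R} \<times> {d..R + 1}"
      have "compact Kc" unfolding Kc_def by (intro compact_Times) auto
      moreover have "continuous_on Kc (\<lambda>p. U p \<omega>)"
        using c by (rule continuous_on_subset) (use d in \<open>auto simp: Kc_def Qplus_def\<close>)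
      ultimately have "bounded ((\<lambda>p. U p \<omega>) ` Kc)" by (intro compact_imp_bounded compact_continuous_image)
      then obtain b where b: "\<And>p. p \<in> Kc \<Longrightarrow> \<bar>U p \<omega>\<bar> \<le> b" by (auto simp: bounded_iff)
      show "(\<lambda>n. S n \<omega>) \<longlonglongrightarrow> VU \<Phi> \<omega>"
        unfolding S_eq VU_def
      proof (rule integral_dominated_convergence[where w="\<lambda>p. \<bar>b\<bar> * \<bar>\<Phi> p\<bar>"])
        have Upm: "(\<lambda>p. \<Phi> p * (indicator Qplus p * U p \<omega>)) \<in> borel_measurable lborel"
        proof -
          have "(\<lambda>p. indicator Qplus p *\<^sub>R U p \<omega>) \<in> borel_measurable borel"
            by (rule borel_measurable_continuous_on_indicator[OF _ c]) simp
          from borel_measurable_times[OF wbd_meas[OF w] this] show ?thesis by simp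
        qed
        then show "(\<lambda>p. \<Phi> p * Ut p \<omega>) \<in> borel_measurable lborel" using e by (metis (no_types, lifting) ext)
        show "(\<lambda>p. \<Phi> p * U (dn n (fst p), dn n (snd p) + 1 / 2 ^ n) \<omega>) \<in> borel_measurable lborel" for n
          unfolding pt[symmetric] by measurable
        show "integrable lborel (\<lambda>p. \<bar>b\<bar> * \<bar>\<Phi> p\<bar>)" using \<Phi>i by simp
        show "AE p in lborel. (\<lambda>n. \<Phi> p * U (dn n (fst p), dn n (snd p) + 1 / 2 ^ n) \<omega>) \<longlonglongrightarrow> \<Phi> p * Ut p \<omega>"
        proof (intro AE_I2)
          fix p :: "real \<times> real"
          show "(\<lambda>n. \<Phi> p * U (dn n (fst p), dn n (snd p) + 1 / 2 ^ n) \<omega>) \<longlonglongrightarrow> \<Phi> p * Ut p \<omega>"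
          proof (cases "\<Phi> p = 0")
            case False
            from box[OF this] d have "0 < snd p" by auto
            then have "(\<lambda>n. U (dn n (fst p), dn n (snd p) + 1 / 2 ^ n) \<omega>) \<longlonglongrightarrow> Ut p \<omega>"
              using U_dn_tendsto[OF c, of "snd p" "fst p"] spec[OF e, of p] by (auto simp: Qplus_def mem_Times_iff)
            then show ?thesis by (intro tendsto_intros)
          qed simp
        qed
        show "AE p in lborel. norm (\<Phi> p * U (dn n (fst p), dn n (snd p) + 1 / 2 ^ n) \<omega>) \<le> \<bar>b\<bar> * \<bar>\<Phi> p\<bar>" for n
        proof (intro AE_I2)
          fix p :: "real \<times> real"
          show "norm (\<Phi> p * U (dn n (fst p), dn n (snd p) + 1 / 2 ^ n) \<omega>) \<le> \<bar>b\<bar> * \<bar>\<Phi> p\<bar>"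
          proof (cases "\<Phi> p = 0")
            case False
            from box[OF this] have bp: "\<bar>fst p\<bar> \<le> R" "d \<le> snd p" "snd p \<le> R" by auto
            have "(dn n (fst p), dn n (snd p) + 1 / 2 ^ n) \<in> Kc"
              unfolding Kc_def using bp dn_le(1)[of n "fst p"] dn_le(2)[of "fst p" n] dn_le(1)[of n "snd p"] dn_le(2)[of "snd p" n] eps_le1[of n]
              unfolding eps_def mem_Times_iff atLeastAtMost_iff fst_conv snd_conv by linarith
            from b[OF this] have "\<bar>\<Phi> p\<bar> * \<bar>U (dn n (fst p), dn n (snd p) + 1 / 2 ^ n) \<omega>\<bar> \<le> \<bar>\<Phi> p\<bar> * \<bar>b\<bar>"
              by (intro mult_left_mono) auto
            then show ?thesis by (simp add: abs_mult mult.commute)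
          qed simp
        qed
      qed
    qed
  qed measurable
qed

lemma VU_gspan:
  assumes w: "wbd K \<Phi>" shows "VU \<Phi> \<in> gspan"
proof -
  note [measurable] = wbd_meas[OF w]
  define S where "S n = {p :: real \<times> real. \<bar>fst p\<bar> \<le> real (Suc n) \<and> 1 / real (Suc n) \<le> snd p \<and> snd p \<le> real (Suc n)}" for n
  have S_closed: "closed (S n)" for n
    unfolding S_def by (intro closed_Collect_conj closed_Collect_le continuous_intros)
  then have [measurable]: "S n \<in> sets borel" for n by auto
  have S: "VU (\<lambda>p. indicator (S n) p * \<Phi> p) \<in> gspan" for n
  proof (rule VU_box_gspan[where K=K and R="real (Suc n)" and d="1 / real (Suc n)"])
    show "wbd K (\<lambda>p. indicator (S n) p * \<Phi> p)"
      unfolding wbd_def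
    proof (intro conjI allI)
      fix p show "\<bar>indicator (S n) p * \<Phi> p\<bar> \<le> K * wt p"
        using wbd_bound[OF w, of p] by (auto simp: indicator_def)
    qed measurable
  qed (auto simp: S_def indicator_def)
  show ?thesis
  proof (rule gspan_limit_AE[OF S])
    show "AE \<omega> in M. (\<lambda>n. VU (\<lambda>p. indicator (S n) p * \<Phi> p) \<omega>) \<longlonglongrightarrow> VU \<Phi> \<omega>"
      using VU_sqi(1)[OF w]
    proof eventually_elim
      fix \<omega> assume i: "integrable lborel (\<lambda>p. \<Phi> p * Ut p \<omega>)"
      show "(\<lambda>n. VU (\<lambda>p. indicator (S n) p * \<Phi> p) \<omega>) \<longlonglongrightarrow> VU \<Phi> \<omega>"
        unfolding VU_def
      proof (rule integral_dominated_convergence[where w="\<lambda>p. \<bar>\<Phi> p * Ut p \<omega>\<bar>"])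
        show "(\<lambda>p. \<Phi> p * Ut p \<omega>) \<in> borel_measurable lborel" using i by auto
        have "(\<lambda>p. indicator (S n) p * (\<Phi> p * Ut p \<omega>)) \<in> borel_measurable lborel" for n
          by (intro borel_measurable_times borel_measurable_indicator borel_measurable_integrable[OF i]) simp
        then show "(\<lambda>p. indicator (S n) p * \<Phi> p * Ut p \<omega>) \<in> borel_measurable lborel" for n by (simp add: mult.assoc)
        show "integrable lborel (\<lambda>p. \<bar>\<Phi> p * Ut p \<omega>\<bar>)" using i by simp
        show "AE p in lborel. norm (indicator (S n) p * \<Phi> p * Ut p \<omega>) \<le> \<bar>\<Phi> p * Ut p \<omega>\<bar>" for n
          by (auto simp: indicator_def)
        show "AE p in lborel. (\<lambda>n. indicator (S n) p * \<Phi> p * Ut p \<omega>) \<longlonglongrightarrow> \<Phi> p * Ut p \<omega>"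
        proof (intro AE_I2)
          fix p :: "real \<times> real"
          show "(\<lambda>n. indicator (S n) p * \<Phi> p * Ut p \<omega>) \<longlonglongrightarrow> \<Phi> p * Ut p \<omega>"
          proof (cases "0 < snd p")
            case True
            obtain N where N: "\<bar>fst p\<bar> + snd p + 1 / snd p \<le> real N" using real_arch_simple by blast
            have "\<forall>\<^sub>F n in sequentially. indicator (S n) p * \<Phi> p * Ut p \<omega> = \<Phi> p * Ut p \<omega>"
            proof (rule eventually_sequentiallyI[of N])
              fix n assume n: "N \<le> n"
              have q: "0 < 1 / snd p" using True by simp
              have n': "real N \<le> real (Suc n)" using n by simp
              have "1 / snd p \<le> real (Suc n)" using N n' True by linarith
              then have "1 / real (Suc n) \<le> snd p" using True by (simp add: field_simps del: of_nat_Suc)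
              moreover have "\<bar>fst p\<bar> \<le> real (Suc n)" using N n' True q by linarith
              moreover have "snd p \<le> real (Suc n)" using N n' q abs_ge_zero[of "fst p"] by linarith
              ultimately show "indicator (S n) p * \<Phi> p * Ut p \<omega> = \<Phi> p * Ut p \<omega>"
                by (simp only: S_def indicator_def mem_Collect_eq of_bool_def simp_thms if_True mult_1)
            qed
            then show ?thesis by (rule tendsto_eventually)
          qed (simp add: Ut_def)
        qed
      qed
    qed
  qed measurable
qed

end

lemma geometric_Cauchy:
  fixes s :: "nat \<Rightarrow> real"
  assumes \<rho>: "0 \<le> \<rho>" "\<rho> < 1" and K: "\<And>n. \<bar>s (Suc n) - s n\<bar> \<le> K * \<rho> ^ n"
  shows "convergent s" "\<bar>lim s - s n\<bar> \<le> K / (1 - \<rho>) * \<rho> ^ n"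
proof -
  have sm: "summable (\<lambda>k. K * \<rho> ^ (n + k))" for n
    using \<rho> by (simp add: power_add)
  have sa: "summable (\<lambda>k. \<bar>s (Suc (n + k)) - s (n + k)\<bar>)" for n
    by (rule summable_comparison_test'[OF sm[of n], of 0]) (use K[of "n + _"] in simp)
  have tel: "(\<Sum>k<m. s (Suc (n + k)) - s (n + k)) = s (n + m) - s n" for n m
    using sum_lessThan_telescope[of "\<lambda>k. s (n + k)" m] by simp
  have lim: "(\<lambda>m. s (n + m) - s n) \<longlonglongrightarrow> (\<Sum>k. s (Suc (n + k)) - s (n + k))" for n
    using summable_LIMSEQ[OF summable_rabs_cancel[OF sa[of n]]] by (simp add: tel)
  from tendsto_add[OF lim[of 0] tendsto_const[of "s 0"]] show c: "convergent s" by (auto simp: convergent_def)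
  have "(\<lambda>m. s (n + m) - s n) \<longlonglongrightarrow> lim s - s n"
    using LIMSEQ_ignore_initial_segment[OF convergent_LIMSEQ_iff[THEN iffD1, OF c], of n]
    by (intro tendsto_diff tendsto_const) (simp add: add.commute)
  then have "lim s - s n = (\<Sum>k. s (Suc (n + k)) - s (n + k))" by (rule LIMSEQ_unique[OF _ lim])
  also have "\<bar>\<dots>\<bar> \<le> (\<Sum>k. \<bar>s (Suc (n + k)) - s (n + k)\<bar>)" by (rule summable_rabs[OF sa])
  also have "\<dots> \<le> (\<Sum>k. K * \<rho> ^ (n + k))" by (intro suminf_le sa sm) (use K[of "n + _"] in simp)
  also have "\<dots> = K / (1 - \<rho>) * \<rho> ^ n"
  proof -
    have "(\<Sum>k. K * \<rho> ^ (n + k)) = (\<Sum>k. (K * \<rho> ^ n) * \<rho> ^ k)" by (simp add: power_add mult.assoc)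
    also have "\<dots> = (K * \<rho> ^ n) * (1 / (1 - \<rho>))" using \<rho> by (subst suminf_mult) (auto simp: suminf_geometric)
    finally show ?thesis by simp
  qed
  finally show "\<bar>lim s - s n\<bar> \<le> K / (1 - \<rho>) * \<rho> ^ n" .
qed

definition gr :: "nat \<Rightarrow> real \<times> real \<Rightarrow> real \<times> real" where
  "gr n p = (dn n (fst p), dn n (snd p))"

text \<open>The increments \<open>gD\<close> compare the value at a point of the \<open>n\<close>-th dyadic grid with those at its neighbours
  in the same grid (\<open>l = 0\<close>) or in the next one (\<open>l = 1\<close>).\<close>

definition gI :: "nat \<Rightarrow> nat \<Rightarrow> (int \<times> int \<times> int \<times> int \<times> nat) set" where
  "gI R n = {- (int R * 2 ^ n)..int R * 2 ^ n} \<times> {0..int R * 2 ^ n} \<times> {-1..1} \<times> {-1..1} \<times> {0..1}"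

definition gD :: "(nat \<Rightarrow> real \<times> real \<Rightarrow> 'b) \<Rightarrow> nat \<Rightarrow> int \<times> int \<times> int \<times> int \<times> nat \<Rightarrow> ('b::minus)" where
  "gD y n = (\<lambda>(i, j, a, b, l). y (n + l) (real_of_int (2 ^ l * i + a) / 2 ^ (n + l), real_of_int (2 ^ l * j + b) / 2 ^ (n + l))
      - y n (real_of_int i / 2 ^ n, real_of_int j / 2 ^ n))"

lemma floor_double:
  fixes x :: real
  shows "\<exists>a\<in>{-1..1}. \<lfloor>x * 2 ^ Suc n\<rfloor> = 2 ^ 1 * \<lfloor>x * 2 ^ n\<rfloor> + (a::int)"
proof -
  define z where "z = x * 2 ^ n"
  have "\<lfloor>2 * z\<rfloor> = 2 * \<lfloor>z\<rfloor> \<or> \<lfloor>2 * z\<rfloor> = 2 * \<lfloor>z\<rfloor> + 1" by linarith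
  then have "\<lfloor>2 * z\<rfloor> - 2 * \<lfloor>z\<rfloor> \<in> {-1..1} \<and> \<lfloor>2 * z\<rfloor> = 2 ^ 1 * \<lfloor>z\<rfloor> + (\<lfloor>2 * z\<rfloor> - 2 * \<lfloor>z\<rfloor>)" by auto
  moreover have "x * 2 ^ Suc n = 2 * z" by (simp add: z_def)
  ultimately show ?thesis unfolding z_def[symmetric] by metis
qed

lemma floor_close:
  fixes x x' :: real
  assumes "\<bar>x - x'\<bar> < 1 / 2 ^ n" shows "\<exists>a\<in>{-1..1}. \<lfloor>x' * 2 ^ n\<rfloor> = 2 ^ 0 * \<lfloor>x * 2 ^ n\<rfloor> + (a::int)"
proof -
  have "\<bar>x * 2 ^ n - x' * 2 ^ n\<bar> < 1"
    using assms by (simp add: pos_less_divide_eq abs_mult flip: left_diff_distrib)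
  then have "\<bar>\<lfloor>x' * 2 ^ n\<rfloor> - \<lfloor>x * 2 ^ n\<rfloor>\<bar> \<le> 1" by linarith
  then have "\<lfloor>x' * 2 ^ n\<rfloor> - \<lfloor>x * 2 ^ n\<rfloor> \<in> {-1..1} \<and> \<lfloor>x' * 2 ^ n\<rfloor> = 2 ^ 0 * \<lfloor>x * 2 ^ n\<rfloor> + (\<lfloor>x' * 2 ^ n\<rfloor> - \<lfloor>x * 2 ^ n\<rfloor>)" by auto
  then show ?thesis by blast
qed

lemma gr_step:
  fixes y :: "nat \<Rightarrow> real \<times> real \<Rightarrow> real"
  assumes K: "\<forall>n. \<forall>i\<in>gI R n. \<bar>gD y n i\<bar> \<le> K * \<rho> ^ n" and p: "\<bar>fst p\<bar> \<le> real R" "0 \<le> snd p" "snd p \<le> real R"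
    and l: "l \<le> 1"
    and a: "a \<in> {-1..1}" "\<lfloor>fst p' * 2 ^ (n + l)\<rfloor> = 2 ^ l * \<lfloor>fst p * 2 ^ n\<rfloor> + a"
    and b: "b \<in> {-1..1}" "\<lfloor>snd p' * 2 ^ (n + l)\<rfloor> = 2 ^ l * \<lfloor>snd p * 2 ^ n\<rfloor> + b"
  shows "\<bar>y (n + l) (gr (n + l) p') - y n (gr n p)\<bar> \<le> K * \<rho> ^ n"
proof -
  have "- (real R * 2 ^ n) \<le> fst p * 2 ^ n" "fst p * 2 ^ n \<le> real R * 2 ^ n" "snd p * 2 ^ n \<le> real R * 2 ^ n" "0 \<le> snd p * 2 ^ n"
    using p mult_right_mono[of "- real R" "fst p" "2 ^ n"] by auto
  from this[THEN floor_mono] have "- (int R * 2 ^ n) \<le> \<lfloor>fst p * 2 ^ n\<rfloor>" "\<lfloor>fst p * 2 ^ n\<rfloor> \<le> int R * 2 ^ n"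
      "\<lfloor>snd p * 2 ^ n\<rfloor> \<le> int R * 2 ^ n" "0 \<le> \<lfloor>snd p * 2 ^ n\<rfloor>"
    using floor_of_int[of "- (int R * 2 ^ n)", where ?'a=real] floor_of_int[of "int R * 2 ^ n", where ?'a=real] by simp_all
  then have "(\<lfloor>fst p * 2 ^ n\<rfloor>, \<lfloor>snd p * 2 ^ n\<rfloor>, a, b, l) \<in> gI R n"
    using a(1) b(1) l by (auto simp: gI_def)
  from K[rule_format, OF this] show ?thesis
    unfolding gD_def gr_def dn_def a(2) b(2) by simp
qed

lemma dyadic_chaining:
  fixes y :: "nat \<Rightarrow> real \<times> real \<Rightarrow> real"
  assumes \<rho>: "0 \<le> \<rho>" "\<rho> < 1" and y: "\<And>R. \<exists>K. \<forall>n. \<forall>i\<in>gI R n. \<bar>gD y n i\<bar> \<le> K * \<rho> ^ n"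
  shows "\<And>p. 0 \<le> snd p \<Longrightarrow> convergent (\<lambda>n. y n (gr n p))"
    and "continuous_on (UNIV \<times> {0..}) (\<lambda>p. lim (\<lambda>n. y n (gr n p)))"
proof -
  have step: "\<bar>y (Suc n) (gr (Suc n) p) - y n (gr n p)\<bar> \<le> K * \<rho> ^ n"
    if K: "\<forall>n. \<forall>i\<in>gI R n. \<bar>gD y n i\<bar> \<le> K * \<rho> ^ n" and p: "\<bar>fst p\<bar> \<le> real R" "0 \<le> snd p" "snd p \<le> real R" for R K p n
  proof -
    obtain a b :: int where "a \<in> {-1..1}" "\<lfloor>fst p * 2 ^ Suc n\<rfloor> = 2 ^ 1 * \<lfloor>fst p * 2 ^ n\<rfloor> + a"
      "b \<in> {-1..1}" "\<lfloor>snd p * 2 ^ Suc n\<rfloor> = 2 ^ 1 * \<lfloor>snd p * 2 ^ n\<rfloor> + b"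
      using floor_double[of "fst p" n] floor_double[of "snd p" n] by blast
    then show ?thesis using gr_step[OF K p, of 1 a p n b] by simp
  qed
  have bnd: "\<exists>R. \<bar>fst p\<bar> + 1 \<le> real R \<and> snd p + 1 \<le> real R" for p :: "real \<times> real"
    using real_arch_simple[of "max (\<bar>fst p\<bar> + 1) (snd p + 1)"] by auto
  show conv: "convergent (\<lambda>n. y n (gr n p))" if p: "0 \<le> snd p" for p
  proof -
    obtain R where R: "\<bar>fst p\<bar> + 1 \<le> real R" "snd p + 1 \<le> real R" using bnd by blast
    obtain K where "\<forall>n. \<forall>i\<in>gI R n. \<bar>gD y n i\<bar> \<le> K * \<rho> ^ n" using y by blast
    from step[OF this, of p] R p show ?thesis by (intro geometric_Cauchy(1)[OF \<rho>]) auto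
  qed
  show "continuous_on (UNIV \<times> {0..}) (\<lambda>p. lim (\<lambda>n. y n (gr n p)))"
    unfolding continuous_on_iff
  proof (intro ballI allI impI)
    fix p :: "real \<times> real" and e :: real assume pm: "p \<in> UNIV \<times> {0..}" and e: "0 < e"
    then have p: "0 \<le> snd p" by auto
    obtain R where R: "\<bar>fst p\<bar> + 1 \<le> real R" "snd p + 1 \<le> real R" using bnd by blast
    obtain K where K: "\<forall>n. \<forall>i\<in>gI R n. \<bar>gD y n i\<bar> \<le> K * \<rho> ^ n" using y by blast
    define L where "L = (\<lambda>p. lim (\<lambda>n. y n (gr n p)))"
    have L: "\<bar>L q - y n (gr n q)\<bar> \<le> K / (1 - \<rho>) * \<rho> ^ n" if "\<bar>fst q\<bar> \<le> real R" "0 \<le> snd q" "snd q \<le> real R" for q n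
      unfolding L_def using step[OF K that] by (intro geometric_Cauchy(2)[OF \<rho>]) auto
    have "(\<lambda>n. (2 * (K / (1 - \<rho>)) + K) * \<rho> ^ n) \<longlonglongrightarrow> (2 * (K / (1 - \<rho>)) + K) * 0"
      using \<rho> by (intro tendsto_intros LIMSEQ_power_zero) auto
    then have "\<forall>\<^sub>F n in sequentially. (2 * (K / (1 - \<rho>)) + K) * \<rho> ^ n < e" using e by (intro order_tendstoD) auto
    then obtain n where n: "(2 * (K / (1 - \<rho>)) + K) * \<rho> ^ n < e" by (auto dest: eventually_happens)
    show "\<exists>d>0. \<forall>q\<in>UNIV \<times> {0..}. dist q p < d \<longrightarrow> dist (lim (\<lambda>n. y n (gr n q))) (lim (\<lambda>n. y n (gr n p))) < e"
    proof (intro exI conjI ballI impI)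
      fix q :: "real \<times> real" assume q: "q \<in> UNIV \<times> {0..}" "dist q p < 1 / 2 ^ n"
      have "\<bar>fst p - fst q\<bar> \<le> dist q p" "\<bar>snd p - snd q\<bar> \<le> dist q p"
        using dist_fst_le[of q p] dist_snd_le[of q p] by (simp_all add: dist_real_def abs_minus_commute)
      then have d: "\<bar>fst p - fst q\<bar> < 1 / 2 ^ n" "\<bar>snd p - snd q\<bar> < 1 / 2 ^ n" using q(2) by auto
      moreover have "1 / 2 ^ n \<le> (1::real)" by simp
      ultimately have qR: "\<bar>fst q\<bar> \<le> real R" "0 \<le> snd q" "snd q \<le> real R" using R q(1) by (simp_all only: mem_Times_iff atLeast_iff)
      obtain a b :: int where "a \<in> {-1..1}" "\<lfloor>fst q * 2 ^ n\<rfloor> = 2 ^ 0 * \<lfloor>fst p * 2 ^ n\<rfloor> + a"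
        "b \<in> {-1..1}" "\<lfloor>snd q * 2 ^ n\<rfloor> = 2 ^ 0 * \<lfloor>snd p * 2 ^ n\<rfloor> + b"
        using floor_close[OF d(1)] floor_close[OF d(2)] by blast
      then have "\<bar>y n (gr n q) - y n (gr n p)\<bar> \<le> K * \<rho> ^ n"
        using gr_step[OF K, of p 0 a q n b] R p by simp
      moreover have "\<bar>L q - y n (gr n q)\<bar> \<le> K / (1 - \<rho>) * \<rho> ^ n" by (rule L[OF qR])
      moreover have "\<bar>L p - y n (gr n p)\<bar> \<le> K / (1 - \<rho>) * \<rho> ^ n" using L[of p] R p by simp
      ultimately have "\<bar>L q - L p\<bar> \<le> (2 * (K / (1 - \<rho>)) + K) * \<rho> ^ n" by (simp add: distrib_right)
      then show "dist (lim (\<lambda>n. y n (gr n q))) (lim (\<lambda>n. y n (gr n p))) < e"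
        using n unfolding L_def dist_real_def by linarith
    qed simp
  qed
qed

definition Zn :: "nat \<Rightarrow> real \<times> real \<Rightarrow> real \<times> real \<Rightarrow> complex" where
  "Zn n p = tens (a\<alpha> (eps n) (fst p)) (a\<beta> (eps n) (snd p))"

definition Z0 :: "real \<times> real \<Rightarrow> real \<times> real \<Rightarrow> complex" where
  "Z0 p = tens (\<alpha>0 (fst p)) (\<beta>0 (snd p))"

definition Tn :: "nat \<Rightarrow> real \<times> real \<Rightarrow> real \<times> real \<Rightarrow> real" where
  "Tn n p = Top (a\<alpha> (eps n) (fst p)) (a\<beta> (eps n) (snd p))"

lemma sqi_Zn: "sqi lborel (Zn n p)"
  unfolding Zn_def by (intro sqi_tens sqi_a\<alpha> sqi_a\<beta> eps_pos)

lemma sqi_Z0: "sqi lborel (Z0 p)"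
  unfolding Z0_def by (intro sqi_tens sqi_\<alpha>0 sqi_\<beta>0)

lemma Tn_wbd: "\<exists>K. wbd K (Tn n p)"
  unfolding Tn_def using Top_wbd xadm_a\<alpha>[OF eps_pos] tadm_a\<beta>[OF eps_pos] by blast

lemma vh_Tn: "AE z in lborel. vh (Tn n p) z = Zn n p z"
  unfolding Tn_def Zn_def using vh_Top xadm_a\<alpha>[OF eps_pos] tadm_a\<beta>[OF eps_pos] by blast

definition GR :: "real \<Rightarrow> real" where "GR R = 16 * (ER R * AR R)"

lemma AR_ER_nonneg: "0 \<le> R \<Longrightarrow> 0 \<le> AR R" "0 \<le> ER R"
  using J0_nonneg by (auto simp: AR_def ER_def)

lemma Zn_diff_le:
  assumes "\<bar>fst p\<bar> \<le> R" "\<bar>snd p\<bar> \<le> R" "\<bar>fst q\<bar> \<le> R" "\<bar>snd q\<bar> \<le> R" "\<bar>fst p - fst q\<bar> \<le> eps n" "\<bar>snd p - snd q\<bar> \<le> eps n"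
  shows "n \<le> m \<Longrightarrow> ip lborel (\<lambda>z. Zn n p z - Zn m q z) (\<lambda>z. Zn n p z - Zn m q z) \<le> GR R * eps n"
    and "ip lborel (\<lambda>z. Zn n p z - Z0 q z) (\<lambda>z. Zn n p z - Z0 q z) \<le> GR R * eps n"
proof -
  have R: "0 \<le> R" using assms(1) by linarith
  have e: "0 \<le> ER R * eps n" using AR_ER_nonneg(2) eps_pos[of n] by (simp add: less_imp_le)
  note A = AR_ER_nonneg(1)[OF R]
  show "ip lborel (\<lambda>z. Zn n p z - Zn m q z) (\<lambda>z. Zn n p z - Zn m q z) \<le> GR R * eps n" if nm: "n \<le> m"
  proof -
    have "ip lborel (\<lambda>z. Zn n p z - Zn m q z) (\<lambda>z. Zn n p z - Zn m q z)
       \<le> 2 * ((4 * (ER R * eps n)) * AR R) + 2 * (AR R * (4 * (ER R * eps n)))"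
      unfolding Zn_def
    proof (rule order_trans[OF tens_diff_le])
      note b = ER_bounds(1)[OF assms(1,3,5) nm] AR_bounds(2)[OF assms(2), of n] AR_bounds(1)[OF assms(3), of m] ER_bounds(2)[OF assms(2,4,6) nm]
      show "2 * (ip lborel (\<lambda>z. a\<alpha> (eps n) (fst p) z - a\<alpha> (eps m) (fst q) z) (\<lambda>z. a\<alpha> (eps n) (fst p) z - a\<alpha> (eps m) (fst q) z)
          * ip lborel (a\<beta> (eps n) (snd p)) (a\<beta> (eps n) (snd p)))
        + 2 * (ip lborel (a\<alpha> (eps m) (fst q)) (a\<alpha> (eps m) (fst q))
          * ip lborel (\<lambda>z. a\<beta> (eps n) (snd p) z - a\<beta> (eps m) (snd q) z) (\<lambda>z. a\<beta> (eps n) (snd p) z - a\<beta> (eps m) (snd q) z))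
        \<le> 2 * ((4 * (ER R * eps n)) * AR R) + 2 * (AR R * (4 * (ER R * eps n)))"
        by (rule add_mono; rule mult_left_mono; (rule mult_mono)?; (rule b ip_nonneg)?) (use A e in simp_all)
    qed (rule sqi_a\<alpha> sqi_a\<beta> eps_pos)+
    then show ?thesis by (simp add: GR_def algebra_simps)
  qed
  have "ip lborel (\<lambda>z. Zn n p z - Z0 q z) (\<lambda>z. Zn n p z - Z0 q z)
       \<le> 2 * ((ER R * eps n) * AR R) + 2 * (AR R * (ER R * eps n))"
    unfolding Zn_def Z0_def
  proof (rule order_trans[OF tens_diff_le])
    note b = ER_bounds0(1)[OF assms(1,5)] AR_bounds(2)[OF assms(2), of n] AR_bounds(3)[OF assms(3)] ER_bounds0(2)[OF assms(2,6)]
    show "2 * (ip lborel (\<lambda>z. a\<alpha> (eps n) (fst p) z - \<alpha>0 (fst q) z) (\<lambda>z. a\<alpha> (eps n) (fst p) z - \<alpha>0 (fst q) z)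
        * ip lborel (a\<beta> (eps n) (snd p)) (a\<beta> (eps n) (snd p)))
      + 2 * (ip lborel (\<alpha>0 (fst q)) (\<alpha>0 (fst q))
        * ip lborel (\<lambda>z. a\<beta> (eps n) (snd p) z - \<beta>0 (snd q) z) (\<lambda>z. a\<beta> (eps n) (snd p) z - \<beta>0 (snd q) z))
      \<le> 2 * ((ER R * eps n) * AR R) + 2 * (AR R * (ER R * eps n))"
      by (rule add_mono; rule mult_left_mono; (rule mult_mono)?; (rule b ip_nonneg)?) (use A e in simp_all)
  qed (rule sqi_a\<alpha> sqi_a\<beta> sqi_\<alpha>0 sqi_\<beta>0 eps_pos)+
  also have "\<dots> \<le> GR R * eps n"
    using mult_nonneg_nonneg[OF A e] by (simp add: GR_def algebra_simps)
  finally show "ip lborel (\<lambda>z. Zn n p z - Z0 q z) (\<lambda>z. Zn n p z - Z0 q z) \<le> GR R * eps n" .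
qed

lemma dn_bounds: "\<bar>dn n x\<bar> \<le> \<bar>x\<bar> + 1" "\<bar>dn n x - x\<bar> \<le> eps n" "n \<le> m \<Longrightarrow> \<bar>dn n x - dn m x\<bar> \<le> eps n"
proof -
  have a: "dn n x \<le> x" "x < dn n x + eps n" for n using dn_le(1)[of n x] dn_le(2)[of x n] by (auto simp: eps_def)
  show "\<bar>dn n x\<bar> \<le> \<bar>x\<bar> + 1" "\<bar>dn n x - x\<bar> \<le> eps n" using a[of n] eps_le1[of n] by auto
  show "\<bar>dn n x - dn m x\<bar> \<le> eps n" if "n \<le> m" using a[of n] a[of m] eps_mono[OF that] by (auto simp: abs_le_iff)
qed

lemma Z0_ip:
  assumes "0 \<le> snd p" "0 \<le> snd q"
  shows "ip lborel (Z0 p) (Z0 q) / (2 * pi\<^sup>2) = rcov (fst p) (fst q) * min (snd p) (snd q)"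
  using assms by (simp add: Z0_def ip_tens sqi_\<alpha>0 sqi_\<beta>0 ip_\<alpha>0 ip_\<beta>0 rcov_eq power2_eq_square)

lemma root6_rho: "0 \<le> root 6 (2/3)" "root 6 (2/3) < 1"
  by simp_all

context she
begin

definition Yn :: "nat \<Rightarrow> real \<times> real \<Rightarrow> 'a \<Rightarrow> real" where
  "Yn n p = VU (Tn n p)"

lemma Yn_gspan: "Yn n p \<in> gspan"
  unfolding Yn_def using Tn_wbd VU_gspan by blast

lemma ip_VU_AE:
  assumes "wbd K \<Phi>" "wbd L \<Psi>" "sqi lborel f" "sqi lborel g" "AE z in lborel. vh \<Phi> z = f z" "AE z in lborel. vh \<Psi> z = g z"
  shows "ip M (VU \<Phi>) (VU \<Psi>) = ip lborel f g / (2 * pi\<^sup>2)"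
  using ip_VU[OF assms(1,2)] ip_cong_AE[OF vh_sqi(1)[OF assms(1)] assms(3) vh_sqi(1)[OF assms(2)] assms(4) assms(5,6)] by simp

lemma ip_Yn: "ip M (Yn n p) (Yn m q) = ip lborel (Zn n p) (Zn m q) / (2 * pi\<^sup>2)"
proof -
  obtain K L where "wbd K (Tn n p)" "wbd L (Tn m q)" using Tn_wbd by blast
  from ip_VU_AE[OF this sqi_Zn sqi_Zn vh_Tn vh_Tn] show ?thesis unfolding Yn_def .
qed

lemma ip_Yn_diff:
  "ip M (\<lambda>\<omega>. Yn n p \<omega> - Yn m q \<omega>) (\<lambda>\<omega>. Yn n p \<omega> - Yn m q \<omega>)
    = ip lborel (\<lambda>z. Zn n p z - Zn m q z) (\<lambda>z. Zn n p z - Zn m q z) / (2 * pi\<^sup>2)"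
  using ip_diff_self[OF gspan_sqi[OF Yn_gspan] gspan_sqi[OF Yn_gspan], of n p m q] ip_diff_self[OF sqi_Zn sqi_Zn, of n p m q]
  by (simp add: ip_Yn add_divide_distrib diff_divide_distrib)

lemma ip_Yn_diff_le:
  assumes "\<bar>fst p\<bar> \<le> R" "\<bar>snd p\<bar> \<le> R" "\<bar>fst q\<bar> \<le> R" "\<bar>snd q\<bar> \<le> R" "\<bar>fst p - fst q\<bar> \<le> eps n" "\<bar>snd p - snd q\<bar> \<le> eps n"
    "n \<le> m"
  shows "ip M (\<lambda>\<omega>. Yn n p \<omega> - Yn m q \<omega>) (\<lambda>\<omega>. Yn n p \<omega> - Yn m q \<omega>) \<le> GR R * eps n"
proof -
  have "1 \<le> 2 * pi\<^sup>2" using power_mono[OF pi_ge_1(1), of 2] by simp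
  then have "ip lborel (\<lambda>z. Zn n p z - Zn m q z) (\<lambda>z. Zn n p z - Zn m q z) / (2 * pi\<^sup>2)
      \<le> ip lborel (\<lambda>z. Zn n p z - Zn m q z) (\<lambda>z. Zn n p z - Zn m q z) / 1"
    by (intro divide_left_mono ip_nonneg) auto
  then show ?thesis unfolding ip_Yn_diff using Zn_diff_le(1)[OF assms] by linarith
qed

lemma Yn_chain: "AE \<omega> in M. \<exists>K. \<forall>n. \<forall>i\<in>gI R n. \<bar>gD (\<lambda>n p. Yn n p \<omega>) n i\<bar> \<le> K * root 6 (2/3) ^ n"
proof (rule Gaussian_increments_bound[where c="18 * ((2 * real R + 1) * (real R + 1))" and C="GR (real R + 1)"])
  fix n :: nat
  show "finite (gI R n)" by (simp add: gI_def)
  have c: "real (card {- (int R * 2 ^ n)..int R * 2 ^ n}) \<le> (2 * real R + 1) * 2 ^ n" "real (card {0..int R * 2 ^ n}) \<le> (real R + 1) * 2 ^ n"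
    by (auto simp: algebra_simps)
  have "real (card (gI R n)) = real (card {- (int R * 2 ^ n)..int R * 2 ^ n}) * real (card {0..int R * 2 ^ n}) * 18"
    unfolding gI_def card_cartesian_product by simp
  also have "\<dots> \<le> ((2 * real R + 1) * 2 ^ n) * ((real R + 1) * 2 ^ n) * 18"
    using c by (intro mult_right_mono mult_mono) auto
  also have "\<dots> = 18 * ((2 * real R + 1) * (real R + 1)) * (2 ^ n * 2 ^ n)" by simp
  also have "(2::real) ^ n * 2 ^ n = 4 ^ n" by (simp flip: power_mult_distrib)
  finally show "real (card (gI R n)) \<le> 18 * ((2 * real R + 1) * (real R + 1)) * 4 ^ n" .
next
  fix n and k :: "int \<times> int \<times> int \<times> int \<times> nat" assume k: "k \<in> gI R n"
  obtain i j a b l where k_eq: "k = (i, j, a, b, l)" by (cases k)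
  define p where "p = (real_of_int i / 2 ^ n, real_of_int j / 2 ^ n)"
  define q where "q = (real_of_int (2 ^ l * i + a) / 2 ^ (n + l), real_of_int (2 ^ l * j + b) / 2 ^ (n + l))"
  show "(\<lambda>\<omega>. gD (\<lambda>n p. Yn n p \<omega>) n k) \<in> gspan"
    unfolding k_eq gD_def split by (intro gspan_diff Yn_gspan)
  have l: "l = 0 \<or> l = 1" and ab: "\<bar>a\<bar> \<le> 1" "\<bar>b\<bar> \<le> 1" and ij: "\<bar>i\<bar> \<le> int R * 2 ^ n" "\<bar>j\<bar> \<le> int R * 2 ^ n"
    using k by (auto simp: k_eq gI_def)
  have sm: "\<bar>real_of_int c / 2 ^ (n + l)\<bar> \<le> eps n" if "\<bar>c\<bar> \<le> 1" for c
  proof -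
    have "\<bar>real_of_int c / 2 ^ (n + l)\<bar> \<le> 1 / 2 ^ (n + l)"
      using that by (simp add: divide_le_cancel)
    also have "\<dots> \<le> eps n" using eps_mono[of n "n + l"] by (simp add: eps_def)
    finally show ?thesis .
  qed
  have q: "q = (fst p + real_of_int a / 2 ^ (n + l), snd p + real_of_int b / 2 ^ (n + l))"
    by (simp add: q_def p_def add_divide_distrib power_add)
  have big: "\<bar>real_of_int c / 2 ^ n\<bar> \<le> real R" if "\<bar>c\<bar> \<le> int R * 2 ^ n" for c
  proof -
    have "real_of_int \<bar>c\<bar> \<le> real_of_int (int R * 2 ^ n)" using that by (simp only: of_int_le_iff)
    then show ?thesis by (simp add: pos_divide_le_eq)
  qed
  have "ip M (\<lambda>\<omega>. gD (\<lambda>n p. Yn n p \<omega>) n k) (\<lambda>\<omega>. gD (\<lambda>n p. Yn n p \<omega>) n k)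
      = ip M (\<lambda>\<omega>. Yn n p \<omega> - Yn (n + l) q \<omega>) (\<lambda>\<omega>. Yn n p \<omega> - Yn (n + l) q \<omega>)"
    unfolding k_eq gD_def split p_def q_def by (rule ip_diff_commute)
  also have "\<dots> \<le> GR (real R + 1) * eps n"
  proof (rule ip_Yn_diff_le)
    note b = big[OF ij(1)] big[OF ij(2)] sm[OF ab(1)] sm[OF ab(2)] eps_le1[of n]
    have pf: "fst p = real_of_int i / 2 ^ n" "snd p = real_of_int j / 2 ^ n" by (simp_all add: p_def)
    have qf: "fst q = fst p + real_of_int a / 2 ^ (n + l)" "snd q = snd p + real_of_int b / 2 ^ (n + l)" by (simp_all add: q)
    show "\<bar>fst p\<bar> \<le> real R + 1" using b unfolding pf by linarith
    show "\<bar>snd p\<bar> \<le> real R + 1" using b unfolding pf by linarith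
    show "\<bar>fst q\<bar> \<le> real R + 1" using b unfolding qf pf by linarith
    show "\<bar>snd q\<bar> \<le> real R + 1" using b unfolding qf pf by linarith
    show "\<bar>fst p - fst q\<bar> \<le> eps n" using b unfolding qf by linarith
    show "\<bar>snd p - snd q\<bar> \<le> eps n" using b unfolding qf by linarith
  qed simp
  finally show "ip M (\<lambda>\<omega>. gD (\<lambda>n p. Yn n p \<omega>) n k) (\<lambda>\<omega>. gD (\<lambda>n p. Yn n p \<omega>) n k) \<le> GR (real R + 1) / 2 ^ n"
    by (simp add: eps_def)
qed (use AR_ER_nonneg in \<open>simp add: GR_def\<close>)

definition Bn :: "real \<times> real \<Rightarrow> 'a \<Rightarrow> real" where
  "Bn p \<omega> = (if 0 \<le> snd p then lim (\<lambda>n. Yn n (gr n p) \<omega>) else 0)"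

lemma Bn_cont: "AE \<omega> in M. (\<forall>p. 0 \<le> snd p \<longrightarrow> (\<lambda>n. Yn n (gr n p) \<omega>) \<longlonglongrightarrow> Bn p \<omega>)
    \<and> continuous_on (UNIV \<times> {0..}) (\<lambda>p. Bn p \<omega>)"
proof -
  have "AE \<omega> in M. \<forall>R. \<exists>K. \<forall>n. \<forall>i\<in>gI R n. \<bar>gD (\<lambda>n p. Yn n p \<omega>) n i\<bar> \<le> K * root 6 (2/3) ^ n"
    using Yn_chain by (simp add: AE_all_countable)
  then show ?thesis
  proof eventually_elim
    fix \<omega> assume "\<forall>R. \<exists>K. \<forall>n. \<forall>i\<in>gI R n. \<bar>gD (\<lambda>n p. Yn n p \<omega>) n i\<bar> \<le> K * root 6 (2/3) ^ n"
    note c = dyadic_chaining[OF root6_rho, of "\<lambda>n p. Yn n p \<omega>", OF spec[OF this]]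
    have "(\<lambda>n. Yn n (gr n p) \<omega>) \<longlonglongrightarrow> Bn p \<omega>" if "0 \<le> snd p" for p
      using c(1)[OF that] that by (simp add: Bn_def convergent_LIMSEQ_iff)
    moreover have "continuous_on (UNIV \<times> {0..}) (\<lambda>p. Bn p \<omega>)"
      using c(2) by (rule continuous_on_eq) (auto simp: Bn_def)
    ultimately show "(\<forall>p. 0 \<le> snd p \<longrightarrow> (\<lambda>n. Yn n (gr n p) \<omega>) \<longlonglongrightarrow> Bn p \<omega>) \<and> continuous_on (UNIV \<times> {0..}) (\<lambda>p. Bn p \<omega>)"
      by blast
  qed
qed

lemma Yn_gr_measurable: "(\<lambda>(p, \<omega>). Yn n (gr n p) \<omega>) \<in> borel_measurable (lborel \<Otimes>\<^sub>M M)"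
proof -
  define f where "f ij pw = Yn n (real_of_int (fst ij) / 2 ^ n, real_of_int (snd ij) / 2 ^ n) (snd pw)" for ij :: "int \<times> int" and pw :: "(real \<times> real) \<times> 'a"
  define g where "g pw = (\<lfloor>fst (fst pw) * 2 ^ n\<rfloor>, \<lfloor>snd (fst pw) * 2 ^ n\<rfloor>)" for pw :: "(real \<times> real) \<times> 'a"
  have "(\<lambda>pw. f (g pw) pw) \<in> borel_measurable (lborel \<Otimes>\<^sub>M M)"
  proof (rule measurable_compose_countable)
    fix ij :: "int \<times> int"
    note [measurable] = gspan_meas[OF Yn_gspan]
    show "f ij \<in> borel_measurable (lborel \<Otimes>\<^sub>M M)" unfolding f_def by measurable
    have "(\<lambda>pw :: (real \<times> real) \<times> 'a. (\<lfloor>fst (fst pw) * 2 ^ n\<rfloor>, \<lfloor>snd (fst pw) * 2 ^ n\<rfloor>)) \<in> measurable (lborel \<Otimes>\<^sub>M M) (count_space UNIV \<Otimes>\<^sub>M count_space UNIV)"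
      by measurable
    then show "g \<in> measurable (lborel \<Otimes>\<^sub>M M) (count_space UNIV)"
      by (simp add: g_def[abs_def] pair_measure_countable)
  qed
  then show ?thesis by (simp add: f_def g_def gr_def dn_def split_beta')
qed

lemma Bn_measurable[measurable]: "(\<lambda>(p, \<omega>). Bn p \<omega>) \<in> borel_measurable (lborel \<Otimes>\<^sub>M M)"
proof -
  have [measurable]: "(\<lambda>pw. lim (\<lambda>n. (\<lambda>(p, \<omega>). Yn n (gr n p) \<omega>) pw)) \<in> borel_measurable (lborel \<Otimes>\<^sub>M M)"
    by (rule borel_measurable_lim_metric[OF Yn_gr_measurable])
  have "(\<lambda>(p, \<omega>). Bn p \<omega>) = (\<lambda>pw. if 0 \<le> snd (fst pw) then lim (\<lambda>n. (\<lambda>(p, \<omega>). Yn n (gr n p) \<omega>) pw) else 0)"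
    by (auto simp: fun_eq_iff Bn_def)
  also have "\<dots> \<in> borel_measurable (lborel \<Otimes>\<^sub>M M)" by measurable
  finally show ?thesis .
qed

lemma Bn_meas[measurable]: "Bn p \<in> borel_measurable M"
  using measurable_compose[OF measurable_Pair1' Bn_measurable, of p] by simp

lemma Bn_gspan: "Bn p \<in> gspan"
proof (cases "0 \<le> snd p")
  case True
  have "AE \<omega> in M. (\<lambda>n. Yn n (gr n p) \<omega>) \<longlonglongrightarrow> Bn p \<omega>" using Bn_cont by eventually_elim (use True in blast)
  then show ?thesis by (intro gspan_limit_AE[OF Yn_gspan Bn_meas])
next
  case False
  then show ?thesis using gspan_0 by (simp add: Bn_def[abs_def])
qed

lemma Bn_L2:
  assumes "0 \<le> snd p"
  shows "(\<lambda>n. ip M (\<lambda>\<omega>. Yn n (gr n p) \<omega> - Bn p \<omega>) (\<lambda>\<omega>. Yn n (gr n p) \<omega> - Bn p \<omega>)) \<longlonglongrightarrow> 0"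
    and "(\<lambda>n. ip lborel (\<lambda>z. Zn n (gr n p) z - Z0 p z) (\<lambda>z. Zn n (gr n p) z - Z0 p z)) \<longlonglongrightarrow> 0"
proof -
  define R where "R = \<bar>fst p\<bar> + \<bar>snd p\<bar> + 1"
  have b: "\<bar>fst (gr n p)\<bar> \<le> R" "\<bar>snd (gr n p)\<bar> \<le> R" "\<bar>fst p\<bar> \<le> R" "\<bar>snd p\<bar> \<le> R" for n
    using dn_bounds(1)[of n "fst p"] dn_bounds(1)[of n "snd p"] by (auto simp: gr_def R_def)
  have lim: "(\<lambda>n. GR R * eps n) \<longlonglongrightarrow> 0"
    using tendsto_mult_right_zero[OF half_pow_tendsto] by (simp add: eps_def)
  have "ip M (\<lambda>\<omega>. Yn n (gr n p) \<omega> - Bn p \<omega>) (\<lambda>\<omega>. Yn n (gr n p) \<omega> - Bn p \<omega>) \<le> GR R * eps n" for n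
  proof (rule sqi_Fatou(2)[where f="\<lambda>n. Yn n (gr n p)"])
    show "AE \<omega> in M. (\<lambda>n. Yn n (gr n p) \<omega>) \<longlonglongrightarrow> Bn p \<omega>" using Bn_cont by eventually_elim (use assms in blast)
    show "ip M (\<lambda>\<omega>. Yn n (gr n p) \<omega> - Yn m (gr m p) \<omega>) (\<lambda>\<omega>. Yn n (gr n p) \<omega> - Yn m (gr m p) \<omega>) \<le> GR R * eps n" if "n \<le> m" for n m
      using b dn_bounds(3)[OF that] that by (intro ip_Yn_diff_le) (auto simp: gr_def)
  qed (auto intro: gspan_sqi Yn_gspan)
  then show "(\<lambda>n. ip M (\<lambda>\<omega>. Yn n (gr n p) \<omega> - Bn p \<omega>) (\<lambda>\<omega>. Yn n (gr n p) \<omega> - Bn p \<omega>)) \<longlonglongrightarrow> 0"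
    by (intro tendsto_sandwich[OF _ _ tendsto_const lim]) (auto intro!: always_eventually ip_nonneg)
  have "ip lborel (\<lambda>z. Zn n (gr n p) z - Z0 p z) (\<lambda>z. Zn n (gr n p) z - Z0 p z) \<le> GR R * eps n" for n
    using b dn_bounds(2) by (intro Zn_diff_le) (auto simp: gr_def)
  then show "(\<lambda>n. ip lborel (\<lambda>z. Zn n (gr n p) z - Z0 p z) (\<lambda>z. Zn n (gr n p) z - Z0 p z)) \<longlonglongrightarrow> 0"
    by (intro tendsto_sandwich[OF _ _ tendsto_const lim]) (auto intro!: always_eventually ip_nonneg)
qed

lemma ip_Bn_VU:
  assumes "0 \<le> snd p" and w: "wbd K \<Phi>" and f: "sqi lborel f" "AE z in lborel. vh \<Phi> z = f z"
  shows "ip M (Bn p) (VU \<Phi>) = ip lborel (Z0 p) f / (2 * pi\<^sup>2)"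
proof -
  have "ip M (Bn p) (VU \<Phi>) = ip lborel (Z0 p) (\<lambda>z. (1 / (2 * pi\<^sup>2)) *\<^sub>R f z)"
  proof (rule ip_tendsto_eq[OF _ _ _ Bn_L2(1)[OF assms(1)] _ _ _ Bn_L2(2)[OF assms(1)]])
    fix n
    obtain L where L: "wbd L (Tn n (gr n p))" using Tn_wbd by blast
    show "ip M (Yn n (gr n p)) (VU \<Phi>) = ip lborel (Zn n (gr n p)) (\<lambda>z. (1 / (2 * pi\<^sup>2)) *\<^sub>R f z)"
      using ip_VU_AE[OF L w sqi_Zn f(1) vh_Tn f(2)] by (simp add: Yn_def ip_scale_right)
  qed (use VU_sqi(2)[OF w] f in \<open>auto intro!: gspan_sqi Yn_gspan Bn_gspan sqi_Zn sqi_Z0 sqi_scale\<close>)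
  then show ?thesis by (simp add: ip_scale_right)
qed

lemma ip_Bn:
  assumes "0 \<le> snd p" "0 \<le> snd q"
  shows "ip M (Bn p) (Bn q) = rcov (fst p) (fst q) * min (snd p) (snd q)"
proof -
  have "ip M (Bn p) (Bn q) = ip lborel (Z0 p) (\<lambda>z. (1 / (2 * pi\<^sup>2)) *\<^sub>R Z0 q z)"
  proof (rule ip_tendsto_eq[OF _ _ _ Bn_L2(1)[OF assms(1)] _ _ _ Bn_L2(2)[OF assms(1)]])
    fix n
    obtain L where L: "wbd L (Tn n (gr n p))" using Tn_wbd by blast
    show "ip M (Yn n (gr n p)) (Bn q) = ip lborel (Zn n (gr n p)) (\<lambda>z. (1 / (2 * pi\<^sup>2)) *\<^sub>R Z0 q z)"
      using ip_Bn_VU[OF assms(2) L sqi_Zn vh_Tn] by (simp add: Yn_def ip_scale_right ip_commute)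
  qed (auto intro!: gspan_sqi Yn_gspan Bn_gspan sqi_Zn sqi_Z0 sqi_scale)
  then show ?thesis by (simp add: ip_scale_right Z0_ip[OF assms, symmetric])
qed

lemma Bn_sheet: "brownian_sheet M Bn"
  unfolding brownian_sheet_def
proof (intro conjI allI impI)
  show "centered_gaussian M (\<lambda>\<omega>. \<Sum>p\<in>F. c p * Bn p \<omega>)" for F c
    by (intro gspan_gaussian gspan_sum gspan_scale Bn_gspan)
  show "(LINT \<omega>|M. Bn (x, s) \<omega> * Bn (y, t) \<omega>) = min s t * (if x * y > 0 then min \<bar>x\<bar> \<bar>y\<bar> else 0)"
    if "0 \<le> s \<and> 0 \<le> t" for x y s t
    using ip_Bn[of "(x, s)" "(y, t)"] that by (simp add: ip_def rcov_def)
  show "AE \<omega> in M. continuous_on (UNIV \<times> {0..}) (\<lambda>p. Bn p \<omega>)" using Bn_cont by (auto elim!: eventually_mono)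
qed

end

definition kB :: "(real \<Rightarrow> complex) \<Rightarrow> (real \<Rightarrow> real) \<Rightarrow> real \<times> real \<Rightarrow> real" where
  "kB \<alpha> \<beta> q = hx 1 \<alpha> (fst q) * (indicator {0<..} (snd q) * hc \<beta> (snd q))"

definition rB :: "real \<times> real \<Rightarrow> real" where
  "rB q = 2 * pi * (sqrt (1 + \<bar>fst q\<bar>) * sqrt (1 + \<bar>snd q\<bar>))"

lemma rB_pos: "0 < rB q"
  by (simp add: rB_def add_pos_nonneg)

lemma rB_measurable[measurable]: "rB \<in> borel_measurable borel"
  unfolding rB_def[abs_def] by measurable

lemma integrable_wt_rB: "integrable lborel (\<lambda>p. wt p * rB p)"
  using integrable_mult_right[OF integrable_lborel2[OF integrable_sqrt_wt integrable_sqrt_wt], of "2 * pi"]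
  by (simp add: wt_def rB_def mult_ac)

lemma kB_wbd:
  assumes a: "xadm \<alpha> K" and b: "tadm \<beta> L" shows "wbd (K * L) (kB \<alpha> \<beta>)"
  unfolding wbd_def
proof (intro conjI allI)
  note [measurable] = xadm_meas[OF a] tadm_meas[OF b]
  show "kB \<alpha> \<beta> \<in> borel_measurable borel" unfolding kB_def[abs_def] by measurable
  fix p :: "real \<times> real"
  have "\<bar>indicator {0<..} (snd p) * hc \<beta> (snd p)\<bar> \<le> \<bar>hc \<beta> (snd p)\<bar>" by (simp add: indicator_def)
  then have "\<bar>indicator {0<..} (snd p) * hc \<beta> (snd p)\<bar> \<le> L / (1 + (snd p)\<^sup>2)"
    using hc_bound[OF b, of "snd p"] by linarith
  then show "\<bar>kB \<alpha> \<beta> p\<bar> \<le> K * L * wt p"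
    unfolding kB_def by (intro prod_wt_bound hx_bound[OF a]) auto
qed

lemma Z0_measurable: "(\<lambda>(q, z). Z0 q z) \<in> borel_measurable (lborel \<Otimes>\<^sub>M lborel)"
  unfolding Z0_def[abs_def] tens_def \<alpha>0_def \<beta>0_def split_beta' by measurable

lemma ip_Z0_le: "ip lborel (Z0 q) (Z0 q) \<le> (rB q)\<^sup>2"
proof -
  have "ip lborel (Z0 q) (Z0 q) = (2 * pi * \<bar>fst q\<bar>) * ip lborel (\<beta>0 (snd q)) (\<beta>0 (snd q))"
    by (simp add: Z0_def ip_tens sqi_\<alpha>0 sqi_\<beta>0 ip_\<alpha>0)
  also have "\<dots> \<le> (2 * pi * (1 + \<bar>fst q\<bar>)) * (2 * pi * (1 + \<bar>snd q\<bar>))"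
    using ip_\<beta>0_self_le[of "snd q"] by (intro mult_mono ip_nonneg) (auto simp: algebra_simps intro: order_trans)
  also have "\<dots> = (rB q)\<^sup>2" by (simp add: rB_def power_mult_distrib) (simp add: power2_eq_square)
  finally show ?thesis .
qed

lemma hx_\<alpha>0:
  assumes a: "xadm \<alpha> K" and z: "\<xi> \<noteq> 0"
  shows "integrable lborel (\<lambda>y. of_real (hx 1 \<alpha> y) * \<alpha>0 y \<xi>)" "(LINT y|lborel. of_real (hx 1 \<alpha> y) * \<alpha>0 y \<xi>) = - \<alpha> \<xi>"
proof -
  have h: "integrable lborel (\<lambda>y. complex_of_real (hx 1 \<alpha> y))" using hx_integrable[OF a, of 1] by simp
  have i: "integrable lborel (\<lambda>y. complex_of_real (hx 1 \<alpha> y) * cis (- (\<eta> * y)))" for \<eta>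
    by (intro integrable_mult_bounded[OF h, of _ 1]) (auto intro!: measurable_compose[OF _ cis_measurable])
  have e: "of_real (hx 1 \<alpha> y) * \<alpha>0 y \<xi> = (of_real (hx 1 \<alpha> y) * cis (- (0 * y)) - of_real (hx 1 \<alpha> y) * cis (- (\<xi> * y))) / (\<i> * of_real \<xi>)" for y
    by (simp add: \<alpha>0_def algebra_simps diff_divide_distrib)
  show "integrable lborel (\<lambda>y. of_real (hx 1 \<alpha> y) * \<alpha>0 y \<xi>)"
    unfolding e by (intro integrable_divide Bochner_Integration.integrable_diff i)
  have "(LINT y|lborel. of_real (hx 1 \<alpha> y) * \<alpha>0 y \<xi>)
      = ((LINT y|lborel. of_real (hx 1 \<alpha> y) * cis (- (0 * y))) - (LINT y|lborel. of_real (hx 1 \<alpha> y) * cis (- (\<xi> * y)))) / (\<i> * of_real \<xi>)"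
    unfolding e by (simp only: integral_divide_zero Bochner_Integration.integral_diff[OF i i])
  also have "\<dots> = - \<alpha> \<xi>" using hx_FT[OF a, of 1 0] hx_FT[OF a, of 1 \<xi>] z by simp
  finally show "(LINT y|lborel. of_real (hx 1 \<alpha> y) * \<alpha>0 y \<xi>) = - \<alpha> \<xi>" .
qed

lemma hc_\<beta>0:
  assumes b: "tadm \<beta> L" and z: "\<tau> \<noteq> 0"
  shows "integrable lborel (\<lambda>s. indicator {0<..} s * hc \<beta> s * \<beta>0 s \<tau>)" "(LINT s|lborel. indicator {0<..} s * hc \<beta> s * \<beta>0 s \<tau>) = - \<beta> \<tau>"
proof -
  have h: "integrable lborel (\<lambda>s. indicator {0<..} s * hc \<beta> s)"
    using integrable_mult_indicator[OF _ hc_integrable[OF b], of "{0<..}"] by simp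
  have i: "integrable lborel (\<lambda>s. indicator {0<..} s * (hc \<beta> s * cos (\<eta> * s)))" for \<eta>
    using integrable_mult_bounded[OF h, of "\<lambda>s. cos (\<eta> * s)" 1] by (simp add: mult.assoc)
  have e: "indicator {0<..} s * hc \<beta> s * \<beta>0 s \<tau> = (indicator {0<..} s * (hc \<beta> s * cos (0 * s)) - indicator {0<..} s * (hc \<beta> s * cos (\<tau> * s))) / \<tau>" for s
    by (simp add: \<beta>0_def algebra_simps diff_divide_distrib)
  show "integrable lborel (\<lambda>s. indicator {0<..} s * hc \<beta> s * \<beta>0 s \<tau>)"
    unfolding e by (intro integrable_divide Bochner_Integration.integrable_diff i)
  have "(LINT s|lborel. indicator {0<..} s * hc \<beta> s * \<beta>0 s \<tau>)
      = ((LINT s|lborel. indicator {0<..} s * (hc \<beta> s * cos (0 * s))) - (LINT s|lborel. indicator {0<..} s * (hc \<beta> s * cos (\<tau> * s)))) / \<tau>"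
    unfolding e by (simp only: integral_divide_zero Bochner_Integration.integral_diff[OF i i])
  also have "\<dots> = - \<beta> \<tau>" unfolding hc_FT[OF b] using z by simp
  finally show "(LINT s|lborel. indicator {0<..} s * hc \<beta> s * \<beta>0 s \<tau>) = - \<beta> \<tau>" .
qed

lemma kB_Z0:
  assumes a: "xadm \<alpha> K" and b: "tadm \<beta> L" and z: "fst z \<noteq> 0" "snd z \<noteq> 0"
  shows "(LINT q|lborel. kB \<alpha> \<beta> q *\<^sub>R Z0 q z) = tens \<alpha> \<beta> z"
proof -
  have "(LINT q|lborel. kB \<alpha> \<beta> q *\<^sub>R Z0 q z)
    = (LINT q|lborel. (of_real (hx 1 \<alpha> (fst q)) * \<alpha>0 (fst q) (fst z)) * of_real (indicator {0<..} (snd q) * hc \<beta> (snd q) * \<beta>0 (snd q) (snd z)))"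
    by (simp add: kB_def Z0_def tens_def scaleR_conv_of_real mult_ac)
  also have "\<dots> = (LINT y|lborel. of_real (hx 1 \<alpha> y) * \<alpha>0 y (fst z)) * (LINT s|lborel. complex_of_real (indicator {0<..} s * hc \<beta> s * \<beta>0 s (snd z)))"
    by (rule integral_lborel2[OF hx_\<alpha>0(1)[OF a z(1)] integrable_of_real[OF hc_\<beta>0(1)[OF b z(2)]]])
  also have "\<dots> = tens \<alpha> \<beta> z"
    unfolding hx_\<alpha>0(2)[OF a z(1)] integral_complex_of_real hc_\<beta>0(2)[OF b z(2)] by (simp add: tens_def scaleR_conv_of_real)
  finally show ?thesis .
qed

lemma ip_kB_Z0:
  assumes a: "xadm \<alpha> K" and b: "tadm \<beta> L" and y: "sqi lborel y"
  shows "(LINT q|lborel. kB \<alpha> \<beta> q * ip lborel (Z0 q) y) = ip lborel (tens \<alpha> \<beta>) y"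
proof -
  note w = kB_wbd[OF a b]
  note [measurable] = xadm_meas[OF a] tadm_meas[OF b] wbd_meas[OF w] sqi_meas[OF y]
  note s = sqi_integral[OF sigma_finite_lborel sigma_finite_lborel Z0_measurable sqi_Z0 ip_Z0_le rB_pos _ _ wbd_integrable[OF w integrable_wt_rB _ less_imp_le[OF rB_pos]]]
  have m: "kB \<alpha> \<beta> \<in> borel_measurable lborel" "rB \<in> borel_measurable lborel" "rB \<in> borel_measurable borel" by measurable
  have "(LINT q|lborel. kB \<alpha> \<beta> q * ip lborel (Z0 q) y) = ip lborel (\<lambda>z. LINT q|lborel. kB \<alpha> \<beta> q *\<^sub>R Z0 q z) y"
    using s(3)[OF m y] by simp
  also have "\<dots> = ip lborel (tens \<alpha> \<beta>) y"
    unfolding ip_def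
  proof (rule integral_cong_AE)
    note [measurable] = sqi_meas[OF s(2)[OF m]]
    show "(\<lambda>z. (LINT q|lborel. kB \<alpha> \<beta> q *\<^sub>R Z0 q z) \<bullet> y z) \<in> borel_measurable lborel" by measurable
    show "(\<lambda>z. tens \<alpha> \<beta> z \<bullet> y z) \<in> borel_measurable lborel" unfolding tens_def by measurable
    show "AE z in lborel. (LINT q|lborel. kB \<alpha> \<beta> q *\<^sub>R Z0 q z) \<bullet> y z = tens \<alpha> \<beta> z \<bullet> y z"
      using AE_lborel2_nonzero by eventually_elim (simp add: kB_Z0[OF a b])
  qed
  finally show ?thesis .
qed

context she
begin

lemma ip_Bn_le: "ip M (Bn q) (Bn q) \<le> (rB q)\<^sup>2"
proof (cases "0 \<le> snd q")
  case True
  have "ip M (Bn q) (Bn q) = \<bar>fst q\<bar> * \<bar>snd q\<bar>" using ip_Bn[OF True True] True by (simp add: rcov_eq)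
  also have "\<dots> \<le> (2 * pi * (1 + \<bar>fst q\<bar>)) * (2 * pi * (1 + \<bar>snd q\<bar>))"
  proof -
    have "\<bar>c\<bar> \<le> 2 * pi * (1 + \<bar>c\<bar>)" for c :: real
      using mult_mono[of 1 "2 * pi" "\<bar>c\<bar>" "1 + \<bar>c\<bar>"] pi_ge_1(2) by simp
    then show ?thesis by (intro mult_mono) auto
  qed
  also have "\<dots> = (rB q)\<^sup>2" by (simp add: rB_def power_mult_distrib) (simp add: power2_eq_square)
  finally show ?thesis .
next
  case False
  then show ?thesis by (simp add: Bn_def[abs_def] ip_def)
qed

lemma VU_Top_eq:
  assumes a: "xadm \<alpha> K" and b: "tadm \<beta> L" and sa: "sqi lborel \<alpha>" and sb: "sqi lborel \<beta>"
  shows "AE \<omega> in M. VU (Top \<alpha> \<beta>) \<omega> = (LINT q|lborel. kB \<alpha> \<beta> q * Bn q \<omega>)"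
proof -
  define W where "W \<omega> = (LINT q|lborel. kB \<alpha> \<beta> q *\<^sub>R Bn q \<omega>)" for \<omega>
  note w = kB_wbd[OF a b]
  note [measurable] = wbd_meas[OF w]
  note s = sqi_integral[OF sigma_finite_lborel sigma_finite_measure_axioms Bn_measurable gspan_sqi[OF Bn_gspan] ip_Bn_le rB_pos _ _ wbd_integrable[OF w integrable_wt_rB _ less_imp_le[OF rB_pos]]]
  have m: "kB \<alpha> \<beta> \<in> borel_measurable lborel" "rB \<in> borel_measurable lborel" "rB \<in> borel_measurable borel" by measurable
  have W: "sqi M W" "\<And>Y. sqi M Y \<Longrightarrow> ip M W Y = (LINT q|lborel. kB \<alpha> \<beta> q * ip M (Bn q) Y)"
    using s(2)[OF m] s(3)[OF m] unfolding W_def[abs_def] by auto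
  define t where "t = tens \<alpha> \<beta>"
  have t: "sqi lborel t" unfolding t_def by (rule sqi_tens[OF sa sb])
  note wT = Top_wbd[OF a b]
  note vT = vh_Top[OF a b, folded t_def]
  have *: "(LINT q|lborel. kB \<alpha> \<beta> q * g q) = ip lborel t y / (2 * pi\<^sup>2)"
    if "\<And>q. 0 \<le> snd q \<Longrightarrow> g q = ip lborel (Z0 q) y / (2 * pi\<^sup>2)" "sqi lborel y" for g y
  proof -
    have "kB \<alpha> \<beta> q * g q = kB \<alpha> \<beta> q * ip lborel (Z0 q) y / (2 * pi\<^sup>2)" for q
      by (cases "0 \<le> snd q") (auto simp: kB_def that(1))
    then show ?thesis using ip_kB_Z0[OF a b that(2)] by (simp add: t_def)
  qed
  define V where "V = VU (Top \<alpha> \<beta>)"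
  have V: "sqi M V" unfolding V_def by (rule VU_sqi(2)[OF wT])
  have VV: "ip M V V = ip lborel t t / (2 * pi\<^sup>2)"
    unfolding V_def by (rule ip_VU_AE[OF wT wT t t vT vT])
  have WV: "ip M W V = ip lborel t t / (2 * pi\<^sup>2)"
    unfolding W(2)[OF V] by (intro * t) (simp add: V_def ip_Bn_VU[OF _ wT t vT])
  have WB: "ip M W (Bn q) = ip lborel t (Z0 q) / (2 * pi\<^sup>2)" if "0 \<le> snd q" for q
    unfolding W(2)[OF gspan_sqi[OF Bn_gspan]] using that
    by (intro * sqi_Z0) (simp add: ip_Bn Z0_ip)
  have WW: "ip M W W = ip lborel t t / (2 * pi\<^sup>2)"
    unfolding W(2)[OF W(1)] by (intro * t) (simp add: ip_commute[of _ "Bn _"] ip_commute[of _ "Z0 _"] WB)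
  have "ip M (\<lambda>\<omega>. V \<omega> - W \<omega>) (\<lambda>\<omega>. V \<omega> - W \<omega>) = 0"
    using ip_diff_self[OF V W(1)] VV WW WV ip_commute[of M V W] by simp
  then have "AE \<omega> in M. (norm (V \<omega> - W \<omega>))\<^sup>2 = 0"
    unfolding ip_self using sqi_diff[OF V W(1)] by (subst (asm) integral_nonneg_eq_0_iff_AE) (auto simp: sqi_def)
  then show ?thesis unfolding V_def W_def by (auto elim!: eventually_mono)
qed

end

section \<open>Test functions as superpositions of kernels\<close>

lemma has_real_derivative_integral:
  fixes F :: "'p \<Rightarrow> real \<Rightarrow> real"
  assumes F: "\<And>p y. (F p has_real_derivative F' p y) (at y)" and i: "\<And>y. integrable N (\<lambda>p. F p y)"
    and w: "\<And>p y. \<bar>F' p y\<bar> \<le> w p" "integrable N w"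
  shows "((\<lambda>y. LINT p|N. F p y) has_real_derivative (LINT p|N. F' p y)) (at y)"
  unfolding DERIV_def LIMSEQ_SEQ_conv[symmetric]
proof (intro allI impI, elim conjE)
  fix S :: "nat \<Rightarrow> real" assume S: "\<forall>n. S n \<noteq> 0" "S \<longlonglongrightarrow> 0"
  have lim: "(\<lambda>n. (F p (y + S n) - F p y) / S n) \<longlonglongrightarrow> F' p y" for p
    using F[of p y] S unfolding DERIV_def LIMSEQ_SEQ_conv[symmetric] by blast
  have m: "(\<lambda>p. (F p (y + S n) - F p y) / S n) \<in> borel_measurable N" for n
    by (intro borel_measurable_divide borel_measurable_diff borel_measurable_integrable[OF i]) simp
  have "(\<lambda>n. LINT p|N. (F p (y + S n) - F p y) / S n) \<longlonglongrightarrow> (LINT p|N. F' p y)"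
  proof (rule integral_dominated_convergence[OF _ m w(2)])
    show "(\<lambda>p. F' p y) \<in> borel_measurable N"
      by (rule borel_measurable_LIMSEQ_real[OF lim m])
    show "AE p in N. (\<lambda>n. (F p (y + S n) - F p y) / S n) \<longlonglongrightarrow> F' p y" using lim by simp
    show "AE p in N. norm ((F p (y + S n) - F p y) / S n) \<le> w p" for n
    proof (intro AE_I2)
      fix p
      have "norm (F p (y + S n) - F p y) \<le> w p * norm (y + S n - y)"
        by (rule field_differentiable_bound[of UNIV "F p" "F' p"]) (use F w(1) in auto)
      then show "norm ((F p (y + S n) - F p y) / S n) \<le> w p" using S(1) by (simp add: pos_divide_le_eq)
    qed
  qed
  then show "(\<lambda>n. ((LINT p|N. F p (y + S n)) - (LINT p|N. F p y)) / S n) \<longlonglongrightarrow> (LINT p|N. F' p y)"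
    by (simp add: Bochner_Integration.integral_diff[OF i i])
qed

lemma hx_real: "dec K (\<lambda>\<xi>. (\<i> * of_real \<xi>) ^ j * \<alpha> \<xi>) \<Longrightarrow>
    hx j \<alpha> y = (LINT \<xi>|lborel. Re ((\<i> * of_real \<xi>) ^ j * \<alpha> \<xi> * cis (\<xi> * y))) / (2 * pi)"
  unfolding hx_def FI_def by (subst integral_Re[OF FI_integrable[OF dec_integrable]]) auto

lemma hx_deriv:
  assumes a: "xadm \<alpha> K" and j: "j \<le> 1"
  shows "(hx j \<alpha> has_real_derivative hx (Suc j) \<alpha> y) (at y)"
proof -
  have d: "dec K (\<lambda>\<xi>. (\<i> * of_real \<xi>) ^ j * \<alpha> \<xi>)" "dec K (\<lambda>\<xi>. (\<i> * of_real \<xi>) ^ Suc j * \<alpha> \<xi>)"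
    using a j unfolding xadm_def by (auto simp del: power_Suc)
  have "((\<lambda>y. LINT \<xi>|lborel. Re ((\<i> * of_real \<xi>) ^ j * \<alpha> \<xi> * cis (\<xi> * y)))
      has_real_derivative (LINT \<xi>|lborel. Re ((\<i> * of_real \<xi>) ^ Suc j * \<alpha> \<xi> * cis (\<xi> * y)))) (at y)"
  proof (rule has_real_derivative_integral[where w="\<lambda>\<xi>. norm ((\<i> * of_real \<xi>) ^ Suc j * \<alpha> \<xi>)"])
    show "((\<lambda>y. Re ((\<i> * of_real \<xi>) ^ j * \<alpha> \<xi> * cis (\<xi> * y))) has_real_derivative
        Re ((\<i> * of_real \<xi>) ^ Suc j * \<alpha> \<xi> * cis (\<xi> * y))) (at y)" for \<xi> y
    proof -
      define c where "c = (\<i> * of_real \<xi>) ^ j * \<alpha> \<xi>"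
      have "((\<lambda>y. Re c * cos (\<xi> * y) - Im c * sin (\<xi> * y)) has_real_derivative
          Re c * (- sin (\<xi> * y) * \<xi>) - Im c * (cos (\<xi> * y) * \<xi>)) (at y)"
        by (auto intro!: derivative_eq_intros)
      moreover have "Re (c * cis (\<xi> * y)) = Re c * cos (\<xi> * y) - Im c * sin (\<xi> * y)" for y by simp
      moreover have "Re ((\<i> * of_real \<xi> * c) * cis (\<xi> * y)) = Re c * (- sin (\<xi> * y) * \<xi>) - Im c * (cos (\<xi> * y) * \<xi>)"
        by (simp add: algebra_simps)
      ultimately show ?thesis unfolding power_Suc mult.assoc[of "\<i> * of_real \<xi>"] c_def[symmetric] by (simp only:)
    qed
    show "integrable lborel (\<lambda>\<xi>. Re ((\<i> * of_real \<xi>) ^ j * \<alpha> \<xi> * cis (\<xi> * y)))" for y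
      using FI_integrable[OF dec_integrable[OF d(1)]] by (rule integrable_Re)
    show "\<bar>Re ((\<i> * of_real \<xi>) ^ Suc j * \<alpha> \<xi> * cis (\<xi> * y))\<bar> \<le> norm ((\<i> * of_real \<xi>) ^ Suc j * \<alpha> \<xi>)" for \<xi> y
      using abs_Re_le_cmod[of "(\<i> * of_real \<xi>) ^ Suc j * \<alpha> \<xi> * cis (\<xi> * y)"] by (simp add: norm_mult)
    show "integrable lborel (\<lambda>\<xi>. norm ((\<i> * of_real \<xi>) ^ Suc j * \<alpha> \<xi>))"
      using dec_integrable[OF d(2)] by (rule integrable_norm)
  qed
  from DERIV_cdivide[OF this, of "2 * pi"] show ?thesis
    unfolding hx_real[OF d(2)] hx_real[OF d(1), abs_def] .
qed

lemma hs_real: "dec K (\<lambda>\<tau>. of_real (\<bar>\<tau>\<bar> powr \<gamma> * \<beta> \<tau>)) \<Longrightarrow>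
    hs \<gamma> \<beta> t = (LINT \<tau>|lborel. \<bar>\<tau>\<bar> powr \<gamma> * \<beta> \<tau> * sin (\<tau> * t)) / pi"
  unfolding hs_def FI_def integral_Im[OF FI_integrable[OF dec_integrable], symmetric] by simp

lemma hc_real: "dec K (\<lambda>\<tau>. of_real (\<tau> * \<beta> \<tau>)) \<Longrightarrow>
    hc \<beta> t = (LINT \<tau>|lborel. \<tau> * \<beta> \<tau> * cos (\<tau> * t)) / pi"
  unfolding hc_def FI_def integral_Re[OF FI_integrable[OF dec_integrable], symmetric] by simp

lemma hs_deriv:
  assumes b: "tadm \<beta> K"
  shows "(hs 0 \<beta> has_real_derivative hc \<beta> t) (at t)"
proof -
  have d: "dec K (\<lambda>\<tau>. of_real (\<bar>\<tau>\<bar> powr 0 * \<beta> \<tau>))" "dec K (\<lambda>\<tau>. of_real (\<tau> * \<beta> \<tau>))"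
    using b unfolding tadm_def by auto
  have "((\<lambda>t. LINT \<tau>|lborel. \<bar>\<tau>\<bar> powr 0 * \<beta> \<tau> * sin (\<tau> * t))
      has_real_derivative (LINT \<tau>|lborel. \<tau> * \<beta> \<tau> * cos (\<tau> * t))) (at t)"
  proof (rule has_real_derivative_integral[where w="\<lambda>\<tau>. \<bar>\<tau> * \<beta> \<tau>\<bar>"])
    show "((\<lambda>t. \<bar>\<tau>\<bar> powr 0 * \<beta> \<tau> * sin (\<tau> * t)) has_real_derivative \<tau> * \<beta> \<tau> * cos (\<tau> * t)) (at t)" for \<tau> t
      unfolding tadm_powr0[OF b] by (auto intro!: derivative_eq_intros)
    show "integrable lborel (\<lambda>\<tau>. \<bar>\<tau>\<bar> powr 0 * \<beta> \<tau> * sin (\<tau> * t))" for t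
      using integrable_Im[OF FI_integrable[OF dec_integrable[OF d(1)]], of t] by simp
    show "\<bar>\<tau> * \<beta> \<tau> * cos (\<tau> * t)\<bar> \<le> \<bar>\<tau> * \<beta> \<tau>\<bar>" for \<tau> t by (simp add: abs_mult mult_left_le)
    show "integrable lborel (\<lambda>\<tau>. \<bar>\<tau> * \<beta> \<tau>\<bar>)"
      using integrable_norm[OF dec_integrable[OF d(2)]] by (simp only: norm_of_real)
  qed
  from DERIV_cdivide[OF this, of pi] show ?thesis
    unfolding hc_real[OF d(2)] hs_real[OF d(1), abs_def] .
qed

definition kadm :: "real \<Rightarrow> bool" where
  "kadm K \<longleftrightarrow> 0 \<le> K \<and> (\<forall>x. xadm (k\<alpha> x) (K * (1 + \<bar>x\<bar>)\<^sup>2)) \<and> (\<forall>x. tadm (k\<beta> x) (K * (1 + \<bar>x\<bar>)\<^sup>2))"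

definition KK :: real where "KK = (SOME K. kadm K)"

lemma KK: "kadm KK"
proof -
  obtain K where K: "0 \<le> K" "\<And>x. xadm (k\<alpha> x) (K * (1 + \<bar>x\<bar>)\<^sup>2)" using xadm_k\<alpha> by blast
  obtain L where L: "0 \<le> L" "\<And>x. tadm (k\<beta> x) (L * (1 + \<bar>x\<bar>)\<^sup>2)" using tadm_k\<beta> by blast
  have le: "K * (1 + \<bar>x\<bar>)\<^sup>2 \<le> (K + L) * (1 + \<bar>x\<bar>)\<^sup>2" "L * (1 + \<bar>x\<bar>)\<^sup>2 \<le> (K + L) * (1 + \<bar>x\<bar>)\<^sup>2" for x :: real
    using K(1) L(1) by (auto intro!: mult_right_mono)
  have "kadm (K + L)"
    unfolding kadm_def
  proof (intro conjI allI)
    show "xadm (k\<alpha> x) ((K + L) * (1 + \<bar>x\<bar>)\<^sup>2)" for x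
      using K(2)[of x] dec_mono[OF _ le(1)[of x]] unfolding xadm_def by blast
    show "tadm (k\<beta> x) ((K + L) * (1 + \<bar>x\<bar>)\<^sup>2)" for x
      using L(2)[of x] dec_mono[OF _ le(2)[of x]] unfolding tadm_def by blast
  qed (use K(1) L(1) in auto)
  then show ?thesis unfolding KK_def by (rule someI)
qed

lemma KK_nonneg: "0 \<le> KK" and xadm_KK: "xadm (k\<alpha> x) (KK * (1 + \<bar>x\<bar>)\<^sup>2)" and tadm_KK: "tadm (k\<beta> x) (KK * (1 + \<bar>x\<bar>)\<^sup>2)"
  using KK unfolding kadm_def by auto

lemma k\<alpha>_measurable[measurable]: "(\<lambda>(x, \<xi>). k\<alpha> x \<xi>) \<in> borel_measurable (borel \<Otimes>\<^sub>M borel)"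
  unfolding k\<alpha>_def by measurable

lemma k\<beta>_measurable[measurable]: "(\<lambda>(x, \<xi>). k\<beta> x \<xi>) \<in> borel_measurable (borel \<Otimes>\<^sub>M borel)"
  unfolding k\<beta>_def by measurable

lemma hx_k\<alpha>_measurable[measurable]: "(\<lambda>(x, y). hx j (k\<alpha> x) y) \<in> borel_measurable (borel \<Otimes>\<^sub>M borel)"
  unfolding hx_def FI_def k\<alpha>_def by measurable

lemma hs_k\<beta>_measurable[measurable]: "(\<lambda>(x, y). hs \<gamma> (k\<beta> x) y) \<in> borel_measurable (borel \<Otimes>\<^sub>M borel)"
  unfolding hs_def FI_def k\<beta>_def by measurable

lemma hc_k\<beta>_measurable[measurable]: "(\<lambda>(x, y). hc (k\<beta> x) y) \<in> borel_measurable (borel \<Otimes>\<^sub>M borel)"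
  unfolding hc_def FI_def k\<beta>_def by measurable

lemma hs0_k\<beta>: "hs 0 (k\<beta> t) s = hx 0 (k\<alpha> t) s - hx 0 (k\<alpha> t) (- s)"
proof -
  note a = xadm_dec[OF xadm_KK, of t]
  have i: "integrable lborel (\<lambda>\<xi>. Re (k\<alpha> t \<xi> * cis (\<xi> * s)))" for s
    using FI_integrable[OF dec_integrable[OF a]] by (rule integrable_Re)
  have h: "hx 0 (k\<alpha> t) s = (LINT \<xi>|lborel. Re (k\<alpha> t \<xi> * cis (\<xi> * s))) / (2 * pi)" for s
    using hx_real[of "KK * (1 + \<bar>t\<bar>)\<^sup>2" 0 "k\<alpha> t" s] a by simp
  have d: "dec (KK * (1 + \<bar>t\<bar>)\<^sup>2) (\<lambda>\<tau>. of_real (\<bar>\<tau>\<bar> powr 0 * k\<beta> t \<tau>))"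
    using tadm_KK[of t] unfolding tadm_def by auto
  have "hs 0 (k\<beta> t) s = (LINT \<tau>|lborel. k\<beta> t \<tau> * sin (\<tau> * s)) / pi"
    unfolding hs_real[OF d] tadm_powr0[OF tadm_KK] ..
  also have "(LINT \<tau>|lborel. k\<beta> t \<tau> * sin (\<tau> * s))
    = (LINT \<xi>|lborel. (Re (k\<alpha> t \<xi> * cis (\<xi> * s)) - Re (k\<alpha> t \<xi> * cis (\<xi> * (- s)))) / 2)"
  proof (intro Bochner_Integration.integral_cong refl)
    fix \<tau>
    have "Re (k\<alpha> t \<tau> * cis (\<tau> * s)) = cos (\<tau> * s - \<tau> * t) / (1 + \<tau>\<^sup>2)\<^sup>2" for s
      unfolding k\<alpha>_def Re_divide_of_real times_divide_eq_left cis_mult by (simp add: algebra_simps)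
    then show "k\<beta> t \<tau> * sin (\<tau> * s) = (Re (k\<alpha> t \<tau> * cis (\<tau> * s)) - Re (k\<alpha> t \<tau> * cis (\<tau> * (- s)))) / 2"
      unfolding k\<beta>_def by (simp only:) (simp add: cos_diff cos_add field_simps add_divide_distrib diff_divide_distrib)
  qed
  also have "\<dots> = ((LINT \<xi>|lborel. Re (k\<alpha> t \<xi> * cis (\<xi> * s))) - (LINT \<xi>|lborel. Re (k\<alpha> t \<xi> * cis (\<xi> * (- s))))) / 2"
    unfolding integral_divide_zero Bochner_Integration.integral_diff[OF i i] ..
  finally show ?thesis unfolding h by (simp add: field_simps)
qed

definition cs :: "real \<Rightarrow> (real \<Rightarrow> real) \<Rightarrow> bool" where
  "cs R g \<longleftrightarrow> continuous_on UNIV g \<and> (\<forall>x. R < \<bar>x\<bar> \<longrightarrow> g x = 0)"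

lemma cs_integrable: assumes "cs R g" shows "integrable lborel g"
proof -
  have "integrable lborel (\<lambda>x. indicator {-R..R} x *\<^sub>R g x)"
    using assms unfolding cs_def by (intro borel_integrable_compact) (auto intro: continuous_on_subset)
  also have "(\<lambda>x. indicator {-R..R} x *\<^sub>R g x) = g"
  proof
    fix x show "indicator {-R..R} x *\<^sub>R g x = g x"
    proof (cases "x \<in> {-R..R}")
      case False
      then have "R < \<bar>x\<bar>" by auto
      then show ?thesis using assms by (simp add: cs_def)
    qed simp
  qed
  finally show ?thesis .
qed

lemma cs_bounded: assumes "cs R g" shows "\<exists>C. \<forall>x. \<bar>g x\<bar> \<le> C"
proof -
  have "bounded (g ` {-R..R})"
    using assms unfolding cs_def by (intro compact_imp_bounded compact_continuous_image) (auto intro: continuous_on_subset)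
  then obtain C where C: "\<And>x. x \<in> {-R..R} \<Longrightarrow> \<bar>g x\<bar> \<le> C" unfolding bounded_iff real_norm_def by blast
  have "\<bar>g x\<bar> \<le> \<bar>C\<bar>" for x
  proof (cases "x \<in> {-R..R}")
    case False
    then have "R < \<bar>x\<bar>" by auto
    then show ?thesis using assms by (simp add: cs_def)
  qed (use C[of x] in linarith)
  then show ?thesis by blast
qed

lemma cs_FI_deriv:
  assumes g: "cs R g" "cs R g'" and d: "\<And>x. (g has_real_derivative g' x) (at x)"
  shows "FI (\<lambda>x. of_real (g' x)) \<xi> = - (\<i> * of_real \<xi>) * FI (\<lambda>x. of_real (g x)) \<xi>"
proof -
  have c: "isCont g x" "isCont g' x" for x using g by (auto simp: cs_def continuous_on_eq_continuous_at)
  have i: "integrable lborel (\<lambda>x. of_real (g' x) * cis (x * \<xi>))" "integrable lborel (\<lambda>x. of_real (g x) * cis (x * \<xi>))"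
    using cs_integrable[OF g(1)] cs_integrable[OF g(2)] by (auto intro!: FI_integrable)
  have i2: "integrable lborel (\<lambda>x. (\<i> * of_real \<xi>) * (of_real (g x) * cis (x * \<xi>)))"
    using i(2) by (rule integrable_mult_right)
  have e: "\<forall>\<^sub>F x in at_top. of_real (g x) * cis (x * \<xi>) = 0" "\<forall>\<^sub>F x in at_bot. of_real (g x) * cis (x * \<xi>) = 0"
  proof -
    have "g x = 0" if "\<bar>R\<bar> < x \<or> x < - \<bar>R\<bar>" for x using that g(1) by (auto simp: cs_def)
    then show "\<forall>\<^sub>F x in at_top. of_real (g x) * cis (x * \<xi>) = 0" "\<forall>\<^sub>F x in at_bot. of_real (g x) * cis (x * \<xi>) = 0"
      by (auto intro!: eventually_mono[OF eventually_gt_at_top[of "\<bar>R\<bar>"]] eventually_mono[OF eventually_gt_at_bot[of "- \<bar>R\<bar>"]])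
  qed
  have C: "isCont (\<lambda>x. of_real (g x) * cis (x * \<xi>)) 0"
    using c by (intro continuous_intros isCont_cis) auto
  have "(LINT x|lborel. of_real (g' x) * cis (x * \<xi>) + (\<i> * of_real \<xi>) * (of_real (g x) * cis (x * \<xi>)))
      = of_real (g 0) * cis (0 * \<xi>) - of_real (g 0) * cis (0 * \<xi>)"
  proof (rule integral_FTC_jump[where F="\<lambda>x. of_real (g x) * cis (x * \<xi>)"])
    fix x :: real
    have "((\<lambda>x. of_real (g x)) has_vector_derivative complex_of_real (g' x)) (at x)"
      using d[of x] by (rule has_vector_derivative_of_real[unfolded has_real_derivative_iff_has_vector_derivative[symmetric]])
    from has_vector_derivative_mult[OF this cis_linear_deriv[where x=\<xi> and \<xi>=x]]
    show "((\<lambda>x. of_real (g x) * cis (x * \<xi>)) has_vector_derivative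
        of_real (g' x) * cis (x * \<xi>) + (\<i> * of_real \<xi>) * (of_real (g x) * cis (x * \<xi>))) (at x)"
      by (simp add: algebra_simps)
    show "isCont (\<lambda>x. of_real (g' x) * cis (x * \<xi>) + (\<i> * of_real \<xi>) * (of_real (g x) * cis (x * \<xi>))) x"
      using c by (intro continuous_intros isCont_cis) auto
  next
    show "integrable lborel (\<lambda>x. of_real (g' x) * cis (x * \<xi>) + (\<i> * of_real \<xi>) * (of_real (g x) * cis (x * \<xi>)))"
      using i(1) i2 by (rule Bochner_Integration.integrable_add)
    show "((\<lambda>x. of_real (g x) * cis (x * \<xi>)) \<longlongrightarrow> of_real (g 0) * cis (0 * \<xi>)) (at_right 0)"
      "((\<lambda>x. of_real (g x) * cis (x * \<xi>)) \<longlongrightarrow> of_real (g 0) * cis (0 * \<xi>)) (at_left 0)"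
      using C by (auto simp: isCont_def intro: filterlim_mono at_le)
    show "((\<lambda>x. of_real (g x) * cis (x * \<xi>)) \<longlongrightarrow> 0) at_top" by (rule tendsto_eventually[OF e(1)])
    show "((\<lambda>x. of_real (g x) * cis (x * \<xi>)) \<longlongrightarrow> 0) at_bot" by (rule tendsto_eventually[OF e(2)])
  qed
  then have "(LINT x|lborel. of_real (g' x) * cis (x * \<xi>)) + (\<i> * of_real \<xi>) * (LINT x|lborel. of_real (g x) * cis (x * \<xi>)) = 0"
    by (simp add: Bochner_Integration.integral_add[OF i(1) i2])
  then show ?thesis unfolding FI_def by (simp add: add_eq_0_iff2)
qed

lemma reproducing:
  assumes g: "cs R g" "cs R g1" "cs R g2" "cs R g3" "cs R g4"
    and d: "\<And>x. (g has_real_derivative g1 x) (at x)" "\<And>x. (g1 has_real_derivative g2 x) (at x)"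
      "\<And>x. (g2 has_real_derivative g3 x) (at x)" "\<And>x. (g3 has_real_derivative g4 x) (at x)"
  shows "(LINT x|lborel. (g x - 2 * g2 x + g4 x) * hx 0 (k\<alpha> x) y) = g y"
proof -
  define D where "D x = g x - 2 * g2 x + g4 x" for x
  have Dc: "cs R D" using g unfolding cs_def D_def by (auto intro!: continuous_intros)
  have iD: "integrable lborel D" by (rule cs_integrable[OF Dc])
  then have [measurable]: "D \<in> borel_measurable borel" by simp
  have ig: "integrable lborel (\<lambda>x. complex_of_real (g x))" using cs_integrable[OF g(1)] by simp
  have FD: "FI (\<lambda>x. of_real (D x)) \<xi> = of_real ((1 + \<xi>\<^sup>2)\<^sup>2) * FI (\<lambda>x. of_real (g x)) \<xi>" for \<xi>
  proof -
    have i: "integrable lborel (\<lambda>x. of_real (g x) * cis (x * \<xi>))" "integrable lborel (\<lambda>x. 2 * (of_real (g2 x) * cis (x * \<xi>)))"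
      "integrable lborel (\<lambda>x. of_real (g4 x) * cis (x * \<xi>))"
      using cs_integrable[OF g(1)] cs_integrable[OF g(3)] cs_integrable[OF g(5)] by (auto intro!: FI_integrable)
    have "FI (\<lambda>x. of_real (D x)) \<xi> = (LINT x|lborel. of_real (g x) * cis (x * \<xi>) - 2 * (of_real (g2 x) * cis (x * \<xi>)) + of_real (g4 x) * cis (x * \<xi>))"
      unfolding FI_def D_def by (simp add: algebra_simps)
    also have "\<dots> = FI (\<lambda>x. of_real (g x)) \<xi> - 2 * FI (\<lambda>x. of_real (g2 x)) \<xi> + FI (\<lambda>x. of_real (g4 x)) \<xi>"
      unfolding FI_def using i by (simp add: Bochner_Integration.integral_add Bochner_Integration.integral_diff)
    also have "\<dots> = of_real ((1 + \<xi>\<^sup>2)\<^sup>2) * FI (\<lambda>x. of_real (g x)) \<xi>"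
      unfolding cs_FI_deriv[OF g(4,5) d(4)] cs_FI_deriv[OF g(3,4) d(3)] cs_FI_deriv[OF g(2,3) d(2)] cs_FI_deriv[OF g(1,2) d(1)]
      by (simp add: algebra_simps power2_eq_square)
    finally show ?thesis .
  qed
  have FI_bound: "norm (FI (\<lambda>x. of_real (g x)) \<xi>) \<le> (LINT x|lborel. \<bar>D x\<bar>) / (1 + \<xi>\<^sup>2)" for \<xi>
  proof -
    have q: "1 \<le> 1 + \<xi>\<^sup>2" by simp
    have "(1 + \<xi>\<^sup>2) * norm (FI (\<lambda>x. of_real (g x)) \<xi>) \<le> (1 + \<xi>\<^sup>2)\<^sup>2 * norm (FI (\<lambda>x. of_real (g x)) \<xi>)"
      using mult_left_mono[OF q, of "1 + \<xi>\<^sup>2"] by (intro mult_right_mono) (auto simp: power2_eq_square[of "1 + \<xi>\<^sup>2"])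
    also have "\<dots> = norm (FI (\<lambda>x. of_real (D x)) \<xi>)" unfolding FD by (simp add: norm_mult norm_power del: of_real_power of_real_add)
    also have "\<dots> \<le> (LINT x|lborel. \<bar>D x\<bar>)" using norm_FI_le[of "\<lambda>x. of_real (D x)" \<xi>] by simp
    finally show ?thesis using one_plus_sq_pos[of \<xi>] by (simp add: field_simps)
  qed
  have FIm: "FI (\<lambda>x. of_real (g x)) \<in> borel_measurable borel" using ig by (intro FI_measurable) simp
  have FIi: "integrable lborel (FI (\<lambda>x. of_real (g x)))"
    by (rule integrable_quadratic_bound[OF FIm FI_bound])
  obtain C where C: "\<And>x. \<bar>g x\<bar> \<le> C" using cs_bounded[OF g(1)] by blast
  have inv: "(LINT \<xi>|lborel. FI (\<lambda>x. of_real (g x)) \<xi> * cis (- (y * \<xi>))) = of_real (2 * pi) * complex_of_real (g y)"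
    unfolding of_real_mult of_real_numeral
    by (rule fourier_inversion[where C=C, OF ig _ _ FIi, unfolded of_real_mult of_real_numeral])
      (use C g(1) in \<open>auto simp: cs_def continuous_on_eq_continuous_at intro!: continuous_intros\<close>)
  define w where "w \<xi> = 1 / (1 + \<xi>\<^sup>2)\<^sup>2" for \<xi> :: real
  have wi: "integrable lborel w"
  proof (rule integrable_quadratic_bound[of _ 1])
    show "w \<in> borel_measurable borel" unfolding w_def[abs_def] by measurable
    show "norm (w \<xi>) \<le> 1 / (1 + \<xi>\<^sup>2)" for \<xi>
    proof -
      have "1 * (1 + \<xi>\<^sup>2) \<le> (1 + \<xi>\<^sup>2) * (1 + \<xi>\<^sup>2)" by (intro mult_right_mono) auto
      then show ?thesis unfolding w_def power2_eq_square[of "1 + \<xi>\<^sup>2"] using one_plus_sq_pos[of \<xi>]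
        by (simp add: frac_le)
    qed
  qed
  have ii: "integrable (lborel \<Otimes>\<^sub>M lborel) (\<lambda>(x, \<xi>). complex_of_real (D x) * (k\<alpha> x \<xi> * cis (\<xi> * y)))"
  proof (rule Bochner_Integration.integrable_bound)
    show "integrable (lborel \<Otimes>\<^sub>M lborel) (\<lambda>p. D (fst p) * w (snd p))"
      by (rule integrable_mult_prod[OF sigma_finite_lborel sigma_finite_lborel iD wi])
    show "(\<lambda>(x, \<xi>). complex_of_real (D x) * (k\<alpha> x \<xi> * cis (\<xi> * y))) \<in> borel_measurable (lborel \<Otimes>\<^sub>M lborel)" by measurable
    show "AE p in lborel \<Otimes>\<^sub>M lborel. norm (case p of (x, \<xi>) \<Rightarrow> complex_of_real (D x) * (k\<alpha> x \<xi> * cis (\<xi> * y))) \<le> norm (D (fst p) * w (snd p))"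
      by (auto simp: k\<alpha>_def w_def norm_mult norm_divide norm_power simp del: of_real_power of_real_add)
  qed
  have iix: "integrable lborel (\<lambda>\<xi>. k\<alpha> x \<xi> * cis (\<xi> * y))" for x
    by (rule FI_integrable[OF dec_integrable[OF xadm_dec[OF xadm_KK]]])
  have "(LINT x|lborel. D x * hx 0 (k\<alpha> x) y) = (LINT x|lborel. Re (LINT \<xi>|lborel. complex_of_real (D x) * (k\<alpha> x \<xi> * cis (\<xi> * y))) / (2 * pi))"
    by (simp add: hx_def FI_def)
  also have "\<dots> = Re (LINT x|lborel. (LINT \<xi>|lborel. complex_of_real (D x) * (k\<alpha> x \<xi> * cis (\<xi> * y)))) / (2 * pi)"
    using lborel_pair.integrable_fst[OF ii] by (simp only: integral_divide_zero integral_Re)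
  also have "(LINT x|lborel. (LINT \<xi>|lborel. complex_of_real (D x) * (k\<alpha> x \<xi> * cis (\<xi> * y))))
      = (LINT \<xi>|lborel. (LINT x|lborel. complex_of_real (D x) * (k\<alpha> x \<xi> * cis (\<xi> * y))))"
    by (rule lborel_pair.Fubini_integral[OF ii, symmetric])
  also have "\<dots> = (LINT \<xi>|lborel. FI (\<lambda>x. of_real (g x)) (- \<xi>) * cis (- (y * - \<xi>)))"
  proof (intro Bochner_Integration.integral_cong refl)
    fix \<xi> :: real
    have "(LINT x|lborel. complex_of_real (D x) * (k\<alpha> x \<xi> * cis (\<xi> * y)))
        = (LINT x|lborel. (complex_of_real (D x) * cis (x * - \<xi>)) * (cis (\<xi> * y) / of_real ((1 + \<xi>\<^sup>2)\<^sup>2)))"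
      unfolding k\<alpha>_def by (intro Bochner_Integration.integral_cong refl) (simp add: mult_ac)
    also have "\<dots> = FI (\<lambda>x. of_real (D x)) (- \<xi>) * (cis (\<xi> * y) / of_real ((1 + \<xi>\<^sup>2)\<^sup>2))"
      by (simp only: FI_def integral_mult_left_zero)
    also have "\<dots> = FI (\<lambda>x. of_real (g x)) (- \<xi>) * cis (- (y * - \<xi>))"
      unfolding FD using one_plus_sq_pos[of \<xi>] by (simp add: mult.commute[of \<xi>] del: of_real_power of_real_add)
    finally show "(LINT x|lborel. complex_of_real (D x) * (k\<alpha> x \<xi> * cis (\<xi> * y))) = FI (\<lambda>x. of_real (g x)) (- \<xi>) * cis (- (y * - \<xi>))" .
  qed
  also have "\<dots> = of_real (2 * pi) * complex_of_real (g y)"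
    using integral_reflect[of "\<lambda>\<xi>. FI (\<lambda>x. of_real (g x)) \<xi> * cis (- (y * \<xi>))"] inv by simp
  finally show ?thesis by (simp add: D_def)
qed

lemma Fubini_bound:
  fixes f :: "'p \<Rightarrow> 'q \<Rightarrow> 'b::{banach, second_countable_topology}"
  assumes M: "sigma_finite_measure M1" "sigma_finite_measure M2" and f: "(\<lambda>(p, q). f p q) \<in> borel_measurable (M1 \<Otimes>\<^sub>M M2)"
    and b: "\<And>p q. norm (f p q) \<le> a p * b q" "integrable M1 a" "integrable M2 b"
  shows "(LINT p|M1. LINT q|M2. f p q) = (LINT q|M2. LINT p|M1. f p q)"
    and "integrable (M1 \<Otimes>\<^sub>M M2) (\<lambda>(p, q). f p q)"
proof -
  interpret pair_sigma_finite M1 M2 using M by (rule pair_sigma_finite.intro)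
  show i: "integrable (M1 \<Otimes>\<^sub>M M2) (\<lambda>(p, q). f p q)"
  proof (rule Bochner_Integration.integrable_bound)
    show "integrable (M1 \<Otimes>\<^sub>M M2) (\<lambda>p. a (fst p) * b (snd p))"
      by (rule integrable_mult_prod[OF M b(2,3)])
    show "AE p in M1 \<Otimes>\<^sub>M M2. norm (case p of (p, q) \<Rightarrow> f p q) \<le> norm (a (fst p) * b (snd p))"
      using b(1) by (auto intro!: AE_I2 order_trans[OF b(1)])
  qed (rule f)
  show "(LINT p|M1. LINT q|M2. f p q) = (LINT q|M2. LINT p|M1. f p q)"
    by (rule Fubini_integral[OF i, symmetric])
qed

definition smooth :: "(real \<times> real \<Rightarrow> real) \<Rightarrow> bool" where
  "smooth f \<longleftrightarrow> (\<forall>k. Ck k f)"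

lemma smooth_dx: "smooth f \<Longrightarrow> smooth (dx f)"
  unfolding smooth_def by (metis Ck.simps(2))

lemma smooth_dt: "smooth f \<Longrightarrow> smooth (dt f)"
  unfolding smooth_def by (metis Ck.simps(2))

lemma smooth_differentiable: "smooth f \<Longrightarrow> f differentiable (at p)"
  unfolding smooth_def by (metis Ck.simps(2))

lemma smooth_cont: "smooth f \<Longrightarrow> continuous_on UNIV f"
  unfolding smooth_def by (metis Ck.simps(1))

lemma dx_DERIV:
  assumes "f differentiable (at (x, t))" shows "((\<lambda>y. f (y, t)) has_real_derivative dx f (x, t)) (at x)"
proof -
  have "(\<lambda>y. f (y, t)) differentiable (at x)"
    using differentiable_chain_at[of "\<lambda>y. (y, t)" x f] assms by (auto simp: o_def intro!: derivative_intros)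
  then show ?thesis by (simp add: dx_def DERIV_deriv_iff_real_differentiable)
qed

lemma dt_DERIV:
  assumes "f differentiable (at (x, t))" shows "((\<lambda>s. f (x, s)) has_real_derivative dt f (x, t)) (at t)"
proof -
  have "(\<lambda>s. f (x, s)) differentiable (at t)"
    using differentiable_chain_at[of "\<lambda>s. (x, s)" t f] assms by (auto simp: o_def intro!: derivative_intros)
  then show ?thesis by (simp add: dt_def DERIV_deriv_iff_real_differentiable)
qed

lemma Ck_lin: "Ck k f \<Longrightarrow> Ck k g \<Longrightarrow> Ck k (\<lambda>p. a * f p + b * g p)"
proof (induction k arbitrary: f g)
  case 0
  then show ?case by (auto intro!: continuous_intros)
next
  case (Suc k)
  have f: "\<And>p. f differentiable (at p)" "Ck k (dx f)" "Ck k (dt f)" and g: "\<And>p. g differentiable (at p)" "Ck k (dx g)" "Ck k (dt g)"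
    using Suc.prems by auto
  have "dx (\<lambda>p. a * f p + b * g p) = (\<lambda>p. a * dx f p + b * dx g p)"
  proof
    fix p :: "real \<times> real"
    obtain x t where p: "p = (x, t)" by (cases p)
    have "((\<lambda>y. a * f (y, t) + b * g (y, t)) has_real_derivative a * dx f (x, t) + b * dx g (x, t)) (at x)"
      by (intro DERIV_add DERIV_cmult dx_DERIV f g)
    then show "dx (\<lambda>p. a * f p + b * g p) p = a * dx f p + b * dx g p" by (simp add: p dx_def[of "\<lambda>p. a * f p + b * g p"] DERIV_imp_deriv)
  qed
  moreover have "dt (\<lambda>p. a * f p + b * g p) = (\<lambda>p. a * dt f p + b * dt g p)"
  proof
    fix p :: "real \<times> real"
    obtain x t where p: "p = (x, t)" by (cases p)
    have "((\<lambda>s. a * f (x, s) + b * g (x, s)) has_real_derivative a * dt f (x, t) + b * dt g (x, t)) (at t)"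
      by (intro DERIV_add DERIV_cmult dt_DERIV f g)
    then show "dt (\<lambda>p. a * f p + b * g p) p = a * dt f p + b * dt g p" by (simp add: p dt_def[of "\<lambda>p. a * f p + b * g p"] DERIV_imp_deriv)
  qed
  moreover have "(\<lambda>p. a * f p + b * g p) differentiable (at p)" for p
    using f(1) g(1) by (auto intro!: derivative_intros)
  ultimately show ?case using Suc.IH f g by simp
qed

definition tf :: "real \<Rightarrow> real \<Rightarrow> (real \<times> real \<Rightarrow> real) \<Rightarrow> bool" where
  "tf d R f \<longleftrightarrow> 0 < d \<and> smooth f \<and> (\<forall>x t. f (x, t) \<noteq> 0 \<longrightarrow> \<bar>x\<bar> \<le> R \<and> d \<le> t \<and> t \<le> R)"

lemma tf_smooth: "tf d R f \<Longrightarrow> smooth f" by (simp add: tf_def)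

lemma tf_zero: "tf d R f \<Longrightarrow> R < \<bar>x\<bar> \<or> t < d \<or> R < t \<Longrightarrow> f (x, t) = 0"
  unfolding tf_def by (meson not_less)

lemma tf_exists:
  assumes "f \<in> Cc_infty Qplus" shows "\<exists>d R. tf d R f"
proof -
  define K where "K = closure {p. f p \<noteq> 0}"
  have K: "compact K" "K \<subseteq> Qplus" "smooth f" using assms by (auto simp: Cc_infty_def K_def smooth_def)
  have s: "f p \<noteq> 0 \<Longrightarrow> p \<in> K" for p unfolding K_def by (rule subsetD[OF closure_subset]) simp
  obtain R where R: "\<And>p. p \<in> K \<Longrightarrow> norm p \<le> R"
    using compact_imp_bounded[OF K(1)] unfolding bounded_iff by blast
  have "\<exists>d>0. \<forall>p\<in>K. d \<le> snd p"
  proof (cases "K = {}")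
    case False
    have "continuous_on K snd" by (intro continuous_intros)
    from continuous_attains_inf[OF K(1) False this] obtain p where "p \<in> K" "\<forall>q\<in>K. snd p \<le> snd q" by blast
    moreover from this have "0 < snd p" using K(2) by (auto simp: Qplus_def)
    ultimately show ?thesis by blast
  qed (auto intro: exI[of _ 1])
  then obtain d where d: "0 < d" "\<And>p. p \<in> K \<Longrightarrow> d \<le> snd p" by blast
  have "\<bar>x\<bar> \<le> R \<and> d \<le> t \<and> t \<le> R" if "f (x, t) \<noteq> 0" for x t
  proof -
    have "\<bar>x\<bar> \<le> norm (x, t)" "\<bar>t\<bar> \<le> norm (x, t)"
      using norm_fst_le[of x t] norm_snd_le[of t x] by simp_all
    then show ?thesis using R[OF s[OF that]] d(2)[OF s[OF that]] by auto
  qed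
  then show ?thesis using d(1) K(3) by (auto simp: tf_def)
qed

lemma deriv_eq_0:
  assumes "(g has_real_derivative D) (at x)" "open S" "x \<in> S" "\<And>y. y \<in> S \<Longrightarrow> g y = 0"
  shows "D = (0::real)"
proof -
  have "(g has_real_derivative 0) (at x)"
    by (rule has_field_derivative_transform_within_open[of "\<lambda>_. 0" 0 x S]) (use assms in auto)
  then show ?thesis using assms(1) DERIV_unique by blast
qed

lemma tf_dx: assumes f: "tf d R f" shows "tf d R (dx f)"
  unfolding tf_def
proof (intro conjI allI impI)
  show "0 < d" "smooth (dx f)" using f by (auto simp: tf_def smooth_dx)
  have D: "((\<lambda>y. f (y, t)) has_real_derivative dx f (x, t)) (at x)" for x t
    using smooth_differentiable[OF tf_smooth[OF f]] by (rule dx_DERIV)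
  fix x t assume nz: "dx f (x, t) \<noteq> 0"
  show "\<bar>x\<bar> \<le> R"
  proof (rule ccontr)
    assume "\<not> \<bar>x\<bar> \<le> R"
    then have "dx f (x, t) = 0"
      by (intro deriv_eq_0[OF D, of "{y. R < \<bar>y\<bar>}"]) (auto intro!: open_Collect_less continuous_intros tf_zero[OF f])
    then show False using nz by simp
  qed
  have "d \<le> t \<and> t \<le> R"
  proof (rule ccontr)
    assume "\<not> (d \<le> t \<and> t \<le> R)"
    then have "dx f (x, t) = 0"
      by (intro deriv_eq_0[OF D, of UNIV]) (auto intro!: tf_zero[OF f])
    then show False using nz by simp
  qed
  then show "d \<le> t" "t \<le> R" by auto
qed

lemma tf_dt: assumes f: "tf d R f" shows "tf d R (dt f)"
  unfolding tf_def
proof (intro conjI allI impI)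
  show "0 < d" "smooth (dt f)" using f by (auto simp: tf_def smooth_dt)
  have D: "((\<lambda>s. f (x, s)) has_real_derivative dt f (x, t)) (at t)" for x t
    using smooth_differentiable[OF tf_smooth[OF f]] by (rule dt_DERIV)
  fix x t assume nz: "dt f (x, t) \<noteq> 0"
  show "\<bar>x\<bar> \<le> R"
  proof (rule ccontr)
    assume "\<not> \<bar>x\<bar> \<le> R"
    then have "dt f (x, t) = 0"
      by (intro deriv_eq_0[OF D, of UNIV]) (auto intro!: tf_zero[OF f])
    then show False using nz by simp
  qed
  show "d \<le> t"
  proof (rule ccontr)
    assume "\<not> d \<le> t"
    then have "dt f (x, t) = 0"
      by (intro deriv_eq_0[OF D, of "{..<d}"]) (auto intro!: tf_zero[OF f])
    then show False using nz by simp
  qed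
  show "t \<le> R"
  proof (rule ccontr)
    assume "\<not> t \<le> R"
    then have "dt f (x, t) = 0"
      by (intro deriv_eq_0[OF D, of "{R<..}"]) (auto intro!: tf_zero[OF f])
    then show False using nz by simp
  qed
qed

lemma tf_comb:
  assumes "tf d R f" "tf d R g" "tf d R h" shows "tf d R (\<lambda>p. f p - 2 * g p + h p)"
proof -
  have "smooth (\<lambda>p. 1 * (1 * f p + (- 2) * g p) + 1 * h p)"
    using assms unfolding tf_def smooth_def by (intro allI Ck_lin) auto
  then have "smooth (\<lambda>p. f p - 2 * g p + h p)" by simp
  moreover have "\<bar>x\<bar> \<le> R \<and> d \<le> t \<and> t \<le> R" if "f (x, t) - 2 * g (x, t) + h (x, t) \<noteq> 0" for x t
  proof -
    from that have "f (x, t) \<noteq> 0 \<or> g (x, t) \<noteq> 0 \<or> h (x, t) \<noteq> 0" by auto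
    then show ?thesis using assms unfolding tf_def by blast
  qed
  ultimately show ?thesis using assms(1) by (auto simp: tf_def)
qed

definition Dx :: "(real \<times> real \<Rightarrow> real) \<Rightarrow> real \<times> real \<Rightarrow> real" where
  "Dx f p = f p - 2 * dx (dx f) p + dx (dx (dx (dx f))) p"

definition Dt :: "(real \<times> real \<Rightarrow> real) \<Rightarrow> real \<times> real \<Rightarrow> real" where
  "Dt f p = f p - 2 * dt (dt f) p + dt (dt (dt (dt f))) p"

lemma tf_Dx: "tf d R f \<Longrightarrow> tf d R (Dx f)"
  unfolding Dx_def[abs_def] by (intro tf_comb tf_dx)

lemma tf_Dt: "tf d R f \<Longrightarrow> tf d R (Dt f)"
  unfolding Dt_def[abs_def] by (intro tf_comb tf_dt)

lemma tf_cs1: assumes f: "tf d R f" shows "cs R (\<lambda>x. f (x, t))"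
  unfolding cs_def using tf_zero[OF f]
  by (auto intro!: continuous_on_compose2[OF smooth_cont[OF tf_smooth[OF f]]] continuous_intros)

lemma tf_cs2: assumes f: "tf d R f" shows "cs R (\<lambda>t. f (x, t))"
proof -
  have "f (x, t) = 0" if "R < \<bar>t\<bar>" for t
    using that f tf_zero[OF f, of x t] by (cases "t < 0") (auto simp: tf_def)
  then show ?thesis
    unfolding cs_def by (auto intro!: continuous_on_compose2[OF smooth_cont[OF tf_smooth[OF f]]] continuous_intros)
qed

lemma reproducing_x:
  assumes f: "tf d R f" shows "(LINT x|lborel. Dx f (x, t) * hx 0 (k\<alpha> x) y) = f (y, t)"
  unfolding Dx_def
proof -
  note d = dx_DERIV[OF smooth_differentiable[OF tf_smooth[where d=d and R=R]], where t=t] and c = tf_cs1[where d=d and R=R]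
  show "(LINT x|lborel. (f (x, t) - 2 * dx (dx f) (x, t) + dx (dx (dx (dx f))) (x, t)) * hx 0 (k\<alpha> x) y) = f (y, t)"
    by (rule reproducing[OF c c c c c d d d d]) (intro tf_dx f)+
qed

lemma reproducing_t:
  assumes f: "tf d R f" and s: "0 < s" shows "(LINT t|lborel. Dt f (x, t) * hs 0 (k\<beta> t) s) = f (x, s)"
proof -
  have r: "(LINT t|lborel. Dt f (x, t) * hx 0 (k\<alpha> t) s) = f (x, s)" for s
    unfolding Dt_def
  proof -
    note d = dt_DERIV[OF smooth_differentiable[OF tf_smooth[where d=d and R=R]], where x=x] and c = tf_cs2[where d=d and R=R]
    show "(LINT t|lborel. (f (x, t) - 2 * dt (dt f) (x, t) + dt (dt (dt (dt f))) (x, t)) * hx 0 (k\<alpha> t) s) = f (x, s)"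
      by (rule reproducing[OF c c c c c d d d d]) (intro tf_dt f)+
  qed
  have i: "integrable lborel (\<lambda>t. Dt f (x, t) * hx 0 (k\<alpha> t) s)" for s
  proof (rule integrable_mult_bounded[OF cs_integrable[OF tf_cs2[OF tf_Dt[OF f]]]])
    show "(\<lambda>t. hx 0 (k\<alpha> t) s) \<in> borel_measurable lborel" by measurable
    fix t
    define w where "w \<xi> = 1 / (1 + \<xi>\<^sup>2)\<^sup>2" for \<xi> :: real
    have "norm (FI (k\<alpha> t) s) \<le> (LINT \<xi>|lborel. norm (k\<alpha> t \<xi>))" by (rule norm_FI_le)
    also have "\<dots> = (LINT \<xi>|lborel. w \<xi>)" by (simp add: k\<alpha>_def w_def norm_divide norm_power del: of_real_power of_real_add)
    finally have "\<bar>Re (FI (k\<alpha> t) s)\<bar> \<le> (LINT \<xi>|lborel. w \<xi>)" using abs_Re_le_cmod order_trans by blast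
    moreover have "\<bar>hx 0 (k\<alpha> t) s\<bar> \<le> \<bar>Re (FI (k\<alpha> t) s)\<bar>"
      unfolding hx_def using pi_ge_1(2) by (simp add: abs_divide divide_le_eq mult_left_le) (meson abs_ge_zero mult_le_cancel_left1 not_less)
    ultimately show "norm (hx 0 (k\<alpha> t) s) \<le> (LINT \<xi>|lborel. w \<xi>)" by simp
  qed
  have "(LINT t|lborel. Dt f (x, t) * hs 0 (k\<beta> t) s)
      = (LINT t|lborel. Dt f (x, t) * hx 0 (k\<alpha> t) s - Dt f (x, t) * hx 0 (k\<alpha> t) (- s))"
    by (simp add: hs0_k\<beta> algebra_simps)
  also have "\<dots> = f (x, s) - f (x, - s)"
    unfolding Bochner_Integration.integral_diff[OF i i] r ..
  also have "f (x, - s) = 0" using f s by (intro tf_zero[OF f]) (auto simp: tf_def)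
  finally show ?thesis by simp
qed

definition WW :: "real \<times> real \<Rightarrow> real" where
  "WW p = (1 + \<bar>fst p\<bar>)\<^sup>2 * (1 + \<bar>snd p\<bar>)\<^sup>2"

lemma WW_nonneg: "0 \<le> WW p" by (simp add: WW_def)

definition WW_int :: "(real \<times> real \<Rightarrow> real) \<Rightarrow> bool" where
  "WW_int H \<longleftrightarrow> H \<in> borel_measurable borel \<and> integrable lborel (\<lambda>p. \<bar>H p\<bar> * WW p)"

lemma WW_int_meas[measurable_dest]: "WW_int H \<Longrightarrow> H \<in> borel_measurable borel" by (simp add: WW_int_def)

lemma tf_WW_int: assumes f: "tf d R f" shows "WW_int f"
proof -
  have c: "continuous_on UNIV f" by (rule smooth_cont[OF tf_smooth[OF f]])
  define K where "K = {-R..R} \<times> {d..R}"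
  have "integrable lborel (\<lambda>p. indicator K p *\<^sub>R (\<bar>f p\<bar> * WW p))"
    unfolding WW_def K_def
    by (intro borel_integrable_compact compact_Times continuous_intros continuous_on_subset[OF c]) auto
  also have "(\<lambda>p. indicator K p *\<^sub>R (\<bar>f p\<bar> * WW p)) = (\<lambda>p. \<bar>f p\<bar> * WW p)"
  proof
    fix p :: "real \<times> real"
    obtain x t where p: "p = (x, t)" by (cases p)
    show "indicator K p *\<^sub>R (\<bar>f p\<bar> * WW p) = \<bar>f p\<bar> * WW p"
    proof (cases "f p = 0")
      case False
      then have "\<bar>x\<bar> \<le> R" "d \<le> t" "t \<le> R" using f by (auto simp: p tf_def)
      then have "p \<in> K" by (auto simp: p K_def)
      then show ?thesis by simp
    qed simp
  qed
  finally show ?thesis using borel_measurable_continuous_onI[OF c] by (simp add: WW_int_def)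
qed

lemma kernel_bounds:
  "j \<le> 2 \<Longrightarrow> \<bar>hx j (k\<alpha> x) y\<bar> \<le> KK * (1 + \<bar>x\<bar>)\<^sup>2 / (1 + y\<^sup>2)"
  "\<gamma> \<in> {0, 1/2, 1} \<Longrightarrow> \<bar>hs \<gamma> (k\<beta> t) s\<bar> \<le> KK * (1 + \<bar>t\<bar>)\<^sup>2 / (1 + s\<^sup>2)"
  "\<bar>hc (k\<beta> t) s\<bar> \<le> KK * (1 + \<bar>t\<bar>)\<^sup>2 / (1 + s\<^sup>2)"
  by (auto intro!: hx_bound[OF xadm_KK] hs_bound[OF tadm_KK] hc_bound[OF tadm_KK])

lemma quotient_le: "0 \<le> a \<Longrightarrow> a / (1 + (y::real)\<^sup>2) \<le> a"
  using mult_left_mono[of 1 "1 + y\<^sup>2" a] one_plus_sq_pos[of y] by (simp add: pos_divide_le_eq)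

lemma kernel_bounds':
  "j \<le> 2 \<Longrightarrow> \<bar>hx j (k\<alpha> x) y\<bar> \<le> KK * (1 + \<bar>x\<bar>)\<^sup>2"
  "\<gamma> \<in> {0, 1/2, 1} \<Longrightarrow> \<bar>hs \<gamma> (k\<beta> t) s\<bar> \<le> KK * (1 + \<bar>t\<bar>)\<^sup>2"
  "\<bar>hc (k\<beta> t) s\<bar> \<le> KK * (1 + \<bar>t\<bar>)\<^sup>2"
proof -
  have n: "0 \<le> KK * (1 + \<bar>z\<bar>)\<^sup>2" for z :: real using KK_nonneg by simp
  show "j \<le> 2 \<Longrightarrow> \<bar>hx j (k\<alpha> x) y\<bar> \<le> KK * (1 + \<bar>x\<bar>)\<^sup>2" "\<gamma> \<in> {0, 1/2, 1} \<Longrightarrow> \<bar>hs \<gamma> (k\<beta> t) s\<bar> \<le> KK * (1 + \<bar>t\<bar>)\<^sup>2"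
    "\<bar>hc (k\<beta> t) s\<bar> \<le> KK * (1 + \<bar>t\<bar>)\<^sup>2"
    by (rule order_trans[OF kernel_bounds(1) quotient_le[OF n]], assumption)
      (rule order_trans[OF kernel_bounds(2) quotient_le[OF n]], assumption, rule order_trans[OF kernel_bounds(3) quotient_le[OF n]])
qed

lemma prod_WW_bound:
  assumes "\<bar>a\<bar> \<le> A * (1 + \<bar>fst p\<bar>)\<^sup>2" "\<bar>b\<bar> \<le> B * (1 + \<bar>snd p\<bar>)\<^sup>2"
  shows "\<bar>h * (a * b)\<bar> \<le> A * B * (\<bar>h\<bar> * WW p)"
proof -
  have "\<bar>a\<bar> * \<bar>b\<bar> \<le> (A * (1 + \<bar>fst p\<bar>)\<^sup>2) * (B * (1 + \<bar>snd p\<bar>)\<^sup>2)"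
    using assms by (intro mult_mono) (auto intro: order_trans[OF abs_ge_zero])
  then have "\<bar>h\<bar> * (\<bar>a\<bar> * \<bar>b\<bar>) \<le> \<bar>h\<bar> * ((A * (1 + \<bar>fst p\<bar>)\<^sup>2) * (B * (1 + \<bar>snd p\<bar>)\<^sup>2))"
    by (intro mult_left_mono) auto
  then show ?thesis by (simp add: abs_mult WW_def mult_ac)
qed

lemma WW_int_kernel:
  assumes H: "WW_int H" and [measurable]: "a \<in> borel_measurable borel" "b \<in> borel_measurable borel"
    and a: "\<And>x. \<bar>a x\<bar> \<le> A * (1 + \<bar>x\<bar>)\<^sup>2" and b: "\<And>t. \<bar>b t\<bar> \<le> B * (1 + \<bar>t\<bar>)\<^sup>2"
  shows "integrable lborel (\<lambda>p. H p * (a (fst p) * b (snd p)))"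
proof (rule Bochner_Integration.integrable_bound)
  note [measurable] = WW_int_meas[OF H]
  show "integrable lborel (\<lambda>p. A * B * (\<bar>H p\<bar> * WW p))" using H by (simp add: WW_int_def)
  show "(\<lambda>p. H p * (a (fst p) * b (snd p))) \<in> borel_measurable lborel" by measurable
  show "AE p in lborel. norm (H p * (a (fst p) * b (snd p))) \<le> norm (A * B * (\<bar>H p\<bar> * WW p))"
    using prod_WW_bound[OF a b] by (auto intro!: AE_I2 order_trans[OF prod_WW_bound[OF a b]])
qed

lemma hx_kernel_DERIV:
  assumes H: "WW_int H" and j: "j \<le> 1" and bm: "b \<in> borel_measurable borel" and b: "\<And>t. \<bar>b t\<bar> \<le> B * (1 + \<bar>t\<bar>)\<^sup>2"
  shows "((\<lambda>y. LINT p|lborel. H p * (hx j (k\<alpha> (fst p)) y * b (snd p))) has_real_derivative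
    (LINT p|lborel. H p * (hx (Suc j) (k\<alpha> (fst p)) y * b (snd p)))) (at y)"
proof (rule has_real_derivative_integral[where w="\<lambda>p. KK * B * (\<bar>H p\<bar> * WW p)"])
  show "((\<lambda>y. H p * (hx j (k\<alpha> (fst p)) y * b (snd p))) has_real_derivative H p * (hx (Suc j) (k\<alpha> (fst p)) y * b (snd p))) (at y)" for p y
    by (intro DERIV_cmult DERIV_cmult_right hx_deriv[OF xadm_KK j])
  show "integrable lborel (\<lambda>p. H p * (hx j (k\<alpha> (fst p)) y * b (snd p)))" for y
    by (rule WW_int_kernel[OF H _ bm kernel_bounds'(1) b]) (use j in auto)
  show "\<bar>H p * (hx (Suc j) (k\<alpha> (fst p)) y * b (snd p))\<bar> \<le> KK * B * (\<bar>H p\<bar> * WW p)" for p y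
    using j by (intro prod_WW_bound kernel_bounds' b) auto
  show "integrable lborel (\<lambda>p. KK * B * (\<bar>H p\<bar> * WW p))" using H by (simp add: WW_int_def)
qed

lemma hs_kernel_DERIV:
  assumes H: "WW_int H" and am: "a \<in> borel_measurable borel" and a: "\<And>x. \<bar>a x\<bar> \<le> A * (1 + \<bar>x\<bar>)\<^sup>2"
  shows "((\<lambda>s. LINT p|lborel. H p * (a (fst p) * hs 0 (k\<beta> (snd p)) s)) has_real_derivative
    (LINT p|lborel. H p * (a (fst p) * hc (k\<beta> (snd p)) s))) (at s)"
proof (rule has_real_derivative_integral[where w="\<lambda>p. A * KK * (\<bar>H p\<bar> * WW p)"])
  show "((\<lambda>s. H p * (a (fst p) * hs 0 (k\<beta> (snd p)) s)) has_real_derivative H p * (a (fst p) * hc (k\<beta> (snd p)) s)) (at s)" for p s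
    by (intro DERIV_cmult hs_deriv[OF tadm_KK])
  show "integrable lborel (\<lambda>p. H p * (a (fst p) * hs 0 (k\<beta> (snd p)) s))" for s
    by (rule WW_int_kernel[OF H am _ a kernel_bounds'(2)]) auto
  show "\<bar>H p * (a (fst p) * hc (k\<beta> (snd p)) s)\<bar> \<le> A * KK * (\<bar>H p\<bar> * WW p)" for p s
    by (intro prod_WW_bound kernel_bounds' a)
  show "integrable lborel (\<lambda>p. A * KK * (\<bar>H p\<bar> * WW p))" using H by (simp add: WW_int_def)
qed

definition JJ :: "(real \<times> real \<Rightarrow> real) \<Rightarrow> (real \<Rightarrow> real \<Rightarrow> real) \<Rightarrow> (real \<Rightarrow> real \<Rightarrow> real) \<Rightarrow> real \<times> real \<Rightarrow> real" where
  "JJ H a b q = (LINT p|lborel. H p * (a (fst p) (fst q) * b (snd p) (snd q)))"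

lemma reproducing_2:
  assumes f: "tf d R f" and s: "0 < s"
  shows "f (y, s) = JJ (Dt (Dx f)) (\<lambda>x. hx 0 (k\<alpha> x)) (\<lambda>t. hs 0 (k\<beta> t)) (y, s)"
proof -
  have i: "integrable (lborel \<Otimes>\<^sub>M lborel) (\<lambda>(x, t). Dt (Dx f) (x, t) * (hx 0 (k\<alpha> x) y * hs 0 (k\<beta> t) s))"
    using WW_int_kernel[OF tf_WW_int[OF tf_Dt[OF tf_Dx[OF f]]] _ _ kernel_bounds'(1)[where j=0 and y=y] kernel_bounds'(2)[where \<gamma>=0 and s=s]]
    by (simp add: lborel_prod split_beta')
  have "JJ (Dt (Dx f)) (\<lambda>x. hx 0 (k\<alpha> x)) (\<lambda>t. hs 0 (k\<beta> t)) (y, s)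
      = (LINT p|(lborel \<Otimes>\<^sub>M lborel). (case p of (x, t) \<Rightarrow> Dt (Dx f) (x, t) * (hx 0 (k\<alpha> x) y * hs 0 (k\<beta> t) s)))"
    by (simp add: JJ_def lborel_prod split_beta')
  also have "\<dots> = (LINT x|lborel. LINT t|lborel. Dt (Dx f) (x, t) * (hx 0 (k\<alpha> x) y * hs 0 (k\<beta> t) s))"
    by (rule lborel_pair.integral_fst[OF i, symmetric])
  also have "\<dots> = (LINT x|lborel. (LINT t|lborel. Dt (Dx f) (x, t) * hs 0 (k\<beta> t) s) * hx 0 (k\<alpha> x) y)"
    unfolding integral_mult_left_zero[symmetric] by (simp add: mult_ac)
  also have "\<dots> = f (y, s)"
    unfolding reproducing_t[OF tf_Dx[OF f] s] by (rule reproducing_x[OF f])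
  finally show ?thesis ..
qed

lemma rep_dxx:
  assumes f: "tf d R f" and s: "0 < s"
  shows "dx (dx f) (y, s) = JJ (Dt (Dx f)) (\<lambda>x. hx 2 (k\<alpha> x)) (\<lambda>t. hs 0 (k\<beta> t)) (y, s)"
proof -
  note H = tf_WW_int[OF tf_Dt[OF tf_Dx[OF f]]]
  note k = hx_kernel_DERIV[OF H _ _ kernel_bounds'(2)[where \<gamma>=0 and s=s]]
  have 1: "dx f (y, s) = JJ (Dt (Dx f)) (\<lambda>x. hx 1 (k\<alpha> x)) (\<lambda>t. hs 0 (k\<beta> t)) (y, s)" for y
  proof -
    have e: "(\<lambda>y. f (y, s)) = (\<lambda>y. LINT p|lborel. Dt (Dx f) p * (hx 0 (k\<alpha> (fst p)) y * hs 0 (k\<beta> (snd p)) s))"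
      by (rule ext) (simp add: reproducing_2[OF f s] JJ_def)
    show ?thesis using DERIV_imp_deriv[OF k[where j=0 and y=y]] by (simp add: dx_def e JJ_def)
  qed
  show ?thesis
    using k[where j=1 and y=y] DERIV_imp_deriv unfolding dx_def[of "dx f"] by (simp add: 1 JJ_def numeral_2_eq_2)
qed

lemma rep_dxt:
  assumes f: "tf d R f" and s: "0 < s"
  shows "dx (dt f) (y, s) = JJ (Dt (Dx f)) (\<lambda>x. hx 1 (k\<alpha> x)) (\<lambda>t. hc (k\<beta> t)) (y, s)"
proof -
  note H = tf_WW_int[OF tf_Dt[OF tf_Dx[OF f]]]
  have 1: "dt f (y, s) = JJ (Dt (Dx f)) (\<lambda>x. hx 0 (k\<alpha> x)) (\<lambda>t. hc (k\<beta> t)) (y, s)" for y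
  proof -
    have "((\<lambda>s. f (y, s)) has_real_derivative JJ (Dt (Dx f)) (\<lambda>x. hx 0 (k\<alpha> x)) (\<lambda>t. hc (k\<beta> t)) (y, s)) (at s)"
    proof (rule has_field_derivative_transform_within_open[of _ _ _ "{0<..}"])
      show "((\<lambda>s. JJ (Dt (Dx f)) (\<lambda>x. hx 0 (k\<alpha> x)) (\<lambda>t. hs 0 (k\<beta> t)) (y, s)) has_real_derivative
          JJ (Dt (Dx f)) (\<lambda>x. hx 0 (k\<alpha> x)) (\<lambda>t. hc (k\<beta> t)) (y, s)) (at s)"
        unfolding JJ_def using hs_kernel_DERIV[OF H _ kernel_bounds'(1)[where j=0 and y=y], where s=s] by simp
    qed (use s reproducing_2[OF f] in auto)
    then show ?thesis by (simp add: dt_def DERIV_imp_deriv)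
  qed
  show ?thesis
    using hx_kernel_DERIV[OF H _ _ kernel_bounds'(3)[where s=s], where j=0 and y=y] DERIV_imp_deriv unfolding dx_def[of "dt f"] by (simp add: 1 JJ_def)
qed

lemma sin_transform:
  assumes f: "tf d R f"
  shows "(LINT s|lborel. f (y, s) * sin (\<tau> * s))
    = (LINT p|lborel. Dt (Dx f) p * (hx 0 (k\<alpha> (fst p)) y * k\<beta> (snd p) \<tau>))"
proof -
  define H where "H = Dt (Dx f)"
  have H: "WW_int H" unfolding H_def by (rule tf_WW_int[OF tf_Dt[OF tf_Dx[OF f]]])
  note [measurable] = WW_int_meas[OF H]
  define F where "F s p = H p * (hx 0 (k\<alpha> (fst p)) y * hs 0 (k\<beta> (snd p)) s) * (indicator {0<..} s * sin (\<tau> * s))" for s :: real and p :: "real \<times> real"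
  have "(LINT s|lborel. f (y, s) * sin (\<tau> * s)) = (LINT s|lborel. LINT p|lborel. F s p)"
  proof (intro Bochner_Integration.integral_cong refl)
    fix s :: real
    show "f (y, s) * sin (\<tau> * s) = (LINT p|lborel. F s p)"
    proof (cases "0 < s")
      case True
      then show ?thesis using reproducing_2[OF f True, of y] by (simp add: F_def JJ_def H_def)
    next
      case False
      then have "f (y, s) = 0" using f by (intro tf_zero[OF f]) (auto simp: tf_def)
      then show ?thesis using False by (simp add: F_def)
    qed
  qed
  also have "\<dots> = (LINT p|lborel. LINT s|lborel. F s p)"
  proof (rule Fubini_bound(1)[OF sigma_finite_lborel sigma_finite_lborel, where a="\<lambda>s. 1 / (1 + s\<^sup>2)" and b="\<lambda>p. KK * KK * (\<bar>H p\<bar> * WW p)"])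
    show "(\<lambda>(s, p). F s p) \<in> borel_measurable (lborel \<Otimes>\<^sub>M lborel)" unfolding F_def by measurable
    show "norm (F s p) \<le> 1 / (1 + s\<^sup>2) * (KK * KK * (\<bar>H p\<bar> * WW p))" for s p
    proof -
      have "\<bar>F s p\<bar> \<le> \<bar>H p * (hx 0 (k\<alpha> (fst p)) y * hs 0 (k\<beta> (snd p)) s)\<bar> * 1"
        unfolding F_def abs_mult[of "H p * _"] by (intro mult_left_mono) (auto simp: indicator_def)
      also have "\<dots> \<le> KK * (KK / (1 + s\<^sup>2)) * (\<bar>H p\<bar> * WW p)"
        using kernel_bounds(2)[of 0 "snd p" s] unfolding mult_1_right by (intro prod_WW_bound kernel_bounds') auto
      finally show ?thesis by (simp add: mult_ac)
    qed
    show "integrable lborel (\<lambda>p. KK * KK * (\<bar>H p\<bar> * WW p))" using H by (simp add: WW_int_def)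
  qed (rule integrable_inverse_quadratic)
  also have "\<dots> = (LINT p|lborel. H p * (hx 0 (k\<alpha> (fst p)) y * k\<beta> (snd p) \<tau>))"
  proof (intro Bochner_Integration.integral_cong refl)
    fix p :: "real \<times> real"
    have "(LINT s|lborel. F s p) = (LINT s|lborel. H p * hx 0 (k\<alpha> (fst p)) y * (indicator {0<..} s * (hs 0 (k\<beta> (snd p)) s * sin (\<tau> * s))))"
      by (simp add: F_def mult_ac)
    also have "\<dots> = H p * hx 0 (k\<alpha> (fst p)) y * (\<bar>\<tau>\<bar> powr 0 * k\<beta> (snd p) \<tau>)"
      unfolding integral_mult_right_zero by (subst hs_FT[OF tadm_KK]) auto
    finally show "(LINT s|lborel. F s p) = H p * (hx 0 (k\<alpha> (fst p)) y * k\<beta> (snd p) \<tau>)"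
      unfolding tadm_powr0[OF tadm_KK] by (simp add: mult_ac)
  qed
  finally show ?thesis by (simp add: H_def)
qed

lemma fourier_anti:
  assumes f: "tf d R f"
  shows "fourier (\<lambda>s. anti f (y, s)) \<tau> = - (2 * \<i>) * of_real (LINT s|lborel. f (y, s) * sin (\<tau> * s))"
proof -
  have i0: "integrable lborel (\<lambda>s. f (y, s))" by (rule cs_integrable[OF tf_cs2[OF f]])
  have i: "integrable lborel (\<lambda>s. complex_of_real (f (y, s)) * cis (r * s))" for r
    using i0 by (intro integrable_mult_bounded[where C=1]) (auto intro!: measurable_compose[OF _ cis_measurable])
  have i': "integrable lborel (\<lambda>s. complex_of_real (f (y, - s)) * cis (- (\<tau> * s)))"
    using lborel_integrable_real_affine[OF i[of \<tau>], of "-1" 0] by simp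
  have e: "anti f (y, s) = f (y, s) - f (y, - s)" for s
    using f tf_zero[OF f, of y s] tf_zero[OF f, of y "- s"] by (auto simp: anti_def tf_def)
  have "fourier (\<lambda>s. anti f (y, s)) \<tau> = (LINT s|lborel. complex_of_real (f (y, s)) * cis (- \<tau> * s) - complex_of_real (f (y, - s)) * cis (- (\<tau> * s)))"
    unfolding fourier_def e by (simp add: algebra_simps)
  also have "\<dots> = (LINT s|lborel. complex_of_real (f (y, s)) * cis (- \<tau> * s)) - (LINT s|lborel. complex_of_real (f (y, - s)) * cis (\<tau> * - s))"
    using Bochner_Integration.integral_diff[OF i[of "- \<tau>"] i'] by simp
  also have "(LINT s|lborel. complex_of_real (f (y, - s)) * cis (\<tau> * - s)) = (LINT s|lborel. complex_of_real (f (y, s)) * cis (\<tau> * s))"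
    by (rule integral_reflect)
  also have "(LINT s|lborel. complex_of_real (f (y, s)) * cis (- \<tau> * s)) - (LINT s|lborel. complex_of_real (f (y, s)) * cis (\<tau> * s))
      = (LINT s|lborel. - (2 * \<i>) * of_real (f (y, s) * sin (\<tau> * s)))"
    unfolding Bochner_Integration.integral_diff[OF i i, symmetric]
    by (intro Bochner_Integration.integral_cong refl) (auto simp: complex_eq_iff)
  also have "\<dots> = - (2 * \<i>) * of_real (LINT s|lborel. f (y, s) * sin (\<tau> * s))"
    unfolding integral_mult_right_zero integral_complex_of_real ..
  finally show ?thesis .
qed

lemma rep_frac:
  assumes f: "tf d R f" and \<gamma>: "\<gamma> \<in> {1/2, 1}"
  shows "frac_dt \<gamma> (anti f) (y, s) = JJ (Dt (Dx f)) (\<lambda>x. hx 0 (k\<alpha> x)) (\<lambda>t. hs \<gamma> (k\<beta> t)) (y, s)"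
proof -
  define H where "H = Dt (Dx f)"
  have H: "WW_int H" unfolding H_def by (rule tf_WW_int[OF tf_Dt[OF tf_Dx[OF f]]])
  note [measurable] = WW_int_meas[OF H]
  define G where "G \<tau> p = of_real (H p * hx 0 (k\<alpha> (fst p)) y) * (of_real (\<bar>\<tau>\<bar> powr \<gamma> * k\<beta> (snd p) \<tau>) * cis (\<tau> * s))" for \<tau> :: real and p :: "real \<times> real"
  have kb: "\<bar>\<tau>\<bar> powr \<gamma> * \<bar>k\<beta> t \<tau>\<bar> \<le> 1 / (1 + \<tau>\<^sup>2)" for \<tau> t
  proof -
    have "\<bar>\<tau>\<bar> powr \<gamma> \<le> 1 + \<tau>\<^sup>2"
    proof (cases "\<bar>\<tau>\<bar> \<le> 1")
      case True
      have "\<bar>\<tau>\<bar> powr \<gamma> \<le> 1" using powr_mono2[of \<gamma> "\<bar>\<tau>\<bar>" 1] True \<gamma> by auto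
      then show ?thesis by (simp add: add_increasing2)
    next
      case False
      then have "\<bar>\<tau>\<bar> powr \<gamma> \<le> \<bar>\<tau>\<bar> powr 2" using \<gamma> by (intro powr_mono) auto
      then show ?thesis by (simp add: powr_numeral)
    qed
    moreover have "\<bar>k\<beta> t \<tau>\<bar> \<le> 1 / (1 + \<tau>\<^sup>2)\<^sup>2" by (simp add: k\<beta>_def abs_divide divide_right_mono)
    ultimately have "\<bar>\<tau>\<bar> powr \<gamma> * \<bar>k\<beta> t \<tau>\<bar> \<le> (1 + \<tau>\<^sup>2) * (1 / (1 + \<tau>\<^sup>2)\<^sup>2)" by (intro mult_mono) auto
    then show ?thesis using one_plus_sq_pos[of \<tau>] by (simp add: power2_eq_square[of "1 + _"])
  qed
  have "(LINT \<tau>|lborel. of_real (\<bar>\<tau>\<bar> powr \<gamma>) * fourier (\<lambda>s. anti f (y, s)) \<tau> * cis (\<tau> * s))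
      = (LINT \<tau>|lborel. - (2 * \<i>) * (LINT p|lborel. G \<tau> p))"
  proof (intro Bochner_Integration.integral_cong refl)
    fix \<tau> :: real
    have "(LINT p|lborel. G \<tau> p) = (LINT p|lborel. of_real (H p * (hx 0 (k\<alpha> (fst p)) y * k\<beta> (snd p) \<tau>)) * (of_real (\<bar>\<tau>\<bar> powr \<gamma>) * cis (\<tau> * s)))"
      by (simp add: G_def mult_ac)
    also have "\<dots> = of_real (LINT s|lborel. f (y, s) * sin (\<tau> * s)) * (of_real (\<bar>\<tau>\<bar> powr \<gamma>) * cis (\<tau> * s))"
      unfolding integral_mult_left_zero integral_complex_of_real sin_transform[OF f] H_def ..
    finally show "of_real (\<bar>\<tau>\<bar> powr \<gamma>) * fourier (\<lambda>s. anti f (y, s)) \<tau> * cis (\<tau> * s) = - (2 * \<i>) * (LINT p|lborel. G \<tau> p)"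
      unfolding fourier_anti[OF f] by (simp add: mult_ac)
  qed
  also have "\<dots> = - (2 * \<i>) * (LINT \<tau>|lborel. LINT p|lborel. G \<tau> p)" by (rule integral_mult_right_zero)
  also have "(LINT \<tau>|lborel. LINT p|lborel. G \<tau> p) = (LINT p|lborel. LINT \<tau>|lborel. G \<tau> p)"
  proof (rule Fubini_bound(1)[OF sigma_finite_lborel sigma_finite_lborel, where a="\<lambda>\<tau>. 1 / (1 + \<tau>\<^sup>2)" and b="\<lambda>p. KK * 1 * (\<bar>H p\<bar> * WW p)"])
    show "(\<lambda>(\<tau>, p). G \<tau> p) \<in> borel_measurable (lborel \<Otimes>\<^sub>M lborel)" unfolding G_def by measurable
    show "norm (G \<tau> p) \<le> 1 / (1 + \<tau>\<^sup>2) * (KK * 1 * (\<bar>H p\<bar> * WW p))" for \<tau> p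
    proof -
      have "norm (G \<tau> p) = \<bar>H p * (hx 0 (k\<alpha> (fst p)) y * 1)\<bar> * (\<bar>\<tau>\<bar> powr \<gamma> * \<bar>k\<beta> (snd p) \<tau>\<bar>)"
        by (simp add: G_def norm_mult abs_mult)
      also have "\<dots> \<le> (KK * 1 * (\<bar>H p\<bar> * WW p)) * (1 / (1 + \<tau>\<^sup>2))"
        by (intro mult_mono kb prod_WW_bound kernel_bounds') (auto simp: KK_nonneg WW_nonneg)
      finally show ?thesis by (simp add: mult_ac)
    qed
    show "integrable lborel (\<lambda>p. KK * 1 * (\<bar>H p\<bar> * WW p))" using H by (simp add: WW_int_def)
  qed (rule integrable_inverse_quadratic)
  also have "(LINT p|lborel. LINT \<tau>|lborel. G \<tau> p) = (LINT p|lborel. of_real (H p * hx 0 (k\<alpha> (fst p)) y) * FI (\<lambda>\<tau>. of_real (\<bar>\<tau>\<bar> powr \<gamma> * k\<beta> (snd p) \<tau>)) s)"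
    unfolding G_def FI_def integral_mult_right_zero ..
  finally have 1: "frac_dt \<gamma> (anti f) (y, s) = Im (LINT p|lborel. of_real (H p * hx 0 (k\<alpha> (fst p)) y) * FI (\<lambda>\<tau>. of_real (\<bar>\<tau>\<bar> powr \<gamma> * k\<beta> (snd p) \<tau>)) s) / pi"
    (is "_ = Im ?I / pi")
    by (simp add: frac_dt_def)
  have fi: "norm (FI (\<lambda>\<tau>. of_real (\<bar>\<tau>\<bar> powr \<gamma> * k\<beta> t \<tau>)) s) \<le> (KK * (1 + \<bar>t\<bar>)\<^sup>2)" for t
    using dec_FI_bound[OF tadm_dec_powr[OF tadm_KK, of \<gamma> t], of s] \<gamma> quotient_le[of "KK * (1 + \<bar>t\<bar>)\<^sup>2" s] KK_nonneg by fastforce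
  have "integrable lborel (\<lambda>p. of_real (H p * hx 0 (k\<alpha> (fst p)) y) * FI (\<lambda>\<tau>. of_real (\<bar>\<tau>\<bar> powr \<gamma> * k\<beta> (snd p) \<tau>)) s)"
  proof (rule Bochner_Integration.integrable_bound)
    show "integrable lborel (\<lambda>p. KK * KK * (\<bar>H p\<bar> * WW p))" using H by (simp add: WW_int_def)
    show "(\<lambda>p. of_real (H p * hx 0 (k\<alpha> (fst p)) y) * FI (\<lambda>\<tau>. of_real (\<bar>\<tau>\<bar> powr \<gamma> * k\<beta> (snd p) \<tau>)) s) \<in> borel_measurable lborel"
      unfolding FI_def by measurable
    show "AE p in lborel. norm (of_real (H p * hx 0 (k\<alpha> (fst p)) y) * FI (\<lambda>\<tau>. of_real (\<bar>\<tau>\<bar> powr \<gamma> * k\<beta> (snd p) \<tau>)) s) \<le> norm (KK * KK * (\<bar>H p\<bar> * WW p))"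
    proof (intro AE_I2)
      fix p
      have "\<bar>H p * (hx 0 (k\<alpha> (fst p)) y * norm (FI (\<lambda>\<tau>. of_real (\<bar>\<tau>\<bar> powr \<gamma> * k\<beta> (snd p) \<tau>)) s))\<bar> \<le> KK * KK * (\<bar>H p\<bar> * WW p)"
        by (intro prod_WW_bound kernel_bounds') (use fi[of "snd p"] in auto)
      then show "norm (of_real (H p * hx 0 (k\<alpha> (fst p)) y) * FI (\<lambda>\<tau>. of_real (\<bar>\<tau>\<bar> powr \<gamma> * k\<beta> (snd p) \<tau>)) s) \<le> norm (KK * KK * (\<bar>H p\<bar> * WW p))"
        by (simp add: norm_mult abs_mult mult_ac KK_nonneg WW_nonneg)
    qed
  qed
  from integral_Im[OF this] have "Im ?I / pi = (LINT p|lborel. Im (of_real (H p * hx 0 (k\<alpha> (fst p)) y) * FI (\<lambda>\<tau>. of_real (\<bar>\<tau>\<bar> powr \<gamma> * k\<beta> (snd p) \<tau>)) s) / pi)"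
    by simp
  also have "\<dots> = JJ H (\<lambda>x. hx 0 (k\<alpha> x)) (\<lambda>t. hs \<gamma> (k\<beta> t)) (y, s)"
    unfolding JJ_def hs_def by (intro Bochner_Integration.integral_cong refl) simp
  finally show ?thesis unfolding 1 H_def .
qed

lemma rep_dx_frac:
  assumes f: "tf d R f"
  shows "dx (frac_dt (1/2) (anti f)) (y, s) = JJ (Dt (Dx f)) (\<lambda>x. hx 1 (k\<alpha> x)) (\<lambda>t. hs (1/2) (k\<beta> t)) (y, s)"
proof -
  note H = tf_WW_int[OF tf_Dt[OF tf_Dx[OF f]]]
  have e: "(\<lambda>y. frac_dt (1/2) (anti f) (y, s)) = (\<lambda>y. LINT p|lborel. Dt (Dx f) p * (hx 0 (k\<alpha> (fst p)) y * hs (1/2) (k\<beta> (snd p)) s))"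
    by (rule ext) (subst rep_frac[OF f], auto simp: JJ_def)
  show ?thesis
    using hx_kernel_DERIV[OF H _ _ kernel_bounds'(2)[where \<gamma>="1/2" and s=s], where j=0 and y=y] DERIV_imp_deriv
    by (simp add: dx_def e JJ_def)
qed

definition Tk :: "real \<times> real \<Rightarrow> real \<times> real \<Rightarrow> real" where
  "Tk p = Top (k\<alpha> (fst p)) (k\<beta> (snd p))"

definition Bk :: "real \<times> real \<Rightarrow> real \<times> real \<Rightarrow> real" where
  "Bk p = kB (k\<alpha> (fst p)) (k\<beta> (snd p))"

lemma Tk_measurable[measurable]: "(\<lambda>(p, q). Tk p q) \<in> borel_measurable (borel \<Otimes>\<^sub>M borel)"
  unfolding Tk_def Top_def by measurable

lemma Bk_measurable[measurable]: "(\<lambda>(p, q). Bk p q) \<in> borel_measurable (borel \<Otimes>\<^sub>M borel)"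
  unfolding Bk_def kB_def by measurable

lemma Tk_bound: "\<bar>Tk p q\<bar> \<le> 4 * KK\<^sup>2 * WW p * wt q"
  using wbd_bound[OF Top_wbd[OF xadm_KK tadm_KK], of "fst p" "snd p" q] by (simp add: Tk_def WW_def power2_eq_square[of KK] mult_ac)

lemma Bk_bound: "\<bar>Bk p q\<bar> \<le> KK\<^sup>2 * WW p * wt q"
  using wbd_bound[OF kB_wbd[OF xadm_KK tadm_KK], of "fst p" "snd p" q] by (simp add: Bk_def WW_def power2_eq_square mult_ac)

lemma weighted_swap:
  assumes H: "WW_int H" and u[measurable]: "u \<in> borel_measurable borel" "integrable lborel (\<lambda>q. wt q * u q)"
    and T[measurable]: "(\<lambda>(p, q). T p q) \<in> borel_measurable (borel \<Otimes>\<^sub>M borel)" and b: "\<And>p q. \<bar>T p q\<bar> \<le> C * WW p * wt q"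
  shows "(LINT q|lborel. u q * (LINT p|lborel. H p * T p q)) = (LINT p|lborel. H p * (LINT q|lborel. T p q * u q))"
proof -
  note [measurable] = WW_int_meas[OF H]
  have "(LINT q|lborel. u q * (LINT p|lborel. H p * T p q)) = (LINT q|lborel. LINT p|lborel. u q * (H p * T p q))"
    unfolding integral_mult_right_zero ..
  also have "\<dots> = (LINT p|lborel. LINT q|lborel. u q * (H p * T p q))"
  proof (rule Fubini_bound(1)[OF sigma_finite_lborel sigma_finite_lborel, where a="\<lambda>q. \<bar>wt q * u q\<bar>" and b="\<lambda>p. C * (\<bar>H p\<bar> * WW p)"])
    show "norm (u q * (H p * T p q)) \<le> \<bar>wt q * u q\<bar> * (C * (\<bar>H p\<bar> * WW p))" for p q
      using mult_left_mono[OF b[of p q], of "\<bar>u q\<bar> * \<bar>H p\<bar>"] wt_pos[of q] by (simp add: abs_mult mult_ac)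
    show "integrable lborel (\<lambda>q. \<bar>wt q * u q\<bar>)" using u(2) by simp
    show "integrable lborel (\<lambda>p. C * (\<bar>H p\<bar> * WW p))" using H by (simp add: WW_int_def)
  qed measurable
  also have "\<dots> = (LINT p|lborel. H p * (LINT q|lborel. T p q * u q))"
    unfolding integral_mult_right_zero[symmetric] by (simp add: mult_ac)
  finally show ?thesis .
qed

lemma JJ_wbd:
  assumes H: "WW_int H" and m: "(\<lambda>(x, y). a x y) \<in> borel_measurable (borel \<Otimes>\<^sub>M borel)" "(\<lambda>(t, s). b t s) \<in> borel_measurable (borel \<Otimes>\<^sub>M borel)"
    and a: "\<And>x y. \<bar>a x y\<bar> \<le> KK * (1 + \<bar>x\<bar>)\<^sup>2 / (1 + y\<^sup>2)" and b: "\<And>t s. \<bar>b t s\<bar> \<le> KK * (1 + \<bar>t\<bar>)\<^sup>2 / (1 + s\<^sup>2)"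
  shows "\<exists>C. wbd C (JJ H a b)"
proof -
  note [measurable] = WW_int_meas[OF H] m
  have "\<bar>JJ H a b q\<bar> \<le> (LINT p|lborel. KK\<^sup>2 * (\<bar>H p\<bar> * WW p)) * wt q" for q
  proof -
    have *: "\<bar>H p * (a (fst p) (fst q) * b (snd p) (snd q))\<bar> \<le> KK\<^sup>2 * (\<bar>H p\<bar> * WW p) * wt q" for p
    proof -
      have "\<bar>H p * (a (fst p) (fst q) * b (snd p) (snd q))\<bar> \<le> (KK / (1 + (fst q)\<^sup>2)) * (KK / (1 + (snd q)\<^sup>2)) * (\<bar>H p\<bar> * WW p)"
        using a[of "fst p" "fst q"] b[of "snd p" "snd q"] by (intro prod_WW_bound) auto
      then show ?thesis by (simp add: wt_def power2_eq_square[of KK] mult_ac)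
    qed
    have iW: "integrable lborel (\<lambda>p. KK\<^sup>2 * (\<bar>H p\<bar> * WW p) * wt q)" using H by (simp add: WW_int_def)
    have "integrable lborel (\<lambda>p. H p * (a (fst p) (fst q) * b (snd p) (snd q)))"
    proof (rule Bochner_Integration.integrable_bound[OF iW])
      show "AE p in lborel. norm (H p * (a (fst p) (fst q) * b (snd p) (snd q))) \<le> norm (KK\<^sup>2 * (\<bar>H p\<bar> * WW p) * wt q)"
        using order_trans[OF * abs_ge_self] by (intro AE_I2) (simp only: real_norm_def)
    qed measurable
    from Bochner_Integration.integral_norm_bound_integral[OF this iW] *
    have "\<bar>JJ H a b q\<bar> \<le> (LINT p|lborel. KK\<^sup>2 * (\<bar>H p\<bar> * WW p) * wt q)"
      by (simp add: JJ_def)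
    also have "\<dots> = (LINT p|lborel. KK\<^sup>2 * (\<bar>H p\<bar> * WW p)) * wt q" by (rule integral_mult_left_zero)
    finally show ?thesis .
  qed
  moreover have "JJ H a b \<in> borel_measurable borel" unfolding JJ_def[abs_def] by measurable
  ultimately show ?thesis unfolding wbd_def by blast
qed

lemma wbd_mult_integrable:
  assumes "wbd C \<Phi>" "u \<in> borel_measurable borel" "integrable lborel (\<lambda>q. wt q * u q)"
  shows "integrable lborel (\<lambda>q. u q * \<Phi> q)"
proof (rule Bochner_Integration.integrable_bound)
  note [measurable] = wbd_meas[OF assms(1)] assms(2)
  show "integrable lborel (\<lambda>q. C * (wt q * u q))" using assms(3) by simp
  show "(\<lambda>q. u q * \<Phi> q) \<in> borel_measurable lborel" by measurable
  show "AE q in lborel. norm (u q * \<Phi> q) \<le> norm (C * (wt q * u q))"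
  proof (intro AE_I2)
    fix q
    have "\<bar>\<Phi> q\<bar> * \<bar>u q\<bar> \<le> C * wt q * \<bar>u q\<bar>" by (intro mult_right_mono wbd_bound[OF assms(1)]) auto
    also have "\<dots> \<le> \<bar>C * (wt q * u q)\<bar>" using abs_ge_self[of "C * wt q"] by (simp add: abs_mult mult_right_mono flip: mult.assoc)
    finally show "norm (u q * \<Phi> q) \<le> norm (C * (wt q * u q))" by (simp add: abs_mult mult.commute)
  qed
qed

lemma pairing_identity:
  assumes f: "f \<in> Cc_infty Qplus" and \<kappa>: "cutoff_seq \<kappa>"
    and ut: "\<And>p. ut p = indicator Qplus p * u p" and utm[measurable]: "ut \<in> borel_measurable borel" and uti: "integrable lborel (\<lambda>q. wt q * ut q)"
    and bm[measurable]: "b \<in> borel_measurable borel" and bi: "integrable lborel (\<lambda>q. wt q * b q)"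
    and ae: "AE p in lborel. (LINT q|lborel. Tk p q * ut q) = (LINT q|lborel. Bk p q * b q)"
  shows "let \<phi> = (\<lambda>p. dx (dx f) p + frac_dt 1 (anti f) p);
           \<psi> = dx (frac_dt (1 / 2) (anti f));
           I = (\<lambda>N. pairing (\<lambda>p. \<kappa> N (snd p) * u p) \<psi>)
       in set_integrable lborel Qplus (\<lambda>p. u p * \<phi> p)
          \<and> (\<forall>N\<ge>1. set_integrable lborel Qplus (\<lambda>p. \<kappa> N (snd p) * u p * \<psi> p))
          \<and> convergent I
          \<and> pairing u \<phi> - sqrt 2 * lim I = pairing b (dx (dt f))"
proof -
  obtain d R where tf: "tf d R f" using tf_exists[OF f] by blast
  define H where "H = Dt (Dx f)"
  have H: "WW_int H" unfolding H_def by (rule tf_WW_int[OF tf_Dt[OF tf_Dx[OF tf]]])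
  note [measurable] = WW_int_meas[OF H]
  define \<phi> where "\<phi> = (\<lambda>p. dx (dx f) p + frac_dt 1 (anti f) p)"
  define \<psi> where "\<psi> = dx (frac_dt (1 / 2) (anti f))"
  define I where "I = (\<lambda>N. pairing (\<lambda>p. \<kappa> N (snd p) * u p) \<psi>)"
  define j1 where "j1 = JJ H (\<lambda>x. hx 2 (k\<alpha> x)) (\<lambda>t. hs 0 (k\<beta> t))"
  define j2 where "j2 = JJ H (\<lambda>x. hx 0 (k\<alpha> x)) (\<lambda>t. hs 1 (k\<beta> t))"
  define j3 where "j3 = JJ H (\<lambda>x. hx 1 (k\<alpha> x)) (\<lambda>t. hs (1/2) (k\<beta> t))"
  define j4 where "j4 = JJ H (\<lambda>x. hx 1 (k\<alpha> x)) (\<lambda>t. hc (k\<beta> t))"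
  obtain C1 where w1: "wbd C1 j1" unfolding j1_def using JJ_wbd[OF H hx_k\<alpha>_measurable hs_k\<beta>_measurable kernel_bounds(1) kernel_bounds(2)] by fastforce
  obtain C2 where w2: "wbd C2 j2" unfolding j2_def using JJ_wbd[OF H hx_k\<alpha>_measurable hs_k\<beta>_measurable kernel_bounds(1) kernel_bounds(2)] by fastforce
  obtain C3 where w3: "wbd C3 j3" unfolding j3_def using JJ_wbd[OF H hx_k\<alpha>_measurable hs_k\<beta>_measurable kernel_bounds(1) kernel_bounds(2)] by fastforce
  note i1 = wbd_mult_integrable[OF w1 utm uti] and i2 = wbd_mult_integrable[OF w2 utm uti] and i3 = wbd_mult_integrable[OF w3 utm uti]
  have \<phi>_eq: "indicator Qplus q * (u q * \<phi> q) = ut q * j1 q + ut q * j2 q" for q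
  proof (cases "q \<in> Qplus")
    case True
    then obtain y s where q: "q = (y, s)" "0 < s" by (auto simp: Qplus_def)
    have "\<phi> q = j1 q + j2 q"
      using rep_dxx[OF tf q(2), of y] rep_frac[OF tf, of 1 y s] by (simp add: \<phi>_def j1_def j2_def H_def q(1))
    then show ?thesis using True by (simp add: ut algebra_simps)
  qed (simp add: ut)
  have \<psi>_eq: "indicator Qplus q * (\<kappa> N (snd q) * u q * \<psi> q) = \<kappa> N (snd q) * (ut q * j3 q)" for q N
    using rep_dx_frac[OF tf, of "fst q" "snd q"] by (simp add: \<psi>_def j3_def H_def ut)
  have \<kappa>m: "\<kappa> N \<in> borel_measurable borel" if "1 \<le> N" for N
  proof -
    have "((deriv ^^ 0) (\<kappa> N)) differentiable (at t)" for t using \<kappa> that unfolding cutoff_seq_def by blast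
    then have "continuous_on UNIV (\<kappa> N)"
      by (simp add: continuous_on_eq_continuous_at differentiable_imp_continuous_within)
    then show ?thesis by (rule borel_measurable_continuous_onI)
  qed
  obtain C where C: "\<And>N t. 1 \<le> N \<Longrightarrow> \<bar>\<kappa> N t\<bar> \<le> C" using \<kappa> unfolding cutoff_seq_def by blast
  have \<kappa>i: "integrable lborel (\<lambda>q. \<kappa> N (snd q) * (ut q * j3 q))" if N: "1 \<le> N" for N
  proof -
    note [measurable] = \<kappa>m[OF N]
    have "integrable lborel (\<lambda>q. (ut q * j3 q) * \<kappa> N (snd q))"
      by (rule integrable_mult_bounded[OF i3, of _ C]) (use C[OF N] in auto)
    then show ?thesis by (simp add: mult.commute)
  qed
  have Ieq: "I N = (LINT q|lborel. \<kappa> N (snd q) * (ut q * j3 q))" for N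
    unfolding I_def pairing_def set_lebesgue_integral_def real_scaleR_def \<psi>_eq ..
  have "(\<lambda>N. I (Suc N)) \<longlonglongrightarrow> (LINT q|lborel. ut q * j3 q)"
    unfolding Ieq
  proof (rule integral_dominated_convergence[where w="\<lambda>q. C * \<bar>ut q * j3 q\<bar>"])
    show "(\<lambda>q. ut q * j3 q) \<in> borel_measurable lborel" using i3 by (rule borel_measurable_integrable)
    show "(\<lambda>q. \<kappa> (Suc N) (snd q) * (ut q * j3 q)) \<in> borel_measurable lborel" for N
      by (rule borel_measurable_integrable[OF \<kappa>i]) simp
    show "integrable lborel (\<lambda>q. C * \<bar>ut q * j3 q\<bar>)" using i3 by simp
    show "AE q in lborel. norm (\<kappa> (Suc N) (snd q) * (ut q * j3 q)) \<le> C * \<bar>ut q * j3 q\<bar>" for N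
      using C[of "Suc N"] by (auto simp: abs_mult[of "\<kappa> _ _"] intro!: mult_right_mono)
    show "AE q in lborel. (\<lambda>N. \<kappa> (Suc N) (snd q) * (ut q * j3 q)) \<longlonglongrightarrow> ut q * j3 q"
    proof (intro AE_I2)
      fix q :: "real \<times> real"
      obtain N0 where N0: "\<bar>snd q\<bar> \<le> real N0" using real_arch_simple by blast
      have "\<forall>\<^sub>F N in sequentially. \<kappa> (Suc N) (snd q) * (ut q * j3 q) = ut q * j3 q"
      proof (rule eventually_sequentiallyI[of N0])
        fix N assume "N0 \<le> N"
        then have "snd q \<in> {- real (Suc N)..real (Suc N)}" using N0 by (auto simp: abs_le_iff)
        then have "\<kappa> (Suc N) (snd q) = 1" using \<kappa> unfolding cutoff_seq_def by (auto simp del: of_nat_Suc)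
        then show "\<kappa> (Suc N) (snd q) * (ut q * j3 q) = ut q * j3 q" by simp
      qed
      then show "(\<lambda>N. \<kappa> (Suc N) (snd q) * (ut q * j3 q)) \<longlonglongrightarrow> ut q * j3 q" by (rule tendsto_eventually)
    qed
  qed
  then have lim: "I \<longlonglongrightarrow> (LINT q|lborel. ut q * j3 q)" by (rule LIMSEQ_imp_Suc)
  have Tint: "integrable lborel (\<lambda>p. H p * (hx j (k\<alpha> (fst p)) y * hs \<gamma> (k\<beta> (snd p)) s))" if "j \<le> 2" "\<gamma> \<in> {0, 1/2, 1}" for j \<gamma> y s
    using that by (intro WW_int_kernel[OF H _ _ kernel_bounds'(1) kernel_bounds'(2)]) auto
  have T: "(LINT p|lborel. H p * Tk p q) = j1 q + j2 q - sqrt 2 * j3 q" for q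
  proof -
    have "(LINT p|lborel. H p * Tk p q) = (LINT p|lborel. H p * (hx 2 (k\<alpha> (fst p)) (fst q) * hs 0 (k\<beta> (snd p)) (snd q))
        + H p * (hx 0 (k\<alpha> (fst p)) (fst q) * hs 1 (k\<beta> (snd p)) (snd q))
        - sqrt 2 * (H p * (hx 1 (k\<alpha> (fst p)) (fst q) * hs (1/2) (k\<beta> (snd p)) (snd q))))"
      by (intro Bochner_Integration.integral_cong refl) (simp add: Tk_def Top_def algebra_simps)
    also have "\<dots> = j1 q + j2 q - sqrt 2 * j3 q"
      unfolding j1_def j2_def j3_def JJ_def
      by (subst Bochner_Integration.integral_diff, intro Bochner_Integration.integrable_add Tint, simp, simp, simp, simp,
          intro integrable_mult_right Tint, simp, simp, subst Bochner_Integration.integral_add)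
        (auto intro!: Tint)
    finally show ?thesis .
  qed
  have "pairing u \<phi> - sqrt 2 * lim I = (LINT q|lborel. ut q * j1 q + ut q * j2 q) - sqrt 2 * (LINT q|lborel. ut q * j3 q)"
    unfolding limI[OF lim] pairing_def set_lebesgue_integral_def real_scaleR_def \<phi>_eq ..
  also have "\<dots> = (LINT q|lborel. ut q * j1 q + ut q * j2 q - sqrt 2 * (ut q * j3 q))"
    using i1 i2 i3 by (subst Bochner_Integration.integral_diff) auto
  also have "\<dots> = (LINT q|lborel. ut q * (LINT p|lborel. H p * Tk p q))"
    unfolding T by (simp add: algebra_simps)
  also have "\<dots> = (LINT p|lborel. H p * (LINT q|lborel. Tk p q * ut q))"
    by (rule weighted_swap[OF H utm uti Tk_measurable Tk_bound])
  also have "\<dots> = (LINT p|lborel. H p * (LINT q|lborel. Bk p q * b q))"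
  proof (rule integral_cong_AE)
    show "AE p in lborel. H p * (LINT q|lborel. Tk p q * ut q) = H p * (LINT q|lborel. Bk p q * b q)"
      using ae by eventually_elim simp
  qed measurable
  also have "\<dots> = (LINT q|lborel. b q * (LINT p|lborel. H p * Bk p q))"
    by (rule weighted_swap[OF H bm bi Bk_measurable Bk_bound, symmetric])
  also have "\<dots> = (LINT q|lborel. indicator Qplus q *\<^sub>R (b q * dx (dt f) q))"
  proof (intro Bochner_Integration.integral_cong refl)
    fix q :: "real \<times> real"
    obtain y s where q: "q = (y, s)" by (cases q)
    show "b q * (LINT p|lborel. H p * Bk p q) = indicator Qplus q *\<^sub>R (b q * dx (dt f) q)"
    proof (cases "0 < s")
      case True
      then have "dx (dt f) q = (LINT p|lborel. H p * Bk p q)"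
        using rep_dxt[OF tf True, of y] by (simp add: q JJ_def Bk_def kB_def H_def)
      then show ?thesis using True by (simp add: q Qplus_def)
    qed (simp add: q Qplus_def Bk_def kB_def)
  qed
  also have "\<dots> = pairing b (dx (dt f))" by (simp add: pairing_def set_lebesgue_integral_def)
  finally have "pairing u \<phi> - sqrt 2 * lim I = pairing b (dx (dt f))" .
  moreover have "set_integrable lborel Qplus (\<lambda>p. u p * \<phi> p)"
    unfolding set_integrable_def real_scaleR_def \<phi>_eq using i1 i2 by (rule Bochner_Integration.integrable_add)
  moreover have "\<forall>N\<ge>1. set_integrable lborel Qplus (\<lambda>p. \<kappa> N (snd p) * u p * \<psi> p)"
    unfolding set_integrable_def real_scaleR_def \<psi>_eq using \<kappa>i by blast
  moreover have "convergent I" using lim by (auto simp: convergent_def)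
  ultimately show ?thesis unfolding Let_def \<phi>_def \<psi>_def I_def by blast
qed

context she
begin

lemma wbd_wt: "wbd 1 wt"
  using wt_pos by (simp add: wbd_def less_imp_le)

lemma Bn_wt: "AE \<omega> in M. integrable lborel (\<lambda>q. wt q * Bn q \<omega>)"
proof -
  note s = sqi_integral(1)[OF sigma_finite_lborel sigma_finite_measure_axioms Bn_measurable gspan_sqi[OF Bn_gspan] ip_Bn_le rB_pos _ _ wbd_integrable[OF wbd_wt integrable_wt_rB _ less_imp_le[OF rB_pos]]]
  show ?thesis using s by simp
qed

lemma Tk_Bk: "AE \<omega> in M. AE p in lborel. (LINT q|lborel. Tk p q * Ut q \<omega>) = (LINT q|lborel. Bk p q * Bn q \<omega>)"
proof -
  have sq: "sqi lborel (k\<alpha> x)" "sqi lborel (k\<beta> x)" for x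
  proof -
    have m: "integrable lborel (\<lambda>\<xi>::real. 1 / (1 + \<xi>\<^sup>2))" by (rule integrable_inverse_quadratic)
    have b: "1 / (1 + \<xi>\<^sup>2) ^ 4 \<le> 1 / (1 + \<xi>\<^sup>2)" for \<xi> :: real
      using self_le_power[of "1 + \<xi>\<^sup>2" 4] one_plus_sq_pos[of \<xi>] by (intro frac_le) auto
    have "norm (k\<alpha> x \<xi>) ^ 2 \<le> 1 / (1 + \<xi>\<^sup>2)" for \<xi>
      using b[of \<xi>] by (simp add: k\<alpha>_def norm_divide norm_power power_divide flip: power_mult del: of_real_power of_real_add)
    then have "integrable lborel (\<lambda>\<xi>. (norm (k\<alpha> x \<xi>))\<^sup>2)" by (intro Bochner_Integration.integrable_bound[OF m]) auto
    then show "sqi lborel (k\<alpha> x)" by (simp add: sqi_def)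
    have "(norm (k\<beta> x \<xi>))\<^sup>2 \<le> 1 / (1 + \<xi>\<^sup>2)" for \<xi>
    proof -
      have "(norm (k\<beta> x \<xi>))\<^sup>2 = (sin (\<xi> * x))\<^sup>2 / (1 + \<xi>\<^sup>2) ^ 4" by (simp add: k\<beta>_def power_divide flip: power_mult)
      also have "\<dots> \<le> 1 / (1 + \<xi>\<^sup>2) ^ 4" by (intro divide_right_mono) (auto simp: abs_square_le_1)
      also note b
      finally show ?thesis .
    qed
    then have "integrable lborel (\<lambda>\<xi>. (norm (k\<beta> x \<xi>))\<^sup>2)" by (intro Bochner_Integration.integrable_bound[OF m]) auto
    then show "sqi lborel (k\<beta> x)" by (simp add: sqi_def)
  qed
  interpret PQ: pair_sigma_finite lborel M by (intro pair_sigma_finite.intro sigma_finite_lborel sigma_finite_measure_axioms)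
  note [measurable] = Ut_measurable Bn_measurable
  have [measurable]: "(\<lambda>w. LINT q|lborel. Tk (fst w) q * Ut q (snd w)) \<in> borel_measurable (lborel \<Otimes>\<^sub>M M)"
    "(\<lambda>w. LINT q|lborel. Bk (fst w) q * Bn q (snd w)) \<in> borel_measurable (lborel \<Otimes>\<^sub>M M)"
    by measurable
  have "AE p in lborel. AE \<omega> in M. (LINT q|lborel. Tk p q * Ut q \<omega>) = (LINT q|lborel. Bk p q * Bn q \<omega>)"
    using VU_Top_eq[OF xadm_KK tadm_KK sq] by (simp add: VU_def Tk_def Bk_def)
  then show ?thesis
    by (subst (asm) PQ.AE_commute) measurable
qed

lemma pairing_identity_AE:
  assumes "cutoff_seq \<kappa>"
  shows "AE \<omega> in M. \<forall>f\<in>Cc_infty Qplus.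
       let u = (\<lambda>p. U p \<omega>);
           \<phi> = (\<lambda>p. dx (dx f) p + frac_dt 1 (anti f) p);
           \<psi> = dx (frac_dt (1 / 2) (anti f));
           I = (\<lambda>N. pairing (\<lambda>p. \<kappa> N (snd p) * u p) \<psi>)
       in set_integrable lborel Qplus (\<lambda>p. u p * \<phi> p)
          \<and> (\<forall>N\<ge>1. set_integrable lborel Qplus (\<lambda>p. \<kappa> N (snd p) * u p * \<psi> p))
          \<and> convergent I
          \<and> pairing u \<phi> - sqrt 2 * lim I = pairing (\<lambda>p. Bn p \<omega>) (dx (dt f))"
  using AE_space Ut_eq VU_sqi(1)[OF wbd_wt] Bn_wt Tk_Bk
proof eventually_elim
  case (elim \<omega>)
  have "(\<lambda>p. Ut p \<omega>) \<in> borel_measurable borel" "(\<lambda>p. Bn p \<omega>) \<in> borel_measurable borel"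
    using measurable_compose[OF measurable_Pair2'[OF elim(1)] Ut_measurable] measurable_compose[OF measurable_Pair2'[OF elim(1)] Bn_measurable]
    by simp_all
  from pairing_identity[OF _ assms(1) spec[OF elim(2)] this(1) elim(3) this(2) elim(4,5)]
  show ?case unfolding Let_def by blast
qed

end

theorem theorem3p11:
  fixes M :: "'a measure"
    and B U :: "real \<times> real \<Rightarrow> 'a \<Rightarrow> real"
    and \<kappa> :: "nat \<Rightarrow> real \<Rightarrow> real"
  assumes "prob_space M" and "complete_measure M"
    and "brownian_sheet M B"
    and "weak_solution M B U"
    and "\<And>p. p \<in> Qplus \<Longrightarrow> has_stoch_integral M B (\<lambda>q. heat_kernel q p) (U p)"
    and "AE \<omega> in M. continuous_on Qplus (\<lambda>p. U p \<omega>)"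
    and "cutoff_seq \<kappa>"
  shows "\<exists>B'. brownian_sheet M B' \<and>
    (AE \<omega> in M. \<forall>f\<in>Cc_infty Qplus.
       let u = (\<lambda>p. U p \<omega>);
           \<phi> = (\<lambda>p. dx (dx f) p + frac_dt 1 (anti f) p);
           \<psi> = dx (frac_dt (1 / 2) (anti f));
           I = (\<lambda>N. pairing (\<lambda>p. \<kappa> N (snd p) * u p) \<psi>)
       in set_integrable lborel Qplus (\<lambda>p. u p * \<phi> p)
          \<and> (\<forall>N\<ge>1. set_integrable lborel Qplus (\<lambda>p. \<kappa> N (snd p) * u p * \<psi> p))
          \<and> convergent I
          \<and> pairing u \<phi> - sqrt 2 * lim I = pairing (\<lambda>p. B' p \<omega>) (dx (dt f)))"
proof -
  interpret she M B U
    by (intro she.intro sheet.intro sheet_axioms.intro she_axioms.intro assms)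
  show ?thesis using Bn_sheet pairing_identity_AE[OF assms(7)] by blast
qed

end
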